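(* Let $M$ be a closed connected oriented surface with $\chi(M)<0$, let $m\geqslant 2$ be an integer, and let $(g,A)$ be a pair consisting of a Riemannian metric $g$ on $M$ and a differential $A$ of degree $m$ on $M$ satisfying the coupled vortex equations $\bar{\partial}A=0$ and $K_g=-1+(m-1)|A|^{2}_{g}$. Then the path geometry defined by the thermostat associated to $(g,A)$ is flat if and only if $m=3$ or $A$ vanishes identically.
   Context: $SM$ is the unit tangent bundle of $(M,g)$ with projection $\pi:SM\to M$; $X$ is the geodesic vector field, $V$ is the infinitesimal generator of the $\mathrm{SO}(2)$-action (rotation in the fibres), and $K_g$ is the Gauss curvature. $J$ denotes rotation by $+\pi/2$, and $\omega_1,\omega_2$ are the $1$-forms on $SM$ given by $(\omega_1)_{(x,v)}(\xi)=g(d\pi(\xi),v)$, $(\omega_2)_{(x,v)}(\xi)=g(d\pi(\xi),Jv)$. A differential of degree $m$ is a smooth section $A$ of $K_M^m$, where $K_M$ is the canonical bundle of the Riemann surface determined by $[g]$ and the orientation. It corresponds to a unique real-valued function $a$ on $SM$ with $VVa=-m^2a$ via $\pi^*A=\left(Va/m+i a\right)(\omega_1+i\omega_2)^m$; its pointwise norm satisfies $\pi^*|A|_g^2=(Va)^2/m^2+a^2$. The thermostat associated to $(g,A)$ is the flow on $SM$ generated by $F=X+aV$. An (oriented) path geometry on an oriented surface $M$ is an oriented line bundle $L\subset T\mathbb{S}M$ on the projective circle bundle $\mathbb{S}M=(TM\setminus\{0\})/\mathbb{R}^+$ which together with the vertical bundle of $\mathbb{S}M\to M$ spans the contact distribution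 of $\mathbb{S}M$. Its paths are the projections to $M$ of the integral curves of $L$, oriented by the orientation of $L$. The path geometry defined by a thermostat $F$ is $L=\mathbb{R}F$ under the obvious identification $SM\simeq\mathbb{S}M$, with vectors of $L$ positive if they are positive multiples of $F$. The path geometry $L$ is flat if for every point $p\in M$ there exist a neighbourhood $U_p$ of $p$ and an orientation preserving diffeomorphism $f:U_p\to V$ onto an open subset $V$ of the oriented $2$-sphere $S^2$ which maps the positively oriented paths contained in $U_p$ onto positively oriented great circles (i.e. onto the oriented great-circle arcs in $V$, these being the paths of the canonical path geometry of $S^2$ given by the unit-sphere geodesic flow). *)

theory Defs
  imports "HOL-Analysis.Analysis" "HOL-Homology.Homology"
begin

section \<open>Smooth maps between Euclidean spaces\<close>

text \<open>Only meant for open sets \<open>S\<close>; the values of \<open>f\<close> outside \<open>S\<close> are then irrelevant.\<close>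

primrec Ck_on :: "nat \<Rightarrow> 'a::euclidean_space set \<Rightarrow> ('a \<Rightarrow> 'b::real_normed_vector) \<Rightarrow> bool" where
  "Ck_on 0 S f \<longleftrightarrow> continuous_on S f"
| "Ck_on (Suc k) S f \<longleftrightarrow>
     (\<forall>x\<in>S. f differentiable (at x)) \<and> (\<forall>h. Ck_on k S (\<lambda>x. frechet_derivative f (at x) h))"

definition smooth_on :: "'a::euclidean_space set \<Rightarrow> ('a \<Rightarrow> 'b::real_normed_vector) \<Rightarrow> bool" where
  "smooth_on S f \<longleftrightarrow> (\<forall>k. Ck_on k S f)"


section \<open>Smooth manifolds\<close>

text \<open>
  A chart is a pair of a domain and a coordinate map, which is only relevant on the domain.
  A smooth manifold is given by a smooth atlas; its points are those covered by the charts and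
  it carries the topology making the charts homeomorphisms onto open sets.
\<close>

type_synonym ('p, 'e) chart = "'p set \<times> ('p \<Rightarrow> 'e)"
type_synonym ('p, 'e) atlas = "('p, 'e) chart set"

definition points :: "('p, 'e) atlas \<Rightarrow> 'p set" where
  "points M = (\<Union>c\<in>M. fst c)"

definition param :: "('p, 'e) chart \<Rightarrow> 'e \<Rightarrow> 'p" where
  "param c = inv_into (fst c) (snd c)"

definition chart_at :: "('p, 'e) atlas \<Rightarrow> 'p \<Rightarrow> ('p, 'e) chart \<Rightarrow> bool" where
  "chart_at M p c \<longleftrightarrow> c \<in> M \<and> p \<in> fst c"

definition transition :: "('p, 'e) chart \<Rightarrow> ('p, 'e) chart \<Rightarrow> 'e \<Rightarrow> 'e" where
  "transition c d = snd d \<circ> param c"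

definition smooth_atlas :: "('p, 'e::euclidean_space) atlas \<Rightarrow> bool" where
  "smooth_atlas M \<longleftrightarrow>
     (\<forall>c\<in>M. inj_on (snd c) (fst c) \<and> open (snd c ` fst c)) \<and>
     (\<forall>c\<in>M. \<forall>d\<in>M. open (snd c ` (fst c \<inter> fst d)) \<and>
        smooth_on (snd c ` (fst c \<inter> fst d)) (transition c d))"

definition manifold_topology :: "('p, 'e::topological_space) atlas \<Rightarrow> 'p topology" where
  "manifold_topology M =
     topology_generated_by {fst c \<inter> snd c -` W | c W. c \<in> M \<and> open W}"

definition oriented_atlas :: "('p, real^2) atlas \<Rightarrow> bool" where
  "oriented_atlas M \<longleftrightarrow> (\<forall>c\<in>M. \<forall>d\<in>M. \<forall>p\<in>fst c \<inter> fst d.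
     det (matrix (frechet_derivative (transition c d) (at (snd c p)))) > 0)"

text \<open>
  A tangent vector at \<open>p\<close> is the family of its components in all charts around \<open>p\<close>, related by
  the derivatives of the transition maps.  Components at all other charts are set to \<open>0\<close>, so
  that a tangent vector is determined by its components in any one chart around \<open>p\<close>.
\<close>

type_synonym ('p, 'e) tvec = "('p, 'e) chart \<Rightarrow> 'e"

definition tangent_space :: "('p, 'e::euclidean_space) atlas \<Rightarrow> 'p \<Rightarrow> ('p, 'e) tvec set" where
  "tangent_space M p = {\<xi>.
     (\<forall>c. \<not> chart_at M p c \<longrightarrow> \<xi> c = 0) \<and>
     (\<forall>c d. chart_at M p c \<longrightarrow> chart_at M p d \<longrightarrow>
        \<xi> d = frechet_derivative (transition c d) (at (snd c p)) (\<xi> c))}"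

definition zero_vec :: "('p, 'e::real_vector) tvec" where
  "zero_vec = (\<lambda>c. 0)"

definition lincomb ::
    "real \<Rightarrow> ('p, 'e::real_vector) tvec \<Rightarrow> real \<Rightarrow> ('p, 'e) tvec \<Rightarrow> ('p, 'e) tvec" where
  "lincomb s \<xi> t \<eta> = (\<lambda>c. s *\<^sub>R \<xi> c + t *\<^sub>R \<eta> c)"

definition scale_vec :: "real \<Rightarrow> ('p, 'e::real_vector) tvec \<Rightarrow> ('p, 'e) tvec" where
  "scale_vec s \<xi> = (\<lambda>c. s *\<^sub>R \<xi> c)"

definition vec_at ::
    "('p, 'e::euclidean_space) atlas \<Rightarrow> ('p, 'e) chart \<Rightarrow> 'p \<Rightarrow> 'e \<Rightarrow> ('p, 'e) tvec" where
  \<comment> \<open>the tangent vector at \<open>p\<close> with components \<open>y\<close> in the chart \<open>c\<close>\<close>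
  "vec_at M c p y =
     (\<lambda>d. if chart_at M p d then frechet_derivative (transition c d) (at (snd c p)) y else 0)"

definition velocity ::
    "('p, 'e::real_normed_vector) atlas \<Rightarrow> (real \<Rightarrow> 'p) \<Rightarrow> real \<Rightarrow> ('p, 'e) tvec" where
  "velocity M \<gamma> t =
     (\<lambda>c. if chart_at M (\<gamma> t) c then vector_derivative (snd c \<circ> \<gamma>) (at t) else 0)"

text \<open>The choice of the chart around \<open>p\<close> in the following two definitions is immaterial.\<close>

definition deriv_along ::
    "('p, 'e::euclidean_space) atlas \<Rightarrow> ('p \<Rightarrow> 'b::real_normed_vector) \<Rightarrow> 'p \<Rightarrow> ('p, 'e) tvec \<Rightarrow> 'b"
  where
  "deriv_along M f p \<xi> =
     (let c = (SOME c. chart_at M p c) in frechet_derivative (f \<circ> param c) (at (snd c p)) (\<xi> c))"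

definition differential ::
    "('p, 'e::euclidean_space) atlas \<Rightarrow> ('q, 'f::euclidean_space) atlas \<Rightarrow> ('p \<Rightarrow> 'q) \<Rightarrow>
     'p \<Rightarrow> ('p, 'e) tvec \<Rightarrow> ('q, 'f) tvec" where
  "differential M N f p \<xi> =
     (\<lambda>d. if chart_at N (f p) d then deriv_along M (snd d \<circ> f) p \<xi> else 0)"

definition smooth_function ::
    "('p, 'e::euclidean_space) atlas \<Rightarrow> ('p \<Rightarrow> 'b::real_normed_vector) \<Rightarrow> bool" where
  "smooth_function M f \<longleftrightarrow> (\<forall>c\<in>M. smooth_on (snd c ` fst c) (f \<circ> param c))"

definition smooth_map ::
    "('p, 'e::euclidean_space) atlas \<Rightarrow> 'p set \<Rightarrow> ('q, 'f::euclidean_space) atlas \<Rightarrow> ('p \<Rightarrow> 'q) \<Rightarrow> bool"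
  where
  "smooth_map M U N f \<longleftrightarrow> f ` U \<subseteq> points N \<and>
     (\<forall>c\<in>M. \<forall>d\<in>N. let W = snd c ` (U \<inter> fst c \<inter> f -` fst d) in
        open W \<and> smooth_on W (snd d \<circ> f \<circ> param c))"

definition diffeomorphism ::
    "('p, 'e::euclidean_space) atlas \<Rightarrow> 'p set \<Rightarrow> ('q, 'f::euclidean_space) atlas \<Rightarrow> 'q set \<Rightarrow>
     ('p \<Rightarrow> 'q) \<Rightarrow> bool" where
  "diffeomorphism M U N W f \<longleftrightarrow>
     openin (manifold_topology M) U \<and> openin (manifold_topology N) W \<and> bij_betw f U W \<and>
     smooth_map M U N f \<and> smooth_map N W M (inv_into U f)"

definition orientation_preserving ::
    "('p, real^2) atlas \<Rightarrow> 'p set \<Rightarrow> ('q, real^2) atlas \<Rightarrow> ('p \<Rightarrow> 'q) \<Rightarrow> bool" where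
  "orientation_preserving M U N f \<longleftrightarrow>
     (\<forall>p\<in>U. \<forall>c d. chart_at M p c \<longrightarrow> chart_at N (f p) d \<longrightarrow>
        det (matrix (frechet_derivative (snd d \<circ> f \<circ> param c) (at (snd c p)))) > 0)"

definition smooth_vector_field_on ::
    "('p, 'e::euclidean_space) atlas \<Rightarrow> 'p set \<Rightarrow> ('p \<Rightarrow> ('p, 'e) tvec) \<Rightarrow> bool" where
  "smooth_vector_field_on M W Y \<longleftrightarrow>
     (\<forall>p\<in>W. Y p \<in> tangent_space M p) \<and>
     (\<forall>c\<in>M. smooth_on (snd c ` (W \<inter> fst c)) (\<lambda>x. Y (param c x) c))"

definition open_interval :: "real set \<Rightarrow> bool" where
  "open_interval I \<longleftrightarrow> open I \<and> is_interval I \<and> I \<noteq> {}"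

definition smooth_curve :: "('p, 'e::euclidean_space) atlas \<Rightarrow> real set \<Rightarrow> (real \<Rightarrow> 'p) \<Rightarrow> bool" where
  "smooth_curve M I \<gamma> \<longleftrightarrow> open_interval I \<and> \<gamma> ` I \<subseteq> points M \<and>
     (\<forall>c\<in>M. open (I \<inter> \<gamma> -` fst c) \<and> smooth_on (I \<inter> \<gamma> -` fst c) (snd c \<circ> \<gamma>))"


section \<open>Closed oriented surfaces and the Euler characteristic\<close>

definition closed_connected_oriented_surface :: "('p, real^2) atlas \<Rightarrow> bool" where
  "closed_connected_oriented_surface M \<longleftrightarrow>
     smooth_atlas M \<and> oriented_atlas M \<and>
     Hausdorff_space (manifold_topology M) \<and> compact_space (manifold_topology M) \<and>
     connected_space (manifold_topology M) \<and> points M \<noteq> {}"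

text \<open>The rank (maximal number of elements independent over the integers) of an abelian group.\<close>

definition int_independent :: "('b, 'c) monoid_scheme \<Rightarrow> 'b set \<Rightarrow> bool" where
  "int_independent G S \<longleftrightarrow> finite S \<and> S \<subseteq> carrier G \<and>
     (\<forall>k :: 'b \<Rightarrow> int. finprod G (\<lambda>x. x [^]\<^bsub>G\<^esub> k x) S = \<one>\<^bsub>G\<^esub> \<longrightarrow> (\<forall>x\<in>S. k x = 0))"

definition group_rank :: "('b, 'c) monoid_scheme \<Rightarrow> nat" where
  "group_rank G = Sup {card S | S. int_independent G S}"

definition betti_number :: "nat \<Rightarrow> 'p topology \<Rightarrow> nat" where
  "betti_number k T = group_rank (homology_group (int k) T)"

definition surface_euler_characteristic :: "('p, real^2) atlas \<Rightarrow> int" where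
  "surface_euler_characteristic M =
     (\<Sum>k\<in>{0..2::nat}. (-1) ^ k * int (betti_number k (manifold_topology M)))"


section \<open>Riemannian metrics on oriented surfaces\<close>

type_synonym 'p svec = "('p, real^2) tvec"
type_synonym 'p metric = "'p \<Rightarrow> 'p svec \<Rightarrow> 'p svec \<Rightarrow> real"

definition metric_matrix ::
    "('p, real^2) atlas \<Rightarrow> 'p metric \<Rightarrow> ('p, real^2) chart \<Rightarrow> real^2 \<Rightarrow> real^2^2" where
  "metric_matrix M g c x =
     (\<chi> i j. g (param c x) (vec_at M c (param c x) (axis i 1)) (vec_at M c (param c x) (axis j 1)))"

definition riemannian_metric :: "('p, real^2) atlas \<Rightarrow> 'p metric \<Rightarrow> bool" where
  "riemannian_metric M g \<longleftrightarrow>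
     (\<forall>p\<in>points M. \<forall>c. chart_at M p c \<longrightarrow>
        bilinear (\<lambda>y z. g p (vec_at M c p y) (vec_at M c p z))) \<and>
     (\<forall>p\<in>points M. \<forall>v\<in>tangent_space M p. \<forall>w\<in>tangent_space M p. g p v w = g p w v) \<and>
     (\<forall>p\<in>points M. \<forall>v\<in>tangent_space M p. v \<noteq> zero_vec \<longrightarrow> g p v v > 0) \<and>
     (\<forall>c\<in>M. smooth_on (snd c ` fst c) (metric_matrix M g c))"

text \<open>
  The Christoffel symbols of the Levi-Civita connection in the chart \<open>c\<close>, as a bilinear map:
  \<open>christoffel M g c x y z\<close> has components \<open>\<Gamma>\<^sup>k\<^sub>i\<^sub>j y\<^sup>i z\<^sup>j\<close>, where
  \<open>2 G\<^sub>l\<^sub>k \<Gamma>\<^sup>k\<^sub>i\<^sub>j = \<partial>\<^sub>i G\<^sub>l\<^sub>j + \<partial>\<^sub>j G\<^sub>l\<^sub>i - \<partial>\<^sub>l G\<^sub>i\<^sub>j\<close>.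
\<close>

definition christoffel ::
    "('p, real^2) atlas \<Rightarrow> 'p metric \<Rightarrow> ('p, real^2) chart \<Rightarrow> real^2 \<Rightarrow> real^2 \<Rightarrow> real^2 \<Rightarrow> real^2" where
  "christoffel M g c x y z =
     (let G = metric_matrix M g c; dG = frechet_derivative G (at x) in
      matrix_inv (G x) *v
        (\<chi> l. ((dG y *v z) $ l + (dG z *v y) $ l - y \<bullet> (dG (axis l 1) *v z)) / 2))"

text \<open>Components of \<open>R(y,w)z = \<nabla>\<^sub>y\<nabla>\<^sub>w z - \<nabla>\<^sub>w\<nabla>\<^sub>y z\<close> for coordinate-constant \<open>y, w, z\<close>.\<close>

definition riemann_curvature ::
    "('p, real^2) atlas \<Rightarrow> 'p metric \<Rightarrow> ('p, real^2) chart \<Rightarrow> real^2 \<Rightarrow>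
     real^2 \<Rightarrow> real^2 \<Rightarrow> real^2 \<Rightarrow> real^2" where
  "riemann_curvature M g c x y w z =
     (let \<Gamma> = christoffel M g c in
      frechet_derivative (\<lambda>x. \<Gamma> x w z) (at x) y - frechet_derivative (\<lambda>x. \<Gamma> x y z) (at x) w
      + \<Gamma> x y (\<Gamma> x w z) - \<Gamma> x w (\<Gamma> x y z))"

definition gauss_curvature :: "('p, real^2) atlas \<Rightarrow> 'p metric \<Rightarrow> 'p \<Rightarrow> real" where
  "gauss_curvature M g p =
     (let c = (SOME c. chart_at M p c); x = snd c p; G = metric_matrix M g c x;
          e1 = axis 1 1; e2 = axis 2 1
      in (riemann_curvature M g c x e1 e2 e2 \<bullet> (G *v e1)) / det G)"

text \<open>Rotation by \<open>+\<pi>/2\<close>; the last condition says that \<open>v, w\<close> is positively oriented (or \<open>v = 0\<close>).\<close>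

definition rotate_J :: "('p, real^2) atlas \<Rightarrow> 'p metric \<Rightarrow> 'p \<Rightarrow> 'p svec \<Rightarrow> 'p svec" where
  "rotate_J M g p v = (THE w. w \<in> tangent_space M p \<and> g p w w = g p v v \<and> g p v w = 0 \<and>
     (\<forall>c. chart_at M p c \<longrightarrow> v c $ 1 * w c $ 2 - v c $ 2 * w c $ 1 \<ge> 0))"

definition complex_scale ::
    "('p, real^2) atlas \<Rightarrow> 'p metric \<Rightarrow> 'p \<Rightarrow> complex \<Rightarrow> 'p svec \<Rightarrow> 'p svec" where
  "complex_scale M g p z v = lincomb (Re z) v (Im z) (rotate_J M g p v)"


section \<open>The unit tangent bundle and the projective circle bundle\<close>

type_synonym 'p tpoint = "'p \<times> 'p svec"
type_synonym 'p ray = "'p tpoint set"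

definition unit_bundle :: "('p, real^2) atlas \<Rightarrow> 'p metric \<Rightarrow> 'p tpoint set" where
  "unit_bundle M g = {(p, v). p \<in> points M \<and> v \<in> tangent_space M p \<and> g p v v = 1}"

text \<open>
  Both bundles are 3-manifolds.  As coordinates of the direction of \<open>v \<noteq> 0\<close> we use its slope
  relative to a unit vector \<open>n\<close> of the coordinate plane; this is defined on the half plane of
  directions which have positive inner product with \<open>n\<close>.
\<close>

definition in_half_plane :: "('p, real^2) chart \<Rightarrow> real^2 \<Rightarrow> 'p tpoint \<Rightarrow> bool" where
  "in_half_plane c n q \<longleftrightarrow> fst q \<in> fst c \<and> n \<bullet> snd q c > 0"

definition direction_coords :: "('p, real^2) chart \<Rightarrow> real^2 \<Rightarrow> 'p tpoint \<Rightarrow> (real^2) \<times> real" where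
  "direction_coords c n q =
     (snd c (fst q), (vector [- (n $ 2), n $ 1] \<bullet> snd q c) / (n \<bullet> snd q c))"

definition unit_bundle_atlas ::
    "('p, real^2) atlas \<Rightarrow> 'p metric \<Rightarrow> ('p tpoint, (real^2) \<times> real) atlas" where
  "unit_bundle_atlas M g =
     {({q \<in> unit_bundle M g. in_half_plane c n q}, direction_coords c n) | c n. c \<in> M \<and> norm n = 1}"

definition ray :: "'p tpoint \<Rightarrow> 'p ray" where
  "ray q = {(fst q, scale_vec t (snd q)) | t. t > 0}"

definition circle_bundle :: "('p, real^2) atlas \<Rightarrow> 'p ray set" where
  "circle_bundle M = {ray (p, v) | p v. p \<in> points M \<and> v \<in> tangent_space M p \<and> v \<noteq> zero_vec}"

definition representative :: "'p ray \<Rightarrow> 'p tpoint" where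
  "representative r = (SOME q. q \<in> r)"

definition footpoint :: "'p ray \<Rightarrow> 'p" where
  "footpoint r = fst (representative r)"

definition circle_bundle_atlas ::
    "('p, real^2) atlas \<Rightarrow> ('p ray, (real^2) \<times> real) atlas" where
  "circle_bundle_atlas M =
     {({r \<in> circle_bundle M. in_half_plane c n (representative r)},
       direction_coords c n \<circ> representative) | c n. c \<in> M \<and> norm n = 1}"

text \<open>
  The geodesic vector field \<open>X\<close>.  In the coordinates \<open>(x, y)\<close> on \<open>TM\<close> induced by a chart it is
  \<open>y\<^sup>k \<partial>/\<partial>x\<^sup>k - \<Gamma>\<^sup>k\<^sub>i\<^sub>j y\<^sup>i y\<^sup>j \<partial>/\<partial>y\<^sup>k\<close>, which is tangent to the unit tangent bundle.
\<close>

definition geodesic_field ::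
    "('p, real^2) atlas \<Rightarrow> 'p metric \<Rightarrow> 'p tpoint \<Rightarrow> ('p tpoint, (real^2) \<times> real) tvec" where
  "geodesic_field M g q =
     (THE \<xi>. \<xi> \<in> tangent_space (unit_bundle_atlas M g) q \<and>
        (\<forall>c. chart_at M (fst q) c \<longrightarrow>
           deriv_along (unit_bundle_atlas M g) (\<lambda>q'. (snd c (fst q'), snd q' c)) q \<xi> =
             (snd q c, - christoffel M g c (snd c (fst q)) (snd q c) (snd q c))))"

text \<open>The generator \<open>V\<close> of the rotation in the fibres.\<close>

definition rotation_field ::
    "('p, real^2) atlas \<Rightarrow> 'p metric \<Rightarrow> 'p tpoint \<Rightarrow> ('p tpoint, (real^2) \<times> real) tvec" where
  "rotation_field M g q = velocity (unit_bundle_atlas M g)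
     (\<lambda>t. (fst q, lincomb (cos t) (snd q) (sin t) (rotate_J M g (fst q) (snd q)))) 0"

definition V_derivative ::
    "('p, real^2) atlas \<Rightarrow> 'p metric \<Rightarrow> ('p tpoint \<Rightarrow> real) \<Rightarrow> 'p tpoint \<Rightarrow> real" where
  "V_derivative M g f q = deriv_along (unit_bundle_atlas M g) f q (rotation_field M g q)"

definition d_proj ::
    "('p, real^2) atlas \<Rightarrow> 'p metric \<Rightarrow> 'p tpoint \<Rightarrow> ('p tpoint, (real^2) \<times> real) tvec \<Rightarrow> 'p svec"
  where
  "d_proj M g q \<xi> = differential (unit_bundle_atlas M g) M fst q \<xi>"

definition omega1 ::
    "('p, real^2) atlas \<Rightarrow> 'p metric \<Rightarrow> 'p tpoint \<Rightarrow> ('p tpoint, (real^2) \<times> real) tvec \<Rightarrow> real" where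
  "omega1 M g q \<xi> = g (fst q) (d_proj M g q \<xi>) (snd q)"

definition omega2 ::
    "('p, real^2) atlas \<Rightarrow> 'p metric \<Rightarrow> 'p tpoint \<Rightarrow> ('p tpoint, (real^2) \<times> real) tvec \<Rightarrow> real" where
  "omega2 M g q \<xi> = g (fst q) (d_proj M g q \<xi>) (rotate_J M g (fst q) (snd q))"


section \<open>Differentials of degree \<open>m\<close>\<close>

text \<open>
  For the complex structure \<open>J\<close> on the real plane \<open>T\<^sub>pM\<close>, an element of the fibre of \<open>K\<^sub>M\<^sup>m\<close> at
  \<open>p\<close> is a complex multilinear form of degree \<open>m\<close> on the complex line \<open>T\<^sub>pM\<close>.  We represent it
  by its values \<open>A p v\<close> on \<open>(v, \<dots>, v)\<close>, i.e. as a homogeneous complex polynomial of degree \<open>m\<close>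
  on the complex line \<open>T\<^sub>pM\<close>.
\<close>

type_synonym 'p kdiff = "'p \<Rightarrow> 'p svec \<Rightarrow> complex"

definition degree_differential ::
    "('p, real^2) atlas \<Rightarrow> 'p metric \<Rightarrow> nat \<Rightarrow> 'p kdiff \<Rightarrow> bool" where
  "degree_differential M g m A \<longleftrightarrow>
     (\<forall>p\<in>points M. \<forall>v\<in>tangent_space M p. \<forall>z. A p (complex_scale M g p z v) = z ^ m * A p v) \<and>
     (\<forall>c\<in>M. \<forall>y. smooth_on (snd c ` fst c) (\<lambda>x. A (param c x) (vec_at M c (param c x) y)))"

definition vanishes_identically :: "('p, real^2) atlas \<Rightarrow> 'p kdiff \<Rightarrow> bool" where
  "vanishes_identically M A \<longleftrightarrow> (\<forall>p\<in>points M. \<forall>v\<in>tangent_space M p. A p v = 0)"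

text \<open>The local holomorphic coordinates of the Riemann surface determined by \<open>[g]\<close> and the
  orientation.\<close>

definition complex_plane :: "(complex, complex) atlas" where
  "complex_plane = {(UNIV, \<lambda>w. w)}"

definition holomorphic_coordinate ::
    "('p, real^2) atlas \<Rightarrow> 'p metric \<Rightarrow> 'p set \<Rightarrow> ('p \<Rightarrow> complex) \<Rightarrow> bool" where
  "holomorphic_coordinate M g U z \<longleftrightarrow>
     diffeomorphism M U complex_plane (z ` U) z \<and>
     (\<forall>p\<in>U. \<forall>v\<in>tangent_space M p.
        deriv_along M z p (rotate_J M g p v) = \<i> * deriv_along M z p v)"

definition wirtinger_bar :: "(complex \<Rightarrow> complex) \<Rightarrow> complex \<Rightarrow> complex" where
  "wirtinger_bar \<alpha> w =
     (frechet_derivative \<alpha> (at w) 1 + \<i> * frechet_derivative \<alpha> (at w) \<i>) / 2"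

text \<open>
  \<open>\<partial>\<close>-bar \<open>A = 0\<close>: around every point, \<open>A = \<alpha>(z) dz\<^sup>m\<close> in a holomorphic coordinate \<open>z\<close> with
  \<open>\<partial>\<alpha>/\<partial>z\<close>-bar \<open>= 0\<close>.
\<close>

definition dbar_vanishes :: "('p, real^2) atlas \<Rightarrow> 'p metric \<Rightarrow> nat \<Rightarrow> 'p kdiff \<Rightarrow> bool" where
  "dbar_vanishes M g m A \<longleftrightarrow>
     (\<forall>p\<in>points M. \<exists>U z \<alpha>. p \<in> U \<and> holomorphic_coordinate M g U z \<and>
        (\<forall>q\<in>U. \<forall>v\<in>tangent_space M q. A q v = \<alpha> (z q) * deriv_along M z q v ^ m) \<and>
        (\<forall>w\<in>z ` U. wirtinger_bar \<alpha> w = 0))"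

text \<open>The square of the pointwise norm: \<open>\<bar>A p v\<bar>\<close> takes the same value at all unit vectors \<open>v\<close>.\<close>

definition norm_sq :: "('p, real^2) atlas \<Rightarrow> 'p metric \<Rightarrow> 'p kdiff \<Rightarrow> 'p \<Rightarrow> real" where
  "norm_sq M g A p = (THE r. \<forall>v. (p, v) \<in> unit_bundle M g \<longrightarrow> r = (cmod (A p v))\<^sup>2)"

definition coupled_vortex_equations ::
    "('p, real^2) atlas \<Rightarrow> 'p metric \<Rightarrow> nat \<Rightarrow> 'p kdiff \<Rightarrow> bool" where
  "coupled_vortex_equations M g m A \<longleftrightarrow> dbar_vanishes M g m A \<and>
     (\<forall>p\<in>points M. gauss_curvature M g p = -1 + (real m - 1) * norm_sq M g A p)"

text \<open>The real-valued function \<open>a\<close> on the unit tangent bundle corresponding to \<open>A\<close>.\<close>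

definition corresponding_function ::
    "('p, real^2) atlas \<Rightarrow> 'p metric \<Rightarrow> nat \<Rightarrow> 'p kdiff \<Rightarrow> ('p tpoint \<Rightarrow> real) \<Rightarrow> bool" where
  "corresponding_function M g m A a \<longleftrightarrow>
     smooth_function (unit_bundle_atlas M g) a \<and>
     (\<forall>q\<in>unit_bundle M g.
        V_derivative M g (V_derivative M g a) q = - (real m)\<^sup>2 * a q \<and>
        (\<forall>\<xi>\<in>tangent_space (unit_bundle_atlas M g) q.
           A (fst q) (d_proj M g q \<xi>) =
             Complex (V_derivative M g a q / real m) (a q) *
             Complex (omega1 M g q \<xi>) (omega2 M g q \<xi>) ^ m))"


section \<open>Path geometries\<close>

text \<open>
  An oriented line subbundle \<open>L\<close> of the tangent bundle of the circle bundle is given by the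
  map \<open>P\<close> assigning to each point \<open>r\<close> the open half line of positive vectors of \<open>L\<^sub>r\<close>.
\<close>

type_synonym 'p circle_tvec = "('p ray, (real^2) \<times> real) tvec"
type_synonym 'p line_field = "'p ray \<Rightarrow> 'p circle_tvec set"

definition oriented_line_bundle :: "('p, real^2) atlas \<Rightarrow> 'p line_field \<Rightarrow> bool" where
  "oriented_line_bundle M P \<longleftrightarrow>
     (\<forall>r\<in>circle_bundle M. \<exists>W Y. openin (manifold_topology (circle_bundle_atlas M)) W \<and> r \<in> W \<and>
        smooth_vector_field_on (circle_bundle_atlas M) W Y \<and>
        (\<forall>r'\<in>W. Y r' \<noteq> zero_vec \<and> P r' = {scale_vec s (Y r') | s. s > 0}))"

definition vertical_space :: "('p, real^2) atlas \<Rightarrow> 'p ray \<Rightarrow> 'p circle_tvec set" where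
  "vertical_space M r = {\<eta> \<in> tangent_space (circle_bundle_atlas M) r.
     differential (circle_bundle_atlas M) M footpoint r \<eta> = zero_vec}"

text \<open>The contact plane at the ray through \<open>v\<close> consists of the vectors projecting to multiples of \<open>v\<close>.\<close>

definition contact_space :: "('p, real^2) atlas \<Rightarrow> 'p ray \<Rightarrow> 'p circle_tvec set" where
  "contact_space M r = {\<zeta> \<in> tangent_space (circle_bundle_atlas M) r.
     \<exists>s. differential (circle_bundle_atlas M) M footpoint r \<zeta> =
           scale_vec s (snd (representative r))}"

definition path_geometry :: "('p, real^2) atlas \<Rightarrow> 'p line_field \<Rightarrow> bool" where
  "path_geometry M P \<longleftrightarrow> oriented_line_bundle M P \<and>
     (\<forall>r\<in>circle_bundle M.
        {lincomb s \<xi> 1 \<eta> | s \<xi> \<eta>. \<xi> \<in> P r \<and> \<eta> \<in> vertical_space M r} = contact_space M r)"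

text \<open>
  Paths are described by their parametrizations \<open>c\<close> on open intervals \<open>I\<close> (values of \<open>c\<close> outside
  \<open>I\<close> are irrelevant).  All positively oriented reparametrizations are included, since the
  velocity of the lift may be any positive vector of the line.
\<close>

definition oriented_path ::
    "('p, real^2) atlas \<Rightarrow> 'p line_field \<Rightarrow> real set \<Rightarrow> (real \<Rightarrow> 'p) \<Rightarrow> bool" where
  "oriented_path M P I c \<longleftrightarrow>
     (\<exists>\<gamma>. smooth_curve (circle_bundle_atlas M) I \<gamma> \<and>
        (\<forall>t\<in>I. velocity (circle_bundle_atlas M) \<gamma> t \<in> P (\<gamma> t)) \<and>
        (\<forall>t\<in>I. c t = footpoint (\<gamma> t)))"

text \<open>
  The unit sphere, oriented by the outward normal.  The charts are the stereographic projections
  from the two poles; the first one is composed with a reflection so as to be positively oriented.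
\<close>

definition sphere_atlas :: "(real^3, real^2) atlas" where
  "sphere_atlas =
     {({x. norm x = 1 \<and> x $ 3 \<noteq> 1}, \<lambda>x. vector [x $ 1 / (1 - x $ 3), - x $ 2 / (1 - x $ 3)]),
      ({x. norm x = 1 \<and> x $ 3 \<noteq> -1}, \<lambda>x. vector [x $ 1 / (1 + x $ 3), x $ 2 / (1 + x $ 3)])}"

definition great_circle_arc :: "real set \<Rightarrow> (real \<Rightarrow> real^3) \<Rightarrow> bool" where
  "great_circle_arc I d \<longleftrightarrow> open_interval I \<and>
     (\<exists>u w \<theta>. norm u = 1 \<and> norm w = 1 \<and> u \<bullet> w = 0 \<and>
        smooth_on I \<theta> \<and> (\<forall>t\<in>I. deriv \<theta> t > 0) \<and>
        (\<forall>t\<in>I. d t = cos (\<theta> t) *\<^sub>R u + sin (\<theta> t) *\<^sub>R w))"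

definition flat_path_geometry :: "('p, real^2) atlas \<Rightarrow> 'p line_field \<Rightarrow> bool" where
  "flat_path_geometry M P \<longleftrightarrow> path_geometry M P \<and>
     (\<forall>p\<in>points M. \<exists>U W f. p \<in> U \<and>
        diffeomorphism M U sphere_atlas W f \<and> orientation_preserving M U sphere_atlas f \<and>
        (\<forall>I c. oriented_path M P I c \<and> c ` I \<subseteq> U \<longrightarrow> great_circle_arc I (f \<circ> c)) \<and>
        (\<forall>I d. great_circle_arc I d \<and> d ` I \<subseteq> W \<longrightarrow>
           (\<exists>c. oriented_path M P I c \<and> c ` I \<subseteq> U \<and> (\<forall>t\<in>I. d t = f (c t)))))"

definition thermostat ::
    "('p, real^2) atlas \<Rightarrow> 'p metric \<Rightarrow> ('p tpoint \<Rightarrow> real) \<Rightarrow>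
     'p tpoint \<Rightarrow> ('p tpoint, (real^2) \<times> real) tvec" where
  "thermostat M g a q = lincomb 1 (geodesic_field M g q) (a q) (rotation_field M g q)"

text \<open>The line field spanned by a vector field \<open>F\<close> on the unit tangent bundle, transported by
  the diffeomorphism \<^const>\<open>ray\<close> from the unit tangent bundle to the circle bundle.\<close>

definition thermostat_path_geometry ::
    "('p, real^2) atlas \<Rightarrow> 'p metric \<Rightarrow>
     ('p tpoint \<Rightarrow> ('p tpoint, (real^2) \<times> real) tvec) \<Rightarrow> 'p line_field" where
  "thermostat_path_geometry M g F r =
     {scale_vec s (differential (unit_bundle_atlas M g) (circle_bundle_atlas M) ray q (F q)) | s q.
        s > 0 \<and> q \<in> unit_bundle M g \<and> ray q = r}"

end

theory Submission imports Defs begin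

text \<open>
  In a chart, a curve \<open>x\<close> is an oriented path of the thermostat if and only if \<open>x' \<noteq> 0\<close> and the
  cross product of \<open>x'\<close> with the covariant acceleration \<open>x'' + \<Gamma>(x', x')\<close> equals
  \<open>\<bar>x'\<bar>\<^sup>3 a(x'/\<bar>x'\<bar>)\<close> up to the area density (\<open>oriented_path_equation\<close>, \<open>oriented_pathI\<close>), where
  \<open>a\<close> is the imaginary part of \<open>A\<close> on unit vectors.

  If the path geometry is flat, a local diffeomorphism to the sphere pulls great circles back to
  paths of every direction.  Great circles satisfy a second order equation whose cross product with
  the velocity is cubic in the velocity, so \<open>\<bar>v\<bar>\<^sup>3\<^sup>-\<^sup>m Im A(v)\<close> is a cubic polynomial in \<open>v\<close>.  On a circle
  of unit vectors it is a multiple of a shifted \<open>sin (m \<theta>)\<close>, whereas a cubic polynomial only has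
  the Fourier modes 1 and 3.  Since \<open>m \<ge> 2\<close>, this leaves \<open>m = 3\<close> or \<open>A = 0\<close>
  (\<open>flat_imp_cubic_or_zero\<close>).

  Conversely, in a holomorphic coordinate the metric is \<open>\<rho> \<bar>dz\<bar>\<^sup>2\<close> (\<open>conformal\<close>) and \<open>A = \<alpha> dz\<^sup>3\<close> with
  \<open>\<alpha>\<close> holomorphic; if \<open>A = 0\<close> we take \<open>\<alpha> = 0\<close>.  Consider the overdetermined linear system for a
  function which prescribes its second derivatives in terms of the function and its first
  derivatives, with coefficients given by the derivatives of \<open>log \<rho>\<close> and by \<open>\<alpha>/\<rho>\<close>.  Its
  integrability conditions are exactly the Cauchy-Riemann equations for \<open>\<alpha>\<close> and the curvature
  equation \<open>K = -1 + 2 \<bar>A\<bar>\<^sup>2\<close>.  Hence the system has three independent solutions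
  (\<open>flat_system_solution\<close>), and their ratios define a map to the plane in which paths become straight
  lines (\<open>straightening\<close>).  Central projection turns oriented straight lines into oriented great
  circles (\<open>straight_imp_great_circle\<close>, \<open>great_circle_imp_straight\<close>).
\<close>

section \<open>Calculus of smooth maps\<close>

abbreviation (input) "fderiv \<equiv> frechet_derivative"

lemma frechet_derivative_cong:
 assumes "open S" "x \<in> S" "!!y. y \<in> S ==> f y = g y"
 shows "fderiv f (at x) = fderiv g (at x)"
proof -
 have "(f has_derivative D) (at x) \<longleftrightarrow> (g has_derivative D) (at x)" for D
  using assms has_derivative_transform_within_open[of f D x UNIV S g]
   has_derivative_transform_within_open[of g D x UNIV S f] by auto
 then show ?thesis unfolding frechet_derivative_def by simp
qed

lemma differentiable_cong:
 assumes "open S" "x \<in> S" "!!y. y \<in> S ==> f y = g y"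
 shows "f differentiable (at x) \<longleftrightarrow> g differentiable (at x)"
 unfolding differentiable_def
 using assms has_derivative_transform_within_open[of f _ x UNIV S g]
   has_derivative_transform_within_open[of g _ x UNIV S f] by metis

lemma Ck_on_cong:
 assumes "open S" "!!y. y \<in> S ==> f y = g y"
 shows "Ck_on k S f \<longleftrightarrow> Ck_on k S g"
 using assms(2)
proof (induction k arbitrary: f g)
 case 0
 then show ?case by (simp cong: continuous_on_cong)
next
 case (Suc k)
 have "Ck_on k S (%x. fderiv f (at x) h) \<longleftrightarrow> Ck_on k S (%x. fderiv g (at x) h)" for h
  by (rule Suc.IH) (metis frechet_derivative_cong[OF assms(1)] Suc.prems)
 moreover have "(\<forall>x\<in>S. f differentiable (at x)) \<longleftrightarrow> (\<forall>x\<in>S. g differentiable (at x))"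
  by (metis differentiable_cong[OF assms(1)] Suc.prems)
 ultimately show ?case by simp
qed

lemma Ck_on_subset: "Ck_on k S f ==> T \<subseteq> S ==> Ck_on k T f"
 by (induction k arbitrary: f) (auto intro: continuous_on_subset)

lemma Ck_on_Suc_imp: "Ck_on (Suc k) S f ==> Ck_on k S f"
proof (induction k arbitrary: f)
 case 0
 then show ?case
  using differentiable_imp_continuous_on[of f S] differentiable_at_withinI[of f _ S]
  by (auto simp: differentiable_on_def)
qed simp

lemma Ck_on_SucI:
 assumes "open S" "!!x. x \<in> S ==> (f has_derivative D x) (at x)"
  and "!!h. Ck_on k S (%x. D x h)"
 shows "Ck_on (Suc k) S f"
proof -
 have "fderiv f (at x) = D x" if "x \<in> S" for x
  using frechet_derivative_at assms(2)[OF that] by metis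
 then have "Ck_on k S (%x. fderiv f (at x) h)" for h
  using Ck_on_cong[OF assms(1), of "%x. fderiv f (at x) h" "%x. D x h"] assms(3) by simp
 then show ?thesis using assms(2) by (auto simp: differentiable_def)
qed

lemma Ck_on_has_derivative:
 "Ck_on (Suc k) S f ==> x \<in> S ==> (f has_derivative fderiv f (at x)) (at x)"
 by (simp add: frechet_derivative_works)

lemma Ck_on_const: "open S ==> Ck_on k S (%x. c)"
proof (induction k arbitrary: c)
 case (Suc k)
 then show ?case by (intro Ck_on_SucI[where D="%x h. 0"]) auto
qed simp

lemma Ck_on_linear:
 assumes "bounded_linear L" "open S"
 shows "Ck_on k S f ==> Ck_on k S (%x. L (f x))"
proof (induction k arbitrary: f)
 case 0
 then show ?case using assms by (simp add: bounded_linear.continuous_on)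
next
 case (Suc k)
 show ?case
 proof (rule Ck_on_SucI[OF assms(2)])
  show "((%x. L (f x)) has_derivative (%h. L (fderiv f (at x) h))) (at x)" if "x \<in> S" for x
   using bounded_linear.has_derivative[OF assms(1) Ck_on_has_derivative[OF Suc.prems that]] .
  show "Ck_on k S (%x. L (fderiv f (at x) h))" for h
   using Suc by auto
 qed
qed

lemma Ck_on_id: "open S ==> Ck_on k S (%x. x)"
proof (cases k)
 case (Suc l)
 assume "open S"
 then show ?thesis unfolding Suc by (intro Ck_on_SucI[where D="%x h. h"]) (auto intro: Ck_on_const)
qed simp

lemma Ck_on_add:
 assumes "open S"
 shows "Ck_on k S f ==> Ck_on k S g ==> Ck_on k S (%x. f x + g x)"
proof (induction k arbitrary: f g)
 case 0
 then show ?case by (auto intro: continuous_intros)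
next
 case (Suc k)
 show ?case
  by (rule Ck_on_SucI[OF assms has_derivative_add[OF Ck_on_has_derivative Ck_on_has_derivative]])
   (use Suc in auto)
qed

lemma Ck_on_sum:
 assumes "open S" "!!i. i \<in> I ==> Ck_on k S (f i)"
 shows "Ck_on k S (%x. \<Sum>i\<in>I. f i x)"
 using assms(2)
 by (induction I rule: infinite_finite_induct) (auto intro: Ck_on_const Ck_on_add assms(1))

lemma Ck_on_bilinear:
 assumes "bounded_bilinear B" "open S"
 shows "Ck_on k S f ==> Ck_on k S g ==> Ck_on k S (%x. B (f x) (g x))"
proof (induction k arbitrary: f g)
 case 0
 then show ?case using bounded_bilinear.continuous_on[OF assms(1)] by auto
next
 case (Suc k)
 show ?case
 proof (rule Ck_on_SucI[OF assms(2)])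
  show "((%x. B (f x) (g x)) has_derivative
   (%h. B (f x) (fderiv g (at x) h) + B (fderiv f (at x) h) (g x))) (at x)"
   if "x \<in> S" for x
   using bounded_bilinear.FDERIV[OF assms(1) Ck_on_has_derivative[OF Suc.prems(1) that] Ck_on_has_derivative[OF Suc.prems(2) that]] .
  show "Ck_on k S (%x. B (f x) (fderiv g (at x) h) + B (fderiv f (at x) h) (g x))" for h
   using Suc.prems Ck_on_Suc_imp[OF Suc.prems(1)] Ck_on_Suc_imp[OF Suc.prems(2)]
   by (intro Ck_on_add[OF assms(2)] Suc.IH) auto
 qed
qed

lemma Ck_on_Pair:
 assumes "open S"
 shows "Ck_on k S f ==> Ck_on k S g ==> Ck_on k S (%x. (f x, g x))"
proof (induction k arbitrary: f g)
 case 0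
 then show ?case by (auto intro: continuous_intros)
next
 case (Suc k)
 show ?case
  by (rule Ck_on_SucI[OF assms has_derivative_Pair[OF Ck_on_has_derivative Ck_on_has_derivative]])
   (use Suc in auto)
qed

lemma Ck_on_compose:
 fixes f :: "'b::euclidean_space \<Rightarrow> 'c::real_normed_vector" and g :: "'a::euclidean_space \<Rightarrow> 'b"
 assumes "open S" "open T"
 shows "Ck_on k T f ==> Ck_on k S g ==> g ` S \<subseteq> T ==> Ck_on k S (%x. f (g x))"
proof (induction k arbitrary: f)
 case 0
 then show ?case by (auto intro: continuous_on_compose2)
next
 case (Suc k)
 let ?D = "%x h. \<Sum>b\<in>Basis. (fderiv g (at x) h \<bullet> b) *\<^sub>R fderiv f (at (g x)) b"
 show ?case
 proof (rule Ck_on_SucI[OF assms(1)])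
  fix x assume x: "x \<in> S"
  have df: "(f has_derivative fderiv f (at (g x))) (at (g x))"
   using Ck_on_has_derivative[OF Suc.prems(1)] x Suc.prems(3) by auto
  have "((%x. f (g x)) has_derivative (%h. fderiv f (at (g x)) (fderiv g (at x) h))) (at x)"
   using has_derivative_compose[OF Ck_on_has_derivative[OF Suc.prems(2) x] df] .
  moreover have "fderiv f (at (g x)) v = (\<Sum>b\<in>Basis. (v \<bullet> b) *\<^sub>R fderiv f (at (g x)) b)" for v
  proof -
   have l: "linear (fderiv f (at (g x)))" using df has_derivative_linear by blast
   show ?thesis
    using linear_sum[OF l, of "%b. (v \<bullet> b) *\<^sub>R b" Basis]
    by (simp only: euclidean_representation linear_cmul[OF l])
  qed
  then have "(%h. fderiv f (at (g x)) (fderiv g (at x) h)) = ?D x" by blast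
  ultimately show "((%x. f (g x)) has_derivative ?D x) (at x)" by (simp only:)
 next
  fix h
  have "Ck_on k S (%x. fderiv f (at (g x)) b)" for b
   using Suc.prems Ck_on_Suc_imp[OF Suc.prems(2)] by (intro Suc.IH) auto
  moreover have "Ck_on k S (%x. fderiv g (at x) h \<bullet> b)" for b
   by (rule Ck_on_linear[OF bounded_linear_inner_left assms(1)]) (use Suc.prems in auto)
  ultimately show "Ck_on k S (%x. ?D x h)"
   by (intro Ck_on_sum[OF assms(1)] Ck_on_bilinear[OF bounded_bilinear_scaleR assms(1)])
 qed
qed

lemma Ck_on_SucI_real:
 fixes f :: "real \<Rightarrow> 'a::real_normed_vector"
 assumes "open S" "!!x. x \<in> S ==> (f has_vector_derivative f' x) (at x)" "Ck_on k S f'"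
 shows "Ck_on (Suc k) S f"
 using assms(1) assms(2)[unfolded has_vector_derivative_def]
 by (rule Ck_on_SucI) (auto intro: Ck_on_linear[OF bounded_linear_scaleR_right assms(1,3)])

lemma Ck_on_minus: "open S ==> Ck_on k S f ==> Ck_on k S (%x. - f x)"
 using Ck_on_linear[OF bounded_linear_minus[OF bounded_linear_ident]] .

lemma Ck_on_real_inverse: "Ck_on k {x::real. x ~= 0} inverse"
proof (induction k)
 case 0
 then show ?case by (auto intro!: continuous_intros)
next
 case (Suc k)
 have o: "open {x::real. x ~= 0}" by (simp add: open_Collect_neq continuous_on_id)
 show ?case
 proof (rule Ck_on_SucI_real[OF o, where f' = "%x. - (inverse x * inverse x)"])
  fix x :: real assume "x \<in> {x. x ~= 0}"
  then show "(inverse has_vector_derivative - (inverse x * inverse x)) (at x)"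
   using DERIV_inverse[of x UNIV] by (simp add: has_real_derivative_iff_has_vector_derivative power2_eq_square)
 qed (intro Ck_on_minus o Ck_on_bilinear[OF bounded_bilinear_mult] Suc)
qed

lemma Ck_on_inverse:
 assumes "open S" "Ck_on k S f" "!!x. x \<in> S ==> f x ~= (0::real)"
 shows "Ck_on k S (%x. inverse (f x))"
 by (rule Ck_on_compose[OF assms(1) _ Ck_on_real_inverse assms(2)])
  (use assms(3) in \<open>auto simp: open_Collect_neq continuous_on_id\<close>)

lemma Ck_on_real_sqrt: "Ck_on k {x::real. x > 0} sqrt"
proof (induction k)
 case 0
 then show ?case by (auto intro!: continuous_intros)
next
 case (Suc k)
 have o: "open {x::real. x > 0}" by (simp add: open_Collect_less continuous_on_id)
 show ?case
 proof (rule Ck_on_SucI_real[OF o, where f' = "%x. inverse (sqrt x) / 2"])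
  fix x :: real assume "x \<in> {x. x > 0}"
  then show "(sqrt has_vector_derivative (inverse (sqrt x) / 2)) (at x)"
   using DERIV_real_sqrt[of x] by (simp only: has_real_derivative_iff_has_vector_derivative mem_Collect_eq)
 next
  have "Ck_on k {x. x > 0} (%x::real. inverse (sqrt x))"
   by (rule Ck_on_inverse[OF o Suc]) simp
  then show "Ck_on k {x. x > 0} (%x::real. inverse (sqrt x) / 2)"
   by (rule Ck_on_linear[OF bounded_linear_divide o])
 qed
qed

lemma Ck_on_real_sin_cos: "Ck_on k UNIV (sin :: real \<Rightarrow> real) \<and> Ck_on k UNIV (cos :: real \<Rightarrow> real)"
proof (induction k)
 case 0
 then show ?case by (auto intro!: continuous_intros)
next
 case (Suc k)
 have "(sin has_vector_derivative cos x) (at x)" "(cos has_vector_derivative - sin x) (at x)" for x :: real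
  using DERIV_sin[of x] DERIV_cos[of x] by (auto simp: has_real_derivative_iff_has_vector_derivative)
 then show ?case
  using Ck_on_SucI_real[OF open_UNIV, of sin cos k] Suc
   Ck_on_SucI_real[OF open_UNIV, of cos "%x. - sin x" k] Ck_on_minus[OF open_UNIV, of k sin] by blast
qed

lemma Ck_on_real_arctan: "Ck_on k UNIV arctan"
proof (cases k)
 case 0
 then show ?thesis by (auto intro!: continuous_intros)
next
 case (Suc l)
 have *: "1 + x * x ~= 0" for x :: real by (smt (verit) zero_le_square)
 show ?thesis unfolding Suc
 proof (rule Ck_on_SucI_real[where f' = "%x. inverse (1 + x * x)"])
  show "(arctan has_vector_derivative inverse (1 + x * x)) (at x)" for x
   using DERIV_arctan[of x] by (simp add: has_real_derivative_iff_has_vector_derivative power2_eq_square)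
 qed (auto intro!: Ck_on_inverse Ck_on_add Ck_on_const Ck_on_id Ck_on_bilinear[OF bounded_bilinear_mult] *)
qed

named_theorems smooth_intros

lemma smooth_on_cong: "open S ==> (!!y. y \<in> S ==> f y = g y) ==> smooth_on S f \<longleftrightarrow> smooth_on S g"
 unfolding smooth_on_def using Ck_on_cong by blast

lemma smooth_on_subset: "smooth_on S f ==> T \<subseteq> S ==> smooth_on T f"
 unfolding smooth_on_def using Ck_on_subset by blast

lemma smooth_on_has_derivative:
 "smooth_on S f ==> x \<in> S ==> (f has_derivative fderiv f (at x)) (at x)"
 unfolding smooth_on_def using Ck_on_has_derivative by blast

lemma smooth_on_differentiable: "smooth_on S f ==> x \<in> S ==> f differentiable (at x)"
 using smooth_on_has_derivative differentiable_def by blast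

lemma smooth_on_continuous_on: "smooth_on S f ==> continuous_on S f"
 unfolding smooth_on_def using Ck_on.simps(1) by blast

lemma smooth_on_frechet: "smooth_on S f ==> smooth_on S (%x. fderiv f (at x) h)"
 unfolding smooth_on_def using Ck_on.simps(2) by blast

lemma smooth_on_compose:
 assumes "open S" "open T" "smooth_on T f" "smooth_on S g" "g ` S \<subseteq> T"
 shows "smooth_on S (%x. f (g x))"
 using assms Ck_on_compose[OF assms(1,2)] unfolding smooth_on_def by blast

lemma smooth_on_const[smooth_intros]: "open S ==> smooth_on S (%x. c)"
 by (simp add: smooth_on_def Ck_on_const)
lemma smooth_on_id[smooth_intros]: "open S ==> smooth_on S (%x. x)"
 by (simp add: smooth_on_def Ck_on_id)
lemma smooth_on_linear: "bounded_linear L ==> open S ==> smooth_on S f ==> smooth_on S (%x. L (f x))"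
 by (simp add: smooth_on_def Ck_on_linear)
lemma smooth_on_bilinear:
 "bounded_bilinear B ==> open S ==> smooth_on S f ==> smooth_on S g ==> smooth_on S (%x. B (f x) (g x))"
 by (simp add: smooth_on_def Ck_on_bilinear)
lemma smooth_on_add[smooth_intros]:
 "open S ==> smooth_on S f ==> smooth_on S g ==> smooth_on S (%x. f x + g x)"
 by (simp add: smooth_on_def Ck_on_add)
lemma smooth_on_minus[smooth_intros]: "open S ==> smooth_on S f ==> smooth_on S (%x. - f x)"
 by (simp add: smooth_on_def Ck_on_minus)
lemma smooth_on_diff[smooth_intros]:
 "open S ==> smooth_on S f ==> smooth_on S g ==> smooth_on S (%x. f x - g x)"
 using smooth_on_add[OF _ _ smooth_on_minus, of S f g] by simp
lemma smooth_on_sum[smooth_intros]: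
 "open S ==> (!!i. i \<in> I ==> smooth_on S (f i)) ==> smooth_on S (%x. \<Sum>i\<in>I. f i x)"
 by (simp add: smooth_on_def Ck_on_sum)
lemma smooth_on_mult[smooth_intros]:
 fixes f g :: "_ \<Rightarrow> 'a::real_normed_algebra"
 shows "open S ==> smooth_on S f ==> smooth_on S g ==> smooth_on S (%x. f x * g x)"
 by (rule smooth_on_bilinear[OF bounded_bilinear_mult])
lemma smooth_on_scaleR[smooth_intros]:
 "open S ==> smooth_on S f ==> smooth_on S g ==> smooth_on S (%x. f x *\<^sub>R g x)"
 by (rule smooth_on_bilinear[OF bounded_bilinear_scaleR])
lemma smooth_on_inner[smooth_intros]:
 "open S ==> smooth_on S f ==> smooth_on S g ==> smooth_on S (%x. f x \<bullet> g x)"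
 by (rule smooth_on_bilinear[OF bounded_bilinear_inner])
lemma smooth_on_Pair[smooth_intros]:
 "open S ==> smooth_on S f ==> smooth_on S g ==> smooth_on S (%x. (f x, g x))"
 by (simp add: smooth_on_def Ck_on_Pair)
lemma smooth_on_fst[smooth_intros]: "open S ==> smooth_on S f ==> smooth_on S (%x. fst (f x))"
 by (rule smooth_on_linear[OF bounded_linear_fst])
lemma smooth_on_snd[smooth_intros]: "open S ==> smooth_on S f ==> smooth_on S (%x. snd (f x))"
 by (rule smooth_on_linear[OF bounded_linear_snd])
lemma smooth_on_nth[smooth_intros]: "open S ==> smooth_on S f ==> smooth_on S (%x. f x $ i)"
 by (rule smooth_on_linear[OF bounded_linear_vec_nth])
lemma smooth_on_power[smooth_intros]:
 fixes f :: "_ \<Rightarrow> 'a::real_normed_algebra_1"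
 shows "open S ==> smooth_on S f ==> smooth_on S (%x. f x ^ n)"
 by (induction n) (simp_all add: smooth_on_const smooth_on_mult)
lemma smooth_on_inverse[smooth_intros]:
 "open S ==> smooth_on S f ==> (!!x. x \<in> S ==> f x ~= (0::real)) ==> smooth_on S (%x. inverse (f x))"
 by (simp add: smooth_on_def Ck_on_inverse)
lemma smooth_on_divide[smooth_intros]:
 "open S ==> smooth_on S f ==> smooth_on S g ==> (!!x. x \<in> S ==> g x ~= (0::real)) ==> smooth_on S (%x. f x / g x)"
 by (simp add: divide_inverse smooth_on_inverse smooth_on_mult)
lemma smooth_on_sqrt[smooth_intros]:
 "open S ==> smooth_on S f ==> (!!x. x \<in> S ==> f x > 0) ==> smooth_on S (%x. sqrt (f x))"
 by (rule smooth_on_compose[of _ "{x::real. x > 0}"])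
  (auto simp: smooth_on_def Ck_on_real_sqrt open_Collect_less continuous_on_id)
lemma smooth_on_cos[smooth_intros]: "open S ==> smooth_on S f ==> smooth_on S (%x. cos (f x :: real))"
 by (rule smooth_on_compose[of _ UNIV]) (auto simp: smooth_on_def Ck_on_real_sin_cos)
lemma smooth_on_sin[smooth_intros]: "open S ==> smooth_on S f ==> smooth_on S (%x. sin (f x :: real))"
 by (rule smooth_on_compose[of _ UNIV]) (auto simp: smooth_on_def Ck_on_real_sin_cos)
lemma smooth_on_arctan[smooth_intros]: "open S ==> smooth_on S f ==> smooth_on S (%x. arctan (f x))"
 by (rule smooth_on_compose[of _ UNIV]) (auto simp: smooth_on_def Ck_on_real_arctan)

lemma bounded_linear_axis: "bounded_linear (axis i :: 'b::euclidean_space \<Rightarrow> 'b^'n)"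
 by (intro linear_conv_bounded_linear[THEN iffD1] linearI) (auto simp: vec_eq_iff axis_def)

lemma smooth_on_vecI:
 fixes f :: "'a::euclidean_space \<Rightarrow> 'b::euclidean_space^'n"
 assumes "open S" "!!i. smooth_on S (%x. f x $ i)"
 shows "smooth_on S f"
proof -
 have "(%x. \<Sum>i\<in>UNIV. axis i (f x $ i)) = f"
  by (rule ext) (simp add: vec_eq_iff axis_def sum.delta if_distrib[of "%v. v $ _"] cong: if_cong)
 moreover have "smooth_on S (%x. \<Sum>i\<in>UNIV. axis i (f x $ i))"
  by (intro smooth_on_sum smooth_on_linear[OF bounded_linear_axis] assms)
 ultimately show ?thesis by (simp only:)
qed

lemma smooth_on_matrix_vector_mult[smooth_intros]:
 fixes f :: "'a::euclidean_space \<Rightarrow> real^'n^'m"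
 shows "open S ==> smooth_on S f ==> smooth_on S g ==> smooth_on S (%x. f x *v g x)"
 by (rule smooth_on_vecI) (simp_all add: matrix_vector_mult_def, intro smooth_intros)

lemma frechet_derivative_sum_Basis:
 fixes f :: "'a::euclidean_space \<Rightarrow> 'b::real_normed_vector"
 assumes "f differentiable (at x)"
 shows "fderiv f (at x) v = (\<Sum>b\<in>Basis. (v \<bullet> b) *\<^sub>R fderiv f (at x) b)"
proof -
 have l: "linear (fderiv f (at x))"
  using assms linear_frechet_derivative by blast
 show ?thesis
  using linear_sum[OF l, of "%b. (v \<bullet> b) *\<^sub>R b" Basis]
  by (simp only: euclidean_representation linear_cmul[OF l])
qed

lemma smooth_on_frechet_derivative:
 fixes f :: "'b::euclidean_space \<Rightarrow> 'c::real_normed_vector"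
 assumes "open S" "open T" "smooth_on T f" "smooth_on S g" "g ` S \<subseteq> T" "smooth_on S h"
 shows "smooth_on S (%x. fderiv f (at (g x)) (h x))"
proof -
 have "smooth_on S (%x. \<Sum>b\<in>Basis. (h x \<bullet> b) *\<^sub>R fderiv f (at (g x)) b)"
  by (intro smooth_intros assms smooth_on_compose[OF assms(1,2) smooth_on_frechet assms(4,5)])
 moreover have "fderiv f (at (g x)) (h x) = (\<Sum>b\<in>Basis. (h x \<bullet> b) *\<^sub>R fderiv f (at (g x)) b)"
  if "x \<in> S" for x
  by (rule frechet_derivative_sum_Basis, rule smooth_on_differentiable[OF assms(3)]) (use that assms in auto)
 ultimately show ?thesis using smooth_on_cong[OF assms(1)] by (metis (no_types, lifting))
qed

subsection \<open>Curves\<close>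

lemma smooth_on_has_vector_derivative:
 "smooth_on I f ==> t \<in> I ==> (f has_vector_derivative vector_derivative f (at t)) (at t)"
 using smooth_on_differentiable vector_derivative_works by blast

lemma smooth_on_vector_derivative:
 assumes "open I" "smooth_on I f"
 shows "smooth_on I (%t. vector_derivative f (at t))"
proof -
 have "vector_derivative f (at t) = fderiv f (at t) 1" if "t \<in> I" for t
 proof -
  have "(f has_derivative (%h. h *\<^sub>R vector_derivative f (at t))) (at t)"
   using smooth_on_has_vector_derivative[OF assms(2) that] by (simp add: has_vector_derivative_def)
  from frechet_derivative_at[OF this] show ?thesis by (metis scaleR_one)
 qed
 then show ?thesis using smooth_on_cong[OF assms(1)] smooth_on_frechet[OF assms(2), of 1]
  by (metis (no_types, lifting))
qed

lemma has_vector_derivative_chain: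
 assumes "(x has_vector_derivative x') (at t)" "(f has_derivative D) (at (x t))"
 shows "((%t. f (x t)) has_vector_derivative D x') (at t)"
proof -
 have "((%t. f (x t)) has_derivative (%h. D (h *\<^sub>R x'))) (at t)"
  using has_derivative_compose[OF assms(1)[unfolded has_vector_derivative_def] assms(2)] .
 moreover have "D (h *\<^sub>R x') = h *\<^sub>R D x'" for h
  using has_derivative_linear[OF assms(2)] by (simp add: linear_cmul)
 ultimately show ?thesis by (simp add: has_vector_derivative_def)
qed

lemma has_vector_derivative_transform_open:
 assumes "(f has_vector_derivative D) (at t)" "open S" "t \<in> S" "!!s. s \<in> S ==> f s = g s"
 shows "(g has_vector_derivative D) (at t)"
 using assms has_vector_derivative_transform_within_open[of f D t S g] by auto

subsection \<open>Symmetry of the second derivative\<close>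

definition D2 :: "('a::euclidean_space \<Rightarrow> 'b::real_normed_vector) \<Rightarrow> 'a \<Rightarrow> 'a \<Rightarrow> 'a \<Rightarrow> 'b" where
 "D2 f x y z = fderiv (%x. fderiv f (at x) y) (at x) z"

lemma second_difference_mvt:
 fixes f :: "'a::euclidean_space \<Rightarrow> real"
 assumes "open S" "smooth_on S f" "h > 0"
  and seg: "!!s t. 0 \<le> s ==> s \<le> h ==> 0 \<le> t ==> t \<le> h ==> x + s *\<^sub>R y + t *\<^sub>R z \<in> S"
 obtains s t where "0 < s" "s < h" "0 < t" "t < h"
  "f (x + h *\<^sub>R y + h *\<^sub>R z) - f (x + h *\<^sub>R y) - f (x + h *\<^sub>R z) + f x = h * h * D2 f (x + s *\<^sub>R y + t *\<^sub>R z) y z"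
proof -
 define u where "u s = f (x + s *\<^sub>R y + h *\<^sub>R z) - f (x + s *\<^sub>R y)" for s
 define u' where "u' s = fderiv f (at (x + s *\<^sub>R y + h *\<^sub>R z)) y - fderiv f (at (x + s *\<^sub>R y)) y" for s
 have ch: "((%s. g (c + s *\<^sub>R w)) has_real_derivative fderiv g (at (c + s *\<^sub>R w)) w) (at s)"
  if "smooth_on S g" "c + s *\<^sub>R w \<in> S" for g :: "'a \<Rightarrow> real" and c w s
 proof -
  have "((%s. c + s *\<^sub>R w) has_vector_derivative w) (at s)"
   by (auto intro!: derivative_eq_intros)
  from has_vector_derivative_chain[OF this smooth_on_has_derivative[OF that]] show ?thesis
   by (simp add: has_real_derivative_iff_has_vector_derivative)
 qed
 have "(u has_real_derivative u' s) (at s)" if "0 \<le> s" "s \<le> h" for s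
 proof -
  have "x + s *\<^sub>R y + h *\<^sub>R z \<in> S" "x + s *\<^sub>R y \<in> S"
   using seg[of s h] seg[of s 0] that assms(3) by auto
  then show ?thesis
   unfolding u_def[abs_def] u'_def
   using ch[OF assms(2), of "x + h *\<^sub>R z" s y] ch[OF assms(2), of x s y]
   by (auto intro!: derivative_eq_intros simp: algebra_simps)
 qed
 with MVT2[OF assms(3), of u u'] obtain s where s: "0 < s" "s < h" "u h - u 0 = h * u' s" by auto
 define w where "w t = fderiv f (at (x + s *\<^sub>R y + t *\<^sub>R z)) y" for t
 have "(w has_real_derivative D2 f (x + s *\<^sub>R y + t *\<^sub>R z) y z) (at t)" if "0 \<le> t" "t \<le> h" for t
  unfolding w_def D2_def
  using ch[OF smooth_on_frechet[OF assms(2)], of "x + s *\<^sub>R y" t z y] seg[of s t] s that by auto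
 with MVT2[OF assms(3), of w "%t. D2 f (x + s *\<^sub>R y + t *\<^sub>R z) y z"] obtain t
  where t: "0 < t" "t < h" "w h - w 0 = h * D2 f (x + s *\<^sub>R y + t *\<^sub>R z) y z" by auto
 have "w h - w 0 = u' s" unfolding w_def u'_def by simp
 with s t have "u h - u 0 = h * h * D2 f (x + s *\<^sub>R y + t *\<^sub>R z) y z" by simp
 with s(1,2) t(1,2) that show thesis unfolding u_def by force
qed

lemma D2_symmetric_real:
 fixes f :: "'a::euclidean_space \<Rightarrow> real"
 assumes "open S" "smooth_on S f" "x \<in> S"
 shows "D2 f x y z = D2 f x z y"
proof (rule ccontr)
 assume ne: "D2 f x y z ~= D2 f x z y"
 define e where "e = \<bar>D2 f x y z - D2 f x z y\<bar> / 2"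
 have e: "e > 0" using ne by (simp add: e_def)
 have c: "continuous_on S (%x. D2 f x y z)" "continuous_on S (%x. D2 f x z y)"
  unfolding D2_def by (intro smooth_on_continuous_on smooth_on_frechet assms)+
 obtain r where r: "r > 0" "ball x r \<subseteq> S" using assms open_contains_ball by blast
 obtain d where d: "d > 0" "!!x'. x' \<in> S ==> dist x' x < d ==> dist (D2 f x' y z) (D2 f x y z) < e"
  using c(1) assms(3) e unfolding continuous_on_iff by metis
 obtain d' where d': "d' > 0" "!!x'. x' \<in> S ==> dist x' x < d' ==> dist (D2 f x' z y) (D2 f x z y) < e"
  using c(2) assms(3) e unfolding continuous_on_iff by metis
 define m where "m = min r (min d d')"
 have m: "m > 0" using r d d' by (simp add: m_def)
 define h where "h = m / (2 * (norm y + norm z + 1))"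
 have h: "h > 0" using m by (simp add: h_def add_nonneg_pos)
 have hm: "h * (norm y + norm z) < m"
 proof -
  have "h * (norm y + norm z) \<le> h * (norm y + norm z + 1)" using h by (simp add: algebra_simps)
  also have "\<dots> = m / 2"
  proof -
   have "m / (2 * K) * K = m / 2" if "K > 0" for K :: real using that by simp
   from this[of "norm y + norm z + 1"] show ?thesis by (simp only: h_def add_nonneg_pos norm_ge_zero zero_less_one add_nonneg_nonneg)
  qed
  finally show ?thesis using m by simp
 qed
 have near: "dist (x + s *\<^sub>R y + t *\<^sub>R z) x < m" if "0 \<le> s" "s \<le> h" "0 \<le> t" "t \<le> h" for s t
 proof -
  have "dist (x + s *\<^sub>R y + t *\<^sub>R z) x \<le> s * norm y + t * norm z"
   using norm_triangle_ineq[of "s *\<^sub>R y" "t *\<^sub>R z"] that by (simp add: dist_norm)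
  also have "\<dots> \<le> h * norm y + h * norm z"
   using that by (intro add_mono mult_right_mono) auto
  finally show ?thesis using hm by (simp add: algebra_simps)
 qed
 have inS: "x + s *\<^sub>R y + t *\<^sub>R z \<in> S" if "0 \<le> s" "s \<le> h" "0 \<le> t" "t \<le> h" for s t
  using near[OF that] r by (auto simp: m_def dist_commute subset_iff)
 have sw: "x + s *\<^sub>R z + t *\<^sub>R y = x + t *\<^sub>R y + s *\<^sub>R z" for s t
  by simp
 obtain s t where 1: "0 < s" "s < h" "0 < t" "t < h"
  "f (x + h *\<^sub>R y + h *\<^sub>R z) - f (x + h *\<^sub>R y) - f (x + h *\<^sub>R z) + f x = h * h * D2 f (x + s *\<^sub>R y + t *\<^sub>R z) y z"
  by (rule second_difference_mvt[OF assms(1,2) h, of x y z]) (use inS in blast)+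
 obtain t' s' where 2: "0 < t'" "t' < h" "0 < s'" "s' < h"
  "f (x + h *\<^sub>R z + h *\<^sub>R y) - f (x + h *\<^sub>R z) - f (x + h *\<^sub>R y) + f x = h * h * D2 f (x + t' *\<^sub>R z + s' *\<^sub>R y) z y"
  by (rule second_difference_mvt[OF assms(1,2) h, of x z y]) (use inS sw in metis, blast)
 have "h * h * D2 f (x + s *\<^sub>R y + t *\<^sub>R z) y z = h * h * D2 f (x + s' *\<^sub>R y + t' *\<^sub>R z) z y"
  using 1(5) 2(5)[unfolded sw] by linarith
 then have eq: "D2 f (x + s *\<^sub>R y + t *\<^sub>R z) y z = D2 f (x + s' *\<^sub>R y + t' *\<^sub>R z) z y" using h by simp
 have "dist (D2 f (x + s *\<^sub>R y + t *\<^sub>R z) y z) (D2 f x y z) < e"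
  using d(2) inS[of s t] near[of s t] 1 by (simp add: m_def)
 moreover have "dist (D2 f (x + s' *\<^sub>R y + t' *\<^sub>R z) z y) (D2 f x z y) < e"
  using d'(2) inS[of s' t'] near[of s' t'] 2 by (simp add: m_def)
 ultimately show False unfolding eq e_def dist_real_def by argo
qed

lemma D2_symmetric:
 fixes f :: "'a::euclidean_space \<Rightarrow> 'b::euclidean_space"
 assumes "open S" "smooth_on S f" "x \<in> S"
 shows "D2 f x y z = D2 f x z y"
proof (rule euclidean_eqI)
 fix b :: 'b assume "b \<in> Basis"
 have "D2 f x y z \<bullet> b = D2 (%x. f x \<bullet> b) x y z" for y z
 proof -
  have *: "fderiv (%x. g x \<bullet> b) (at x) h = fderiv g (at x) h \<bullet> b"
   if "smooth_on S g" "x \<in> S" for g x h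
   using frechet_derivative_at[OF has_derivative_inner_left[OF smooth_on_has_derivative[OF that], of b]] by metis
  have "D2 f x y z \<bullet> b = fderiv (%x. fderiv f (at x) y \<bullet> b) (at x) z"
   unfolding D2_def by (rule *[symmetric]) (intro smooth_on_frechet assms)+
  also have "\<dots> = D2 (%x. f x \<bullet> b) x y z"
   unfolding D2_def by (rule arg_cong[where f="%D. D z"], rule frechet_derivative_cong[OF assms(1,3)])
    (use * assms in auto)
  finally show ?thesis .
 qed
 then show "D2 f x y z \<bullet> b = D2 f x z y \<bullet> b"
  using D2_symmetric_real[OF assms(1) smooth_on_inner[OF assms(1,2) smooth_on_const[OF assms(1)]] assms(3)] by metis
qed

section \<open>Tangent vectors on a manifold given by an atlas\<close>

lemma snd_param: "x \<in> snd c ` S ==> S \<subseteq> fst c ==> snd c (param c x) = x \<and> param c x \<in> fst c"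
 unfolding param_def by (meson f_inv_into_f image_mono inv_into_into subsetD)

locale smooth_manifold =
 fixes M :: "('p, 'e::euclidean_space) atlas"
 assumes atlas: "smooth_atlas M"
begin

lemma chart_inj: "c \<in> M ==> inj_on (snd c) (fst c)"
 and chart_open: "c \<in> M ==> open (snd c ` fst c)"
 and overlap_open: "c \<in> M ==> d \<in> M ==> open (snd c ` (fst c \<inter> fst d))"
 and transition_smooth: "c \<in> M ==> d \<in> M ==> smooth_on (snd c ` (fst c \<inter> fst d)) (transition c d)"
 using atlas unfolding smooth_atlas_def by auto

lemma param_snd [simp]: "c \<in> M ==> p \<in> fst c ==> param c (snd c p) = p"
 unfolding param_def using chart_inj by simp

lemma chart_atD: "chart_at M p c ==> c \<in> M" "chart_at M p c ==> p \<in> fst c"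
 by (auto simp: chart_at_def)

lemma transition_snd: "c \<in> M ==> p \<in> fst c ==> transition c d (snd c p) = snd d p"
 by (simp add: transition_def)

lemma transition_has_derivative:
 assumes "chart_at M p c" "chart_at M p d"
 shows "(transition c d has_derivative fderiv (transition c d) (at (snd c p))) (at (snd c p))"
 using transition_smooth[of c d] assms
 by (intro smooth_on_has_derivative[of "snd c ` (fst c \<inter> fst d)"]) (auto simp: chart_at_def)

lemma transition_linear:
 assumes "chart_at M p c" "chart_at M p d"
 shows "linear (fderiv (transition c d) (at (snd c p)))"
 using transition_has_derivative[OF assms] has_derivative_linear by blast

lemma transition_derivative_self:
 assumes "chart_at M p c"
 shows "fderiv (transition c c) (at (snd c p)) = (%y. y)"
proof -
 note c = chart_atD[OF assms]
 have "fderiv (transition c c) (at (snd c p)) = fderiv (%x. x) (at (snd c p))"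
  by (rule frechet_derivative_cong[OF chart_open[OF c(1)]]) (use c in \<open>auto simp: transition_snd\<close>)
 then show ?thesis by (simp add: frechet_derivative_ident)
qed

lemma transition_derivative_compose:
 assumes "chart_at M p c" "chart_at M p d" "chart_at M p e"
 shows "fderiv (transition d e) (at (snd d p)) (fderiv (transition c d) (at (snd c p)) y)
  = fderiv (transition c e) (at (snd c p)) y"
proof -
 note c = chart_atD[OF assms(1)] and d = chart_atD[OF assms(2)] and e = chart_atD[OF assms(3)]
 let ?D1 = "fderiv (transition c d) (at (snd c p))"
 let ?D2 = "fderiv (transition d e) (at (snd d p))"
 have "((%x. transition d e (transition c d x)) has_derivative (%y. ?D2 (?D1 y))) (at (snd c p))"
  by (rule has_derivative_compose[OF transition_has_derivative[OF assms(1,2)]])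
   (use transition_has_derivative[OF assms(2,3)] c d in \<open>simp add: transition_snd\<close>)
 moreover have "transition d e (transition c d x) = transition c e x" if "x \<in> snd c ` (fst c \<inter> fst d)" for x
  using that c d by (auto simp: transition_snd)
 ultimately have "(transition c e has_derivative (%y. ?D2 (?D1 y))) (at (snd c p))"
  using has_derivative_transform_within_open[OF _ overlap_open[OF c(1) d(1)]] c d by blast
 from frechet_derivative_at[OF this] show ?thesis by metis
qed

lemma tangent_transition:
 "\<xi> \<in> tangent_space M p ==> chart_at M p c ==> chart_at M p d ==>
  \<xi> d = fderiv (transition c d) (at (snd c p)) (\<xi> c)"
 unfolding tangent_space_def by blast

lemma tangent_outside: "\<xi> \<in> tangent_space M p ==> \<not> chart_at M p c ==> \<xi> c = 0"
 unfolding tangent_space_def by blast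

lemma tangent_spaceI:
 assumes "!!c. \<not> chart_at M p c ==> \<xi> c = 0"
  "!!c d. chart_at M p c ==> chart_at M p d ==> \<xi> d = fderiv (transition c d) (at (snd c p)) (\<xi> c)"
 shows "\<xi> \<in> tangent_space M p"
 unfolding tangent_space_def using assms by blast

lemma tangent_eqI:
 assumes "\<xi> \<in> tangent_space M p" "\<eta> \<in> tangent_space M p" "chart_at M p c" "\<xi> c = \<eta> c"
 shows "\<xi> = \<eta>"
proof
 fix d
 show "\<xi> d = \<eta> d"
  using assms tangent_transition[OF _ assms(3)] tangent_outside by (cases "chart_at M p d") metis+
qed

lemma vec_at_apply: "chart_at M p d ==> vec_at M c p y d = fderiv (transition c d) (at (snd c p)) y"
 by (simp add: vec_at_def)

lemma vec_at_self [simp]: "chart_at M p c ==> vec_at M c p y c = y"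
 by (simp add: vec_at_def transition_derivative_self)

lemma vec_at_tangent: "chart_at M p c ==> vec_at M c p y \<in> tangent_space M p"
 by (rule tangent_spaceI) (auto simp: vec_at_def transition_derivative_compose)

lemma vec_at_tangent_apply: "\<xi> \<in> tangent_space M p ==> chart_at M p c ==> vec_at M c p (\<xi> c) = \<xi>"
 using tangent_eqI vec_at_tangent by (metis vec_at_self)

lemma lincomb_tangent:
 assumes "\<xi> \<in> tangent_space M p" "\<eta> \<in> tangent_space M p"
 shows "lincomb s \<xi> t \<eta> \<in> tangent_space M p"
proof -
 have "lincomb s \<xi> t \<eta> d = fderiv (transition c d) (at (snd c p)) (lincomb s \<xi> t \<eta> c)"
  if "chart_at M p c" "chart_at M p d" for c d
  unfolding lincomb_def linear_add[OF transition_linear[OF that]] linear_cmul[OF transition_linear[OF that]]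
  using tangent_transition[OF assms(1) that] tangent_transition[OF assms(2) that] by presburger
 moreover have "lincomb s \<xi> t \<eta> c = 0" if "\<not> chart_at M p c" for c
  using tangent_outside[OF assms(1) that] tangent_outside[OF assms(2) that] by (simp add: lincomb_def)
 ultimately show ?thesis by (rule tangent_spaceI[rotated])
qed

lemma scale_vec_lincomb: "scale_vec s \<xi> = lincomb s \<xi> 0 \<xi>"
 by (simp add: scale_vec_def lincomb_def)

lemma scale_vec_tangent: "\<xi> \<in> tangent_space M p ==> scale_vec s \<xi> \<in> tangent_space M p"
 by (simp add: scale_vec_lincomb lincomb_tangent)

lemma zero_vec_tangent: "zero_vec \<in> tangent_space M p"
 by (rule tangent_spaceI) (auto simp: zero_vec_def linear_0[OF transition_linear])

lemma tangent_zero_iff: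
 assumes "\<xi> \<in> tangent_space M p" "chart_at M p c"
 shows "\<xi> = zero_vec \<longleftrightarrow> \<xi> c = 0"
 using tangent_eqI[OF assms(1) zero_vec_tangent assms(2)] by (auto simp: zero_vec_def)

lemma chart_at_some: "p \<in> points M ==> chart_at M p (SOME c. chart_at M p c)"
 by (rule someI_ex) (auto simp: points_def chart_at_def)

lemma chart_at_points: "chart_at M p c ==> p \<in> points M"
 by (auto simp: points_def chart_at_def)

lemma deriv_along_chart:
 assumes "\<xi> \<in> tangent_space M p" "chart_at M p c"
 shows "deriv_along M (snd c) p \<xi> = \<xi> c"
 unfolding deriv_along_def Let_def
 using tangent_transition[OF assms(1) chart_at_some[OF chart_at_points[OF assms(2)]] assms(2)]
 by (simp add: transition_def)

text \<open>The directional derivative can be computed in any chart.\<close>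

lemma deriv_along_eq:
 assumes "\<xi> \<in> tangent_space M p" "chart_at M p c" "(f \<circ> param c has_derivative D) (at (snd c p))"
 shows "deriv_along M f p \<xi> = D (\<xi> c)"
proof -
 define e where "e = (SOME c. chart_at M p c)"
 have ep: "chart_at M p e" unfolding e_def by (rule chart_at_some[OF chart_at_points[OF assms(2)]])
 note c = chart_atD[OF assms(2)] and e = chart_atD[OF ep]
 let ?T = "fderiv (transition e c) (at (snd e p))"
 have "((%x. (f \<circ> param c) (transition e c x)) has_derivative (%y. D (?T y))) (at (snd e p))"
  by (rule has_derivative_compose[OF transition_has_derivative[OF ep assms(2)]])
   (use assms(3) e in \<open>simp add: transition_snd comp_def\<close>)
 moreover have "(f \<circ> param c) (transition e c x) = (f \<circ> param e) x" if "x \<in> snd e ` (fst e \<inter> fst c)" for x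
  using that c e by (auto simp: transition_snd)
 ultimately have "(f \<circ> param e has_derivative (%y. D (?T y))) (at (snd e p))"
  using has_derivative_transform_within_open[OF _ overlap_open[OF e(1) c(1)]] c e by blast
 from frechet_derivative_at[OF this]
 have "fderiv (f \<circ> param e) (at (snd e p)) = (%y. D (?T y))" by simp
 then show ?thesis
  unfolding deriv_along_def Let_def e_def[symmetric]
  using tangent_transition[OF assms(1) ep assms(2)] by simp
qed

lemma velocity_chart:
 assumes "chart_at M (\<gamma> t) c" "open I" "t \<in> I" "!!s. s \<in> I ==> \<gamma> s \<in> fst c"
  "((%s. snd c (\<gamma> s)) has_vector_derivative y) (at t)"
 shows "chart_at M (\<gamma> t) d ==>
   ((%s. snd d (\<gamma> s)) has_vector_derivative fderiv (transition c d) (at (snd c (\<gamma> t))) y) (at t)"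
  and "velocity M \<gamma> t = vec_at M c (\<gamma> t) y"
proof -
 note c = chart_atD[OF assms(1)]
 show *: "((%s. snd d (\<gamma> s)) has_vector_derivative fderiv (transition c d) (at (snd c (\<gamma> t))) y) (at t)"
  if "chart_at M (\<gamma> t) d" for d
 proof -
  have "((%s. transition c d (snd c (\<gamma> s))) has_vector_derivative fderiv (transition c d) (at (snd c (\<gamma> t))) y) (at t)"
   by (rule has_vector_derivative_chain[OF assms(5) transition_has_derivative[OF assms(1) that]])
  then show ?thesis
   by (rule has_vector_derivative_transform_open[OF _ assms(2,3)]) (simp add: c transition_snd assms(4))
 qed
 have "velocity M \<gamma> t d = vec_at M c (\<gamma> t) y d" for d
  using vector_derivative_at[OF *, of d] by (simp add: velocity_def vec_at_def comp_def)
 then show "velocity M \<gamma> t = vec_at M c (\<gamma> t) y" by blast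
qed

lemma deriv_along_velocity:
 assumes "chart_at M (\<gamma> t) c" "open I" "t \<in> I" "!!s. s \<in> I ==> \<gamma> s \<in> fst c"
  "((%s. snd c (\<gamma> s)) has_vector_derivative y) (at t)"
  "(f \<circ> param c) differentiable (at (snd c (\<gamma> t)))"
  "((%s. f (\<gamma> s)) has_vector_derivative z) (at t)"
 shows "deriv_along M f (\<gamma> t) (velocity M \<gamma> t) = z"
proof -
 note c = chart_atD[OF assms(1)]
 obtain D where D: "(f \<circ> param c has_derivative D) (at (snd c (\<gamma> t)))"
  using assms(6) differentiable_def by blast
 have "((%s. (f \<circ> param c) (snd c (\<gamma> s))) has_vector_derivative D y) (at t)"
  by (rule has_vector_derivative_chain[OF assms(5) D])
 then have "((%s. f (\<gamma> s)) has_vector_derivative D y) (at t)"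
  by (rule has_vector_derivative_transform_open[OF _ assms(2,3)]) (simp add: c assms(4))
 then have "D y = z" using assms(7) vector_derivative_unique_at by blast
 then show ?thesis
  using deriv_along_eq[OF vec_at_tangent[OF assms(1)] assms(1) D, of y] velocity_chart(2)[OF assms(1-5)] assms(1)
  by simp
qed

lemma smooth_curve_velocity:
 assumes "smooth_curve M I \<gamma>" "t \<in> I" "chart_at M (\<gamma> t) c"
 shows "open (I \<inter> \<gamma> -` fst c)" "t \<in> I \<inter> \<gamma> -` fst c" "smooth_on (I \<inter> \<gamma> -` fst c) (%s. snd c (\<gamma> s))"
  "velocity M \<gamma> t = vec_at M c (\<gamma> t) (vector_derivative (%s. snd c (\<gamma> s)) (at t))"
proof -
 show 1: "open (I \<inter> \<gamma> -` fst c)" and 2: "t \<in> I \<inter> \<gamma> -` fst c" and 3: "smooth_on (I \<inter> \<gamma> -` fst c) (%s. snd c (\<gamma> s))"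
  using assms chart_atD[OF assms(3)] by (auto simp: smooth_curve_def comp_def)
 show "velocity M \<gamma> t = vec_at M c (\<gamma> t) (vector_derivative (%s. snd c (\<gamma> s)) (at t))"
  by (rule velocity_chart(2)[of \<gamma> t c "I \<inter> \<gamma> -` fst c", OF assms(3) 1 2]) (use smooth_on_has_vector_derivative[OF 3 2] in auto)
qed

lemma preimage_transition_open:
 assumes "c \<in> M" "d \<in> M" "open W"
 shows "open (snd d ` (fst d \<inter> fst c \<inter> snd c -` W))"
proof -
 have "snd d ` (fst d \<inter> fst c \<inter> snd c -` W) = {x \<in> snd d ` (fst d \<inter> fst c). transition d c x \<in> W}"
  using assms by (auto simp: transition_snd)
 moreover have "open \<dots>"
  using continuous_open_preimage[OF smooth_on_continuous_on[OF transition_smooth] overlap_open assms(3)] assms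
  by (simp add: Int_def vimage_def)
 ultimately show ?thesis by simp
qed

text \<open>A set is open in the manifold topology if and only if its image in every chart is open.\<close>

lemma openin_manifold_topology_iff:
 "openin (manifold_topology M) U \<longleftrightarrow> U \<subseteq> points M \<and> (\<forall>c\<in>M. open (snd c ` (U \<inter> fst c)))"
proof
 let ?B = "{fst c \<inter> snd c -` W | c W. c \<in> M \<and> open W}"
 assume "openin (manifold_topology M) U"
 then have "generate_topology_on ?B U"
  unfolding manifold_topology_def by (rule openin_topology_generated_by)
 then show "U \<subseteq> points M \<and> (\<forall>c\<in>M. open (snd c ` (U \<inter> fst c)))"
 proof induction
  case (Int a b)
  have "snd c ` (a \<inter> b \<inter> fst c) = snd c ` (a \<inter> fst c) \<inter> snd c ` (b \<inter> fst c)" if "c \<in> M" for c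
   using chart_inj[OF that] inj_on_image_Int[OF chart_inj[OF that], of "a \<inter> fst c" "b \<inter> fst c"]
   by (simp add: Int_assoc Int_left_commute)
  then show ?case using Int by auto
 next
  case (UN K)
  have "snd c ` (\<Union>K \<inter> fst c) = (\<Union>k\<in>K. snd c ` (k \<inter> fst c))" for c :: "('p, 'e) chart" by auto
  moreover have "open (\<Union>k\<in>K. snd c ` (k \<inter> fst c))" if "c \<in> M" for c
   by (rule open_UN) (use UN.IH that in blast)
  moreover have "\<Union>K \<subseteq> points M" using UN.IH by blast
  ultimately show ?case by simp
 next
  case (Basis s)
  then obtain c W where cW: "s = fst c \<inter> snd c -` W" "c \<in> M" "open W" by auto
  have "s \<inter> fst d = fst d \<inter> fst c \<inter> snd c -` W" for d :: "('p, 'e) chart" using cW by auto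
  then have "open (snd d ` (s \<inter> fst d))" if "d \<in> M" for d
   using preimage_transition_open[OF cW(2) that cW(3)] by simp
  moreover have "s \<subseteq> points M" using cW(1,2) unfolding points_def by blast
  ultimately show ?case by blast
 qed auto
next
 assume U: "U \<subseteq> points M \<and> (\<forall>c\<in>M. open (snd c ` (U \<inter> fst c)))"
 define W where "W c = fst c \<inter> snd c -` (snd c ` (U \<inter> fst c))" for c :: "('p, 'e) chart"
 have W: "W c = U \<inter> fst c" if "c \<in> M" for c
  unfolding W_def using inj_onD[OF chart_inj[OF that]] by blast
 have "openin (manifold_topology M) (W c)" if "c \<in> M" for c
  unfolding manifold_topology_def W_def by (rule topology_generated_by_Basis) (use that U in blast)
 then have "openin (manifold_topology M) (\<Union>c\<in>M. W c)" by blast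
 moreover have "(\<Union>c\<in>M. W c) = (\<Union>c\<in>M. U \<inter> fst c)" using W by simp
 moreover have "(\<Union>c\<in>M. U \<inter> fst c) = U" using U unfolding points_def by blast
 ultimately show "openin (manifold_topology M) U" by simp
qed

lemma openin_chart_preimage:
 assumes "c \<in> M" "open W"
 shows "openin (manifold_topology M) (fst c \<inter> snd c -` W)"
 unfolding manifold_topology_def by (rule topology_generated_by_Basis) (use assms in blast)

end

section \<open>Circle bundles of directions\<close>

lemma inner2: "(x :: real^2) \<bullet> y = x $ 1 * y $ 1 + x $ 2 * y $ 2"
 by (simp add: inner_vec_def sum_2)

lemma norm2_eq_1: "norm (n :: real^2) = 1 \<longleftrightarrow> n $ 1 * n $ 1 + n $ 2 * n $ 2 = 1"
 by (simp add: norm_eq_sqrt_inner inner2)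

lemma real2_eq_iff: "(x :: real^2) = y \<longleftrightarrow> x $ 1 = y $ 1 \<and> x $ 2 = y $ 2"
 by (simp add: vec_eq_iff forall_2)

definition cross2 :: "real^2 \<Rightarrow> real^2 \<Rightarrow> real" where
 "cross2 y z = y $ 1 * z $ 2 - y $ 2 * z $ 1"

definition slope :: "real^2 \<Rightarrow> real^2 \<Rightarrow> real" where
 "slope n y = (vector [- (n $ 2), n $ 1] \<bullet> y) / (n \<bullet> y)"

definition slope_vec :: "real^2 \<Rightarrow> real \<Rightarrow> real^2" where
 "slope_vec n s = n + s *\<^sub>R vector [- (n $ 2), n $ 1]"

lemma slope_vec_inner: "norm n = 1 ==> n \<bullet> slope_vec n s = 1"
 by (simp add: slope_vec_def norm2_eq_1 inner2 algebra_simps)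

lemma slope_slope_vec: "norm n = 1 ==> slope n (slope_vec n s) = s"
 unfolding slope_def slope_vec_inner
 by (simp add: slope_vec_def norm2_eq_1 inner2 algebra_simps) (metis distrib_left mult.right_neutral)

lemma slope_vec_slope:
 assumes "norm n = 1" "n \<bullet> y ~= 0"
 shows "(n \<bullet> y) *\<^sub>R slope_vec n (slope n y) = y"
proof -
 have "(n \<bullet> y) * slope n y = n $ 1 * y $ 2 - n $ 2 * y $ 1"
  using assms(2) by (simp add: slope_def) (simp add: inner2)
 then have "(n \<bullet> y) *\<^sub>R slope_vec n (slope n y) = (n \<bullet> y) *\<^sub>R n + (n $ 1 * y $ 2 - n $ 2 * y $ 1) *\<^sub>R vector [- (n $ 2), n $ 1]"
  by (simp add: slope_vec_def scaleR_add_right)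
 moreover have "(n \<bullet> y) * n $ 1 - (n $ 1 * y $ 2 - n $ 2 * y $ 1) * n $ 2 = (n $ 1 * n $ 1 + n $ 2 * n $ 2) * y $ 1"
  "(n \<bullet> y) * n $ 2 + (n $ 1 * y $ 2 - n $ 2 * y $ 1) * n $ 1 = (n $ 1 * n $ 1 + n $ 2 * n $ 2) * y $ 2"
  by (simp_all add: inner2 algebra_simps)
 ultimately show ?thesis using assms(1) by (simp add: real2_eq_iff norm2_eq_1)
qed

lemma slope_scaleR: "k ~= 0 ==> slope n (k *\<^sub>R y) = slope n y"
 by (simp add: slope_def)

lemma slope_has_vector_derivative:
 assumes "(Y has_vector_derivative Y') (at t)" "norm n = 1" "n \<bullet> Y t ~= 0"
 shows "((%t. slope n (Y t)) has_vector_derivative cross2 (Y t) Y' / (n \<bullet> Y t)\<^sup>2) (at t)"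
proof -
 let ?p = "vector [- (n $ 2), n $ 1] :: real^2"
 have lin: "((%t. u \<bullet> Y t) has_real_derivative u \<bullet> Y') (at t)" for u
  using bounded_linear.has_vector_derivative[OF bounded_linear_inner_right assms(1)]
  by (simp add: has_real_derivative_iff_has_vector_derivative)
 have "((%t. slope n (Y t)) has_real_derivative ((?p \<bullet> Y') * (n \<bullet> Y t) - (?p \<bullet> Y t) * (n \<bullet> Y')) / ((n \<bullet> Y t) * (n \<bullet> Y t))) (at t)"
  unfolding slope_def by (rule DERIV_divide[OF lin lin assms(3)])
 moreover have "(?p \<bullet> Y') * (n \<bullet> Y t) - (?p \<bullet> Y t) * (n \<bullet> Y') = (n $ 1 * n $ 1 + n $ 2 * n $ 2) * cross2 (Y t) Y'"
  by (simp add: inner2 cross2_def algebra_simps)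
 ultimately show ?thesis using assms(2)
  by (simp add: norm2_eq_1 power2_eq_square has_real_derivative_iff_has_vector_derivative)
qed

lemma smooth_on_slope [smooth_intros]:
 "open S ==> smooth_on S f ==> (!!x. x \<in> S ==> n \<bullet> f x ~= 0) ==> smooth_on S (%x. slope n (f x))"
 unfolding slope_def by (intro smooth_intros)

lemma smooth_on_slope_vec [smooth_intros]:
 "open S ==> smooth_on S f ==> smooth_on S (%x. slope_vec n (f x))"
 unfolding slope_vec_def by (intro smooth_intros)

text \<open>
 The unit tangent bundle and the projective circle bundle have the same kind of charts, a chart of
 the surface together with the slope of a direction.  The locale treats them together: \<open>rep\<close> chooses a
 tangent vector representing a point of the bundle.
\<close>

locale direction_bundle = smooth_manifold M for M :: "('p, real^2) atlas" +
 fixes E :: "'e set" and rep :: "'e \<Rightarrow> 'p tpoint"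
 assumes rep_points: "e \<in> E ==> fst (rep e) \<in> points M"
  and rep_tangent: "e \<in> E ==> snd (rep e) \<in> tangent_space M (fst (rep e))"
  and rep_nonzero: "e \<in> E ==> snd (rep e) ~= zero_vec"
  and rep_exists: "p \<in> points M ==> v \<in> tangent_space M p ==> v ~= zero_vec ==>
   \<exists>e\<in>E. \<exists>t>0. rep e = (p, scale_vec t v)"
  and rep_unique: "e \<in> E ==> e' \<in> E ==> fst (rep e') = fst (rep e) ==> t > 0 ==>
   snd (rep e') = scale_vec t (snd (rep e)) ==> e' = e"
begin

definition bchart :: "('p, real^2) chart \<Rightarrow> real^2 \<Rightarrow> ('e, (real^2) \<times> real) chart" where
 "bchart c n = ({e \<in> E. in_half_plane c n (rep e)}, direction_coords c n \<circ> rep)"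

definition batlas :: "('e, (real^2) \<times> real) atlas" where
 "batlas = {bchart c n | c n. c \<in> M \<and> norm n = 1}"

definition element :: "'p \<Rightarrow> 'p svec \<Rightarrow> 'e" where
 "element p v = (SOME e. e \<in> E \<and> (\<exists>t>0. rep e = (p, scale_vec t v)))"

lemma element:
 assumes "p \<in> points M" "v \<in> tangent_space M p" "v ~= zero_vec"
 shows "element p v \<in> E" "\<exists>t>0. rep (element p v) = (p, scale_vec t v)"
proof -
 have "\<exists>e. e \<in> E \<and> (\<exists>t>0. rep e = (p, scale_vec t v))" using rep_exists[OF assms] by blast
 from someI_ex[OF this] show "element p v \<in> E" "\<exists>t>0. rep (element p v) = (p, scale_vec t v)"
  unfolding element_def by blast+
qed

lemma element_eqI:
 assumes "e \<in> E" "t > 0" "snd (rep e) = scale_vec t v" "v \<in> tangent_space M (fst (rep e))"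
 shows "element (fst (rep e)) v = e"
proof -
 have v: "v ~= zero_vec" using rep_nonzero[OF assms(1)] assms(3) by (auto simp: scale_vec_def zero_vec_def)
 obtain s where s: "s > 0" "rep (element (fst (rep e)) v) = (fst (rep e), scale_vec s v)"
  using element(2)[OF rep_points[OF assms(1)] assms(4) v] by blast
 have "scale_vec s v = scale_vec (s / t) (snd (rep e))"
  using assms(2,3) by (simp add: scale_vec_def)
 then show ?thesis
  using rep_unique[OF assms(1) element(1)[OF rep_points[OF assms(1)] assms(4) v], of "s / t"] s assms(2) by simp
qed

lemma bchart_mem: "e \<in> fst (bchart c n) \<longleftrightarrow> e \<in> E \<and> fst (rep e) \<in> fst c \<and> n \<bullet> snd (rep e) c > 0"
 by (simp add: bchart_def in_half_plane_def)

lemma bchart_coords: "snd (bchart c n) e = (snd c (fst (rep e)), slope n (snd (rep e) c))"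
 by (simp add: bchart_def direction_coords_def slope_def)

lemma bchart_at: "c \<in> M ==> norm n = 1 ==> chart_at batlas e (bchart c n) \<longleftrightarrow> e \<in> fst (bchart c n)"
 unfolding chart_at_def batlas_def by blast

lemma batlasE: "C \<in> batlas ==> (!!c n. c \<in> M ==> norm n = 1 ==> C = bchart c n ==> thesis) ==> thesis"
 unfolding batlas_def by blast

definition bparam :: "('p, real^2) chart \<Rightarrow> real^2 \<Rightarrow> (real^2) \<times> real \<Rightarrow> 'e" where
 "bparam c n z = element (param c (fst z)) (vec_at M c (param c (fst z)) (slope_vec n (snd z)))"

lemma bparam_rep:
 assumes "c \<in> M" "norm n = 1" "x \<in> snd c ` fst c"
 obtains t where "t > 0" "bparam c n (x, s) \<in> E" "fst (rep (bparam c n (x, s))) = param c x"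
  "snd (rep (bparam c n (x, s))) = scale_vec t (vec_at M c (param c x) (slope_vec n s))"
proof -
 have p: "chart_at M (param c x) c" using snd_param[OF assms(3)] assms(1) by (simp add: chart_at_def)
 have nz: "vec_at M c (param c x) (slope_vec n s) ~= zero_vec"
  using slope_vec_inner[OF assms(2), of s] vec_at_self[OF p, of "slope_vec n s"] by (auto simp: zero_vec_def)
 show thesis
  using element[OF chart_at_points[OF p] vec_at_tangent[OF p] nz] that unfolding bparam_def by auto
qed

lemma bparam:
 assumes "c \<in> M" "norm n = 1" "x \<in> snd c ` fst c"
 shows "bparam c n (x, s) \<in> fst (bchart c n)" "snd (bchart c n) (bparam c n (x, s)) = (x, s)"
proof -
 have p: "chart_at M (param c x) c" and x: "snd c (param c x) = x"
  using snd_param[OF assms(3)] assms(1) by (auto simp: chart_at_def)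
 obtain t where t: "t > 0" "bparam c n (x, s) \<in> E" "fst (rep (bparam c n (x, s))) = param c x"
  "snd (rep (bparam c n (x, s))) = scale_vec t (vec_at M c (param c x) (slope_vec n s))"
  using bparam_rep[OF assms] by blast
 show "bparam c n (x, s) \<in> fst (bchart c n)"
  using t p chart_atD[OF p] slope_vec_inner[OF assms(2)] by (simp add: bchart_mem scale_vec_def)
 show "snd (bchart c n) (bparam c n (x, s)) = (x, s)"
  using t p x slope_scaleR[of t] slope_slope_vec[OF assms(2)] by (simp add: bchart_coords scale_vec_def)
qed

lemma bparam_bchart:
 assumes "c \<in> M" "norm n = 1" "e \<in> fst (bchart c n)"
 shows "bparam c n (snd (bchart c n) e) = e"
proof -
 let ?v = "snd (rep e)" and ?p = "fst (rep e)"
 have e: "e \<in> E" "?p \<in> fst c" "n \<bullet> ?v c > 0" using assms(3) by (auto simp: bchart_mem)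
 have c: "chart_at M ?p c" using e assms by (simp add: chart_at_def)
 have v: "?v \<in> tangent_space M ?p" using rep_tangent[OF e(1)] .
 have "?v = scale_vec (n \<bullet> ?v c) (vec_at M c ?p (slope_vec n (slope n (?v c))))"
  by (rule tangent_eqI[OF v scale_vec_tangent[OF vec_at_tangent[OF c]] c])
   (use c e slope_vec_slope[OF assms(2), of "?v c"] in \<open>simp add: scale_vec_def\<close>)
 from element_eqI[OF e(1) e(3) this vec_at_tangent[OF c]]
 show ?thesis using assms e by (simp add: bparam_def bchart_coords)
qed

lemma bchart_inj: "c \<in> M ==> norm n = 1 ==> inj_on (snd (bchart c n)) (fst (bchart c n))"
 by (rule inj_on_inverseI[where g="bparam c n"]) (rule bparam_bchart)

lemma bchart_param:
 assumes "c \<in> M" "norm n = 1" "x \<in> snd c ` fst c"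
 shows "param (bchart c n) (x, s) = bparam c n (x, s)"
 using inv_into_f_f[OF bchart_inj[OF assms(1,2)] bparam(1)[OF assms, of s]]
 unfolding param_def bparam(2)[OF assms] .

lemma bchart_image:
 assumes "c \<in> M" "norm n = 1"
 shows "snd (bchart c n) ` fst (bchart c n) = (snd c ` fst c) \<times> UNIV"
proof (intro equalityI subsetI)
 fix z assume "z \<in> snd (bchart c n) ` fst (bchart c n)"
 then show "z \<in> (snd c ` fst c) \<times> UNIV" by (auto simp: bchart_mem bchart_coords)
next
 fix z assume "z \<in> (snd c ` fst c) \<times> (UNIV :: real set)"
 then show "z \<in> snd (bchart c n) ` fst (bchart c n)"
  using bparam(1)[OF assms, of "fst z" "snd z"] bparam(2)[OF assms, of "fst z" "snd z"]
  by (auto simp: image_iff) (metis prod.collapse)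
qed

definition boverlap :: "('p, real^2) chart \<Rightarrow> real^2 \<Rightarrow> ('p, real^2) chart \<Rightarrow> real^2 \<Rightarrow> ((real^2) \<times> real) set" where
 "boverlap c n d k = {z \<in> snd c ` (fst c \<inter> fst d) \<times> UNIV.
  k \<bullet> fderiv (transition c d) (at (fst z)) (slope_vec n (snd z)) > 0}"

lemma bparam_other:
 assumes "c \<in> M" "norm n = 1" "d \<in> M" "norm k = 1" "x \<in> snd c ` (fst c \<inter> fst d)"
 shows "bparam c n (x, s) \<in> fst (bchart d k) \<longleftrightarrow> (x, s) \<in> boverlap c n d k"
  "snd (bchart d k) (bparam c n (x, s)) =
   (transition c d x, slope k (fderiv (transition c d) (at x) (slope_vec n s)))"
proof -
 have x': "x \<in> snd c ` fst c" using assms(5) by auto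
 have x: "snd c (param c x) = x" and p: "chart_at M (param c x) c" "chart_at M (param c x) d"
  using assms snd_param[OF x'] by (auto simp: chart_at_def)
 obtain t where t: "t > 0" "bparam c n (x, s) \<in> E" "fst (rep (bparam c n (x, s))) = param c x"
  "snd (rep (bparam c n (x, s))) = scale_vec t (vec_at M c (param c x) (slope_vec n s))"
  using bparam_rep[OF assms(1,2) x'] by blast
 show "bparam c n (x, s) \<in> fst (bchart d k) \<longleftrightarrow> (x, s) \<in> boverlap c n d k"
  using t p assms(5) by (simp add: bchart_mem boverlap_def scale_vec_def vec_at_apply x chart_at_def zero_less_mult_iff)
 show "snd (bchart d k) (bparam c n (x, s)) =
   (transition c d x, slope k (fderiv (transition c d) (at x) (slope_vec n s)))"
  using t p slope_scaleR[of t] by (simp add: bchart_coords scale_vec_def vec_at_apply x transition_def)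
qed

lemma boverlap_eq:
 assumes "c \<in> M" "norm n = 1" "d \<in> M" "norm k = 1"
 shows "snd (bchart c n) ` (fst (bchart c n) \<inter> fst (bchart d k)) = boverlap c n d k"
proof (intro equalityI subsetI)
 fix z assume "z \<in> snd (bchart c n) ` (fst (bchart c n) \<inter> fst (bchart d k))"
 then obtain e where e: "e \<in> fst (bchart c n)" "e \<in> fst (bchart d k)" "z = snd (bchart c n) e" by auto
 then have "fst z \<in> snd c ` (fst c \<inter> fst d)" by (auto simp: bchart_mem bchart_coords)
 moreover have "bparam c n (fst z, snd z) = e" using bparam_bchart[OF assms(1,2) e(1)] e(3) by simp
 ultimately show "z \<in> boverlap c n d k"
  using bparam_other(1)[OF assms, of "fst z" "snd z"] e by simp
next
 fix z assume z: "z \<in> boverlap c n d k"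
 then have x: "fst z \<in> snd c ` (fst c \<inter> fst d)" by (auto simp: boverlap_def)
 then have x': "fst z \<in> snd c ` fst c" by auto
 show "z \<in> snd (bchart c n) ` (fst (bchart c n) \<inter> fst (bchart d k))"
  using bparam_other(1)[OF assms x, of "snd z"] bparam[OF assms(1,2) x', of "snd z"] z
  by (intro image_eqI[where x="bparam c n z"]) auto
qed

lemma smooth_on_transition_slope_vec:
 assumes "c \<in> M" "d \<in> M"
 shows "smooth_on (snd c ` (fst c \<inter> fst d) \<times> UNIV)
  (%z. fderiv (transition c d) (at (fst z)) (slope_vec n (snd z)))"
proof (rule smooth_on_frechet_derivative[OF _ overlap_open[OF assms] transition_smooth[OF assms]])
 show o: "open (snd c ` (fst c \<inter> fst d) \<times> (UNIV :: real set))"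
  using overlap_open[OF assms] by (simp add: open_Times)
 show "smooth_on (snd c ` (fst c \<inter> fst d) \<times> (UNIV :: real set)) fst"
  using smooth_on_fst[OF o smooth_on_id[OF o]] by simp
 show "smooth_on (snd c ` (fst c \<inter> fst d) \<times> UNIV) (%z. slope_vec n (snd z))"
  by (intro smooth_intros o)
qed auto

lemma boverlap_open:
 assumes "c \<in> M" "d \<in> M"
 shows "open (boverlap c n d k)"
proof -
 let ?S = "snd c ` (fst c \<inter> fst d) \<times> (UNIV :: real set)"
 have o: "open ?S" using overlap_open[OF assms] by (simp add: open_Times)
 have "continuous_on ?S (%z. k \<bullet> fderiv (transition c d) (at (fst z)) (slope_vec n (snd z)))"
  by (intro continuous_intros smooth_on_continuous_on smooth_on_transition_slope_vec assms)
 from continuous_open_preimage[OF this o open_greaterThan[of 0]]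
 show ?thesis unfolding boverlap_def by (simp add: Int_def vimage_def)
qed

lemma batlas_smooth: "smooth_atlas batlas"
 unfolding smooth_atlas_def
proof (intro conjI ballI)
 fix C assume "C \<in> batlas"
 then obtain c n where c: "c \<in> M" "norm n = 1" "C = bchart c n" by (rule batlasE)
 show "inj_on (snd C) (fst C)" using bchart_inj c by simp
 show "open (snd C ` fst C)" using bchart_image[OF c(1,2)] chart_open[OF c(1)] c(3) by (simp add: open_Times)
next
 fix C D assume "C \<in> batlas" "D \<in> batlas"
 then obtain c n d k where c: "c \<in> M" "norm n = 1" "C = bchart c n" and d: "d \<in> M" "norm k = 1" "D = bchart d k"
  by (metis batlasE)
 have eq: "snd C ` (fst C \<inter> fst D) = boverlap c n d k" using boverlap_eq c d by simp
 have o: "open (boverlap c n d k)" by (rule boverlap_open[OF c(1) d(1)])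
 then show "open (snd C ` (fst C \<inter> fst D))" using eq by simp
 have sub: "boverlap c n d k \<subseteq> snd c ` (fst c \<inter> fst d) \<times> UNIV" by (auto simp: boverlap_def)
 have "smooth_on (boverlap c n d k) (%z. (transition c d (fst z),
   slope k (fderiv (transition c d) (at (fst z)) (slope_vec n (snd z)))))"
 proof (intro smooth_intros o)
  show "smooth_on (boverlap c n d k) (%z. transition c d (fst z))"
   by (rule smooth_on_compose[OF o overlap_open[OF c(1) d(1)] transition_smooth[OF c(1) d(1)] smooth_on_fst[OF o smooth_on_id[OF o]]])
    (use sub in auto)
  show "smooth_on (boverlap c n d k) (%z. fderiv (transition c d) (at (fst z)) (slope_vec n (snd z)))"
   by (rule smooth_on_subset[OF smooth_on_transition_slope_vec[OF c(1) d(1)] sub])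
 qed (auto simp: boverlap_def)
 moreover have "transition C D z = (transition c d (fst z),
   slope k (fderiv (transition c d) (at (fst z)) (slope_vec n (snd z))))"
  if "z \<in> boverlap c n d k" for z
 proof -
  have z: "fst z \<in> snd c ` (fst c \<inter> fst d)" using that sub by auto
  then have z': "fst z \<in> snd c ` fst c" by auto
  show ?thesis
   using bparam_other(2)[OF c(1,2) d(1,2) z, of "snd z"] bchart_param[OF c(1,2) z', of "snd z"] c(3) d(3)
   by (simp add: transition_def)
 qed
 ultimately show "smooth_on (snd C ` (fst C \<inter> fst D)) (transition C D)"
  using smooth_on_cong[OF o] eq by (metis (no_types, lifting))
qed

sublocale dirs: smooth_manifold batlas
 by unfold_locales (rule batlas_smooth)

lemma bchart_exists:
 assumes "e \<in> E" "chart_at M (fst (rep e)) c"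
 obtains n where "norm n = 1" "chart_at batlas e (bchart c n)"
proof -
 have "snd (rep e) c ~= 0"
  using tangent_zero_iff[OF rep_tangent[OF assms(1)] assms(2)] rep_nonzero[OF assms(1)] by simp
 then have "norm (snd (rep e) c /\<^sub>R norm (snd (rep e) c)) = 1"
  "(snd (rep e) c /\<^sub>R norm (snd (rep e) c)) \<bullet> snd (rep e) c > 0" by simp_all
 then show thesis
  using that[of "snd (rep e) c /\<^sub>R norm (snd (rep e) c)"] assms chart_atD[OF assms(2)]
  by (simp add: bchart_at bchart_mem)
qed

lemma batlas_points: "points batlas = E"
proof
 show "points batlas \<subseteq> E" unfolding points_def by (rule UN_least, erule batlasE) (auto simp: bchart_def)
 show "E \<subseteq> points batlas"
 proof
  fix e assume e: "e \<in> E"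
  show "e \<in> points batlas"
   by (rule bchart_exists[OF e chart_at_some[OF rep_points[OF e]]]) (rule dirs.chart_at_points)
 qed
qed

lemma bchart_at_iff:
 "c \<in> M ==> norm n = 1 ==> chart_at batlas e (bchart c n) \<longleftrightarrow> e \<in> E \<and> chart_at M (fst (rep e)) c \<and> n \<bullet> snd (rep e) c > 0"
 by (simp add: bchart_at bchart_mem) (auto simp: chart_at_def)

text \<open>
 The slope coordinate only sees the direction of a vector, so a curve of directions may be
 differentiated through any positive multiple of its representative.
\<close>

lemma bchart_curve_derivative:
 assumes "open I" "t \<in> I" "norm n = 1" "n \<bullet> Y t ~= 0"
  and rep: "!!s. s \<in> I ==> \<exists>k. k > 0 \<and> snd (rep (\<gamma> s)) c = k *\<^sub>R Y s"
  and "((%s. snd c (fst (rep (\<gamma> s)))) has_vector_derivative x') (at t)" "(Y has_vector_derivative Y') (at t)"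
 shows "((%s. snd (bchart c n) (\<gamma> s)) has_vector_derivative (x', cross2 (Y t) Y' / (n \<bullet> Y t)\<^sup>2)) (at t)"
proof -
 have "((%s. (snd c (fst (rep (\<gamma> s))), slope n (Y s))) has_vector_derivative (x', cross2 (Y t) Y' / (n \<bullet> Y t)\<^sup>2)) (at t)"
  by (intro has_vector_derivative_Pair assms slope_has_vector_derivative)
 moreover have "slope n (Y s) = slope n (snd (rep (\<gamma> s)) c)" if "s \<in> I" for s
  using rep[OF that] slope_scaleR by auto
 ultimately show ?thesis
  by (elim has_vector_derivative_transform_open[OF _ assms(1,2)]) (simp add: bchart_coords)
qed

lemma bundle_velocity:
 assumes "open I" "t \<in> I" "!!s. s \<in> I ==> \<gamma> s \<in> E \<and> fst (rep (\<gamma> s)) \<in> fst c" "c \<in> M"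
  and rep: "!!s. s \<in> I ==> \<exists>k. k > 0 \<and> snd (rep (\<gamma> s)) c = k *\<^sub>R Y s"
  and x: "((%s. snd c (fst (rep (\<gamma> s)))) has_vector_derivative x') (at t)"
  and Y: "(Y has_vector_derivative Y') (at t)"
 shows "velocity batlas \<gamma> t \<in> tangent_space batlas (\<gamma> t)"
  and "chart_at batlas (\<gamma> t) (bchart c n) ==> norm n = 1 ==>
   velocity batlas \<gamma> t (bchart c n) = (x', cross2 (Y t) Y' / (n \<bullet> Y t)\<^sup>2)"
  and "chart_at batlas (\<gamma> t) (bchart c n) ==> norm n = 1 ==>
   \<exists>J. open J \<and> t \<in> J \<and> J \<subseteq> I \<and> (\<forall>s\<in>J. \<gamma> s \<in> fst (bchart c n))"
proof -
 have pos: "n \<bullet> Y s > 0 \<longleftrightarrow> n \<bullet> snd (rep (\<gamma> s)) c > 0" if s: "s \<in> I" for s n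
  using rep[OF s] by (auto simp: zero_less_mult_iff)
 have main: "\<exists>J. open J \<and> t \<in> J \<and> J \<subseteq> I \<and> (\<forall>s\<in>J. \<gamma> s \<in> fst (bchart c n))"
  "velocity batlas \<gamma> t = vec_at batlas (bchart c n) (\<gamma> t) (x', cross2 (Y t) Y' / (n \<bullet> Y t)\<^sup>2)"
  if at: "chart_at batlas (\<gamma> t) (bchart c n)" and n: "norm n = 1" for n
 proof -
  have nY: "n \<bullet> Y t > 0" using at n bchart_at_iff[OF assms(4) n] pos[OF assms(2)] by simp
  have "((%s. n \<bullet> Y s) \<longlongrightarrow> n \<bullet> Y t) (at t)"
   by (intro tendsto_intros has_vector_derivative_continuous[OF Y, unfolded isCont_def])
  from order_tendstoD(1)[OF this nY] obtain J where J: "open J" "t \<in> J" "!!s. s \<in> J ==> s ~= t ==> n \<bullet> Y s > 0"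
   unfolding eventually_at_topological by auto
  have J': "\<gamma> s \<in> fst (bchart c n)" if "s \<in> J \<inter> I" for s
   using that J nY pos[of s n] assms(3)[of s] by (cases "s = t") (auto simp: bchart_mem)
  have o: "open (J \<inter> I)" "t \<in> J \<inter> I" using J assms by auto
  then show "\<exists>J. open J \<and> t \<in> J \<and> J \<subseteq> I \<and> (\<forall>s\<in>J. \<gamma> s \<in> fst (bchart c n))"
   using J' by (metis inf_le2)
  show "velocity batlas \<gamma> t = vec_at batlas (bchart c n) (\<gamma> t) (x', cross2 (Y t) Y' / (n \<bullet> Y t)\<^sup>2)"
   by (rule dirs.velocity_chart(2)[of \<gamma> t "bchart c n" "J \<inter> I", OF at o J' bchart_curve_derivative[OF assms(1,2) n _ rep x Y]])
    (use nY in auto)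
 qed
 from main show "chart_at batlas (\<gamma> t) (bchart c n) ==> norm n = 1 ==>
   \<exists>J. open J \<and> t \<in> J \<and> J \<subseteq> I \<and> (\<forall>s\<in>J. \<gamma> s \<in> fst (bchart c n))"
  "chart_at batlas (\<gamma> t) (bchart c n) ==> norm n = 1 ==>
   velocity batlas \<gamma> t (bchart c n) = (x', cross2 (Y t) Y' / (n \<bullet> Y t)\<^sup>2)"
  using dirs.vec_at_self by (blast, metis)
 obtain n where n: "norm n = 1" "chart_at batlas (\<gamma> t) (bchart c n)"
  using bchart_exists[of "\<gamma> t" c] assms(2-4) by (auto simp: chart_at_def)
 then show "velocity batlas \<gamma> t \<in> tangent_space batlas (\<gamma> t)"
  using main(2)[OF n(2,1)] dirs.vec_at_tangent[OF n(2)] by simp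
qed

lemma differential_footpoint:
 assumes "\<xi> \<in> tangent_space batlas e" "chart_at batlas e (bchart c n)" "c \<in> M" "norm n = 1"
 shows "differential batlas M (fst \<circ> rep) e \<xi> c = fst (\<xi> (bchart c n))"
proof -
 have e: "e \<in> fst (bchart c n)" "e \<in> E" "chart_at M (fst (rep e)) c"
  using assms bchart_at_iff bchart_at by auto
 let ?z = "snd (bchart c n) e"
 have "((snd c \<circ> (fst \<circ> rep)) \<circ> param (bchart c n) has_derivative fst) (at ?z)"
 proof (rule has_derivative_transform_within_open[OF bounded_linear_imp_has_derivative[OF bounded_linear_fst]])
  show "open (snd (bchart c n) ` fst (bchart c n))"
   using dirs.chart_open assms(2) chart_at_def by metis
  show "?z \<in> snd (bchart c n) ` fst (bchart c n)" using e by auto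
  fix z assume "z \<in> snd (bchart c n) ` fst (bchart c n)"
  then obtain e' where "e' \<in> fst (bchart c n)" "z = snd (bchart c n) e'" by auto
  then show "fst z = ((snd c \<circ> (fst \<circ> rep)) \<circ> param (bchart c n)) z"
   using dirs.param_snd[of "bchart c n" e'] assms(2) by (simp add: chart_at_def bchart_coords)
 qed
 from dirs.deriv_along_eq[OF assms(1,2) this] show ?thesis
  using e by (simp add: differential_def)
qed

lemma differential_footpoint_outside:
 "\<not> chart_at M (fst (rep e)) c ==> differential batlas M (fst \<circ> rep) e \<xi> c = 0"
 by (simp add: differential_def)

lemma transition_footpoint:
 assumes "\<xi> \<in> tangent_space batlas e" "chart_at batlas e (bchart c n)" "c \<in> M" "norm n = 1"
  "chart_at batlas e (bchart d k)" "d \<in> M" "norm k = 1"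
 shows "fst (\<xi> (bchart d k)) = fderiv (transition c d) (at (snd c (fst (rep e)))) (fst (\<xi> (bchart c n)))"
proof -
 have e: "e \<in> fst (bchart c n)" "e \<in> E" "chart_at M (fst (rep e)) c" "chart_at M (fst (rep e)) d" "e \<in> fst (bchart d k)"
  using assms bchart_at_iff bchart_at by auto
 let ?z = "snd (bchart c n) e"
 let ?D = "fderiv (transition (bchart c n) (bchart d k)) (at ?z)"
 have z1: "fst ?z = snd c (fst (rep e))" by (simp add: bchart_coords)
 have 1: "((%z. fst (transition (bchart c n) (bchart d k) z)) has_derivative (%h. fst (?D h))) (at ?z)"
  by (intro has_derivative_fst dirs.transition_has_derivative assms)
 have "((%z. transition c d (fst z)) has_derivative (%h. fderiv (transition c d) (at (fst ?z)) (fst h))) (at ?z)"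
  by (rule has_derivative_compose[OF bounded_linear_imp_has_derivative[OF bounded_linear_fst]])
   (use transition_has_derivative[OF e(3,4)] z1 in simp)
 then have 2: "((%z. fst (transition (bchart c n) (bchart d k) z)) has_derivative (%h. fderiv (transition c d) (at (fst ?z)) (fst h))) (at ?z)"
 proof (rule has_derivative_transform_within_open)
  show "open (snd (bchart c n) ` fst (bchart c n))"
   using dirs.chart_open assms(2) chart_at_def by metis
  show "?z \<in> snd (bchart c n) ` fst (bchart c n)" using e by auto
  fix z assume "z \<in> snd (bchart c n) ` fst (bchart c n)"
  then obtain e' where "e' \<in> fst (bchart c n)" "z = snd (bchart c n) e'" by auto
  then show "transition c d (fst z) = fst (transition (bchart c n) (bchart d k) z)"
   using dirs.param_snd[of "bchart c n" e'] assms(2,3) by (simp add: chart_at_def bchart_coords transition_def bchart_mem)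
 qed
 have "fst (?D h) = fderiv (transition c d) (at (fst ?z)) (fst h)" for h
  using has_derivative_unique[OF 1 2] by metis
 then show ?thesis using dirs.tangent_transition[OF assms(1,2,5)] z1 by simp
qed

lemma differential_footpoint_tangent:
 assumes "\<xi> \<in> tangent_space batlas e" "e \<in> E"
 shows "differential batlas M (fst \<circ> rep) e \<xi> \<in> tangent_space M (fst (rep e))"
proof (rule tangent_spaceI)
 fix c d assume c: "chart_at M (fst (rep e)) c" and d: "chart_at M (fst (rep e)) d"
 obtain n where n: "norm n = 1" "chart_at batlas e (bchart c n)" using bchart_exists[OF assms(2) c] .
 obtain k where k: "norm k = 1" "chart_at batlas e (bchart d k)" using bchart_exists[OF assms(2) d] .
 show "differential batlas M (fst \<circ> rep) e \<xi> d =
   fderiv (transition c d) (at (snd c (fst (rep e)))) (differential batlas M (fst \<circ> rep) e \<xi> c)"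
  using transition_footpoint[OF assms(1) n(2) _ n(1) k(2) _ k(1)] chart_atD[OF c] chart_atD[OF d]
   differential_footpoint[OF assms(1) n(2) _ n(1)] differential_footpoint[OF assms(1) k(2) _ k(1)] by simp
qed (rule differential_footpoint_outside)

end

section \<open>Riemannian metrics on open subsets of the plane\<close>

lemma mv2: "(A :: real^2^2) *v y = vector [A $ 1 $ 1 * y $ 1 + A $ 1 $ 2 * y $ 2, A $ 2 $ 1 * y $ 1 + A $ 2 $ 2 * y $ 2]"
 by (simp add: real2_eq_iff matrix_vector_mult_def sum_2)

lemma bounded_bilinear_matrix_vector_mult:
 "bounded_bilinear ((*v) :: real^2^2 \<Rightarrow> real^2 \<Rightarrow> real^2)"
 by (rule bilinear_conv_bounded_bilinear[THEN iffD1])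
  (auto simp: bilinear_def real2_eq_iff mv2 algebra_simps intro!: linearI)

lemma smooth_on_vector2 [smooth_intros]:
 fixes f g :: "_ \<Rightarrow> real"
 assumes "open S" "smooth_on S f" "smooth_on S g"
 shows "smooth_on S (%x. vector [f x, g x] :: real^2)"
proof (rule smooth_on_vecI[OF assms(1)])
 fix i :: 2
 show "smooth_on S (%x. (vector [f x, g x] :: real^2) $ i)"
  using exhaust_2[of i] assms by auto
qed

definition christoffel_of :: "(real^2 \<Rightarrow> real^2^2) \<Rightarrow> real^2 \<Rightarrow> real^2 \<Rightarrow> real^2 \<Rightarrow> real^2" where
 "christoffel_of G x y z = matrix_inv (G x) *v
  (\<chi> l. ((fderiv G (at x) y *v z) $ l + (fderiv G (at x) z *v y) $ l
    - y \<bullet> (fderiv G (at x) (axis l 1) *v z)) / 2)"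

lemma christoffel_eq: "christoffel M g c = christoffel_of (metric_matrix M g c)"
 by (intro ext) (simp add: christoffel_def christoffel_of_def Let_def)

definition curvature_of :: "(real^2 \<Rightarrow> real^2 \<Rightarrow> real^2 \<Rightarrow> real^2) \<Rightarrow> real^2 \<Rightarrow> real^2 \<Rightarrow> real^2 \<Rightarrow> real^2 \<Rightarrow> real^2" where
 "curvature_of \<Gamma> x y w z = fderiv (%x. \<Gamma> x w z) (at x) y - fderiv (%x. \<Gamma> x y z) (at x) w
   + \<Gamma> x y (\<Gamma> x w z) - \<Gamma> x w (\<Gamma> x y z)"

lemma riemann_curvature_eq: "riemann_curvature M g c = curvature_of (christoffel_of (metric_matrix M g c))"
 by (intro ext) (simp add: riemann_curvature_def curvature_of_def Let_def christoffel_eq)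

lemma cross2_scaleR: "cross2 (k *\<^sub>R y) z = k * cross2 y z" "cross2 y (k *\<^sub>R z) = k * cross2 y z"
 by (simp_all add: cross2_def algebra_simps)

lemma cross2_add: "cross2 (y + y') z = cross2 y z + cross2 y' z" "cross2 y (z + z') = cross2 y z + cross2 y z'"
 by (simp_all add: cross2_def algebra_simps)

lemma cross2_self [simp]: "cross2 y y = 0" "cross2 y 0 = 0"
 by (simp_all add: cross2_def)

definition rotation_of :: "real^2^2 \<Rightarrow> real^2 \<Rightarrow> real^2" where
 "rotation_of A y = (1 / sqrt (det A)) *\<^sub>R vector [- ((A *v y) $ 2), (A *v y) $ 1]"

definition pos_def :: "real^2^2 \<Rightarrow> bool" where
 "pos_def A \<longleftrightarrow> A $ 1 $ 2 = A $ 2 $ 1 \<and> (\<forall>y. y ~= 0 --> y \<bullet> (A *v y) > 0)"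

lemma pos_def_sym: "pos_def A ==> y \<bullet> (A *v z) = z \<bullet> (A *v y)"
 by (simp add: pos_def_def mv2 inner2 algebra_simps)

lemma lagrange_identity:
 assumes "pos_def A"
 shows "(y \<bullet> (A *v y)) * (z \<bullet> (A *v z)) - (y \<bullet> (A *v z))\<^sup>2 = det A * (cross2 y z)\<^sup>2"
proof -
 have "A $ 2 $ 1 = A $ 1 $ 2" using assms by (simp add: pos_def_def)
 then show ?thesis by (simp add: mv2 inner2 det_2 cross2_def power2_eq_square algebra_simps)
qed

lemma pos_def_det:
 assumes "pos_def A"
 shows "det A > 0"
proof -
 let ?y = "vector [1, 0] :: real^2" and ?z = "vector [- (A $ 1 $ 2), A $ 1 $ 1] :: real^2"
 have y: "?y \<bullet> (A *v ?y) > 0" using assms by (auto simp: pos_def_def real2_eq_iff)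
 then have a: "A $ 1 $ 1 > 0" by (simp add: mv2 inner2)
 have "?z \<bullet> (A *v ?z) > 0" using assms a by (auto simp: pos_def_def real2_eq_iff)
 moreover have "?z \<bullet> (A *v ?z) = A $ 1 $ 1 * det A"
  using assms by (simp add: mv2 inner2 det_2 pos_def_def algebra_simps)
 ultimately show ?thesis using a by (simp add: zero_less_mult_iff)
qed

lemma pos_def_inv:
 assumes "pos_def A"
 shows "A *v (matrix_inv A *v u) = u"
proof -
 have "invertible A" using pos_def_det[OF assms] invertible_det_nz[of A] by simp
 then have "\<exists>B. A ** B = mat 1 \<and> B ** A = mat 1" by (simp add: invertible_def)
 from someI_ex[OF this] have "A ** matrix_inv A = mat 1" unfolding matrix_inv_def by blast
 then show ?thesis by (simp add: matrix_vector_mul_assoc)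
qed

lemma pos_def_eqI:
 assumes "pos_def A" "!!w. w \<bullet> (A *v u) = w \<bullet> (A *v v)"
 shows "u = v"
proof (rule ccontr)
 assume "u ~= v"
 then have "(u - v) \<bullet> (A *v (u - v)) > 0" using assms(1) by (simp add: pos_def_def)
 then show False using assms(2)[of "u - v"]
  by (simp add: matrix_vector_mult_diff_distrib inner_diff_right)
qed

lemma pos_def_frame_eqI:
 assumes "pos_def A" "y ~= 0" "y \<bullet> (A *v u) = y \<bullet> (A *v v)" "cross2 y u = cross2 y v"
 shows "u = v"
proof (rule ccontr)
 assume "u ~= v"
 then have "(u - v) \<bullet> (A *v (u - v)) > 0" "y \<bullet> (A *v y) > 0" using assms(1,2) by (simp_all add: pos_def_def)
 moreover have "y \<bullet> (A *v (u - v)) = 0" "cross2 y (u - v) = 0"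
  using assms(3,4) by (simp_all add: matrix_vector_mult_diff_distrib inner_diff_right cross2_def algebra_simps)
 ultimately show False using lagrange_identity[OF assms(1), of y "u - v"] by simp
qed

lemma rotation_of:
 assumes "pos_def A"
 shows "y \<bullet> (A *v rotation_of A y) = 0" "rotation_of A y \<bullet> (A *v rotation_of A y) = y \<bullet> (A *v y)"
  "cross2 y (rotation_of A y) = (y \<bullet> (A *v y)) / sqrt (det A)"
proof -
 let ?r = "vector [- ((A *v y) $ 2), (A *v y) $ 1] :: real^2"
 note d = pos_def_det[OF assms]
 have s: "A $ 2 $ 1 = A $ 1 $ 2" using assms by (simp add: pos_def_def)
 have 1: "y \<bullet> (A *v ?r) = 0" by (simp add: mv2 inner2 s algebra_simps)
 have 2: "cross2 y ?r = y \<bullet> (A *v y)" by (simp add: mv2 inner2 cross2_def algebra_simps)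
 have 3: "?r \<bullet> (A *v ?r) = det A * (y \<bullet> (A *v y))" by (simp add: mv2 inner2 det_2 s algebra_simps)
 show "y \<bullet> (A *v rotation_of A y) = 0" using 1 by (simp add: rotation_of_def matrix_vector_mult_scaleR)
 show "cross2 y (rotation_of A y) = (y \<bullet> (A *v y)) / sqrt (det A)"
  unfolding rotation_of_def cross2_scaleR(2) 2 by simp
 have "rotation_of A y \<bullet> (A *v rotation_of A y) = (1 / sqrt (det A)) * ((1 / sqrt (det A)) * (?r \<bullet> (A *v ?r)))"
  by (simp only: rotation_of_def matrix_vector_mult_scaleR inner_scaleR_left inner_scaleR_right)
 also have "\<dots> = y \<bullet> (A *v y)"
  using d by (simp only: 3) (simp add: field_simps)
 finally show "rotation_of A y \<bullet> (A *v rotation_of A y) = y \<bullet> (A *v y)" .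
qed

lemma rotation_of_unique:
 assumes "pos_def A" "y \<bullet> (A *v z) = 0" "z \<bullet> (A *v z) = y \<bullet> (A *v y)" "cross2 y z \<ge> 0"
 shows "z = rotation_of A y"
proof (cases "y = 0")
 case True
 then have "z \<bullet> (A *v z) = 0" using assms(3) by simp
 then have "z = 0" using assms(1) unfolding pos_def_def by (metis less_irrefl)
 then show ?thesis using True by (simp add: rotation_of_def real2_eq_iff mv2)
next
 case False
 note d = pos_def_det[OF assms(1)]
 have q: "y \<bullet> (A *v y) > 0" using False assms(1) by (simp add: pos_def_def)
 have "det A * (cross2 y z)\<^sup>2 = (y \<bullet> (A *v y))\<^sup>2"
  using lagrange_identity[OF assms(1), of y z] assms(2,3) by (simp add: power2_eq_square)
 then have "(sqrt (det A) * cross2 y z)\<^sup>2 = (y \<bullet> (A *v y))\<^sup>2"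
  using d by (simp add: power_mult_distrib)
 then have "sqrt (det A) * cross2 y z = y \<bullet> (A *v y)"
  by (rule power2_eq_imp_eq) (use assms(4) q d in \<open>simp_all add: less_imp_le\<close>)
 then have "sqrt (det A) * cross2 y z = sqrt (det A) * cross2 y (rotation_of A y)"
  unfolding rotation_of(3)[OF assms(1)] using d by simp
 then have "cross2 y z = cross2 y (rotation_of A y)" using d by simp
 then show ?thesis
  by (rule pos_def_frame_eqI[OF assms(1) False, rotated]) (simp add: assms(2) rotation_of(1)[OF assms(1)])
qed

lemma has_derivative_preimage_open:
 assumes "(f has_derivative f') (at x)" "open \<Omega>" "f x \<in> \<Omega>"
 obtains S where "open S" "x \<in> S" "!!y. y \<in> S ==> f y \<in> \<Omega>"
proof -
 have "\<forall>\<^sub>F y in at x. f y \<in> \<Omega>"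
  using has_derivative_continuous[OF assms(1)] assms(2,3) unfolding isCont_def by (rule topological_tendstoD)
 then obtain S where S: "open S" "x \<in> S" "!!y. y \<in> S ==> y ~= x ==> f y \<in> \<Omega>"
  unfolding eventually_at_topological by auto
 show thesis by (rule that[OF S(1,2)]) (use S(3) assms(3) in metis)
qed

locale plane_metric =
 fixes \<Omega> :: "(real^2) set" and G :: "real^2 \<Rightarrow> real^2^2"
 assumes dom_open: "open \<Omega>" and metric_smooth: "smooth_on \<Omega> G" and metric_pos_def: "x \<in> \<Omega> ==> pos_def (G x)"
begin

lemma metric_has_derivative: "x \<in> \<Omega> ==> (G has_derivative fderiv G (at x)) (at x)"
 by (rule smooth_on_has_derivative[OF metric_smooth])

lemma metric_derivative_linear: "x \<in> \<Omega> ==> linear (fderiv G (at x))"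
 using metric_has_derivative has_derivative_linear by blast

lemma metric_derivative_axis:
 assumes "x \<in> \<Omega>"
 shows "fderiv G (at x) w = w $ 1 *\<^sub>R fderiv G (at x) (axis 1 1) + w $ 2 *\<^sub>R fderiv G (at x) (axis 2 1)"
proof -
 have "w = w $ 1 *\<^sub>R axis 1 1 + w $ 2 *\<^sub>R axis 2 1" by (simp add: real2_eq_iff axis_def)
 then have "fderiv G (at x) w = fderiv G (at x) (w $ 1 *\<^sub>R axis 1 1 + w $ 2 *\<^sub>R axis 2 1)" by simp
 then show ?thesis using metric_derivative_linear[OF assms] by (simp only: linear_add linear_cmul)
qed

lemma christoffel_of_char:
 assumes "x \<in> \<Omega>"
 shows "2 * (w \<bullet> (G x *v christoffel_of G x y z)) =
  w \<bullet> (fderiv G (at x) y *v z) + w \<bullet> (fderiv G (at x) z *v y) - y \<bullet> (fderiv G (at x) w *v z)"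
proof -
 have "y \<bullet> (fderiv G (at x) w *v z) =
   w $ 1 * (y \<bullet> (fderiv G (at x) (axis 1 1) *v z)) + w $ 2 * (y \<bullet> (fderiv G (at x) (axis 2 1) *v z))"
  by (subst metric_derivative_axis[OF assms, of w])
   (simp add: matrix_vector_mult_add_rdistrib scaleR_matrix_vector_assoc[symmetric] inner_add_right)
 then show ?thesis
  unfolding christoffel_of_def pos_def_inv[OF metric_pos_def[OF assms]]
  by (simp add: inner2[of w] field_simps)
qed

lemma christoffel_of_add1: "x \<in> \<Omega> ==> christoffel_of G x (y + y') z = christoffel_of G x y z + christoffel_of G x y' z"
 and christoffel_of_add2: "x \<in> \<Omega> ==> christoffel_of G x z (y + y') = christoffel_of G x z y + christoffel_of G x z y'"
 and christoffel_of_scale1: "x \<in> \<Omega> ==> christoffel_of G x (k *\<^sub>R y) z = k *\<^sub>R christoffel_of G x y z"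
 and christoffel_of_scale2: "x \<in> \<Omega> ==> christoffel_of G x z (k *\<^sub>R y) = k *\<^sub>R christoffel_of G x z y"
proof -
 assume x: "x \<in> \<Omega>"
 note l = metric_derivative_linear[OF x]
 note simps = matrix_vector_right_distrib matrix_vector_mult_add_rdistrib inner_add_right inner_add_left
  linear_add[OF l] linear_cmul[OF l] matrix_vector_mult_scaleR inner_scaleR_right inner_scaleR_left scaleR_matrix_vector_assoc[symmetric]
 show "christoffel_of G x (y + y') z = christoffel_of G x y z + christoffel_of G x y' z"
 proof (rule pos_def_eqI[OF metric_pos_def[OF x]])
  fix w
  have "2 * (w \<bullet> (G x *v christoffel_of G x (y + y') z)) = 2 * (w \<bullet> (G x *v christoffel_of G x y z)) + 2 * (w \<bullet> (G x *v christoffel_of G x y' z))"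
   unfolding christoffel_of_char[OF x] by (simp add: simps)
  then show "w \<bullet> (G x *v christoffel_of G x (y + y') z) = w \<bullet> (G x *v (christoffel_of G x y z + christoffel_of G x y' z))"
   by (simp add: simps)
 qed
 show "christoffel_of G x z (y + y') = christoffel_of G x z y + christoffel_of G x z y'"
 proof (rule pos_def_eqI[OF metric_pos_def[OF x]])
  fix w
  have "2 * (w \<bullet> (G x *v christoffel_of G x z (y + y'))) = 2 * (w \<bullet> (G x *v christoffel_of G x z y)) + 2 * (w \<bullet> (G x *v christoffel_of G x z y'))"
   unfolding christoffel_of_char[OF x] by (simp add: simps)
  then show "w \<bullet> (G x *v christoffel_of G x z (y + y')) = w \<bullet> (G x *v (christoffel_of G x z y + christoffel_of G x z y'))"
   by (simp add: simps)
 qed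
 show "christoffel_of G x (k *\<^sub>R y) z = k *\<^sub>R christoffel_of G x y z"
 proof (rule pos_def_eqI[OF metric_pos_def[OF x]])
  fix w
  have "2 * (w \<bullet> (G x *v christoffel_of G x (k *\<^sub>R y) z)) = k * (2 * (w \<bullet> (G x *v christoffel_of G x y z)))"
   unfolding christoffel_of_char[OF x] by (simp add: simps algebra_simps)
  then show "w \<bullet> (G x *v christoffel_of G x (k *\<^sub>R y) z) = w \<bullet> (G x *v (k *\<^sub>R christoffel_of G x y z))"
   by (simp add: simps)
 qed
 show "christoffel_of G x z (k *\<^sub>R y) = k *\<^sub>R christoffel_of G x z y"
 proof (rule pos_def_eqI[OF metric_pos_def[OF x]])
  fix w
  have "2 * (w \<bullet> (G x *v christoffel_of G x z (k *\<^sub>R y))) = k * (2 * (w \<bullet> (G x *v christoffel_of G x z y)))"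
   unfolding christoffel_of_char[OF x] by (simp add: simps algebra_simps)
  then show "w \<bullet> (G x *v christoffel_of G x z (k *\<^sub>R y)) = w \<bullet> (G x *v (k *\<^sub>R christoffel_of G x z y))"
   by (simp add: simps)
 qed
qed

lemma metric_derivative_smooth: "smooth_on \<Omega> (%x. fderiv G (at x) h)"
 by (rule smooth_on_frechet[OF metric_smooth])

lemma smooth_on_det_metric: "smooth_on \<Omega> (%x. det (G x))"
 unfolding det_2 by (intro smooth_intros dom_open metric_smooth)

lemma smooth_on_inverse_metric: "smooth_on \<Omega> (%x. matrix_inv (G x) *v h)"
proof -
 have "matrix_inv (G x) *v h = vector [(G x $ 2 $ 2 * h $ 1 - G x $ 1 $ 2 * h $ 2) / det (G x), (G x $ 1 $ 1 * h $ 2 - G x $ 2 $ 1 * h $ 1) / det (G x)]"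
  (is "_ = ?v x") if x: "x \<in> \<Omega>" for x
 proof -
  have d: "det (G x) ~= 0" using pos_def_det[OF metric_pos_def[OF x]] by simp
  have "(G x *v ?v x) $ 1 * det (G x) = h $ 1 * det (G x)" "(G x *v ?v x) $ 2 * det (G x) = h $ 2 * det (G x)"
   using d by (simp_all add: mv2 field_simps) (simp_all add: det_2 algebra_simps)
  then have "G x *v ?v x = h" using d by (simp add: real2_eq_iff)
  then show ?thesis using pos_def_inv[OF metric_pos_def[OF x], of h] pos_def_eqI[OF metric_pos_def[OF x]] by metis
 qed
 moreover have "smooth_on \<Omega> ?v"
  by (intro smooth_on_vector2 smooth_intros dom_open metric_smooth smooth_on_det_metric)
   (use pos_def_det[OF metric_pos_def] in \<open>force+\<close>)
 ultimately show ?thesis using smooth_on_cong[OF dom_open] by (metis (no_types, lifting))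
qed

lemma smooth_on_christoffel: "smooth_on \<Omega> (%x. christoffel_of G x y z)"
proof -
 define c where "c l x = ((fderiv G (at x) y *v z) $ l + (fderiv G (at x) z *v y) $ l
    - y \<bullet> (fderiv G (at x) (axis l 1) *v z)) / 2" for l x
 have "smooth_on \<Omega> (c l)" for l
  unfolding c_def by (intro smooth_intros dom_open metric_derivative_smooth) auto
 then have "smooth_on \<Omega> (%x. c 1 x *\<^sub>R (matrix_inv (G x) *v axis 1 1) + c 2 x *\<^sub>R (matrix_inv (G x) *v axis 2 1))"
  by (intro smooth_intros dom_open smooth_on_inverse_metric)
 moreover have "christoffel_of G x y z = c 1 x *\<^sub>R (matrix_inv (G x) *v axis 1 1) + c 2 x *\<^sub>R (matrix_inv (G x) *v axis 2 1)" for x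
  unfolding christoffel_of_def c_def[symmetric] by (simp add: real2_eq_iff mv2 axis_def algebra_simps)
 ultimately show ?thesis by (simp only:)
qed

lemma christoffel_of_expand:
 assumes "x \<in> \<Omega>"
 shows "christoffel_of G x u v = (\<Sum>i\<in>UNIV. \<Sum>j\<in>UNIV. (u $ i * v $ j) *\<^sub>R christoffel_of G x (axis i 1) (axis j 1))"
proof -
 have *: "w = w $ 1 *\<^sub>R axis 1 1 + w $ 2 *\<^sub>R axis 2 1" for w :: "real^2" by (simp add: real2_eq_iff axis_def)
 have "christoffel_of G x u v = christoffel_of G x (u $ 1 *\<^sub>R axis 1 1 + u $ 2 *\<^sub>R axis 2 1) (v $ 1 *\<^sub>R axis 1 1 + v $ 2 *\<^sub>R axis 2 1)"
  by (simp only: *[symmetric])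
 also have "\<dots> = (\<Sum>i\<in>UNIV. \<Sum>j\<in>UNIV. (u $ i * v $ j) *\<^sub>R christoffel_of G x (axis i 1) (axis j 1))"
  by (simp only: christoffel_of_add1[OF assms] christoffel_of_add2[OF assms] christoffel_of_scale1[OF assms] christoffel_of_scale2[OF assms] sum_2)
   (simp add: algebra_simps)
 finally show ?thesis .
qed

lemma smooth_on_christoffel_apply:
 assumes "open S" "smooth_on S f" "f ` S \<subseteq> \<Omega>" "smooth_on S u" "smooth_on S v"
 shows "smooth_on S (%x. christoffel_of G (f x) (u x) (v x))"
proof -
 have "smooth_on S (%x. \<Sum>i\<in>UNIV. \<Sum>j\<in>UNIV. (u x $ i * v x $ j) *\<^sub>R christoffel_of G (f x) (axis i 1) (axis j 1))"
  by (intro smooth_intros assms smooth_on_compose[OF assms(1) dom_open smooth_on_christoffel assms(2,3)])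
 moreover have "christoffel_of G (f x) (u x) (v x) = (\<Sum>i\<in>UNIV. \<Sum>j\<in>UNIV. (u x $ i * v x $ j) *\<^sub>R christoffel_of G (f x) (axis i 1) (axis j 1))"
  if "x \<in> S" for x using christoffel_of_expand[of "f x"] assms(3) that by blast
 ultimately show ?thesis using smooth_on_cong[OF assms(1)] by (metis (no_types, lifting))
qed

lemma christoffel_has_derivative:
 assumes "(f has_derivative f') (at x)" "f x \<in> \<Omega>" "(u has_derivative u') (at x)" "(v has_derivative v') (at x)"
 shows "((%x. christoffel_of G (f x) (u x) (v x)) has_derivative (%h.
   fderiv (%y. christoffel_of G y (u x) (v x)) (at (f x)) (f' h)
   + christoffel_of G (f x) (u' h) (v x) + christoffel_of G (f x) (u x) (v' h))) (at x)"
proof -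
 let ?E = "%i j x. christoffel_of G x (axis i 1) (axis j 1)"
 let ?D = "%i j. fderiv (?E i j) (at (f x))"
 have E: "(?E i j has_derivative ?D i j) (at (f x))" for i j
  by (rule smooth_on_has_derivative[OF smooth_on_christoffel assms(2)])
 have "((%y. \<Sum>i\<in>UNIV. \<Sum>j\<in>UNIV. (u x $ i * v x $ j) *\<^sub>R ?E i j y) has_derivative
   (%h. \<Sum>i\<in>UNIV. \<Sum>j\<in>UNIV. (u x $ i * v x $ j) *\<^sub>R ?D i j h)) (at (f x))"
  by (intro has_derivative_sum has_derivative_scaleR_right E)
 then have "((%y. christoffel_of G y (u x) (v x)) has_derivative
   (%h. \<Sum>i\<in>UNIV. \<Sum>j\<in>UNIV. (u x $ i * v x $ j) *\<^sub>R ?D i j h)) (at (f x))"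
  by (rule has_derivative_transform_within_open[OF _ dom_open assms(2)]) (rule christoffel_of_expand[symmetric])
 from frechet_derivative_at[OF this]
 have F: "fderiv (%y. christoffel_of G y (u x) (v x)) (at (f x)) =
  (%h. \<Sum>i\<in>UNIV. \<Sum>j\<in>UNIV. (u x $ i * v x $ j) *\<^sub>R ?D i j h)" by simp
 obtain S where S: "open S" "x \<in> S" "!!y. y \<in> S ==> f y \<in> \<Omega>"
  by (rule has_derivative_preimage_open[OF assms(1) dom_open assms(2)]) blast
 have "((%x. \<Sum>i\<in>UNIV. \<Sum>j\<in>UNIV. (u x $ i * v x $ j) *\<^sub>R ?E i j (f x)) has_derivative
   (%h. \<Sum>i\<in>UNIV. \<Sum>j\<in>UNIV. (u x $ i * v x $ j) *\<^sub>R ?D i j (f' h) + (u x $ i * v' h $ j + u' h $ i * v x $ j) *\<^sub>R ?E i j (f x))) (at x)"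
  by (intro has_derivative_sum has_derivative_scaleR has_derivative_mult
    bounded_linear.has_derivative[OF bounded_linear_vec_nth] assms has_derivative_compose[OF assms(1) E])
 then have "((%x. christoffel_of G (f x) (u x) (v x)) has_derivative
   (%h. \<Sum>i\<in>UNIV. \<Sum>j\<in>UNIV. (u x $ i * v x $ j) *\<^sub>R ?D i j (f' h) + (u x $ i * v' h $ j + u' h $ i * v x $ j) *\<^sub>R ?E i j (f x))) (at x)"
  by (rule has_derivative_transform_within_open[OF _ S(1,2)]) (rule christoffel_of_expand[OF S(3), symmetric])
 moreover have "(\<Sum>i\<in>UNIV. \<Sum>j\<in>UNIV. (u x $ i * v x $ j) *\<^sub>R ?D i j (f' h) + (u x $ i * v' h $ j + u' h $ i * v x $ j) *\<^sub>R ?E i j (f x))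
  = fderiv (%y. christoffel_of G y (u x) (v x)) (at (f x)) (f' h)
   + christoffel_of G (f x) (u' h) (v x) + christoffel_of G (f x) (u x) (v' h)" for h
  unfolding F christoffel_of_expand[OF assms(2), of "u' h"] christoffel_of_expand[OF assms(2), of _ "v' h"]
  unfolding sum_2 by (simp only: scaleR_add_left ac_simps)
 ultimately show ?thesis by (simp only:)
qed

end

lemma frechet_apply_has_derivative:
 fixes \<tau> :: "'a::euclidean_space \<Rightarrow> 'b::real_normed_vector" and f :: "'c::real_normed_vector \<Rightarrow> 'a"
 assumes "open \<Omega>" "smooth_on \<Omega> \<tau>" "f x \<in> \<Omega>" "(f has_derivative f') (at x)" "(v has_derivative v') (at x)"
 shows "((%x. fderiv \<tau> (at (f x)) (v x)) has_derivative
  (%h. D2 \<tau> (f x) (v x) (f' h) + fderiv \<tau> (at (f x)) (v' h))) (at x)"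
proof -
 let ?E = "%b x. fderiv \<tau> (at x) b"
 let ?D = "%b. fderiv (?E b) (at (f x))"
 have E: "(?E b has_derivative ?D b) (at (f x))" for b
  by (rule smooth_on_has_derivative[OF smooth_on_frechet[OF assms(2)] assms(3)])
 have ex: "fderiv \<tau> (at y) w = (\<Sum>b\<in>Basis. (w \<bullet> b) *\<^sub>R ?E b y)" if "y \<in> \<Omega>" for y w
  by (rule frechet_derivative_sum_Basis[OF smooth_on_differentiable[OF assms(2) that]])
 have "((%y. \<Sum>b\<in>Basis. (v x \<bullet> b) *\<^sub>R ?E b y) has_derivative (%h. \<Sum>b\<in>Basis. (v x \<bullet> b) *\<^sub>R ?D b h)) (at (f x))"
  by (intro has_derivative_sum has_derivative_scaleR_right E)
 then have "((%y. fderiv \<tau> (at y) (v x)) has_derivative (%h. \<Sum>b\<in>Basis. (v x \<bullet> b) *\<^sub>R ?D b h)) (at (f x))"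
  by (rule has_derivative_transform_within_open[OF _ assms(1,3)]) (rule ex[symmetric])
 from fun_cong[OF frechet_derivative_at[OF this]]
 have F: "D2 \<tau> (f x) (v x) h = (\<Sum>b\<in>Basis. (v x \<bullet> b) *\<^sub>R ?D b h)" for h
  unfolding D2_def by (rule sym)
 obtain S where S: "open S" "x \<in> S" "!!y. y \<in> S ==> f y \<in> \<Omega>"
  by (rule has_derivative_preimage_open[OF assms(4,1,3)]) blast
 have "((%x. \<Sum>b\<in>Basis. (v x \<bullet> b) *\<^sub>R ?E b (f x)) has_derivative
   (%h. \<Sum>b\<in>Basis. (v x \<bullet> b) *\<^sub>R ?D b (f' h) + (v' h \<bullet> b) *\<^sub>R ?E b (f x))) (at x)"
  by (intro has_derivative_sum has_derivative_scaleR has_derivative_inner_left has_derivative_compose[OF assms(4) E] assms)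
 then have "((%x. fderiv \<tau> (at (f x)) (v x)) has_derivative
   (%h. \<Sum>b\<in>Basis. (v x \<bullet> b) *\<^sub>R ?D b (f' h) + (v' h \<bullet> b) *\<^sub>R ?E b (f x))) (at x)"
  by (rule has_derivative_transform_within_open[OF _ S(1,2)]) (rule ex[OF S(3), symmetric])
 moreover have "(\<Sum>b\<in>Basis. (v x \<bullet> b) *\<^sub>R ?D b (f' h) + (v' h \<bullet> b) *\<^sub>R ?E b (f x)) = D2 \<tau> (f x) (v x) (f' h) + fderiv \<tau> (at (f x)) (v' h)" for h
  unfolding F ex[OF assms(3), of "v' h"] by (rule sum.distrib)
 ultimately show ?thesis by (simp only:)
qed

lemma frechet_apply_has_vector_derivative:
 fixes \<tau> :: "'a::euclidean_space \<Rightarrow> 'b::real_normed_vector"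
 assumes "open \<Omega>" "smooth_on \<Omega> \<tau>" "x t \<in> \<Omega>" "(x has_vector_derivative x') (at t)" "(v has_vector_derivative v') (at t)"
 shows "((%t. fderiv \<tau> (at (x t)) (v t)) has_vector_derivative
  (D2 \<tau> (x t) (v t) x' + fderiv \<tau> (at (x t)) v')) (at t)"
proof -
 have l: "linear (fderiv \<tau> (at (x t)))" "linear (D2 \<tau> (x t) (v t))"
  using smooth_on_has_derivative[OF assms(2,3)] smooth_on_has_derivative[OF smooth_on_frechet[OF assms(2)] assms(3)] has_derivative_linear
  unfolding D2_def[abs_def] by blast+
 show ?thesis
  using frechet_apply_has_derivative[OF assms(1-3) assms(4,5)[unfolded has_vector_derivative_def]]
  unfolding has_vector_derivative_def by (simp add: linear_cmul[OF l(1)] linear_cmul[OF l(2)] scaleR_add_right)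
qed

subsection \<open>Isometries\<close>

locale plane_isometry = src: plane_metric \<Omega> G + tgt: plane_metric \<Omega>' G'
 for \<Omega> G \<Omega>' G' +
 fixes \<tau> :: "real^2 \<Rightarrow> real^2"
 assumes map_smooth: "smooth_on \<Omega> \<tau>" and map_into: "\<tau> ` \<Omega> \<subseteq> \<Omega>'"
  and isometry: "x \<in> \<Omega> ==> y \<bullet> (G x *v z) = fderiv \<tau> (at x) y \<bullet> (G' (\<tau> x) *v fderiv \<tau> (at x) z)"
begin

abbreviation (input) T where "T x \<equiv> fderiv \<tau> (at x)"

lemma T_linear: "x \<in> \<Omega> ==> linear (T x)"
 using smooth_on_has_derivative[OF map_smooth] has_derivative_linear by blast

lemma T_surj:
 assumes "x \<in> \<Omega>"
 shows "\<exists>z. T x z = w"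
proof -
 have "inj (T x)"
 proof (rule linear_injective_0[OF T_linear[OF assms], THEN iffD2, rule_format])
  fix y assume "T x y = 0"
  then have "y \<bullet> (G x *v y) = 0" using isometry[OF assms] by simp
  then show "y = 0" using src.metric_pos_def[OF assms] unfolding pos_def_def by (metis less_irrefl)
 qed
 then have "surj (T x)" using linear_injective_imp_surjective T_linear[OF assms] by blast
 then show ?thesis by (metis surjD)
qed

lemma T_det:
 assumes "x \<in> \<Omega>"
 shows "det (G x) * (cross2 y z)\<^sup>2 = det (G' (\<tau> x)) * (cross2 (T x y) (T x z))\<^sup>2"
 using lagrange_identity[OF src.metric_pos_def[OF assms], of y z]
  lagrange_identity[OF tgt.metric_pos_def, of "\<tau> x" "T x y" "T x z"] isometry[OF assms] map_into assms by auto

lemma D2_sym: "x \<in> \<Omega> ==> D2 \<tau> x y z = D2 \<tau> x z y"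
 by (rule D2_symmetric[OF src.dom_open map_smooth])

lemma metric_derivative:
 assumes "x \<in> \<Omega>"
 shows "y \<bullet> (fderiv G (at x) w *v z) =
  D2 \<tau> x y w \<bullet> (G' (\<tau> x) *v T x z) + T x y \<bullet> (fderiv G' (at (\<tau> x)) (T x w) *v T x z)
   + T x y \<bullet> (G' (\<tau> x) *v D2 \<tau> x z w)"
proof -
 have x': "\<tau> x \<in> \<Omega>'" using map_into assms by auto
 have 1: "((%x. y \<bullet> (G x *v z)) has_derivative (%w. y \<bullet> (fderiv G (at x) w *v z))) (at x)"
  using has_derivative_inner_right[OF bounded_bilinear.FDERIV[OF bounded_bilinear_matrix_vector_mult src.metric_has_derivative[OF assms] has_derivative_const[of z]], of y]
  by simp
 have d: "((%x. T x y) has_derivative (%w. D2 \<tau> x y w)) (at x)" for y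
  unfolding D2_def by (rule smooth_on_has_derivative[OF smooth_on_frechet[OF map_smooth] assms])
 have 2: "((%x. T x y \<bullet> (G' (\<tau> x) *v T x z)) has_derivative (%w. T x y \<bullet> (G' (\<tau> x) *v D2 \<tau> x z w + fderiv G' (at (\<tau> x)) (T x w) *v T x z)
   + D2 \<tau> x y w \<bullet> (G' (\<tau> x) *v T x z))) (at x)"
  by (rule has_derivative_inner[OF d bounded_bilinear.FDERIV[OF bounded_bilinear_matrix_vector_mult _ d]],
    rule has_derivative_compose[OF smooth_on_has_derivative[OF map_smooth assms] tgt.metric_has_derivative[OF x']])
 have "((%x. y \<bullet> (G x *v z)) has_derivative (%w. T x y \<bullet> (G' (\<tau> x) *v D2 \<tau> x z w + fderiv G' (at (\<tau> x)) (T x w) *v T x z)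
   + D2 \<tau> x y w \<bullet> (G' (\<tau> x) *v T x z))) (at x)"
  by (rule has_derivative_transform_within_open[OF 2 src.dom_open assms]) (simp add: isometry)
 from fun_cong[OF has_derivative_unique[OF 1 this], of w] show ?thesis by (simp add: inner_add_right)
qed

text \<open>
 The transformation law of the Levi-Civita connection: both sides satisfy the equations which
 characterize the Christoffel symbols of the metric \<open>G\<close>.
\<close>

lemma christoffel_isometry:
 assumes "x \<in> \<Omega>"
 shows "christoffel_of G' (\<tau> x) (T x y) (T x z) = T x (christoffel_of G x y z) - D2 \<tau> x y z"
proof -
 have x': "\<tau> x \<in> \<Omega>'" using map_into assms by auto
 note pd = tgt.metric_pos_def[OF x']
 show ?thesis
 proof (rule pos_def_eqI[OF pd])
  fix w'
  obtain w where w: "w' = T x w" using T_surj[OF assms] by metis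
  have s: "G' (\<tau> x) $ 2 $ 1 = G' (\<tau> x) $ 1 $ 2" using pd by (simp add: pos_def_def)
  have a: "2 * (T x w \<bullet> (G' (\<tau> x) *v T x (christoffel_of G x y z))) =
   w \<bullet> (fderiv G (at x) y *v z) + w \<bullet> (fderiv G (at x) z *v y) - y \<bullet> (fderiv G (at x) w *v z)"
   using src.christoffel_of_char[OF assms, of w y z] isometry[OF assms] by simp
  have "D2 \<tau> x w y \<bullet> (G' (\<tau> x) *v T x z) = D2 \<tau> x y w \<bullet> (G' (\<tau> x) *v T x z)"
   "D2 \<tau> x w z \<bullet> (G' (\<tau> x) *v T x y) = T x y \<bullet> (G' (\<tau> x) *v D2 \<tau> x z w)"
   "T x w \<bullet> (G' (\<tau> x) *v D2 \<tau> x z y) = T x w \<bullet> (G' (\<tau> x) *v D2 \<tau> x y z)"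
   using D2_sym[OF assms] pos_def_sym[OF pd] by metis+
  then have "2 * (T x w \<bullet> (G' (\<tau> x) *v christoffel_of G' (\<tau> x) (T x y) (T x z))) =
   2 * (T x w \<bullet> (G' (\<tau> x) *v T x (christoffel_of G x y z))) - 2 * (T x w \<bullet> (G' (\<tau> x) *v D2 \<tau> x y z))"
   unfolding tgt.christoffel_of_char[OF x'] a metric_derivative[OF assms] by linarith
  then show "w' \<bullet> (G' (\<tau> x) *v christoffel_of G' (\<tau> x) (T x y) (T x z)) = w' \<bullet> (G' (\<tau> x) *v (T x (christoffel_of G x y z) - D2 \<tau> x y z))"
   unfolding w by (simp add: matrix_vector_mult_diff_distrib inner_diff_right)
 qed
qed

lemma curvature_isometry:
 assumes "x \<in> \<Omega>"
 shows "curvature_of (christoffel_of G') (\<tau> x) (T x y) (T x w) (T x z) = T x (curvature_of (christoffel_of G) x y w z)"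
proof -
 have x': "\<tau> x \<in> \<Omega>'" using map_into assms by auto
 let ?\<Gamma> = "christoffel_of G" and ?\<Gamma>' = "christoffel_of G'"
 define C where "C w z y = fderiv (%x. D2 \<tau> x w z) (at x) y" for w z y
 have d: "((%x. T x y) has_derivative (%w. D2 \<tau> x y w)) (at x)" for y
  unfolding D2_def by (rule smooth_on_has_derivative[OF smooth_on_frechet[OF map_smooth] assms])
 have key: "fderiv (%x'. ?\<Gamma>' x' (T x w) (T x z)) (at (\<tau> x)) (T x y) + ?\<Gamma>' (\<tau> x) (D2 \<tau> x w y) (T x z) + ?\<Gamma>' (\<tau> x) (T x w) (D2 \<tau> x z y)
   = D2 \<tau> x (?\<Gamma> x w z) y + T x (fderiv (%x. ?\<Gamma> x w z) (at x) y) - C w z y" for w z y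
 proof -
  have 1: "((%x. ?\<Gamma>' (\<tau> x) (T x w) (T x z)) has_derivative (%y.
   fderiv (%x'. ?\<Gamma>' x' (T x w) (T x z)) (at (\<tau> x)) (T x y) + ?\<Gamma>' (\<tau> x) (D2 \<tau> x w y) (T x z) + ?\<Gamma>' (\<tau> x) (T x w) (D2 \<tau> x z y))) (at x)"
   by (rule tgt.christoffel_has_derivative[OF smooth_on_has_derivative[OF map_smooth assms] x' d d])
  have "((%x. T x (?\<Gamma> x w z) - D2 \<tau> x w z) has_derivative (%y.
   (D2 \<tau> x (?\<Gamma> x w z) y + T x (fderiv (%x. ?\<Gamma> x w z) (at x) y)) - C w z y)) (at x)"
  proof (rule has_derivative_diff)
   show "((%x. T x (?\<Gamma> x w z)) has_derivative (%y. D2 \<tau> x (?\<Gamma> x w z) y + T x (fderiv (%x. ?\<Gamma> x w z) (at x) y))) (at x)"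
    by (rule frechet_apply_has_derivative[OF src.dom_open map_smooth assms has_derivative_ident smooth_on_has_derivative[OF src.smooth_on_christoffel assms]])
   show "((%x. D2 \<tau> x w z) has_derivative C w z) (at x)"
    unfolding C_def D2_def by (rule smooth_on_has_derivative[OF smooth_on_frechet[OF smooth_on_frechet[OF map_smooth]] assms])
  qed
  then have 2: "((%x. ?\<Gamma>' (\<tau> x) (T x w) (T x z)) has_derivative (%y.
   (D2 \<tau> x (?\<Gamma> x w z) y + T x (fderiv (%x. ?\<Gamma> x w z) (at x) y)) - C w z y)) (at x)"
   by (rule has_derivative_transform_within_open[OF _ src.dom_open assms]) (simp add: christoffel_isometry)
  show ?thesis using fun_cong[OF has_derivative_unique[OF 1 2], of y] .
 qed
 have Csym: "C w z y = C y z w"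
 proof -
  have "C w z y = fderiv (%x. D2 \<tau> x z w) (at x) y" for w z y
   unfolding C_def by (rule arg_cong[where f="%D. D y"], rule frechet_derivative_cong[OF src.dom_open assms]) (rule D2_sym)
  then have "C w z y = D2 (%x. T x z) x w y" for w z y by (simp add: D2_def)
  then show ?thesis using D2_symmetric[OF src.dom_open smooth_on_frechet[OF map_smooth] assms] by metis
 qed
 have sq: "?\<Gamma>' (\<tau> x) (T x y) (?\<Gamma>' (\<tau> x) (T x w) (T x z)) = T x (?\<Gamma> x y (?\<Gamma> x w z)) - D2 \<tau> x (?\<Gamma> x w z) y - ?\<Gamma>' (\<tau> x) (T x y) (D2 \<tau> x z w)" for y w
 proof -
  have "?\<Gamma>' (\<tau> x) (T x y) (?\<Gamma>' (\<tau> x) (T x w) (T x z)) = ?\<Gamma>' (\<tau> x) (T x y) (T x (?\<Gamma> x w z) + (-1) *\<^sub>R D2 \<tau> x w z)"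
   by (simp add: christoffel_isometry[OF assms])
  also have "\<dots> = ?\<Gamma>' (\<tau> x) (T x y) (T x (?\<Gamma> x w z)) - ?\<Gamma>' (\<tau> x) (T x y) (D2 \<tau> x w z)"
   by (simp only: tgt.christoffel_of_add2[OF x'] tgt.christoffel_of_scale2[OF x']) simp
  finally show ?thesis by (simp add: christoffel_isometry[OF assms] D2_sym[OF assms, of y] D2_sym[OF assms, of w])
 qed
 have "T x (curvature_of ?\<Gamma> x y w z) = T x (fderiv (%x. ?\<Gamma> x w z) (at x) y) - T x (fderiv (%x. ?\<Gamma> x y z) (at x) w)
   + T x (?\<Gamma> x y (?\<Gamma> x w z)) - T x (?\<Gamma> x w (?\<Gamma> x y z))"
  unfolding curvature_of_def by (simp only: linear_add[OF T_linear[OF assms]] linear_diff[OF T_linear[OF assms]])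
 moreover have "a1 - a2 + (p1 - d1 - c2) - (p2 - d2 - c1) = e1 - e2 + p1 - p2"
  if "a1 + b + c1 = d1 + e1 - k" "a2 + b + c2 = d2 + e2 - k" for a1 a2 b c1 c2 d1 d2 e1 e2 p1 p2 k :: "real^2"
  using that unfolding real2_eq_iff vector_add_component vector_minus_component by (intro conjI) linarith+
 note this[OF key[of w z y] key[of y z w, unfolded D2_sym[OF assms, of y w] Csym[symmetric]]]
 ultimately show ?thesis
  unfolding curvature_of_def[of ?\<Gamma>'] sq by (simp only:)
qed

end

section \<open>The unit tangent bundle of an oriented Riemannian surface\<close>

lemma cross2_linear:
 assumes "linear (T :: real^2 \<Rightarrow> real^2)"
 shows "cross2 (T y) (T z) = det (matrix T) * cross2 y z"
proof -
 have "cross2 (A *v y) (A *v z) = det A * cross2 y z" for A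
  by (simp add: cross2_def mv2 det_2 algebra_simps)
 from this[of "matrix T"] show ?thesis
  using fun_cong[OF matrix_vector_mul(2)[OF assms]] by simp
qed

locale riemannian_surface = smooth_manifold M for M :: "('p, real^2) atlas" +
 fixes g :: "'p metric"
 assumes oriented: "oriented_atlas M" and metric: "riemannian_metric M g"
begin

abbreviation "Gm \<equiv> metric_matrix M g"

lemma metric_in_chart:
 assumes "chart_at M p c" "v \<in> tangent_space M p" "w \<in> tangent_space M p"
 shows "g p v w = v c \<bullet> (Gm c (snd c p) *v w c)"
proof -
 have p: "p \<in> points M" "param c (snd c p) = p" using assms(1) chart_at_points chart_atD by auto
 let ?b = "%y z. g p (vec_at M c p y) (vec_at M c p z)"
 have b: "bilinear ?b" using metric assms(1) p(1) unfolding riemannian_metric_def by blast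
 have "?b y z = y \<bullet> (Gm c (snd c p) *v z)" for y z
 proof -
  have *: "w = w $ 1 *\<^sub>R axis 1 1 + w $ 2 *\<^sub>R axis 2 1" for w :: "real^2" by (simp add: real2_eq_iff axis_def)
  have "?b y z = ?b (y $ 1 *\<^sub>R axis 1 1 + y $ 2 *\<^sub>R axis 2 1) (z $ 1 *\<^sub>R axis 1 1 + z $ 2 *\<^sub>R axis 2 1)"
   by (simp only: *[symmetric])
  also have "\<dots> = y \<bullet> (Gm c (snd c p) *v z)"
   by (simp only: bilinear_ladd[OF b] bilinear_radd[OF b] bilinear_lmul[OF b] bilinear_rmul[OF b])
    (simp add: mv2 inner2 metric_matrix_def p(2) algebra_simps)
  finally show ?thesis .
 qed
 from this[of "v c" "w c"] show ?thesis using vec_at_tangent_apply assms by simp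
qed

lemma metric_sym: "p \<in> points M ==> v \<in> tangent_space M p ==> w \<in> tangent_space M p ==> g p v w = g p w v"
 using metric unfolding riemannian_metric_def by blast

lemma plane_metric_chart:
 assumes "c \<in> M" "open S" "S \<subseteq> snd c ` fst c"
 shows "plane_metric S (Gm c)"
proof
 show "smooth_on S (Gm c)"
  using metric assms smooth_on_subset unfolding riemannian_metric_def by blast
 fix x assume "x \<in> S"
 then obtain p where p: "p \<in> fst c" "x = snd c p" using assms by auto
 then have c: "chart_at M p c" using assms by (simp add: chart_at_def)
 have e: "g p (vec_at M c p y) (vec_at M c p z) = y \<bullet> (Gm c x *v z)" for y z
  using metric_in_chart[OF c vec_at_tangent[OF c] vec_at_tangent[OF c]] c p by simp
 have "axis 1 1 \<bullet> (Gm c x *v axis 2 1) = axis 2 1 \<bullet> (Gm c x *v axis 1 1)"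
  using metric_sym[OF chart_at_points[OF c] vec_at_tangent[OF c] vec_at_tangent[OF c]] e by metis
 moreover have "y \<bullet> (Gm c x *v y) > 0" if "y ~= 0" for y
 proof -
  have "vec_at M c p y ~= zero_vec" using tangent_zero_iff[OF vec_at_tangent[OF c] c] c that by simp
  then have "g p (vec_at M c p y) (vec_at M c p y) > 0"
   using metric vec_at_tangent[OF c] chart_at_points[OF c] unfolding riemannian_metric_def by blast
  then show ?thesis by (simp only: e)
 qed
 ultimately show "pos_def (Gm c x)" by (simp add: pos_def_def mv2 inner2 axis_def)
qed (rule assms)

lemma plane_metric_full: "c \<in> M ==> plane_metric (snd c ` fst c) (Gm c)"
 by (rule plane_metric_chart) (auto simp: chart_open)

lemma Gm_pos_def: "chart_at M p c ==> pos_def (Gm c (snd c p))"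
 using plane_metric.metric_pos_def[OF plane_metric_full] chart_atD by blast

lemma transition_isometry:
 assumes "c \<in> M" "d \<in> M"
 shows "plane_isometry (snd c ` (fst c \<inter> fst d)) (Gm c) (snd d ` (fst c \<inter> fst d)) (Gm d) (transition c d)"
proof -
 have o: "open (snd d ` (fst c \<inter> fst d))" using overlap_open[of d c] assms by (simp add: Int_commute)
 interpret a: plane_metric "snd c ` (fst c \<inter> fst d)" "Gm c"
  by (rule plane_metric_chart) (use assms overlap_open in auto)
 interpret b: plane_metric "snd d ` (fst c \<inter> fst d)" "Gm d"
  by (rule plane_metric_chart) (use assms o in auto)
 show ?thesis
 proof
  show "smooth_on (snd c ` (fst c \<inter> fst d)) (transition c d)" by (rule transition_smooth[OF assms])
  show "transition c d ` snd c ` (fst c \<inter> fst d) \<subseteq> snd d ` (fst c \<inter> fst d)"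
   using assms by (auto simp: transition_snd)
  fix x y z assume "x \<in> snd c ` (fst c \<inter> fst d)"
  then obtain p where p: "x = snd c p" "chart_at M p c" "chart_at M p d" using assms by (auto simp: chart_at_def)
  have "y \<bullet> (Gm c x *v z) = g p (vec_at M c p y) (vec_at M c p z)"
   using metric_in_chart[OF p(2) vec_at_tangent[OF p(2)] vec_at_tangent[OF p(2)]] p by simp
  also have "\<dots> = vec_at M c p y d \<bullet> (Gm d (snd d p) *v vec_at M c p z d)"
   by (rule metric_in_chart[OF p(3) vec_at_tangent[OF p(2)] vec_at_tangent[OF p(2)]])
  finally show "y \<bullet> (Gm c x *v z) = fderiv (transition c d) (at x) y \<bullet>
   (Gm d (transition c d x) *v fderiv (transition c d) (at x) z)"
   using p by (simp add: vec_at_apply transition_snd chart_atD)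
 qed
qed

abbreviation "\<Gamma> c \<equiv> christoffel_of (Gm c)"

lemma christoffel_transition:
 assumes "chart_at M p c" "chart_at M p d"
 shows "\<Gamma> d (snd d p) (fderiv (transition c d) (at (snd c p)) y) (fderiv (transition c d) (at (snd c p)) z)
  = fderiv (transition c d) (at (snd c p)) (\<Gamma> c (snd c p) y z) - D2 (transition c d) (snd c p) y z"
 using plane_isometry.christoffel_isometry[OF transition_isometry, of c d "snd c p" y z] assms
 by (simp add: chart_at_def transition_snd)

lemma transition_det_pos:
 assumes "chart_at M p c" "chart_at M p d"
 shows "det (matrix (fderiv (transition c d) (at (snd c p)))) > 0"
 using oriented assms unfolding oriented_atlas_def chart_at_def by auto

lemma cross2_transition:
 assumes "chart_at M p c" "chart_at M p d" "v \<in> tangent_space M p" "w \<in> tangent_space M p"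
 shows "\<exists>k>0. cross2 (v d) (w d) = k * cross2 (v c) (w c)"
 using tangent_transition[OF assms(3,1,2)] tangent_transition[OF assms(4,1,2)]
  cross2_linear[OF transition_linear[OF assms(1,2)], of "v c" "w c"] transition_det_pos[OF assms(1,2)] by metis

lemma rotate_J_eq:
 assumes v: "v \<in> tangent_space M p" and c: "chart_at M p c"
 shows "rotate_J M g p v = vec_at M c p (rotation_of (Gm c (snd c p)) (v c))"
proof -
 let ?A = "Gm c (snd c p)"
 let ?w = "vec_at M c p (rotation_of ?A (v c))"
 note pd = Gm_pos_def[OF c]
 have w: "?w \<in> tangent_space M p" by (rule vec_at_tangent[OF c])
 show ?thesis unfolding rotate_J_def
 proof (rule the_equality, intro conjI allI impI)
  show "g p ?w ?w = g p v v" "g p v ?w = 0"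
   using metric_in_chart[OF c v w] metric_in_chart[OF c w w] metric_in_chart[OF c v v] rotation_of[OF pd] c by simp_all
  have "cross2 (v c) (?w c) \<ge> 0"
  proof (cases "v c = 0")
   case False
   then have "v c \<bullet> (?A *v v c) \<ge> 0" using pd unfolding pos_def_def by (simp add: less_imp_le)
   then show ?thesis using rotation_of(3)[OF pd, of "v c"] c pos_def_det[OF pd] by simp
  qed (simp add: cross2_def)
  then show "v d $ 1 * ?w d $ 2 - v d $ 2 * ?w d $ 1 \<ge> 0" if "chart_at M p d" for d
   using cross2_transition[OF c that v w] unfolding cross2_def[symmetric] by (metis mult_nonneg_nonneg less_imp_le)
 next
  fix w' assume w': "w' \<in> tangent_space M p \<and> g p w' w' = g p v v \<and> g p v w' = 0 \<and>
   (\<forall>c. chart_at M p c --> v c $ 1 * w' c $ 2 - v c $ 2 * w' c $ 1 \<ge> 0)"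
  then have "cross2 (v c) (w' c) \<ge> 0" and t: "w' \<in> tangent_space M p"
   and e: "g p w' w' = g p v v" "g p v w' = 0" using c unfolding cross2_def by blast+
  then have "w' c = rotation_of ?A (v c)"
   using metric_in_chart[OF c v t] metric_in_chart[OF c t t] metric_in_chart[OF c v v]
   by (intro rotation_of_unique[OF pd]) simp_all
  then show "w' = ?w" using c by (intro tangent_eqI[OF t w c]) simp
 qed (rule w)
qed

lemma rotate_J_chart:
 "v \<in> tangent_space M p ==> chart_at M p c ==> rotate_J M g p v c = rotation_of (Gm c (snd c p)) (v c)"
 by (simp add: rotate_J_eq)

lemma rotate_J:
 assumes "p \<in> points M" "v \<in> tangent_space M p"
 shows "rotate_J M g p v \<in> tangent_space M p" "g p v (rotate_J M g p v) = 0"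
  "g p (rotate_J M g p v) (rotate_J M g p v) = g p v v"
proof -
 define c where "c = (SOME c. chart_at M p c)"
 have c: "chart_at M p c" unfolding c_def by (rule chart_at_some[OF assms(1)])
 show J: "rotate_J M g p v \<in> tangent_space M p" using rotate_J_eq[OF assms(2) c] vec_at_tangent[OF c] by simp
 show "g p v (rotate_J M g p v) = 0" "g p (rotate_J M g p v) (rotate_J M g p v) = g p v v"
  using metric_in_chart[OF c assms(2) J] metric_in_chart[OF c J J] metric_in_chart[OF c assms(2) assms(2)]
   rotate_J_chart[OF assms(2) c] rotation_of[OF Gm_pos_def[OF c]] by simp_all
qed

lemma metric_scale:
 assumes "p \<in> points M" "v \<in> tangent_space M p"
 shows "g p (scale_vec t v) (scale_vec t v) = t\<^sup>2 * g p v v"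
proof -
 define c where "c = (SOME c. chart_at M p c)"
 have c: "chart_at M p c" unfolding c_def by (rule chart_at_some[OF assms(1)])
 show ?thesis
  using metric_in_chart[OF c scale_vec_tangent[OF assms(2)] scale_vec_tangent[OF assms(2)], of t t] metric_in_chart[OF c assms(2) assms(2)]
  by (simp add: scale_vec_def matrix_vector_mult_scaleR power2_eq_square)
qed

lemma metric_pos: "p \<in> points M ==> v \<in> tangent_space M p ==> v ~= zero_vec ==> g p v v > 0"
 using metric unfolding riemannian_metric_def by blast

lemma metric_zero: "p \<in> points M ==> g p zero_vec zero_vec = 0"
 using metric_scale[of p zero_vec 0] zero_vec_tangent by (simp add: scale_vec_def zero_vec_def)

lemma scale_vec_zero_iff: "scale_vec t v = zero_vec \<longleftrightarrow> t = 0 \<or> v = zero_vec"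
 by (auto simp: scale_vec_def zero_vec_def fun_eq_iff)

lemma scale_vec_scale_vec [simp]: "scale_vec s (scale_vec t v) = scale_vec (s * t) v"
 by (simp add: scale_vec_def)

lemma scale_vec_one [simp]: "scale_vec 1 v = v" by (simp add: scale_vec_def)

lemma normalize_unit:
 assumes "p \<in> points M" "v \<in> tangent_space M p" "v ~= zero_vec"
 shows "(p, scale_vec (1 / sqrt (g p v v)) v) \<in> unit_bundle M g"
 using metric_scale[OF assms(1,2), of "1 / sqrt (g p v v)"] metric_pos[OF assms] assms scale_vec_tangent
 by (simp add: unit_bundle_def power_divide)

sublocale ub: direction_bundle M "unit_bundle M g" "%q. q"
proof
 fix e assume "e \<in> unit_bundle M g"
 then show "fst e \<in> points M" "snd e \<in> tangent_space M (fst e)" "snd e ~= zero_vec"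
  using metric_zero by (auto simp: unit_bundle_def)
next
 fix p v assume pv: "p \<in> points M" "v \<in> tangent_space M p" "v ~= zero_vec"
 show "\<exists>e\<in>unit_bundle M g. \<exists>t>0. e = (p, scale_vec t v)"
  using normalize_unit[OF pv] metric_pos[OF pv] by (intro bexI exI[of _ "1 / sqrt (g p v v)"]) auto
next
 fix e e' t assume a: "e \<in> unit_bundle M g" "e' \<in> unit_bundle M g" "fst e' = fst e" "(t::real) > 0" "snd e' = scale_vec t (snd e)"
 then have "t\<^sup>2 = 1" using metric_scale[of "fst e" "snd e" t] by (auto simp: unit_bundle_def)
 then have "t = 1" using a(4) by (simp add: power2_eq_1_iff)
 then show "e' = e" using a by (simp add: prod_eq_iff)
qed

lemma ub_atlas: "unit_bundle_atlas M g = ub.batlas"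
 by (simp add: unit_bundle_atlas_def ub.batlas_def ub.bchart_def comp_def)

lemma representative_ray: "\<exists>t>0. representative (ray q) = (fst q, scale_vec t (snd q))"
proof -
 have "(fst q, scale_vec 1 (snd q)) \<in> ray q" unfolding ray_def by (intro CollectI exI[of _ 1]) simp
 then have "representative (ray q) \<in> ray q" unfolding representative_def by (rule someI)
 then show ?thesis by (auto simp: ray_def)
qed

lemma ray_scale: "t > 0 ==> ray (p, scale_vec t v) = ray (p, v)"
proof -
 assume t: "t > 0"
 have "scale_vec s v = scale_vec (s / t * t) v" for s using t by simp
 then show ?thesis unfolding ray_def using t
  by (auto intro: exI[of _ "_ * t"]) (metis divide_pos_pos nonzero_eq_divide_eq order_less_irrefl)
qed

lemma ray_representative: "r \<in> circle_bundle M ==> ray (representative r) = r"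
proof -
 assume "r \<in> circle_bundle M"
 then obtain p v where r: "r = ray (p, v)" by (auto simp: circle_bundle_def)
 from representative_ray[of "(p, v)"] obtain t where "t > 0" "representative r = (p, scale_vec t v)" using r by auto
 then show ?thesis using ray_scale r by simp
qed

sublocale cb: direction_bundle M "circle_bundle M" representative
proof
 fix e assume "e \<in> circle_bundle M"
 then obtain p v where e: "e = ray (p, v)" "p \<in> points M" "v \<in> tangent_space M p" "v ~= zero_vec" by (auto simp: circle_bundle_def)
 from representative_ray[of "(p, v)"] obtain t where "t > 0" "representative e = (p, scale_vec t v)" using e(1) by auto
 then show "fst (representative e) \<in> points M" "snd (representative e) \<in> tangent_space M (fst (representative e))" "snd (representative e) ~= zero_vec"
  using e by (auto simp: scale_vec_tangent scale_vec_zero_iff)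
next
 fix p v assume pv: "p \<in> points M" "v \<in> tangent_space M p" "v ~= zero_vec"
 then show "\<exists>e\<in>circle_bundle M. \<exists>t>0. representative e = (p, scale_vec t v)"
  using representative_ray[of "(p, v)"] by (intro bexI[of _ "ray (p, v)"]) (auto simp: circle_bundle_def)
next
 fix e e' t assume a: "e \<in> circle_bundle M" "e' \<in> circle_bundle M" "fst (representative e') = fst (representative e)"
  "(t::real) > 0" "snd (representative e') = scale_vec t (snd (representative e))"
 have "representative e' = (fst (representative e), scale_vec t (snd (representative e)))" using a by (simp add: prod_eq_iff)
 then have "ray (representative e') = ray (representative e)"
  using ray_scale[OF a(4), of "fst (representative e)" "snd (representative e)"] by simp
 then show "e' = e" using ray_representative a by simp
qed

lemma cb_atlas: "circle_bundle_atlas M = cb.batlas"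
 by (simp add: circle_bundle_atlas_def cb.batlas_def cb.bchart_def)

lemma cb_footpoint: "footpoint = fst \<circ> representative"
 by (auto simp: footpoint_def)

lemma ub_param:
 assumes "c \<in> M" "norm n = 1" "x \<in> snd c ` fst c"
 shows "param (ub.bchart c n) (x, s) =
  (param c x, vec_at M c (param c x) ((1 / sqrt (slope_vec n s \<bullet> (Gm c x *v slope_vec n s))) *\<^sub>R slope_vec n s))"
proof -
 obtain t where t: "t > 0" "ub.bparam c n (x, s) \<in> unit_bundle M g" "fst (ub.bparam c n (x, s)) = param c x"
  "snd (ub.bparam c n (x, s)) = scale_vec t (vec_at M c (param c x) (slope_vec n s))"
  using ub.bparam_rep[OF assms, of s] by blast
 have c: "chart_at M (param c x) c" and x: "snd c (param c x) = x" using snd_param[OF assms(3)] assms(1) by (auto simp: chart_at_def)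
 let ?w = "slope_vec n s"
 have w: "?w ~= 0" using slope_vec_inner[OF assms(2), of s] by auto
 have q: "?w \<bullet> (Gm c x *v ?w) > 0" using Gm_pos_def[OF c] w x by (simp add: pos_def_def)
 have "t\<^sup>2 * (?w \<bullet> (Gm c x *v ?w)) = 1"
  using t metric_scale[OF chart_at_points[OF c] vec_at_tangent[OF c], of t ?w]
   metric_in_chart[OF c vec_at_tangent[OF c] vec_at_tangent[OF c], of ?w ?w] c x
  by (auto simp: unit_bundle_def)
 then have "(t * sqrt (?w \<bullet> (Gm c x *v ?w)))\<^sup>2 = 1\<^sup>2" using q by (simp add: power_mult_distrib)
 then have "t * sqrt (?w \<bullet> (Gm c x *v ?w)) = 1" by (rule power2_eq_imp_eq) (use t q in simp_all)
 then have "t = 1 / sqrt (?w \<bullet> (Gm c x *v ?w))" using q by (simp add: field_simps)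
 moreover have "scale_vec t (vec_at M c (param c x) ?w) = vec_at M c (param c x) (t *\<^sub>R ?w)"
  by (rule tangent_eqI[OF scale_vec_tangent[OF vec_at_tangent[OF c]] vec_at_tangent[OF c] c]) (simp add: c scale_vec_def)
 ultimately show ?thesis
  using t ub.bchart_param[OF assms, of s] by (simp add: prod_eq_iff)
qed

lemma unit_bundle_chart:
 assumes "q \<in> unit_bundle M g" "chart_at M (fst q) c"
 shows "snd q c \<bullet> (Gm c (snd c (fst q)) *v snd q c) = 1" "snd q c ~= 0"
proof -
 show 1: "snd q c \<bullet> (Gm c (snd c (fst q)) *v snd q c) = 1"
  using metric_in_chart[OF assms(2) ub.rep_tangent ub.rep_tangent] assms by (auto simp: unit_bundle_def)
 then show "snd q c ~= 0" by auto
qed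

subsection \<open>The geodesic vector field, the rotation field and the thermostat\<close>

text \<open>
 The velocity of a curve of unit vectors which moves along \<open>y\<close> with zero covariant acceleration
 to first order; normalizing the vectors does not change the first order.
\<close>

lemma geodesic_curve:
 assumes q: "q \<in> unit_bundle M g" and c: "chart_at M (fst q) c"
 defines "y \<equiv> snd q c" and "x0 \<equiv> snd c (fst q)"
 obtains I \<gamma> Y where "open I" "0 \<in> I" "\<gamma> 0 = q" "Y 0 = y"
  "!!s. s \<in> I ==> \<gamma> s \<in> unit_bundle M g \<and> fst (\<gamma> s) \<in> fst c"
  "!!s. s \<in> I ==> snd (\<gamma> s) c = Y s"
  "((%s. snd c (fst (\<gamma> s))) has_vector_derivative y) (at 0)"
  "(Y has_vector_derivative - \<Gamma> c x0 y y) (at 0)"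
proof -
 note cM = chart_atD(1)[OF c]
 interpret pm: plane_metric "snd c ` fst c" "Gm c" by (rule plane_metric_full[OF cM])
 have x0: "x0 \<in> snd c ` fst c" using chart_atD[OF c] by (simp add: x0_def)
 define x where "x s = x0 + s *\<^sub>R y" for s
 define Z where "Z s = y + s *\<^sub>R (- \<Gamma> c x0 y y)" for s
 define N where "N s = Z s \<bullet> (Gm c (x s) *v Z s)" for s
 define Y where "Y s = (1 / sqrt (N s)) *\<^sub>R Z s" for s
 define I where "I = x -` (snd c ` fst c) \<inter> Z -` (- {0})"
 define \<gamma> where "\<gamma> s = (param c (x s), vec_at M c (param c (x s)) (Y s))" for s
 have xd: "(x has_vector_derivative y) (at 0)" and Zd: "(Z has_vector_derivative - \<Gamma> c x0 y y) (at 0)"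
  unfolding x_def Z_def by (auto intro!: derivative_eq_intros)
 have "continuous_on UNIV x" "continuous_on UNIV Z" unfolding x_def Z_def by (intro continuous_intros)+
 then have oI: "open I" unfolding I_def
  by (intro open_Int open_vimage pm.dom_open) auto
 have y1: "y \<bullet> (Gm c x0 *v y) = 1" and y0: "y ~= 0" using unit_bundle_chart[OF q c] by (simp_all add: y_def x0_def)
 have 0: "x 0 = x0" "Z 0 = y" "N 0 = 1" "Y 0 = y" using y1 by (simp_all add: x_def Z_def N_def Y_def)
 have I0: "0 \<in> I" using x0 y0 0 by (simp add: I_def)
 have "(Gm c has_derivative fderiv (Gm c) (at x0)) (at (x 0))" using pm.metric_has_derivative[OF x0] 0 by simp
 from has_vector_derivative_chain[OF xd this]
 have Gd: "((%s. Gm c (x s)) has_vector_derivative fderiv (Gm c) (at x0) y) (at 0)" .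
 have "(N has_vector_derivative (Z 0 \<bullet> (Gm c (x 0) *v (- \<Gamma> c x0 y y) + fderiv (Gm c) (at x0) y *v Z 0)
   + (- \<Gamma> c x0 y y) \<bullet> (Gm c (x 0) *v Z 0))) (at 0)"
  unfolding N_def
  by (rule bounded_bilinear.has_vector_derivative[OF bounded_bilinear_inner Zd
    bounded_bilinear.has_vector_derivative[OF bounded_bilinear_matrix_vector_mult Gd Zd]])
 moreover have "(Z 0 \<bullet> (Gm c (x 0) *v (- \<Gamma> c x0 y y) + fderiv (Gm c) (at x0) y *v Z 0)
   + (- \<Gamma> c x0 y y) \<bullet> (Gm c (x 0) *v Z 0)) = 0"
 proof -
  have s: "\<Gamma> c x0 y y \<bullet> (Gm c x0 *v y) = y \<bullet> (Gm c x0 *v \<Gamma> c x0 y y)"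
   by (rule pos_def_sym[OF pm.metric_pos_def[OF x0]])
  have m: "Gm c x0 *v (- u) = - (Gm c x0 *v u)" for u by (simp add: mv2 real2_eq_iff)
  show ?thesis using pm.christoffel_of_char[OF x0, of y y y] s by (simp add: 0 m inner_add_right inner_diff_right)
 qed
 ultimately have Nd: "(N has_real_derivative 0) (at 0)"
  by (simp add: has_real_derivative_iff_has_vector_derivative)
 have "((%s. 1 / sqrt (N s)) has_real_derivative 0) (at 0)"
  using Nd 0 by (auto intro!: derivative_eq_intros)
 then have "(Y has_vector_derivative ((1 / sqrt (N 0)) *\<^sub>R (- \<Gamma> c x0 y y) + 0 *\<^sub>R Z 0)) (at 0)"
  unfolding Y_def by (rule has_vector_derivative_scaleR[OF _ Zd])
 then have Yd: "(Y has_vector_derivative - \<Gamma> c x0 y y) (at 0)" using 0 by simp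
 have I: "snd c (param c (x s)) = x s" "chart_at M (param c (x s)) c" "Z s ~= 0" if "s \<in> I" for s
  using that snd_param[of "x s" c "fst c"] cM by (auto simp: I_def chart_at_def)
 have E: "\<gamma> s \<in> unit_bundle M g" if "s \<in> I" for s
 proof -
  have "N s > 0" using Gm_pos_def[OF I(2)[OF that]] I[OF that] by (simp add: N_def pos_def_def)
  then have "Y s \<bullet> (Gm c (x s) *v Y s) = 1"
   by (simp add: Y_def matrix_vector_mult_scaleR N_def[symmetric])
  then show ?thesis
   using metric_in_chart[OF I(2)[OF that] vec_at_tangent[OF I(2)[OF that]] vec_at_tangent[OF I(2)[OF that]], of "Y s" "Y s"]
    I[OF that] chart_at_points[OF I(2)[OF that]] vec_at_tangent[OF I(2)[OF that]]
   by (simp add: unit_bundle_def \<gamma>_def)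
 qed
 have xI: "((%s. snd c (fst (\<gamma> s))) has_vector_derivative y) (at 0)"
  by (rule has_vector_derivative_transform_open[OF xd oI I0]) (simp add: \<gamma>_def I)
 have "\<gamma> 0 = q"
  using vec_at_tangent_apply[OF ub.rep_tangent[OF q] c] chart_atD[OF c] by (simp add: \<gamma>_def 0) (simp add: x0_def y_def)
 then show thesis
  using that[OF oI I0 _ 0(4) _ _ xI Yd] E I by (auto simp: \<gamma>_def chart_at_def)
qed

lemma phase_coords_differentiable:
 assumes "q \<in> unit_bundle M g" "chart_at M (fst q) c" "chart_at ub.batlas q (ub.bchart c n)" "norm n = 1" "chart_at M (fst q) d"
 shows "((%q'. (snd d (fst q'), snd q' d)) \<circ> param (ub.bchart c n)) differentiable (at (snd (ub.bchart c n) q))"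
proof -
 let ?S = "snd c ` (fst c \<inter> fst d) \<times> (UNIV :: real set)"
 note c = chart_atD[OF assms(2)] and d = chart_atD[OF assms(5)]
 have o: "open ?S" using overlap_open[OF c(1) d(1)] by (simp add: open_Times)
 have pos: "slope_vec n (snd z) \<bullet> (Gm c (fst z) *v slope_vec n (snd z)) > 0" if z: "z \<in> ?S" for z
 proof -
  obtain p where p: "p \<in> fst c" "fst z = snd c p" using z by (auto simp: mem_Times_iff)
  then have "pos_def (Gm c (fst z))" using Gm_pos_def[of p c] c(1) by (simp add: chart_at_def)
  moreover have "slope_vec n (snd z) ~= 0" using slope_vec_inner[OF assms(4), of "snd z"] by auto
  ultimately show ?thesis by (simp add: pos_def_def)
 qed
 have sf: "smooth_on ?S fst" using smooth_on_fst[OF o smooth_on_id[OF o]] by simp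
 have "smooth_on ?S (%z. (transition c d (fst z), fderiv (transition c d) (at (fst z))
  ((1 / sqrt (slope_vec n (snd z) \<bullet> (Gm c (fst z) *v slope_vec n (snd z)))) *\<^sub>R slope_vec n (snd z))))"
  (is "smooth_on _ ?f")
 proof (intro smooth_on_Pair o)
  show "smooth_on ?S (%z. transition c d (fst z))"
   by (rule smooth_on_compose[OF o overlap_open[OF c(1) d(1)] transition_smooth[OF c(1) d(1)] sf]) auto
  show "smooth_on ?S (%z. fderiv (transition c d) (at (fst z))
   ((1 / sqrt (slope_vec n (snd z) \<bullet> (Gm c (fst z) *v slope_vec n (snd z)))) *\<^sub>R slope_vec n (snd z)))"
  proof (rule smooth_on_frechet_derivative[OF o overlap_open[OF c(1) d(1)] transition_smooth[OF c(1) d(1)] sf])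
   have "smooth_on ?S (%z. Gm c (fst z))"
    by (rule smooth_on_compose[OF o overlap_open[OF c(1) d(1)] plane_metric.metric_smooth[OF plane_metric_chart] sf])
     (use c d overlap_open in auto)
   then show "smooth_on ?S (%z. (1 / sqrt (slope_vec n (snd z) \<bullet> (Gm c (fst z) *v slope_vec n (snd z)))) *\<^sub>R slope_vec n (snd z))"
    using pos by (intro smooth_intros o) (auto simp: less_imp_neq[symmetric])
  qed auto
 qed
 moreover have zS: "snd (ub.bchart c n) q \<in> ?S" using assms by (auto simp: ub.bchart_coords chart_at_def)
 ultimately have df: "?f differentiable (at (snd (ub.bchart c n) q))" by (rule smooth_on_differentiable)
 have eq: "?f z = ((%q'. (snd d (fst q'), snd q' d)) \<circ> param (ub.bchart c n)) z" if "z \<in> ?S" for z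
 proof -
  have x: "fst z \<in> snd c ` fst c" using that by (auto simp: mem_Times_iff)
  have p: "chart_at M (param c (fst z)) d" "snd c (param c (fst z)) = fst z"
   using that c d by (auto simp: chart_at_def mem_Times_iff)
  show ?thesis using ub_param[OF c(1) assms(4) x, of "snd z"] p by (simp add: vec_at_apply transition_def)
 qed
 show ?thesis by (rule differentiable_cong[OF o zS eq, THEN iffD1, OF _ df])
qed

lemma geodesic_field:
 assumes q: "q \<in> unit_bundle M g" and c: "chart_at M (fst q) c"
 shows "geodesic_field M g q \<in> tangent_space ub.batlas q"
  and "norm n = 1 ==> chart_at ub.batlas q (ub.bchart c n) ==>
   geodesic_field M g q (ub.bchart c n) = (snd q c, - cross2 (snd q c) (\<Gamma> c (snd c (fst q)) (snd q c) (snd q c)) / (n \<bullet> snd q c)\<^sup>2)"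
proof -
 define y x0 where "y = snd q c" and "x0 = snd c (fst q)"
 note cM = chart_atD[OF c]
 obtain I \<gamma> Y where \<gamma>: "open I" "0 \<in> I" "\<gamma> 0 = q" "Y 0 = y"
  "!!s. s \<in> I ==> \<gamma> s \<in> unit_bundle M g \<and> fst (\<gamma> s) \<in> fst c"
  "!!s. s \<in> I ==> snd (\<gamma> s) c = Y s"
  "((%s. snd c (fst (\<gamma> s))) has_vector_derivative y) (at 0)"
  "(Y has_vector_derivative - \<Gamma> c x0 y y) (at 0)"
  by (rule geodesic_curve[OF q c, folded y_def x0_def], rule that)
 define \<xi> where "\<xi> = velocity ub.batlas \<gamma> 0"
 have k: "\<exists>k. k > 0 \<and> snd (\<gamma> s) c = k *\<^sub>R Y s" if "s \<in> I" for s
  using \<gamma>(6)[OF that] by (intro exI[of _ 1]) simp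
 note bv = ub.bundle_velocity[of I 0 \<gamma> c, OF \<gamma>(1,2,5) cM(1) k \<gamma>(7,8)]
 have \<xi>: "\<xi> \<in> tangent_space ub.batlas q" using bv(1) \<gamma>(3) by (simp add: \<xi>_def)
 have \<xi>c: "\<xi> (ub.bchart c n) = (y, - cross2 y (\<Gamma> c x0 y y) / (n \<bullet> y)\<^sup>2)"
  if "norm n = 1" "chart_at ub.batlas q (ub.bchart c n)" for n
  using bv(2)[of n] that \<gamma>(3,4) by (simp add: \<xi>_def cross2_def)
 obtain n0 where n0: "norm n0 = 1" "chart_at ub.batlas q (ub.bchart c n0)" using ub.bchart_exists[of q c] q c by auto
 let ?f = "%d q'. (snd d (fst q'), snd q' d)"
 have phase: "deriv_along ub.batlas (?f d) q \<xi> = (snd q d, - \<Gamma> d (snd d (fst q)) (snd q d) (snd q d))"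
  if d: "chart_at M (fst q) d" for d
 proof -
  let ?T = "%x. fderiv (transition c d) (at x)"
  have qd: "snd q d = ?T x0 y" using tangent_transition[OF ub.rep_tangent[OF q] c d] by (simp add: x0_def y_def)
  obtain J where J: "open J" "0 \<in> J" "J \<subseteq> I" "!!s. s \<in> J ==> \<gamma> s \<in> fst (ub.bchart c n0)"
   using bv(3)[of n0] n0 \<gamma>(3) by metis
  have x0: "x0 \<in> snd c ` (fst c \<inter> fst d)" using c d by (auto simp: x0_def chart_at_def)
  have xc: "((%s. snd c (fst (\<gamma> s))) \<longlongrightarrow> x0) (at 0)"
   using has_vector_derivative_continuous[OF \<gamma>(7)] \<gamma>(3) by (simp add: isCont_def x0_def)
  obtain K where K: "open K" "0 \<in> K" "!!s. s \<in> K ==> s ~= 0 ==> snd c (fst (\<gamma> s)) \<in> snd c ` (fst c \<inter> fst d)"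
   using topological_tendstoD[OF xc overlap_open[OF cM(1) chart_atD(1)[OF d]] x0] unfolding eventually_at_topological by auto
  have fd: "fst (\<gamma> s) \<in> fst d" if "s \<in> I \<inter> K" for s
  proof (cases "s = 0")
   case False
   then have "snd c (fst (\<gamma> s)) \<in> snd c ` (fst c \<inter> fst d)" using K(3) that by auto
   then show ?thesis using \<gamma>(5)[of s] that chart_inj[OF cM(1)] by (auto dest: inj_onD)
  qed (use \<gamma>(3) d in \<open>simp add: chart_at_def\<close>)
  have dom: "open (I \<inter> K)" "0 \<in> I \<inter> K" using \<gamma>(1,2) K by auto
  have x0': "snd c (fst (\<gamma> 0)) = x0" using \<gamma>(3) by (simp add: x0_def)
  have d1: "((%s. transition c d (snd c (fst (\<gamma> s)))) has_vector_derivative ?T x0 y) (at 0)"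
   by (rule has_vector_derivative_chain[OF \<gamma>(7)]) (use transition_has_derivative[OF c d] x0' in \<open>simp add: x0_def\<close>)
  have d2: "((%s. ?T (snd c (fst (\<gamma> s))) (Y s)) has_vector_derivative (D2 (transition c d) x0 y y + ?T x0 (- \<Gamma> c x0 y y))) (at 0)"
   using frechet_apply_has_vector_derivative[OF overlap_open[OF cM(1) chart_atD(1)[OF d]] transition_smooth[OF cM(1) chart_atD(1)[OF d]] _ \<gamma>(7,8)]
   x0 x0' \<gamma>(4) by simp
  have "((%s. ?f d (\<gamma> s)) has_vector_derivative (?T x0 y, D2 (transition c d) x0 y y + ?T x0 (- \<Gamma> c x0 y y))) (at 0)"
  proof (rule has_vector_derivative_transform_open[OF has_vector_derivative_Pair[OF d1 d2] dom])
   fix s assume s: "s \<in> I \<inter> K"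
   then have at: "chart_at M (fst (\<gamma> s)) c" "chart_at M (fst (\<gamma> s)) d" using \<gamma>(5) fd cM chart_atD[OF d] by (auto simp: chart_at_def)
   show "(transition c d (snd c (fst (\<gamma> s))), ?T (snd c (fst (\<gamma> s))) (Y s)) = ?f d (\<gamma> s)"
    using tangent_transition[OF ub.rep_tangent at] \<gamma>(5,6)[of s] s at by (simp add: transition_snd chart_atD)
  qed
  moreover have "D2 (transition c d) x0 y y + ?T x0 (- \<Gamma> c x0 y y) = - \<Gamma> d (snd d (fst q)) (snd q d) (snd q d)"
   using christoffel_transition[OF c d, of y y] linear_neg[OF transition_linear[OF c d]] qd by (simp add: x0_def)
  ultimately have fd': "((%s. ?f d (\<gamma> s)) has_vector_derivative (snd q d, - \<Gamma> d (snd d (fst q)) (snd q d) (snd q d))) (at 0)"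
   using qd by simp
  show ?thesis
   unfolding \<xi>_def \<gamma>(3)[symmetric]
  proof (rule ub.dirs.deriv_along_velocity[OF _ J(1,2,4)])
   show "chart_at ub.batlas (\<gamma> 0) (ub.bchart c n0)" using n0 \<gamma>(3) by simp
   show "((%s. snd (ub.bchart c n0) (\<gamma> s)) has_vector_derivative (y, cross2 (Y 0) (- \<Gamma> c x0 y y) / (n0 \<bullet> Y 0)\<^sup>2)) (at 0)"
    by (rule ub.bchart_curve_derivative[OF \<gamma>(1,2) n0(1) _ k \<gamma>(7,8)])
     (use n0 ub.bchart_at_iff[OF cM(1) n0(1)] \<gamma>(4) in \<open>auto simp: y_def\<close>)
   show "?f d \<circ> param (ub.bchart c n0) differentiable at (snd (ub.bchart c n0) (\<gamma> 0))"
    using phase_coords_differentiable[OF q c n0(2,1) d] \<gamma>(3) by simp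
  qed (assumption | rule fd'[folded \<gamma>(3)])+
 qed
 have "geodesic_field M g q = \<xi>"
  unfolding geodesic_field_def ub_atlas christoffel_eq
 proof (rule the_equality, intro conjI allI impI \<xi> phase)
  fix \<eta> assume h: "\<eta> \<in> tangent_space ub.batlas q \<and> (\<forall>c. chart_at M (fst q) c -->
    deriv_along ub.batlas (?f c) q \<eta> = (snd q c, - \<Gamma> c (snd c (fst q)) (snd q c) (snd q c)))"
  have \<eta>: "\<eta> \<in> tangent_space ub.batlas q" "deriv_along ub.batlas (?f c) q \<eta> = deriv_along ub.batlas (?f c) q \<xi>"
   using conjunct1[OF h] conjunct2[OF h, rule_format, OF c] phase[OF c] by simp_all
  obtain D where D: "(?f c \<circ> param (ub.bchart c n0) has_derivative D) (at (snd (ub.bchart c n0) q))"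
   using phase_coords_differentiable[OF q c n0(2,1) c] differentiable_def by blast
  let ?\<Phi> = "%z. (fst z, slope n0 (snd z))" and ?z = "(?f c \<circ> param (ub.bchart c n0)) (snd (ub.bchart c n0) q)"
  have zq: "?z = (snd c (fst q), snd q c)" using ub.dirs.param_snd n0(2) by (simp add: chart_at_def)
  have "?\<Phi> differentiable (at ?z)"
  proof (rule smooth_on_differentiable)
   have o: "open {z :: (real^2) \<times> (real^2). n0 \<bullet> snd z > 0}" by (intro open_Collect_less continuous_intros)
   show "smooth_on {z :: (real^2) \<times> (real^2). n0 \<bullet> snd z > 0} ?\<Phi>" by (intro smooth_intros o) auto
   show "?z \<in> {z. n0 \<bullet> snd z > 0}" using n0 ub.bchart_at_iff[OF cM(1) n0(1)] zq by auto
  qed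
  then obtain D' where "(?\<Phi> has_derivative D') (at ?z)" using differentiable_def by blast
  from has_derivative_compose[OF D this]
  have h: "((%w. ?\<Phi> ((?f c \<circ> param (ub.bchart c n0)) w)) has_derivative (%v. D' (D v))) (at (snd (ub.bchart c n0) q))" .
  have "((%w. w) has_derivative (%v. D' (D v))) (at (snd (ub.bchart c n0) q))"
  proof (rule has_derivative_transform_within_open[OF h])
   show "open (snd (ub.bchart c n0) ` fst (ub.bchart c n0))" "snd (ub.bchart c n0) q \<in> snd (ub.bchart c n0) ` fst (ub.bchart c n0)"
    using ub.dirs.chart_open n0(2) by (auto simp: chart_at_def)
   fix w assume "w \<in> snd (ub.bchart c n0) ` fst (ub.bchart c n0)"
   from snd_param[OF this subset_refl] have "snd (ub.bchart c n0) (param (ub.bchart c n0) w) = w" ..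
   then show "?\<Phi> ((?f c \<circ> param (ub.bchart c n0)) w) = w" by (simp add: ub.bchart_coords)
  qed
  from fun_cong[OF has_derivative_unique[OF this has_derivative_ident]] have id: "D' (D v) = v" for v .
  have "D (\<eta> (ub.bchart c n0)) = D (\<xi> (ub.bchart c n0))"
   using \<eta>(2) ub.dirs.deriv_along_eq[OF \<eta>(1) n0(2) D] ub.dirs.deriv_along_eq[OF \<xi> n0(2) D] by simp
  then have "\<eta> (ub.bchart c n0) = \<xi> (ub.bchart c n0)" by (metis id)
  then show "\<eta> = \<xi>" by (rule ub.dirs.tangent_eqI[OF \<eta>(1) \<xi> n0(2)])
 qed
 then show "geodesic_field M g q \<in> tangent_space ub.batlas q"
  "norm n = 1 ==> chart_at ub.batlas q (ub.bchart c n) ==>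
   geodesic_field M g q (ub.bchart c n) = (snd q c, - cross2 (snd q c) (\<Gamma> c (snd c (fst q)) (snd q c) (snd q c)) / (n \<bullet> snd q c)\<^sup>2)"
  using \<xi> \<xi>c by (simp_all add: y_def x0_def)
qed

lemma rotation_field:
 assumes q: "q \<in> unit_bundle M g" and c: "chart_at M (fst q) c"
 shows "rotation_field M g q \<in> tangent_space ub.batlas q"
  and "norm n = 1 ==> chart_at ub.batlas q (ub.bchart c n) ==>
   rotation_field M g q (ub.bchart c n) = (0, 1 / sqrt (det (Gm c (snd c (fst q)))) / (n \<bullet> snd q c)\<^sup>2)"
proof -
 define y where "y = snd q c"
 define w where "w = rotation_of (Gm c (snd c (fst q))) y"
 define \<gamma> where "\<gamma> t = (fst q, lincomb (cos t) (snd q) (sin t) (rotate_J M g (fst q) (snd q)))" for t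
 define Y where "Y t = cos t *\<^sub>R y + sin t *\<^sub>R w" for t
 note pd = Gm_pos_def[OF c] and p = ub.rep_points[OF q] and v = ub.rep_tangent[OF q]
 note J = rotate_J[OF p v]
 have \<gamma>0: "\<gamma> 0 = q" by (simp add: \<gamma>_def lincomb_def)
 have Yt: "snd (\<gamma> t) c = Y t" for t
  using rotate_J_chart[OF v c] by (simp add: \<gamma>_def lincomb_def Y_def w_def y_def)
 have y1: "y \<bullet> (Gm c (snd c (fst q)) *v y) = 1" using unit_bundle_chart[OF q c] by (simp add: y_def)
 have w: "y \<bullet> (Gm c (snd c (fst q)) *v w) = 0" "w \<bullet> (Gm c (snd c (fst q)) *v w) = 1"
  "w \<bullet> (Gm c (snd c (fst q)) *v y) = 0" "cross2 y w = 1 / sqrt (det (Gm c (snd c (fst q))))"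
  using rotation_of[OF pd, of y] y1 pos_def_sym[OF pd, of w y] by (simp_all add: w_def)
 have E: "\<gamma> t \<in> unit_bundle M g" for t
 proof -
  have tv: "snd (\<gamma> t) \<in> tangent_space M (fst q)" unfolding \<gamma>_def using lincomb_tangent[OF v J(1)] by simp
  have "g (fst q) (snd (\<gamma> t)) (snd (\<gamma> t)) = Y t \<bullet> (Gm c (snd c (fst q)) *v Y t)"
   using metric_in_chart[OF c tv tv] Yt by simp
  also have "\<dots> = (cos t)\<^sup>2 + (sin t)\<^sup>2"
   by (simp add: Y_def matrix_vector_right_distrib matrix_vector_mult_scaleR inner_add_left inner_add_right w y1 power2_eq_square)
  finally show ?thesis using tv p by (simp add: unit_bundle_def \<gamma>_def)
 qed
 have Yd: "(Y has_vector_derivative w) (at 0)" unfolding Y_def by (auto intro!: derivative_eq_intros)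
 have xd: "((%t. snd c (fst (\<gamma> t))) has_vector_derivative 0) (at 0)" by (simp add: \<gamma>_def)
 have k: "\<exists>k. k > 0 \<and> snd (\<gamma> s) c = k *\<^sub>R Y s" for s using Yt[of s] by (intro exI[of _ 1]) simp
 note bv = ub.bundle_velocity[of UNIV 0 \<gamma> c, OF open_UNIV UNIV_I _ chart_atD(1)[OF c] k xd Yd]
 have r: "rotation_field M g q = velocity ub.batlas \<gamma> 0" unfolding rotation_field_def ub_atlas \<gamma>_def ..
 show "rotation_field M g q \<in> tangent_space ub.batlas q"
  using bv(1) E chart_atD[OF c] \<gamma>0 by (simp add: r) (simp add: \<gamma>_def)
 show "norm n = 1 ==> chart_at ub.batlas q (ub.bchart c n) ==>
   rotation_field M g q (ub.bchart c n) = (0, 1 / sqrt (det (Gm c (snd c (fst q)))) / (n \<bullet> snd q c)\<^sup>2)"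
  using bv(2)[of n] E chart_atD[OF c] \<gamma>0 w(4) by (simp add: r) (simp add: \<gamma>_def Y_def y_def)
qed

lemma thermostat:
 assumes q: "q \<in> unit_bundle M g" and c: "chart_at M (fst q) c"
 shows "thermostat M g a q \<in> tangent_space ub.batlas q"
  and "norm n = 1 ==> chart_at ub.batlas q (ub.bchart c n) ==>
   thermostat M g a q (ub.bchart c n) = (snd q c,
    (a q / sqrt (det (Gm c (snd c (fst q)))) - cross2 (snd q c) (\<Gamma> c (snd c (fst q)) (snd q c) (snd q c))) / (n \<bullet> snd q c)\<^sup>2)"
proof -
 show "thermostat M g a q \<in> tangent_space ub.batlas q"
  unfolding thermostat_def by (rule ub.dirs.lincomb_tangent[OF geodesic_field(1)[OF assms] rotation_field(1)[OF assms]])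
 show "norm n = 1 ==> chart_at ub.batlas q (ub.bchart c n) ==>
   thermostat M g a q (ub.bchart c n) = (snd q c,
    (a q / sqrt (det (Gm c (snd c (fst q)))) - cross2 (snd q c) (\<Gamma> c (snd c (fst q)) (snd q c) (snd q c))) / (n \<bullet> snd q c)\<^sup>2)"
  by (simp add: thermostat_def lincomb_def geodesic_field(2)[OF assms] rotation_field(2)[OF assms] diff_divide_distrib)
qed

lemma d_proj_geodesic_field:
 assumes q: "q \<in> unit_bundle M g"
 shows "d_proj M g q (geodesic_field M g q) = snd q"
proof -
 obtain c where c: "chart_at M (fst q) c" using chart_at_some[OF ub.rep_points[OF q]] by blast
 obtain n where n: "norm n = 1" "chart_at ub.batlas q (ub.bchart c n)" using ub.bchart_exists[of q c] q c by auto
 have f: "fst \<circ> (%q. q) = fst" by (simp add: comp_def)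
 note gf = geodesic_field(1)[OF q c]
 show ?thesis unfolding d_proj_def ub_atlas
  by (rule tangent_eqI[OF ub.differential_footpoint_tangent[OF gf q, unfolded f] ub.rep_tangent[OF q] c])
   (use ub.differential_footpoint[OF gf n(2) chart_atD(1)[OF c] n(1), unfolded f] geodesic_field(2)[OF q c n] in simp)
qed

lemma corresponding_function_eq:
 assumes "corresponding_function M g m A a" "q \<in> unit_bundle M g"
 shows "a q = Im (A (fst q) (snd q))"
proof -
 obtain c where c: "chart_at M (fst q) c" using chart_at_some[OF ub.rep_points[OF assms(2)]] by blast
 have p: "d_proj M g q (geodesic_field M g q) = snd q" by (rule d_proj_geodesic_field[OF assms(2)])
 note J = rotate_J[OF ub.rep_points[OF assms(2)] ub.rep_tangent[OF assms(2)]]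
 have "omega1 M g q (geodesic_field M g q) = 1" "omega2 M g q (geodesic_field M g q) = 0"
  unfolding omega1_def omega2_def p using J assms(2) by (auto simp: unit_bundle_def)
 moreover have "geodesic_field M g q \<in> tangent_space (unit_bundle_atlas M g) q"
  using geodesic_field(1)[OF assms(2) c] ub_atlas by simp
 ultimately have "A (fst q) (snd q) = Complex (V_derivative M g a q / real m) (a q) * Complex 1 0 ^ m"
  using assms p unfolding corresponding_function_def by metis
 then show ?thesis by (simp add: complex_eq_iff one_complex.code[symmetric])
qed

end

section \<open>Paths of the thermostat\<close>

context direction_bundle begin

lemma bchart_transition:
 assumes "c \<in> M" "norm n = 1" "d \<in> M" "norm k = 1" "z \<in> boverlap c n d k"
 shows "transition (bchart c n) (bchart d k) z =
  (transition c d (fst z), slope k (fderiv (transition c d) (at (fst z)) (slope_vec n (snd z))))"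
proof -
 have z: "fst z \<in> snd c ` (fst c \<inter> fst d)" using assms(5) by (auto simp: boverlap_def)
 then have z': "fst z \<in> snd c ` fst c" by auto
 show ?thesis
  using bparam_other(2)[OF assms(1-4) z, of "snd z"] bchart_param[OF assms(1,2) z', of "snd z"]
  by (simp add: transition_def)
qed

end

context riemannian_surface begin

definition dray :: "'p tpoint \<Rightarrow> ('p tpoint, (real^2) \<times> real) tvec \<Rightarrow> 'p circle_tvec" where
 "dray q \<xi> = differential ub.batlas cb.batlas ray q \<xi>"

lemma ray_coords: "snd (cb.bchart c n) (ray q) = snd (ub.bchart c n) q"
proof -
 obtain t where "t > 0" "representative (ray q) = (fst q, scale_vec t (snd q))" using representative_ray by blast
 then show ?thesis by (simp add: cb.bchart_coords ub.bchart_coords scale_vec_def slope_scaleR)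
qed

lemma ray_circle: "q \<in> unit_bundle M g ==> ray q \<in> circle_bundle M"
 using ub.rep_points[of q] ub.rep_tangent[of q] ub.rep_nonzero[of q] unfolding circle_bundle_def
 by (metis (mono_tags, lifting) mem_Collect_eq prod.collapse)

lemma ray_bchart:
 assumes "q \<in> unit_bundle M g"
 shows "ray q \<in> fst (cb.bchart c n) \<longleftrightarrow> q \<in> fst (ub.bchart c n)"
proof -
 obtain t where "t > 0" "representative (ray q) = (fst q, scale_vec t (snd q))" using representative_ray by blast
 then show ?thesis using assms ray_circle[OF assms]
  by (simp add: cb.bchart_mem ub.bchart_mem scale_vec_def zero_less_mult_iff)
qed

lemma dray_bchart:
 assumes "q \<in> unit_bundle M g" "\<xi> \<in> tangent_space ub.batlas q" "c \<in> M" "norm n = 1" "q \<in> fst (ub.bchart c n)"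
 shows "dray q \<xi> (cb.bchart c n) = \<xi> (ub.bchart c n)"
proof -
 have "chart_at cb.batlas (ray q) (cb.bchart c n)" "chart_at ub.batlas q (ub.bchart c n)"
  using assms by (simp_all add: cb.bchart_at ub.bchart_at ray_bchart)
 moreover have "snd (cb.bchart c n) \<circ> ray = snd (ub.bchart c n)" by (rule ext) (simp add: ray_coords)
 ultimately show ?thesis
  unfolding dray_def differential_def using ub.dirs.deriv_along_chart[OF assms(2)] by simp
qed

lemma dray_tangent:
 assumes q: "q \<in> unit_bundle M g" and \<xi>: "\<xi> \<in> tangent_space ub.batlas q"
 shows "dray q \<xi> \<in> tangent_space cb.batlas (ray q)"
proof (rule cb.dirs.tangent_spaceI)
 show "dray q \<xi> C = 0" if "\<not> chart_at cb.batlas (ray q) C" for C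
  using that by (simp add: dray_def differential_def)
 fix C D assume C: "chart_at cb.batlas (ray q) C" and D: "chart_at cb.batlas (ray q) D"
 obtain c n where c: "c \<in> M" "norm n = 1" "C = cb.bchart c n" using C by (auto simp: chart_at_def elim!: cb.batlasE)
 obtain d k where d: "d \<in> M" "norm k = 1" "D = cb.bchart d k" using D by (auto simp: chart_at_def elim!: cb.batlasE)
 have qc: "q \<in> fst (ub.bchart c n)" "q \<in> fst (ub.bchart d k)"
  using C D c d ray_bchart[OF q] by (auto simp: chart_at_def)
 have at: "chart_at ub.batlas q (ub.bchart c n)" "chart_at ub.batlas q (ub.bchart d k)"
  using qc ub.bchart_at c d by auto
 have z: "snd (ub.bchart c n) q \<in> ub.boverlap c n d k"
  using ub.boverlap_eq[OF c(1,2) d(1,2)] qc by auto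
 have "fderiv (transition C D) (at (snd C (ray q))) =
  fderiv (transition (ub.bchart c n) (ub.bchart d k)) (at (snd (ub.bchart c n) q))"
  unfolding c(3) d(3) ray_coords
  by (rule frechet_derivative_cong[OF ub.boverlap_open[OF c(1) d(1)] z])
   (simp add: ub.bchart_transition[OF c(1,2) d(1,2)] cb.bchart_transition[OF c(1,2) d(1,2)])
 then show "dray q \<xi> D = fderiv (transition C D) (at (snd C (ray q))) (dray q \<xi> C)"
  using ub.dirs.tangent_transition[OF \<xi> at] dray_bchart[OF q \<xi> c(1,2) qc(1)] dray_bchart[OF q \<xi> d(1,2) qc(2)] c(3) d(3) by simp
qed

definition unit_rep :: "'p ray \<Rightarrow> 'p tpoint" where
 "unit_rep r = (fst (representative r),
  scale_vec (1 / sqrt (g (fst (representative r)) (snd (representative r)) (snd (representative r)))) (snd (representative r)))"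

lemma unit_rep:
 assumes "r \<in> circle_bundle M"
 shows "unit_rep r \<in> unit_bundle M g" "ray (unit_rep r) = r"
proof -
 note pv = cb.rep_points[OF assms] cb.rep_tangent[OF assms] cb.rep_nonzero[OF assms]
 show "unit_rep r \<in> unit_bundle M g" unfolding unit_rep_def by (rule normalize_unit[OF pv])
 show "ray (unit_rep r) = r"
  unfolding unit_rep_def
  using ray_scale[of _ "fst (representative r)" "snd (representative r)"] metric_pos[OF pv] ray_representative[OF assms] by simp
qed

lemma unit_rep_ray:
 assumes "q \<in> unit_bundle M g"
 shows "unit_rep (ray q) = q"
proof -
 note r = ray_circle[OF assms]
 have "representative (ray (unit_rep (ray q))) = representative (ray q)" using unit_rep(2)[OF r] by simp
 then obtain t s where "t > 0" "s > 0" "fst (unit_rep (ray q)) = fst q"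
  "scale_vec t (snd (unit_rep (ray q))) = scale_vec s (snd q)"
  using representative_ray[of q] representative_ray[of "unit_rep (ray q)"] by auto
 then have "snd (unit_rep (ray q)) = scale_vec (s / t) (snd q)"
  by (metis (no_types, opaque_lifting) divide_inverse mult.commute order_less_irrefl right_inverse scale_vec_one scale_vec_scale_vec)
 with \<open>fst (unit_rep (ray q)) = fst q\<close> show ?thesis
  using ub.rep_unique[OF assms unit_rep(1)[OF r], of "s / t"] \<open>t > 0\<close> \<open>s > 0\<close> by simp
qed

abbreviation "paths a \<equiv> thermostat_path_geometry M g (thermostat M g a)"

lemma paths_eq:
 assumes "r \<in> circle_bundle M"
 shows "paths a r = {scale_vec s (dray (unit_rep r) (thermostat M g a (unit_rep r))) | s. s > 0}"
proof -
 have uniq: "q = unit_rep r" if "q \<in> unit_bundle M g" "ray q = r" for q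
  using unit_rep_ray[OF that(1)] that(2) by simp
 have P: "paths a r = {scale_vec s (dray q (thermostat M g a q)) | s q. s > 0 \<and> q \<in> unit_bundle M g \<and> ray q = r}"
  by (simp only: thermostat_path_geometry_def ub_atlas cb_atlas dray_def)
 show ?thesis
 proof (intro equalityI subsetI)
  fix \<xi> assume "\<xi> \<in> paths a r"
  then obtain s q where "\<xi> = scale_vec s (dray q (thermostat M g a q))" "s > 0" "q \<in> unit_bundle M g" "ray q = r"
   unfolding P by blast
  with uniq[of q] show "\<xi> \<in> {scale_vec s (dray (unit_rep r) (thermostat M g a (unit_rep r))) | s. s > 0}" by blast
 next
  fix \<xi> assume "\<xi> \<in> {scale_vec s (dray (unit_rep r) (thermostat M g a (unit_rep r))) | s. s > 0}"
  with unit_rep[OF assms] show "\<xi> \<in> paths a r" unfolding P by blast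
 qed
qed

lemma dray_thermostat:
 assumes q: "q \<in> unit_bundle M g" and c: "c \<in> M" "norm n = 1" "q \<in> fst (ub.bchart c n)"
 shows "dray q (thermostat M g a q) \<in> tangent_space cb.batlas (ray q)"
  "dray q (thermostat M g a q) (cb.bchart c n) = (snd q c,
    (a q / sqrt (det (Gm c (snd c (fst q)))) - cross2 (snd q c) (\<Gamma> c (snd c (fst q)) (snd q c) (snd q c))) / (n \<bullet> snd q c)\<^sup>2)"
proof -
 have ca: "chart_at M (fst q) c" "chart_at ub.batlas q (ub.bchart c n)"
  using c ub.rep_points[OF q] by (auto simp: chart_at_def[of M] ub.bchart_mem ub.bchart_at)
 show "dray q (thermostat M g a q) \<in> tangent_space cb.batlas (ray q)"
  by (rule dray_tangent[OF q thermostat(1)[OF q ca(1)]])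
 show "dray q (thermostat M g a q) (cb.bchart c n) = (snd q c,
    (a q / sqrt (det (Gm c (snd c (fst q)))) - cross2 (snd q c) (\<Gamma> c (snd c (fst q)) (snd q c) (snd q c))) / (n \<bullet> snd q c)\<^sup>2)"
  using dray_bchart[OF q thermostat(1)[OF q ca(1)] c] thermostat(2)[OF q ca(1) c(2) ca(2)] by simp
qed

definition speed :: "('p, real^2) chart \<Rightarrow> real^2 \<Rightarrow> real^2 \<Rightarrow> real" where
 "speed c x y = sqrt (y \<bullet> (Gm c x *v y))"

text \<open>
 The equation of the paths in a chart: the covariant acceleration of a curve parametrized by arc
 length is \<open>a\<close> times the rotated velocity; taking the cross product with the velocity removes the
 dependence on the parametrization.
\<close>

definition path_equation :: "('p tpoint \<Rightarrow> real) \<Rightarrow> ('p, real^2) chart \<Rightarrow> 'p \<Rightarrow> real^2 \<Rightarrow> real^2 \<Rightarrow> bool" where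
 "path_equation a c p y z \<longleftrightarrow> y ~= 0 \<and> cross2 y (z + \<Gamma> c (snd c p) y y) =
  (speed c (snd c p) y)^3 * a (p, vec_at M c p ((1 / speed c (snd c p) y) *\<^sub>R y)) / sqrt (det (Gm c (snd c p)))"

lemma path_equation_scaled:
 assumes "q \<in> unit_bundle M g" "chart_at M (fst q) c" "\<nu> > 0"
 shows "path_equation a c (fst q) (\<nu> *\<^sub>R snd q c) z \<longleftrightarrow>
  cross2 (\<nu> *\<^sub>R snd q c) z = \<nu>^3 * (a q / sqrt (det (Gm c (snd c (fst q)))) - cross2 (snd q c) (\<Gamma> c (snd c (fst q)) (snd q c) (snd q c)))"
proof -
 interpret pm: plane_metric "snd c ` fst c" "Gm c" by (rule plane_metric_full[OF chart_atD(1)[OF assms(2)]])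
 have x: "snd c (fst q) \<in> snd c ` fst c" using assms(2) by (auto simp: chart_at_def)
 note u = unit_bundle_chart[OF assms(1,2)]
 have s: "speed c (snd c (fst q)) (\<nu> *\<^sub>R snd q c) = \<nu>"
  using u(1) assms(3) by (simp add: speed_def matrix_vector_mult_scaleR real_sqrt_mult)
 have v: "vec_at M c (fst q) (snd q c) = snd q" using vec_at_tangent_apply[OF ub.rep_tangent[OF assms(1)] assms(2)] .
 have "cross2 (\<nu> *\<^sub>R snd q c) (z + \<Gamma> c (snd c (fst q)) (\<nu> *\<^sub>R snd q c) (\<nu> *\<^sub>R snd q c)) =
  cross2 (\<nu> *\<^sub>R snd q c) z + \<nu>^3 * cross2 (snd q c) (\<Gamma> c (snd c (fst q)) (snd q c) (snd q c))"
  by (simp add: cross2_add cross2_scaleR pm.christoffel_of_scale1[OF x] pm.christoffel_of_scale2[OF x] power3_eq_cube)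
 then show ?thesis unfolding path_equation_def s using u assms(3) v by (auto simp: right_diff_distrib)
qed

text \<open>
 The velocity of the lift to the circle bundle is a positive multiple of the thermostat field.
 Comparing base components, the curve moves in the direction of the lift; comparing slope
 components gives the second order equation.
\<close>

lemma oriented_path_equation:
 assumes path: "oriented_path M (paths a) I \<kappa>" and t: "t \<in> I" and c: "chart_at M (\<kappa> t) c"
 obtains J where "open J" "t \<in> J" "J \<subseteq> I" "\<kappa> ` J \<subseteq> fst c" "smooth_on J (%s. snd c (\<kappa> s))"
  "path_equation a c (\<kappa> t) (vector_derivative (%s. snd c (\<kappa> s)) (at t))
   (vector_derivative (%s. vector_derivative (%s. snd c (\<kappa> s)) (at s)) (at t))"
proof -
 obtain \<gamma> where \<gamma>: "smooth_curve cb.batlas I \<gamma>" "!!t. t \<in> I ==> velocity cb.batlas \<gamma> t \<in> paths a (\<gamma> t)"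
  "!!t. t \<in> I ==> \<kappa> t = fst (representative (\<gamma> t))"
  using path unfolding oriented_path_def cb_atlas by (auto simp: footpoint_def)
 have E: "\<gamma> s \<in> circle_bundle M" if "s \<in> I" for s
  using \<gamma>(1) that cb.batlas_points unfolding smooth_curve_def by blast
 note cM = chart_atD[OF c]
 obtain n where n: "norm n = 1" "chart_at cb.batlas (\<gamma> t) (cb.bchart c n)"
  using cb.bchart_exists[OF E[OF t], of c] c \<gamma>(3)[OF t] by metis
 let ?C = "cb.bchart c n"
 define J where "J = I \<inter> \<gamma> -` fst ?C"
 note sc = cb.dirs.smooth_curve_velocity[OF \<gamma>(1), folded J_def]
 have J: "open J" "t \<in> J" "smooth_on J (%s. snd ?C (\<gamma> s))"
  using sc[OF t n(2)] unfolding J_def by auto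
 have at: "chart_at cb.batlas (\<gamma> s) ?C" if "s \<in> J" for s
  using that n cM by (auto simp: cb.bchart_at J_def)
 define x where "x s = snd c (\<kappa> s)" for s
 define \<sigma> where "\<sigma> s = slope n (snd (representative (\<gamma> s)) c)" for s
 have C: "snd ?C (\<gamma> s) = (x s, \<sigma> s)" if "s \<in> J" for s
  using that \<gamma>(3) by (simp add: J_def cb.bchart_coords x_def \<sigma>_def)
 have sm: "smooth_on J (%s. (x s, \<sigma> s))"
  using J(3) smooth_on_cong[OF J(1), of "%s. snd ?C (\<gamma> s)" "%s. (x s, \<sigma> s)"] C by simp
 have sx: "smooth_on J x" and s\<sigma>: "smooth_on J \<sigma>"
  using smooth_on_fst[OF J(1) sm] smooth_on_snd[OF J(1) sm] by simp_all
 define x' where "x' s = vector_derivative x (at s)" for s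
 define \<sigma>' where "\<sigma>' s = vector_derivative \<sigma> (at s)" for s
 have dx: "(x has_vector_derivative x' s) (at s)" and d\<sigma>: "(\<sigma> has_vector_derivative \<sigma>' s) (at s)" if "s \<in> J" for s
  unfolding x'_def \<sigma>'_def using smooth_on_has_vector_derivative[OF sx that] smooth_on_has_vector_derivative[OF s\<sigma> that] .
 have key: "\<exists>\<nu>>0. x' s = \<nu> *\<^sub>R snd (unit_rep (\<gamma> s)) c \<and> \<sigma>' s = \<nu> *
  ((a (unit_rep (\<gamma> s)) / sqrt (det (Gm c (x s))) - cross2 (snd (unit_rep (\<gamma> s)) c) (\<Gamma> c (x s) (snd (unit_rep (\<gamma> s)) c) (snd (unit_rep (\<gamma> s)) c))) / (n \<bullet> snd (unit_rep (\<gamma> s)) c)\<^sup>2) \<and>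
  \<sigma> s = slope n (x' s) \<and> n \<bullet> x' s > 0 \<and> unit_rep (\<gamma> s) \<in> unit_bundle M g \<and> fst (unit_rep (\<gamma> s)) = \<kappa> s" if s: "s \<in> J" for s
 proof -
  let ?q = "unit_rep (\<gamma> s)"
  have sI: "s \<in> I" using s by (simp add: J_def)
  note q = unit_rep[OF E[OF sI]]
  have qc: "?q \<in> fst (ub.bchart c n)" using ray_bchart[OF q(1)] q(2) s by (simp add: J_def)
  obtain \<nu> where l: "\<nu> > 0" "velocity cb.batlas \<gamma> s = scale_vec \<nu> (dray ?q (thermostat M g a ?q))"
   using \<gamma>(2)[OF sI] unfolding paths_eq[OF E[OF sI]] by blast
  have "velocity cb.batlas \<gamma> s ?C = vector_derivative (%s. snd ?C (\<gamma> s)) (at s)"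
   using at[OF s] by (simp add: velocity_def comp_def)
  moreover have "((%s. snd ?C (\<gamma> s)) has_vector_derivative (x' s, \<sigma>' s)) (at s)"
   by (rule has_vector_derivative_transform_open[OF has_vector_derivative_Pair[OF dx[OF s] d\<sigma>[OF s]] J(1) s]) (simp add: C)
  ultimately have "(x' s, \<sigma>' s) = scale_vec \<nu> (dray ?q (thermostat M g a ?q)) ?C"
   using l(2) vector_derivative_at by metis
  moreover have fq: "fst ?q = \<kappa> s" using \<gamma>(3)[OF sI] by (simp add: unit_rep_def)
  ultimately have 1: "x' s = \<nu> *\<^sub>R snd ?q c" "\<sigma>' s = \<nu> *
  ((a ?q / sqrt (det (Gm c (x s))) - cross2 (snd ?q c) (\<Gamma> c (x s) (snd ?q c) (snd ?q c))) / (n \<bullet> snd ?q c)\<^sup>2)"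
   using dray_thermostat(2)[OF q(1) cM(1) n(1) qc, of a] by (simp_all add: scale_vec_def x_def)
  have "\<sigma> s = slope n (snd ?q c)"
   using ray_coords[of c n ?q] q(2) C[OF s] by (simp add: ub.bchart_coords)
  moreover have "n \<bullet> snd ?q c > 0" using qc by (simp add: ub.bchart_mem)
  ultimately show ?thesis using 1 l(1) q(1) fq by (auto simp: slope_scaleR intro!: exI[of _ \<nu>])
 qed
 have sig: "slope n (x' s) = \<sigma> s" if "s \<in> J" for s using key[OF that] by force
 have sx': "smooth_on J x'" unfolding x'_def by (rule smooth_on_vector_derivative[OF J(1) sx])
 obtain \<nu> where l: "\<nu> > 0" "x' t = \<nu> *\<^sub>R snd (unit_rep (\<gamma> t)) c" "\<sigma>' t = \<nu> *
  ((a (unit_rep (\<gamma> t)) / sqrt (det (Gm c (x t))) - cross2 (snd (unit_rep (\<gamma> t)) c) (\<Gamma> c (x t) (snd (unit_rep (\<gamma> t)) c) (snd (unit_rep (\<gamma> t)) c))) / (n \<bullet> snd (unit_rep (\<gamma> t)) c)\<^sup>2)"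
  "n \<bullet> x' t > 0" "unit_rep (\<gamma> t) \<in> unit_bundle M g" "fst (unit_rep (\<gamma> t)) = \<kappa> t"
  using key[OF J(2)] by blast
 have np: "n \<bullet> snd (unit_rep (\<gamma> t)) c ~= 0" using l(4) unfolding l(2) by auto
 let ?x'' = "vector_derivative x' (at t)"
 have "(\<sigma> has_vector_derivative cross2 (x' t) ?x'' / (n \<bullet> x' t)\<^sup>2) (at t)"
  by (rule has_vector_derivative_transform_open[OF slope_has_vector_derivative[OF smooth_on_has_vector_derivative[OF sx' J(2)] n(1)] J(1,2)])
   (use l(4) sig in auto)
 then have "cross2 (x' t) ?x'' / (n \<bullet> x' t)\<^sup>2 = \<sigma>' t" using d\<sigma>[OF J(2)] vector_derivative_unique_at by blast
 then have "cross2 (x' t) ?x'' = (n \<bullet> x' t)\<^sup>2 * \<sigma>' t" using l(4) by (simp add: field_simps)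
 also have "\<dots> = \<nu>^3 * (a (unit_rep (\<gamma> t)) / sqrt (det (Gm c (x t))) - cross2 (snd (unit_rep (\<gamma> t)) c) (\<Gamma> c (x t) (snd (unit_rep (\<gamma> t)) c) (snd (unit_rep (\<gamma> t)) c)))"
  using l(1) np unfolding l(2,3) by (simp add: power3_eq_cube power2_eq_square)
 finally have "path_equation a c (\<kappa> t) (x' t) ?x''"
  using path_equation_scaled[OF l(5) _ l(1), of c a ?x''] c l(2,6) by (simp add: x_def)
 moreover have "\<kappa> ` J \<subseteq> fst c" using \<gamma>(3) at by (auto simp: J_def cb.bchart_mem)
 moreover have "J \<subseteq> I" by (simp add: J_def)
 ultimately show thesis
  using that[OF J(1,2)] sx unfolding x'_def[abs_def] x_def[abs_def] by blast
qed

text \<open>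
 The lift of the curve to the circle bundle consists of the rays through its velocities.
\<close>

lemma oriented_pathI:
 assumes \<kappa>: "smooth_curve M I \<kappa>"
  and eq: "!!t. t \<in> I ==> \<exists>c. chart_at M (\<kappa> t) c \<and> path_equation a c (\<kappa> t) (vector_derivative (%s. snd c (\<kappa> s)) (at t))
   (vector_derivative (%s. vector_derivative (%s. snd c (\<kappa> s)) (at s)) (at t))"
 shows "oriented_path M (paths a) I \<kappa>"
proof -
 define v where "v s = velocity M \<kappa> s" for s
 define \<gamma> where "\<gamma> s = ray (\<kappa> s, v s)" for s
 have vT: "v s \<in> tangent_space M (\<kappa> s)" "v s ~= zero_vec" "\<kappa> s \<in> points M" if "s \<in> I" for s
 proof -
  obtain c where c: "chart_at M (\<kappa> s) c" "vector_derivative (%s. snd c (\<kappa> s)) (at s) ~= 0"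
   using eq[OF \<open>s \<in> I\<close>] unfolding path_equation_def by blast
  note sc = smooth_curve_velocity(4)[OF \<kappa> that c(1)]
  show "v s \<in> tangent_space M (\<kappa> s)" unfolding v_def sc by (rule vec_at_tangent[OF c(1)])
  show "v s ~= zero_vec" unfolding v_def sc using tangent_zero_iff[OF vec_at_tangent[OF c(1)] c(1)] c by simp
  show "\<kappa> s \<in> points M" by (rule chart_at_points[OF c(1)])
 qed
 have rep: "\<exists>k>0. representative (\<gamma> s) = (\<kappa> s, scale_vec k (v s))" for s
  using representative_ray[of "(\<kappa> s, v s)"] by (simp add: \<gamma>_def)
 have E: "\<gamma> s \<in> circle_bundle M" if "s \<in> I" for s
  using vT[OF that] unfolding circle_bundle_def \<gamma>_def by blast
 have v: "v s c = vector_derivative (%s. snd c (\<kappa> s)) (at s)" if "chart_at M (\<kappa> s) c" for s c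
  using that by (simp add: v_def velocity_def comp_def)
 have pos: "n \<bullet> snd (representative (\<gamma> s)) c > 0 \<longleftrightarrow> n \<bullet> v s c > 0" and
  foot: "fst (representative (\<gamma> s)) = \<kappa> s" and
  sl: "slope n (snd (representative (\<gamma> s)) c) = slope n (v s c)" and
  pr: "\<exists>k. k > 0 \<and> snd (representative (\<gamma> s)) c = k *\<^sub>R v s c" for s n c
  using rep[of s] by (auto simp: scale_vec_def slope_scaleR zero_less_mult_iff)
 have cur: "open (I \<inter> \<gamma> -` fst (cb.bchart c n))" "smooth_on (I \<inter> \<gamma> -` fst (cb.bchart c n)) (snd (cb.bchart c n) \<circ> \<gamma>)"
  if "c \<in> M" "norm n = 1" for c n
 proof -
  define J where "J = I \<inter> \<kappa> -` fst c"
  have J: "open J" "smooth_on J (%s. snd c (\<kappa> s))" using \<kappa> that unfolding smooth_curve_def J_def by (auto simp: comp_def)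
  let ?x' = "%s. vector_derivative (%s. snd c (\<kappa> s)) (at s)"
  have sx': "smooth_on J ?x'" by (rule smooth_on_vector_derivative[OF J])
  have at: "chart_at M (\<kappa> s) c" if "s \<in> J" for s using that \<open>c \<in> M\<close> by (auto simp: J_def chart_at_def)
  have set: "I \<inter> \<gamma> -` fst (cb.bchart c n) = {s \<in> J. n \<bullet> ?x' s > 0}" (is "?L = ?R")
  proof (intro equalityI subsetI)
   fix s assume s: "s \<in> ?L"
   then have "s \<in> J" using foot by (auto simp: cb.bchart_mem J_def)
   then show "s \<in> ?R" using s v[OF at] pos by (auto simp: cb.bchart_mem)
  next
   fix s assume s: "s \<in> ?R"
   then show "s \<in> ?L" using v[OF at] pos[of n s c] foot[of s] E by (auto simp: cb.bchart_mem J_def)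
  qed
  have o: "open {s \<in> J. n \<bullet> ?x' s > 0}"
  proof -
   have "continuous_on J (%s. n \<bullet> ?x' s)" by (intro continuous_intros smooth_on_continuous_on[OF sx'])
   from continuous_open_preimage[OF this J(1) open_greaterThan[of 0]] show ?thesis by (simp add: Int_def vimage_def)
  qed
  show "open (I \<inter> \<gamma> -` fst (cb.bchart c n))" unfolding set by (rule o)
  have sub: "{s \<in> J. n \<bullet> ?x' s > 0} \<subseteq> J" by blast
  have "smooth_on {s \<in> J. n \<bullet> ?x' s > 0} (%s. (snd c (\<kappa> s), slope n (?x' s)))"
   by (intro smooth_intros o smooth_on_subset[OF J(2) sub] smooth_on_subset[OF sx' sub]) auto
  moreover have "(snd c (\<kappa> s), slope n (?x' s)) = (snd (cb.bchart c n) \<circ> \<gamma>) s" if "s \<in> {s \<in> J. n \<bullet> ?x' s > 0}" for s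
   using that v[OF at, of s] foot[of s] sl[of n s c] by (simp add: cb.bchart_coords)
  ultimately show "smooth_on (I \<inter> \<gamma> -` fst (cb.bchart c n)) (snd (cb.bchart c n) \<circ> \<gamma>)"
   unfolding set using smooth_on_cong[OF o] by (metis (no_types, lifting))
 qed
 have sc: "smooth_curve cb.batlas I \<gamma>"
  unfolding smooth_curve_def
 proof (intro conjI ballI)
  show "open_interval I" using \<kappa> by (simp add: smooth_curve_def)
  show "\<gamma> ` I \<subseteq> points cb.batlas" unfolding cb.batlas_points using E by blast
  fix C assume "C \<in> cb.batlas"
  then obtain c n where "c \<in> M" "norm n = 1" "C = cb.bchart c n" by (rule cb.batlasE)
  then show "open (I \<inter> \<gamma> -` fst C)" "smooth_on (I \<inter> \<gamma> -` fst C) (snd C \<circ> \<gamma>)" using cur by auto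
 qed
 have vel: "velocity cb.batlas \<gamma> t \<in> paths a (\<gamma> t)" if t: "t \<in> I" for t
 proof -
  obtain c where c: "chart_at M (\<kappa> t) c" "path_equation a c (\<kappa> t) (vector_derivative (%s. snd c (\<kappa> s)) (at t))
   (vector_derivative (%s. vector_derivative (%s. snd c (\<kappa> s)) (at s)) (at t))" using eq[OF t] by blast
  note cM = chart_atD[OF c(1)]
  note scv = smooth_curve_velocity[OF \<kappa> t c(1)]
  let ?x = "%s. snd c (\<kappa> s)"
  let ?x' = "%s. vector_derivative ?x (at s)"
  let ?x'' = "vector_derivative ?x' (at t)"
  let ?J = "I \<inter> \<kappa> -` fst c"
  obtain n where n: "norm n = 1" "chart_at cb.batlas (\<gamma> t) (cb.bchart c n)"
   using cb.bchart_exists[OF E[OF t], of c] c(1) foot[of t] by metis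
  let ?q = "unit_rep (\<gamma> t)"
  note q = unit_rep[OF E[OF t]]
  have fq: "fst ?q = \<kappa> t" using foot by (simp add: unit_rep_def)
  have qc: "?q \<in> fst (ub.bchart c n)" using ray_bchart[OF q(1)] q(2) n cM by (simp add: cb.bchart_at)
  obtain \<nu> where l: "\<nu> > 0" "?x' t = \<nu> *\<^sub>R snd ?q c"
  proof -
   obtain k where k: "k > 0" "representative (\<gamma> t) = (\<kappa> t, scale_vec k (v t))" using rep by blast
   obtain k' where k': "k' > 0" "representative (\<gamma> t) = (fst ?q, scale_vec k' (snd ?q))"
    using representative_ray[of ?q] q(2) by auto
   have "k *\<^sub>R v t c = k' *\<^sub>R snd ?q c" using k k' by (simp add: scale_vec_def fun_eq_iff del: split_paired_All)
   moreover have "v t c = (1 / k) *\<^sub>R (k *\<^sub>R v t c)" using k(1) by simp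
   ultimately have "v t c = (k' / k) *\<^sub>R snd ?q c" by simp
   then show thesis using that[of "k' / k"] k k' v[OF c(1)] by simp
  qed
  have k: "\<exists>k. k > 0 \<and> snd (representative (\<gamma> s)) c = k *\<^sub>R ?x' s" if "s \<in> ?J" for s
  proof -
   have "chart_at M (\<kappa> s) c" using that cM by (auto simp: chart_at_def)
   then show ?thesis using pr[of s c] v by simp
  qed
  have ef: "\<gamma> s \<in> circle_bundle M \<and> fst (representative (\<gamma> s)) \<in> fst c" if "s \<in> ?J" for s using that E foot by auto
  have x': "((%s. snd c (fst (representative (\<gamma> s)))) has_vector_derivative ?x' t) (at t)"
   using smooth_on_has_vector_derivative[OF scv(3,2)] by (simp add: foot)
  note bv = cb.bundle_velocity[of ?J t \<gamma> c, OF scv(1,2) ef cM(1) k x'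
   smooth_on_has_vector_derivative[OF smooth_on_vector_derivative[OF scv(1,3)] scv(2)]]
  have b1: "velocity cb.batlas \<gamma> t \<in> tangent_space cb.batlas (\<gamma> t)" by (rule bv(1))
  have b2: "velocity cb.batlas \<gamma> t (cb.bchart c n) = (?x' t, cross2 (?x' t) ?x'' / (n \<bullet> ?x' t)\<^sup>2)"
   by (rule bv(2)[OF _ _ n(2,1)])
  have nq: "n \<bullet> snd ?q c > 0" using qc by (simp add: ub.bchart_mem)
  have "cross2 (?x' t) ?x'' = \<nu>^3 * (a ?q / sqrt (det (Gm c (snd c (fst ?q)))) - cross2 (snd ?q c) (\<Gamma> c (snd c (fst ?q)) (snd ?q c) (snd ?q c)))"
   using path_equation_scaled[OF q(1) _ l(1), of c a ?x''] c l(2) fq by simp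
  then have "cross2 (?x' t) ?x'' / (n \<bullet> ?x' t)\<^sup>2 =
   \<nu> * ((a ?q / sqrt (det (Gm c (snd c (fst ?q)))) - cross2 (snd ?q c) (\<Gamma> c (snd c (fst ?q)) (snd ?q c) (snd ?q c))) / (n \<bullet> snd ?q c)\<^sup>2)"
   using l nq by (simp add: power3_eq_cube power2_eq_square)
  then have "velocity cb.batlas \<gamma> t (cb.bchart c n) = scale_vec \<nu> (dray ?q (thermostat M g a ?q)) (cb.bchart c n)"
   using b2 dray_thermostat(2)[OF q(1) cM(1) n(1) qc, of a] l(2) by (simp add: scale_vec_def)
  moreover have "dray ?q (thermostat M g a ?q) \<in> tangent_space cb.batlas (\<gamma> t)"
   using dray_thermostat(1)[OF q(1) cM(1) n(1) qc, of a] q(2) by simp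
  ultimately have "velocity cb.batlas \<gamma> t = scale_vec \<nu> (dray ?q (thermostat M g a ?q))"
   by (intro cb.dirs.tangent_eqI[OF b1 cb.dirs.scale_vec_tangent n(2)])
  then show ?thesis unfolding paths_eq[OF E[OF t]] using l(1) by blast
 qed
 show ?thesis
  unfolding oriented_path_def cb_atlas
  by (intro exI[of _ \<gamma>] conjI ballI sc vel) (simp_all add: footpoint_def foot)
qed

subsection \<open>The thermostat defines a path geometry\<close>

lemma path_geometry_thermostat:
 assumes a: "smooth_function ub.batlas a"
 shows "path_geometry M (paths a)"
proof -
 define Y where "Y r = dray (unit_rep r) (thermostat M g a (unit_rep r))" for r
 have qr: "\<exists>c n. c \<in> M \<and> norm n = 1 \<and> unit_rep r \<in> fst (ub.bchart c n)" if "r \<in> circle_bundle M" for r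
 proof -
  note q = unit_rep(1)[OF that]
  obtain c where c: "chart_at M (fst (unit_rep r)) c" using chart_at_some[OF ub.rep_points[OF q]] by blast
  from ub.bchart_exists[OF q c] obtain n where "norm n = 1" "chart_at ub.batlas (unit_rep r) (ub.bchart c n)" .
  then show ?thesis using chart_atD[OF c] ub.bchart_at by blast
 qed
 have YT: "Y r \<in> tangent_space cb.batlas r" if r: "r \<in> circle_bundle M" for r
  using qr[OF r] dray_thermostat(1)[OF unit_rep(1)[OF r]] unit_rep(2)[OF r] unfolding Y_def by metis
 have Yc: "Y r (cb.bchart c n) = (snd (unit_rep r) c,
    (a (unit_rep r) / sqrt (det (Gm c (snd c (fst (unit_rep r))))) - cross2 (snd (unit_rep r) c) (\<Gamma> c (snd c (fst (unit_rep r))) (snd (unit_rep r) c) (snd (unit_rep r) c))) / (n \<bullet> snd (unit_rep r) c)\<^sup>2)"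
  if "r \<in> circle_bundle M" "c \<in> M" "norm n = 1" "unit_rep r \<in> fst (ub.bchart c n)" for r c n
  using dray_thermostat(2)[OF unit_rep(1)[OF that(1)] that(2-4)] unfolding Y_def .
 have Y0: "Y r ~= zero_vec" if r: "r \<in> circle_bundle M" for r
 proof -
  obtain c n where c: "c \<in> M" "norm n = 1" "unit_rep r \<in> fst (ub.bchart c n)" using qr[OF r] by blast
  then have "n \<bullet> snd (unit_rep r) c > 0" by (simp add: ub.bchart_mem)
  then have "snd (unit_rep r) c ~= 0" by auto
  then show ?thesis using Yc[OF r c] by (auto simp: zero_vec_def zero_prod_def)
 qed
 have smY: "smooth_vector_field_on cb.batlas (circle_bundle M) Y"
  unfolding smooth_vector_field_on_def
 proof (intro conjI ballI YT)
  fix C assume "C \<in> cb.batlas"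
  then obtain c n where c: "c \<in> M" "norm n = 1" "C = cb.bchart c n" by (rule cb.batlasE)
  interpret pm: plane_metric "snd c ` fst c" "Gm c" by (rule plane_metric_full[OF c(1)])
  let ?S = "(snd c ` fst c) \<times> (UNIV :: real set)"
  have o: "open ?S" using pm.dom_open by (simp add: open_Times)
  have dom: "snd C ` (circle_bundle M \<inter> fst C) = ?S"
  proof -
   have "circle_bundle M \<inter> fst C = fst C" using c by (auto simp: cb.bchart_mem)
   then show ?thesis using cb.bchart_image[OF c(1,2)] c(3) by simp
  qed
  define y where "y z = (1 / sqrt (slope_vec n (snd z) \<bullet> (Gm c (fst z) *v slope_vec n (snd z)))) *\<^sub>R slope_vec n (snd z)" for z
  have sf: "smooth_on ?S fst" using smooth_on_fst[OF o smooth_on_id[OF o]] by simp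
  have sfs: "fst ` ?S \<subseteq> snd c ` fst c" by auto
  have sG: "smooth_on ?S (%z. Gm c (fst z))" by (rule smooth_on_compose[OF o pm.dom_open pm.metric_smooth sf sfs])
  have sv: "slope_vec n s ~= 0" for s using slope_vec_inner[OF c(2), of s] by auto
  have pos: "slope_vec n (snd z) \<bullet> (Gm c (fst z) *v slope_vec n (snd z)) > 0" if "z \<in> ?S" for z
   using pm.metric_pos_def[of "fst z"] sv that by (auto simp: pos_def_def mem_Times_iff)
  have sy: "smooth_on ?S y" unfolding y_def
   using pos by (intro smooth_intros o sG) (auto simp: less_imp_neq[symmetric])
  have ny: "n \<bullet> y z ~= 0" if "z \<in> ?S" for z using pos[OF that] slope_vec_inner[OF c(2)] by (simp add: y_def)
  have sa: "smooth_on ?S (%z. a (param (ub.bchart c n) z))"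
  proof -
   have "ub.bchart c n \<in> ub.batlas" using c unfolding ub.batlas_def by blast
   then have "smooth_on (snd (ub.bchart c n) ` fst (ub.bchart c n)) (a \<circ> param (ub.bchart c n))"
    using a unfolding smooth_function_def by blast
   then show ?thesis using ub.bchart_image[OF c(1,2)] by (simp add: comp_def)
  qed
  have dpos: "det (Gm c (fst z)) > 0" if "z \<in> ?S" for z
   using pos_def_det[OF pm.metric_pos_def] that by (auto simp: mem_Times_iff)
  have "smooth_on ?S (%z. (y z, (a (param (ub.bchart c n) z) / sqrt (det (Gm c (fst z))) - cross2 (y z) (\<Gamma> c (fst z) (y z) (y z))) / (n \<bullet> y z)\<^sup>2))"
   unfolding cross2_def
   by (intro smooth_intros o sy sa pm.smooth_on_christoffel_apply sf sfs smooth_on_compose[OF o pm.dom_open pm.smooth_on_det_metric sf sfs])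
    (use ny dpos in \<open>force+\<close>)
  moreover have "(y z, (a (param (ub.bchart c n) z) / sqrt (det (Gm c (fst z))) - cross2 (y z) (\<Gamma> c (fst z) (y z) (y z))) / (n \<bullet> y z)\<^sup>2) = Y (param C z) C"
   if z: "z \<in> ?S" for z
  proof -
   have x: "fst z \<in> snd c ` fst c" using z by (simp add: mem_Times_iff)
   let ?q = "param (ub.bchart c n) z"
   have qeq: "?q = (param c (fst z), vec_at M c (param c (fst z)) (y z))"
    using ub_param[OF c(1,2) x, of "snd z"] by (simp add: y_def)
   have qm: "?q \<in> fst (ub.bchart c n)" "snd (ub.bchart c n) ?q = z"
    using ub.bparam[OF c(1,2) x, of "snd z"] ub.bchart_param[OF c(1,2) x, of "snd z"] by simp_all
   then have qE: "?q \<in> unit_bundle M g" by (simp add: ub.bchart_mem)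
   have "ray ?q \<in> fst C" using ray_bchart[OF qE] qm c by simp
   moreover have "snd C (ray ?q) = z" using ray_coords[of c n ?q] qm(2) c(3) by simp
   ultimately have rq: "param C z = ray ?q"
    using cb.dirs.param_snd[of C "ray ?q"] \<open>C \<in> cb.batlas\<close> by metis
   have cp: "chart_at M (param c (fst z)) c" "snd c (param c (fst z)) = fst z"
    using snd_param[OF x] c(1) by (auto simp: chart_at_def)
   have ur: "unit_rep (ray ?q) = ?q" by (rule unit_rep_ray[OF qE])
   show ?thesis
    unfolding rq unfolding c(3)
    using Yc[OF ray_circle[OF qE] c(1,2), unfolded ur, OF qm(1)] cp by (simp add: qeq)
  qed
  ultimately show "smooth_on (snd C ` (circle_bundle M \<inter> fst C)) (%x. Y (param C x) C)"
   unfolding dom using smooth_on_cong[OF o] by (metis (no_types, lifting))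
 qed
 have op: "openin (manifold_topology cb.batlas) (circle_bundle M)"
  unfolding cb.dirs.openin_manifold_topology_iff
 proof (intro conjI ballI)
  show "circle_bundle M \<subseteq> points cb.batlas" by (simp add: cb.batlas_points)
  fix C assume C: "C \<in> cb.batlas"
  then have "circle_bundle M \<inter> fst C = fst C" by (rule cb.batlasE) (auto simp: cb.bchart_mem)
  then show "open (snd C ` (circle_bundle M \<inter> fst C))" using cb.dirs.chart_open[OF C] by simp
 qed
 have olb: "oriented_line_bundle M (paths a)"
  unfolding oriented_line_bundle_def cb_atlas
  using op smY Y0 paths_eq[of _ a, folded Y_def] by blast
 have dfoot: "differential cb.batlas M footpoint r \<xi> c = fst (\<xi> (cb.bchart c n))"
  if "r \<in> circle_bundle M" "\<xi> \<in> tangent_space cb.batlas r" "c \<in> M" "norm n = 1" "chart_at cb.batlas r (cb.bchart c n)" for r \<xi> c n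
  unfolding cb_footpoint by (rule cb.differential_footpoint[OF that(2,5,3,4)])
 have contact: "{lincomb s \<xi> 1 \<eta> | s \<xi> \<eta>. \<xi> \<in> paths a r \<and> \<eta> \<in> vertical_space M r} = contact_space M r"
  if r: "r \<in> circle_bundle M" for r
 proof -
  note q = unit_rep[OF r]
  obtain c where c: "chart_at M (fst (representative r)) c" using chart_at_some[OF cb.rep_points[OF r]] by blast
  note cM = chart_atD[OF c]
  obtain n where n: "norm n = 1" "chart_at cb.batlas r (cb.bchart c n)" using cb.bchart_exists[OF r c] .
  have qc: "unit_rep r \<in> fst (ub.bchart c n)" using ray_bchart[OF q(1)] q(2) n cM by (simp add: cb.bchart_at)
  define \<mu> where "\<mu> = 1 / sqrt (g (fst (representative r)) (snd (representative r)) (snd (representative r)))"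
  have \<mu>: "\<mu> > 0" using metric_pos[OF cb.rep_points[OF r] cb.rep_tangent[OF r] cb.rep_nonzero[OF r]] by (simp add: \<mu>_def)
  have Yf: "fst (Y r (cb.bchart c n)) = \<mu> *\<^sub>R snd (representative r) c"
   using Yc[OF r cM(1) n(1) qc] by (simp add: unit_rep_def \<mu>_def scale_vec_def)
  let ?d = "differential cb.batlas M footpoint r"
  have dT: "?d \<xi> \<in> tangent_space M (fst (representative r))" if "\<xi> \<in> tangent_space cb.batlas r" for \<xi>
   unfolding cb_footpoint by (rule cb.differential_footpoint_tangent[OF that r])
  have dc: "?d \<xi> c = fst (\<xi> (cb.bchart c n))" if "\<xi> \<in> tangent_space cb.batlas r" for \<xi>
   by (rule dfoot[OF r that cM(1) n])
  have vert: "\<eta> \<in> vertical_space M r \<longleftrightarrow> \<eta> \<in> tangent_space cb.batlas r \<and> fst (\<eta> (cb.bchart c n)) = 0" for \<eta>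
   unfolding vertical_space_def cb_atlas using tangent_zero_iff[OF dT c] dc by auto
  have con: "\<zeta> \<in> contact_space M r \<longleftrightarrow> \<zeta> \<in> tangent_space cb.batlas r \<and> (\<exists>s. fst (\<zeta> (cb.bchart c n)) = s *\<^sub>R snd (representative r) c)" for \<zeta>
  proof -
   have "?d \<zeta> = scale_vec s (snd (representative r)) \<longleftrightarrow> fst (\<zeta> (cb.bchart c n)) = s *\<^sub>R snd (representative r) c"
    if z: "\<zeta> \<in> tangent_space cb.batlas r" for s
    using tangent_eqI[OF dT[OF z] scale_vec_tangent[OF cb.rep_tangent[OF r]] c, of s] dc[OF z]
    by (auto simp: scale_vec_def)
   then show ?thesis unfolding contact_space_def cb_atlas by auto
  qed
  show ?thesis
  proof (intro equalityI subsetI)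
   fix \<zeta> assume "\<zeta> \<in> {lincomb s \<xi> 1 \<eta> | s \<xi> \<eta>. \<xi> \<in> paths a r \<and> \<eta> \<in> vertical_space M r}"
   then obtain s \<xi> \<eta> where z: "\<zeta> = lincomb s \<xi> 1 \<eta>" "\<xi> \<in> paths a r" "\<eta> \<in> vertical_space M r" by blast
   obtain k where k: "\<xi> = scale_vec k (Y r)" using z(2) paths_eq[OF r, of a, folded Y_def] by blast
   have "\<zeta> \<in> tangent_space cb.batlas r"
    unfolding z(1) k using z(3) vert by (intro cb.dirs.lincomb_tangent cb.dirs.scale_vec_tangent YT[OF r]) blast
   moreover have "fst (\<zeta> (cb.bchart c n)) = (s * k * \<mu>) *\<^sub>R snd (representative r) c"
    using z(3) vert Yf unfolding z(1) k by (simp add: lincomb_def scale_vec_def)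
   ultimately show "\<zeta> \<in> contact_space M r" using con by blast
  next
   fix \<zeta> assume "\<zeta> \<in> contact_space M r"
   then obtain s where s: "\<zeta> \<in> tangent_space cb.batlas r" "fst (\<zeta> (cb.bchart c n)) = s *\<^sub>R snd (representative r) c"
    using con by blast
   define \<eta> where "\<eta> = lincomb 1 \<zeta> (- (s / \<mu>)) (Y r)"
   have "\<eta> \<in> tangent_space cb.batlas r" unfolding \<eta>_def by (rule cb.dirs.lincomb_tangent[OF s(1) YT[OF r]])
   moreover have "fst (\<eta> (cb.bchart c n)) = 0" using s(2) Yf \<mu> by (simp add: \<eta>_def lincomb_def)
   ultimately have "\<eta> \<in> vertical_space M r" using vert by blast
   moreover have "\<zeta> = lincomb (s / \<mu>) (scale_vec 1 (Y r)) 1 \<eta>" by (simp add: \<eta>_def lincomb_def scale_vec_def)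
   moreover have "scale_vec 1 (Y r) \<in> paths a r" unfolding paths_eq[OF r, of a, folded Y_def] by (intro CollectI exI[of _ 1]) simp
   ultimately show "\<zeta> \<in> {lincomb s \<xi> 1 \<eta> | s \<xi> \<eta>. \<xi> \<in> paths a r \<and> \<eta> \<in> vertical_space M r}" by blast
  qed
 qed
 show ?thesis unfolding path_geometry_def using olb contact by blast
qed

end

section \<open>The round sphere\<close>

lemma vec3_eq_iff: "(x :: real^3) = y \<longleftrightarrow> x $ 1 = y $ 1 \<and> x $ 2 = y $ 2 \<and> x $ 3 = y $ 3"
 by (simp add: vec_eq_iff forall_3)

lemma inner3: "(x :: real^3) \<bullet> y = x $ 1 * y $ 1 + x $ 2 * y $ 2 + x $ 3 * y $ 3"
 by (simp add: inner_vec_def sum_3)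

lemma norm3_eq_1: "norm (x :: real^3) = 1 \<longleftrightarrow> x $ 1 * x $ 1 + x $ 2 * x $ 2 + x $ 3 * x $ 3 = 1"
 by (simp add: norm_eq_sqrt_inner inner3)

text \<open>
 The two stereographic charts, written with the sign \<open>e\<close> of the third coordinate of the point
 opposite to the pole of projection.
\<close>

definition stereo :: "real \<Rightarrow> real^3 \<Rightarrow> real^2" where
 "stereo e x = vector [x $ 1 / (1 + e * x $ 3), e * x $ 2 / (1 + e * x $ 3)]"

definition inv_stereo :: "real \<Rightarrow> real^2 \<Rightarrow> real^3" where
 "inv_stereo e y = vector [2 * y $ 1 / (1 + y \<bullet> y), e * (2 * y $ 2) / (1 + y \<bullet> y), e * (1 - y \<bullet> y) / (1 + y \<bullet> y)]"

definition stereo_dom :: "real \<Rightarrow> (real^3) set" where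
 "stereo_dom e = {x. norm x = 1 \<and> x $ 3 ~= - e}"

lemma sphere_atlas_eq: "sphere_atlas = {(stereo_dom (-1), stereo (-1)), (stereo_dom 1, stereo 1)}"
 unfolding sphere_atlas_def stereo_dom_def stereo_def by (simp add: fun_eq_iff)

lemma sphere_atlasE:
 assumes "d \<in> sphere_atlas"
 obtains e where "e = 1 \<or> e = -1" "d = (stereo_dom e, stereo e)"
 using assms unfolding sphere_atlas_eq by blast

lemma inv_stereo_stereo:
 assumes "e = 1 \<or> e = -1" "x \<in> stereo_dom e"
 shows "inv_stereo e (stereo e x) = x"
proof -
 let ?s = "1 + e * x $ 3"
 have ee: "e * e = 1" using assms(1) by auto
 have n: "x $ 1 * x $ 1 + x $ 2 * x $ 2 + x $ 3 * x $ 3 = 1" and s: "?s ~= 0"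
  using assms by (auto simp: stereo_dom_def norm3_eq_1)
 have q: "x $ 1 * x $ 1 + x $ 2 * x $ 2 = (1 - e * x $ 3) * ?s"
 proof -
  have "(1 - e * x $ 3) * ?s = 1 - (e * e) * (x $ 3 * x $ 3)" by (simp add: algebra_simps)
  then show ?thesis using n ee by simp
 qed
 have "stereo e x \<bullet> stereo e x = (x $ 1 * x $ 1 + (e * e) * (x $ 2 * x $ 2)) / (?s * ?s)"
  by (simp add: stereo_def inner2 add_divide_distrib mult_ac)
 also have "\<dots> = (1 - e * x $ 3) / ?s" using s by (simp add: ee q)
 finally have r: "stereo e x \<bullet> stereo e x = (1 - e * x $ 3) / ?s" .
 then have d: "1 + stereo e x \<bullet> stereo e x = 2 / ?s" "1 - stereo e x \<bullet> stereo e x = 2 * e * x $ 3 / ?s"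
  using s by (simp_all add: field_simps)
 show ?thesis
  unfolding inv_stereo_def d vec3_eq_iff using s ee by (simp add: stereo_def mult.assoc[symmetric])
qed

lemma stereo_inv_stereo:
 assumes "e = 1 \<or> e = -1"
 shows "stereo e (inv_stereo e y) = y" "inv_stereo e y \<in> stereo_dom e"
proof -
 have ee: "e * e = 1" using assms by auto
 have p: "1 + y \<bullet> y > 0" by (simp add: add_pos_nonneg)
 have t: "1 + e * (inv_stereo e y $ 3) = 2 / (1 + y \<bullet> y)"
 proof -
  have "e * (inv_stereo e y $ 3) = (e * e) * ((1 - y \<bullet> y) / (1 + y \<bullet> y))" by (simp add: inv_stereo_def)
  then have "1 + e * (inv_stereo e y $ 3) = 1 + (1 - y \<bullet> y) / (1 + y \<bullet> y)" by (simp only: ee mult_1_left)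
  also have "\<dots> = ((1 + y \<bullet> y) + (1 - y \<bullet> y)) / (1 + y \<bullet> y)" using p by (subst add_divide_distrib) simp
  finally show ?thesis by simp
 qed
 show "stereo e (inv_stereo e y) = y"
  unfolding stereo_def t real2_eq_iff using p ee by (simp add: inv_stereo_def mult.assoc[symmetric])
 have "norm (inv_stereo e y) = 1"
 proof -
  have "(2 * y $ 1)\<^sup>2 + (e * (2 * y $ 2))\<^sup>2 + (e * (1 - y \<bullet> y))\<^sup>2 = (1 + y \<bullet> y)\<^sup>2"
   using assms by (auto simp: inner2 power2_eq_square algebra_simps)
  then have "((2 * y $ 1)\<^sup>2 + (e * (2 * y $ 2))\<^sup>2 + (e * (1 - y \<bullet> y))\<^sup>2) / (1 + y \<bullet> y)\<^sup>2 = 1" using p by simp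
  then show ?thesis
   unfolding norm3_eq_1 inv_stereo_def by (simp add: power2_eq_square add_divide_distrib)
 qed
 moreover have "inv_stereo e y $ 3 ~= - e"
 proof
  assume "inv_stereo e y $ 3 = - e"
  then have "2 / (1 + y \<bullet> y) = 0" using t ee by simp
  then show False using p by simp
 qed
 ultimately show "inv_stereo e y \<in> stereo_dom e" by (simp add: stereo_dom_def)
qed

lemma stereo_inj: "e = 1 \<or> e = -1 ==> inj_on (stereo e) (stereo_dom e)"
 by (rule inj_on_inverseI) (rule inv_stereo_stereo)

lemma param_stereo: "e = 1 \<or> e = -1 ==> param (stereo_dom e, stereo e) = inv_stereo e"
 unfolding param_def fst_conv snd_conv
 by (rule ext) (metis inv_into_f_f stereo_inj stereo_inv_stereo)

lemma smooth_on_vector3 [smooth_intros]: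
 fixes f g h :: "_ \<Rightarrow> real"
 assumes "open S" "smooth_on S f" "smooth_on S g" "smooth_on S h"
 shows "smooth_on S (%x. vector [f x, g x, h x] :: real^3)"
proof (rule smooth_on_vecI[OF assms(1)])
 fix i :: 3
 show "smooth_on S (%x. (vector [f x, g x, h x] :: real^3) $ i)"
  using exhaust_3[of i] assms by auto
qed

lemma smooth_on_inv_stereo [smooth_intros]: "open S ==> smooth_on S f ==> smooth_on S (%x. inv_stereo e (f x))"
 unfolding inv_stereo_def
 by (intro smooth_intros) (auto simp: add_pos_nonneg less_imp_neq[symmetric])

lemma smooth_on_stereo [smooth_intros]:
 "open S ==> smooth_on S f ==> (!!x. x \<in> S ==> 1 + e * f x $ 3 ~= 0) ==> smooth_on S (%x. stereo e (f x))"
 unfolding stereo_def by (intro smooth_intros) auto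

section \<open>Flatness forces cubic differentials\<close>

lemma trig_sum_zero:
 fixes a b :: "'k \<Rightarrow> real" and \<omega> :: "'k \<Rightarrow> real"
 assumes "!!\<theta>. (\<Sum>k\<in>K. a k * sin (\<omega> k * \<theta>) + b k * cos (\<omega> k * \<theta>)) = 0"
 shows "(\<Sum>k\<in>K. (\<omega> k)\<^sup>2 * (a k * sin (\<omega> k * \<theta>) + b k * cos (\<omega> k * \<theta>))) = 0"
proof -
 have step: "(\<Sum>k\<in>K. (- \<omega> k * b k) * sin (\<omega> k * \<theta>) + (\<omega> k * a k) * cos (\<omega> k * \<theta>)) = 0"
  if "!!\<theta>. (\<Sum>k\<in>K. a k * sin (\<omega> k * \<theta>) + b k * cos (\<omega> k * \<theta>)) = 0" for a b :: "'k \<Rightarrow> real" and \<theta>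
 proof -
  have "((%\<theta>. \<Sum>k\<in>K. a k * sin (\<omega> k * \<theta>) + b k * cos (\<omega> k * \<theta>)) has_real_derivative
   (\<Sum>k\<in>K. (- \<omega> k * b k) * sin (\<omega> k * \<theta>) + (\<omega> k * a k) * cos (\<omega> k * \<theta>))) (at \<theta>)"
   by (auto intro!: derivative_eq_intros sum.cong simp: algebra_simps)
  moreover have "((%\<theta>. \<Sum>k\<in>K. a k * sin (\<omega> k * \<theta>) + b k * cos (\<omega> k * \<theta>)) has_real_derivative 0) (at \<theta>)"
   unfolding that by simp
  ultimately show ?thesis by (rule DERIV_unique)
 qed
 have "(\<Sum>k\<in>K. (- \<omega> k * (\<omega> k * a k)) * sin (\<omega> k * \<theta>) + (\<omega> k * (- \<omega> k * b k)) * cos (\<omega> k * \<theta>)) = 0"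
  by (rule step) (rule step, rule assms)
 then have "- (\<Sum>k\<in>K. (\<omega> k)\<^sup>2 * (a k * sin (\<omega> k * \<theta>) + b k * cos (\<omega> k * \<theta>))) = 0"
  by (simp add: sum_negf[symmetric] power2_eq_square algebra_simps)
 then show ?thesis by simp
qed

text \<open>
 A cubic form restricted to the unit circle only has the Fourier modes \<open>1\<close> and \<open>3\<close>; the operator
 \<open>(D\<^sup>2 + 1) (D\<^sup>2 + 9)\<close>, with \<open>D\<close> the derivative, annihilates it.
\<close>

lemma cubic_fourier_mode:
 fixes m :: nat
 assumes eq: "!!\<theta>. Im (z * cis (real m * \<theta>)) = k0 * cos \<theta> ^ 3 + k1 * (cos \<theta>)\<^sup>2 * sin \<theta> + k2 * cos \<theta> * (sin \<theta>)\<^sup>2 + k3 * sin \<theta> ^ 3"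
  and "m \<ge> 2" "z ~= 0"
 shows "m = 3"
proof (rule ccontr)
 assume "m ~= 3"
 define Q where "Q \<theta> = Re z * sin (real m * \<theta>) + Im z * cos (real m * \<theta>)" for \<theta>
 define R1 where "R1 \<theta> = - ((k1 + 3 * k3) / 4) * sin (1 * \<theta>) + - ((3 * k0 + k2) / 4) * cos (1 * \<theta>)" for \<theta>
 define R3 where "R3 \<theta> = - ((k1 - k3) / 4) * sin (3 * \<theta>) + - ((k0 - k2) / 4) * cos (3 * \<theta>)" for \<theta>
 define a where "a = (%k::nat. if k = 0 then Re z else if k = 1 then - ((k1 + 3 * k3) / 4) else - ((k1 - k3) / 4))"
 define b where "b = (%k::nat. if k = 0 then Im z else if k = 1 then - ((3 * k0 + k2) / 4) else - ((k0 - k2) / 4))"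
 define \<omega> where "\<omega> = (%k::nat. if k = 0 then real m else if k = 1 then 1 else 3)"
 have S: "(\<Sum>k\<in>{0,1,2}. c k * (a k * sin (\<omega> k * \<theta>) + b k * cos (\<omega> k * \<theta>))) = c 0 * Q \<theta> + (c 1 * R1 \<theta> + c 2 * R3 \<theta>)" for c :: "nat \<Rightarrow> real" and \<theta>
  by (simp add: a_def b_def \<omega>_def Q_def R1_def R3_def)
 have 0: "Q \<theta> + R1 \<theta> + R3 \<theta> = 0" for \<theta>
 proof -
  have c3: "cos (3 * \<theta>) = 4 * cos \<theta> ^ 3 - 3 * cos \<theta>" by (rule cos_treble_cos)
  have "sin (3 * \<theta>) = sin (2 * \<theta> + \<theta>)" by (simp add: algebra_simps)
  then have s3: "sin (3 * \<theta>) = 3 * (cos \<theta>)\<^sup>2 * sin \<theta> - sin \<theta> ^ 3"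
   unfolding sin_add sin_double cos_double by (simp add: algebra_simps power2_eq_square power3_eq_cube)
  have p: "(sin \<theta>)\<^sup>2 = 1 - (cos \<theta>)\<^sup>2" by (rule sin_squared_eq)
  have "Im (z * cis (real m * \<theta>)) = Q \<theta>" by (simp add: Q_def)
  then have Q: "Q \<theta> = k0 * cos \<theta> ^ 3 + k1 * (cos \<theta>)\<^sup>2 * sin \<theta> + k2 * cos \<theta> * (sin \<theta>)\<^sup>2 + k3 * sin \<theta> ^ 3" using eq by simp
  have "sin \<theta> ^ 3 = sin \<theta> * (sin \<theta>)\<^sup>2" by (simp add: power3_eq_cube power2_eq_square)
  then have s33: "sin \<theta> ^ 3 = sin \<theta> - (cos \<theta>)\<^sup>2 * sin \<theta>" unfolding p by (simp add: algebra_simps)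
  have ss: "cos \<theta> * (sin \<theta>)\<^sup>2 = cos \<theta> - cos \<theta> ^ 3"
   unfolding p by (simp add: power3_eq_cube power2_eq_square algebra_simps)
  have r1: "4 * R1 \<theta> = - (k1 + 3 * k3) * sin \<theta> - (3 * k0 + k2) * cos \<theta>" by (simp add: R1_def field_simps)
  have r3: "4 * R3 \<theta> = - (k1 - k3) * (4 * ((cos \<theta>)\<^sup>2 * sin \<theta>) - sin \<theta>) - (k0 - k2) * (4 * cos \<theta> ^ 3 - 3 * cos \<theta>)"
   unfolding R3_def c3 s3 s33 by (simp add: field_simps)
  have q: "Q \<theta> = k0 * cos \<theta> ^ 3 + k1 * ((cos \<theta>)\<^sup>2 * sin \<theta>) + k2 * (cos \<theta> - cos \<theta> ^ 3) + k3 * (sin \<theta> - (cos \<theta>)\<^sup>2 * sin \<theta>)"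
   unfolding Q s33 by (simp add: ss mult.assoc)
  have "4 * (Q \<theta> + R1 \<theta> + R3 \<theta>) = 4 * Q \<theta> + 4 * R1 \<theta> + 4 * R3 \<theta>" by simp
  also have "\<dots> = 0" unfolding r1 r3 q by (simp add: algebra_simps)
  finally show ?thesis by simp
 qed
 have Z0: "(\<Sum>k\<in>{0,1,2}. a k * sin (\<omega> k * \<theta>) + b k * cos (\<omega> k * \<theta>)) = 0" for \<theta>
  using S[of "%_. 1"] 0 by (simp add: add.assoc)
 have Z2: "(\<Sum>k\<in>{0,1,2}. (\<omega> k)\<^sup>2 * (a k * sin (\<omega> k * \<theta>) + b k * cos (\<omega> k * \<theta>))) = 0" for \<theta>
  by (rule trig_sum_zero) (rule Z0)
 have Z4: "(\<Sum>k\<in>{0,1,2}. (\<omega> k)\<^sup>2 * (((\<omega> k)\<^sup>2 * a k) * sin (\<omega> k * \<theta>) + ((\<omega> k)\<^sup>2 * b k) * cos (\<omega> k * \<theta>))) = 0" for \<theta>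
  by (rule trig_sum_zero) (use Z2 in \<open>simp only: distrib_left mult.assoc\<close>)
 have Q0: "Q \<theta> = 0" for \<theta>
 proof -
  have e2: "(real m)\<^sup>2 * Q \<theta> + R1 \<theta> + 9 * R3 \<theta> = 0"
   using Z2[of \<theta>] unfolding S[of "%k. (\<omega> k)\<^sup>2"] by (simp add: \<omega>_def)
  have "(\<Sum>k\<in>{0,1,2}. ((\<omega> k)\<^sup>2 * (\<omega> k)\<^sup>2) * (a k * sin (\<omega> k * \<theta>) + b k * cos (\<omega> k * \<theta>))) = 0"
   using Z4[of \<theta>] by (simp only: distrib_left mult.assoc)
  then have e4: "(real m)\<^sup>2 * (real m)\<^sup>2 * Q \<theta> + R1 \<theta> + 81 * R3 \<theta> = 0"
   unfolding S[of "%k. (\<omega> k)\<^sup>2 * (\<omega> k)\<^sup>2"] by (simp add: \<omega>_def)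
  have "((real m)\<^sup>2 - 1) * ((real m)\<^sup>2 - 9) * Q \<theta> = 0"
  proof -
   have "(M - 1) * (M - 9) * q = M * M * q - 10 * (M * q) + 9 * q" for M q :: real by (simp add: algebra_simps)
   then show ?thesis using 0[of \<theta>] e2 e4 by simp
  qed
  moreover have "(real m)\<^sup>2 - 1 ~= 0" "(real m)\<^sup>2 - 9 ~= 0"
  proof -
   have "m\<^sup>2 ~= 1\<^sup>2" "m\<^sup>2 ~= 3\<^sup>2" using assms(2) \<open>m ~= 3\<close> by (simp_all only: power2_eq_iff_nonneg) auto
   then have "real (m\<^sup>2) ~= real (1\<^sup>2)" "real (m\<^sup>2) ~= real (3\<^sup>2)" by (simp_all only: of_nat_eq_iff not_False_eq_True)
   then show "(real m)\<^sup>2 - 1 ~= 0" "(real m)\<^sup>2 - 9 ~= 0" by simp_all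
  qed
  ultimately show ?thesis by simp
 qed
 have "Im z = 0" using Q0[of 0] by (simp add: Q_def)
 moreover have "Re z = 0" using Q0[of "pi / 2 / real m"] assms(2) calculation by (simp add: Q_def)
 ultimately show False using assms(3) by (simp add: complex_eq_iff)
qed

lemma tangent_plane_nondegenerate:
 fixes L :: "real^2 \<Rightarrow> real^3"
 assumes "linear L" "!!v. L v = 0 ==> v = 0" "norm u = 1" "!!v. u \<bullet> L v = 0"
 shows "cross3 u (L (axis 1 1)) \<bullet> L (axis 2 1) ~= 0"
proof
 let ?a = "L (axis 1 1)" and ?b = "L (axis 2 1)"
 assume 0: "cross3 u ?a \<bullet> ?b = 0"
 have u: "u \<bullet> u = 1" using assms(3) by (simp add: norm_eq_1)
 have "(u \<bullet> u) * ((?a \<bullet> ?a) * (?b \<bullet> ?b) - (?a \<bullet> ?b)\<^sup>2) = (cross3 u ?a \<bullet> ?b)\<^sup>2 + (u \<bullet> ?a) * ((u \<bullet> ?a) * (?b \<bullet> ?b) - (u \<bullet> ?b) * (?a \<bullet> ?b)) + (u \<bullet> ?b) * ((u \<bullet> ?b) * (?a \<bullet> ?a) - (u \<bullet> ?a) * (?a \<bullet> ?b))"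
  by (simp add: inner3 cross3_simps power2_eq_square)
 then have g: "(?a \<bullet> ?a) * (?b \<bullet> ?b) = (?a \<bullet> ?b)\<^sup>2" using 0 u assms(4) by simp
 let ?w = "(?a \<bullet> ?b) *\<^sub>R axis 1 1 - (?a \<bullet> ?a) *\<^sub>R axis 2 1 :: real^2"
 have "L ?w = (?a \<bullet> ?b) *\<^sub>R ?a - (?a \<bullet> ?a) *\<^sub>R ?b" using assms(1) by (simp add: linear_diff linear_cmul)
 moreover have "((?a \<bullet> ?b) *\<^sub>R ?a - (?a \<bullet> ?a) *\<^sub>R ?b) \<bullet> ((?a \<bullet> ?b) *\<^sub>R ?a - (?a \<bullet> ?a) *\<^sub>R ?b) = (?a \<bullet> ?a) * ((?a \<bullet> ?a) * (?b \<bullet> ?b) - (?a \<bullet> ?b)\<^sup>2)"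
  by (simp add: inner_diff_left inner_diff_right inner_commute power2_eq_square algebra_simps)
 ultimately have "L ?w = 0" using g by (metis cancel_comm_monoid_add_class.diff_cancel inner_eq_zero_iff mult_zero_right)
 then have "?w = 0" by (rule assms(2))
 then have "?w $ 2 = 0" by simp
 then have "?a = 0" by (simp add: axis_def)
 then have "axis 1 (1::real) = (0 :: real^2)" using assms(2) by blast
 then show False by (simp add: axis_eq_0_iff)
qed

context riemannian_surface begin

lemma complex_scale_real:
 assumes "v \<in> tangent_space M p" "p \<in> points M"
 shows "complex_scale M g p (of_real s) v = scale_vec s v"
 by (simp add: complex_scale_def lincomb_def scale_vec_def)

text \<open>
 Around a point of a flat path geometry, a parametrization of a piece of the sphere by a chart
 pulls great circles back to paths.
\<close>

lemma flat_local_map: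
 assumes flat: "flat_path_geometry M (paths a)" and c: "chart_at M p c"
 obtains \<Omega> \<Psi> where "open \<Omega>" "snd c p \<in> \<Omega>" "\<Omega> \<subseteq> snd c ` fst c" "smooth_on \<Omega> \<Psi>"
  "!!x. x \<in> \<Omega> ==> norm (\<Psi> x :: real^3) = 1"
  "!!y. fderiv \<Psi> (at (snd c p)) y = 0 ==> y = 0"
  "!!w. norm w = 1 ==> \<Psi> (snd c p) \<bullet> w = 0 ==> \<exists>I \<kappa>. 0 \<in> I \<and> oriented_path M (paths a) I \<kappa> \<and> \<kappa> 0 = p \<and>
   (\<forall>t\<in>I. snd c (\<kappa> t) \<in> \<Omega> \<and> \<Psi> (snd c (\<kappa> t)) = cos t *\<^sub>R \<Psi> (snd c p) + sin t *\<^sub>R w)"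
proof -
 note cM = chart_atD[OF c]
 obtain U W f where f12: "p \<in> U" "diffeomorphism M U sphere_atlas W f"
  and f3: "\<forall>I d. great_circle_arc I d \<and> d ` I \<subseteq> W -->
   (\<exists>\<kappa>. oriented_path M (paths a) I \<kappa> \<and> \<kappa> ` I \<subseteq> U \<and> (\<forall>t\<in>I. d t = f (\<kappa> t)))"
  using bspec[OF conjunct2[OF flat[unfolded flat_path_geometry_def]] chart_at_points[OF c]]
  by (elim exE conjE) (rule that)
 note f = f12 f3[rule_format, OF conjI]
 note df = f(2)[unfolded diffeomorphism_def]
 have inj: "inj_on f U" and img: "f ` U = W" using df by (auto simp: bij_betw_def)
 define h where "h = inv_into U f"
 have hf: "h (f q) = q" if "q \<in> U" for q using inj that by (simp add: h_def)
 have smf: "smooth_map M U sphere_atlas f" and smh: "smooth_map sphere_atlas W M h" using df by (auto simp: h_def)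
 have "f p \<in> points sphere_atlas" using smf f(1) unfolding smooth_map_def by blast
 then obtain d where d: "d \<in> sphere_atlas" "f p \<in> fst d" unfolding points_def by blast
 obtain e where e: "e = 1 \<or> e = -1" "d = (stereo_dom e, stereo e)" using d(1) by (rule sphere_atlasE)
 define S where "S = (%x. stereo e (f (param c x)))"
 define \<Omega> where "\<Omega> = snd c ` (U \<inter> fst c \<inter> f -` stereo_dom e)"
 have "open (snd c ` (U \<inter> fst c \<inter> f -` fst d)) \<and> smooth_on (snd c ` (U \<inter> fst c \<inter> f -` fst d)) (snd d \<circ> f \<circ> param c)"
  using smf cM(1) d(1) unfolding smooth_map_def Let_def by blast
 then have \<Omega>: "open \<Omega>" "smooth_on \<Omega> S"
  unfolding \<Omega>_def S_def e(2) by (simp_all add: comp_def)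
 have mem: "param c x \<in> U \<inter> fst c \<inter> f -` stereo_dom e" "snd c (param c x) = x" if "x \<in> \<Omega>" for x
  using that cM(1) unfolding \<Omega>_def by auto
 define \<Psi> where "\<Psi> x = inv_stereo e (S x)" for x
 have \<Psi>f: "\<Psi> x = f (param c x)" if "x \<in> \<Omega>" for x
  using mem[OF that] inv_stereo_stereo[OF e(1)] by (simp add: \<Psi>_def S_def)
 have s\<Psi>: "smooth_on \<Omega> \<Psi>" unfolding \<Psi>_def by (intro smooth_intros \<Omega>)
 define x0 where "x0 = snd c p"
 have x0: "x0 \<in> \<Omega>" using f(1) d(2) e(2) cM by (auto simp: \<Omega>_def x0_def)
 have px0: "param c x0 = p" using cM by (simp add: x0_def)
 define W' where "W' = stereo e ` (W \<inter> stereo_dom e \<inter> h -` fst c)"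
 define T where "T = (%y. snd c (h (inv_stereo e y)))"
 have "open (snd d ` (W \<inter> fst d \<inter> h -` fst c)) \<and> smooth_on (snd d ` (W \<inter> fst d \<inter> h -` fst c)) (snd c \<circ> h \<circ> param d)"
  using smh cM(1) d(1) unfolding smooth_map_def Let_def by blast
 then have W': "open W'" "smooth_on W' T"
  unfolding W'_def T_def e(2) param_stereo[OF e(1)] by (simp_all add: comp_def)
 have u0: "f p \<in> W \<inter> stereo_dom e \<inter> h -` fst c" using img f(1) d(2) e(2) hf cM by auto
 have TS: "T (stereo e (\<Psi> x)) = x" if "x \<in> \<Omega>" for x
  using mem[OF that] hf \<Psi>f[OF that] inv_stereo_stereo[OF e(1)] by (simp add: T_def)
 have injD: "y = 0" if y: "fderiv \<Psi> (at x0) y = 0" for y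
 proof -
  let ?O = "{z :: real^3. 1 + e * z $ 3 ~= 0}"
  have o: "open ?O" by (intro open_Collect_neq continuous_intros)
  have pd: "f p \<in> ?O" using u0 e(1) by (auto simp: stereo_dom_def)
  have "smooth_on ?O (stereo e)" using smooth_on_stereo[OF o smooth_on_id[OF o], of e] by simp
  then obtain D1 where D1: "(stereo e has_derivative D1) (at (\<Psi> x0))"
   using smooth_on_has_derivative pd \<Psi>f[OF x0] px0 by metis
  have "stereo e (\<Psi> x0) \<in> W'" using u0 \<Psi>f[OF x0] px0 by (auto simp: W'_def)
  then obtain D2 where D2: "(T has_derivative D2) (at (stereo e (\<Psi> x0)))"
   using smooth_on_has_derivative[OF W'(2)] by blast
  have "((%x. T (stereo e (\<Psi> x))) has_derivative (%h. D2 (D1 (fderiv \<Psi> (at x0) h)))) (at x0)"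
   by (rule has_derivative_compose[OF has_derivative_compose[OF smooth_on_has_derivative[OF s\<Psi> x0] D1] D2])
  then have "((%x. x) has_derivative (%h. D2 (D1 (fderiv \<Psi> (at x0) h)))) (at x0)"
   by (rule has_derivative_transform_within_open[OF _ \<Omega>(1) x0]) (rule TS)
  from fun_cong[OF has_derivative_unique[OF this has_derivative_ident], of y]
  have "D2 (D1 (fderiv \<Psi> (at x0) y)) = y" .
  moreover have "D2 (D1 0) = 0"
   using linear_0[OF has_derivative_linear[OF D1]] linear_0[OF has_derivative_linear[OF D2]] by simp
  ultimately show ?thesis using y by simp
 qed
 have arc: "\<exists>I \<kappa>. 0 \<in> I \<and> oriented_path M (paths a) I \<kappa> \<and> \<kappa> 0 = p \<and>
   (\<forall>t\<in>I. snd c (\<kappa> t) \<in> \<Omega> \<and> \<Psi> (snd c (\<kappa> t)) = cos t *\<^sub>R \<Psi> x0 + sin t *\<^sub>R w)"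
  if w: "norm w = 1" "\<Psi> x0 \<bullet> w = 0" for w
 proof -
  define u where "u = f p"
  have u: "norm u = 1" "u \<bullet> w = 0" "\<Psi> x0 = u" using u0 w \<Psi>f[OF x0] px0 by (auto simp: u_def stereo_dom_def)
  define dd where "dd t = cos t *\<^sub>R u + sin t *\<^sub>R w" for t
  have nd: "norm (dd t) = 1" for t
  proof -
   have "dd t \<bullet> dd t = (cos t)\<^sup>2 * (u \<bullet> u) + 2 * (cos t * sin t) * (u \<bullet> w) + (sin t)\<^sup>2 * (w \<bullet> w)"
    by (simp add: dd_def inner_add_left inner_add_right inner_commute power2_eq_square algebra_simps)
   then show ?thesis using u w by (simp add: norm_eq_1)
  qed
  have cdd: "isCont dd t" for t unfolding dd_def by (intro continuous_intros)
  have dd0: "dd 0 = u" by (simp add: dd_def)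
  define I0 where "I0 = {t. 1 + e * dd t $ 3 ~= 0 \<and> stereo e (dd t) \<in> W'}"
  have "\<forall>\<^sub>F t in at 0. t \<in> I0"
  proof -
   have p0: "1 + e * u $ 3 ~= 0" using u0 e(1) by (auto simp: stereo_dom_def u_def)
   have c1: "((%t. 1 + e * dd t $ 3) \<longlongrightarrow> 1 + e * u $ 3) (at 0)"
    using cdd[of 0] dd0 by (auto intro!: tendsto_intros simp: isCont_def)
   have c2: "((%t. stereo e (dd t)) \<longlongrightarrow> stereo e u) (at 0)"
   proof -
    have "isCont (stereo e) u"
    proof -
     have o: "open {z :: real^3. 1 + e * z $ 3 ~= 0}" by (intro open_Collect_neq continuous_intros)
     have "smooth_on {z :: real^3. 1 + e * z $ 3 ~= 0} (stereo e)" using smooth_on_stereo[OF o smooth_on_id[OF o], of e] by simp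
     from smooth_on_continuous_on[OF this] show ?thesis using p0 o continuous_on_eq_continuous_at by blast
    qed
    then have "isCont (%t. stereo e (dd t)) 0" using isCont_o2[OF cdd[of 0], of "stereo e"] dd0 by simp
    then show ?thesis using dd0 by (simp add: isCont_def)
   qed
   have "stereo e u \<in> W'" using u0 by (auto simp: W'_def u_def)
   then have "\<forall>\<^sub>F t in at 0. stereo e (dd t) \<in> W'" by (rule topological_tendstoD[OF c2 W'(1)])
   moreover have "\<forall>\<^sub>F t in at 0. 1 + e * dd t $ 3 \<in> - {0}"
    by (rule topological_tendstoD[OF c1]) (use p0 in auto)
   ultimately show ?thesis by eventually_elim (simp add: I0_def)
  qed
  then obtain r where r: "r > 0" "!!t. t ~= 0 ==> dist t 0 < r ==> t \<in> I0" unfolding eventually_at by auto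
  have 00: "0 \<in> I0" using u0 e(1) by (auto simp: I0_def dd0 stereo_dom_def u_def W'_def)
  define I where "I = {-r<..<r}"
  have I0: "t \<in> I0" if "t \<in> I" for t using that r 00 by (cases "t = 0") (auto simp: I_def)
  have ddW: "dd t \<in> W \<inter> stereo_dom e \<inter> h -` fst c" if tI: "t \<in> I" for t
  proof -
   have "dd t \<in> stereo_dom e" using I0[OF tI] nd e(1) by (auto simp: I0_def stereo_dom_def)
   moreover obtain y where "y \<in> W \<inter> stereo_dom e \<inter> h -` fst c" "stereo e (dd t) = stereo e y"
    using I0[OF tI] by (auto simp: I0_def W'_def)
   ultimately show ?thesis using inj_onD[OF stereo_inj[OF e(1)]] by auto
  qed
  have "great_circle_arc I dd"
   unfolding great_circle_arc_def
  proof (rule conjI)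
   show "open_interval I" using r(1) by (auto simp: open_interval_def I_def is_interval_def)
   have "smooth_on I (%t. t)" by (rule smooth_on_id) (simp add: I_def)
   then show "\<exists>u w \<theta>. norm u = 1 \<and> norm w = 1 \<and> u \<bullet> w = 0 \<and> smooth_on I \<theta> \<and> (\<forall>t\<in>I. deriv \<theta> t > 0) \<and>
     (\<forall>t\<in>I. dd t = cos (\<theta> t) *\<^sub>R u + sin (\<theta> t) *\<^sub>R w)"
    using u(1,2) w(1) by (intro exI[where x=u] exI[where x=w] exI[where x="%t. t"]) (simp add: dd_def)
  qed
  from f(3)[OF this] ddW obtain \<kappa> where \<kappa>: "oriented_path M (paths a) I \<kappa>" "\<kappa> ` I \<subseteq> U" "!!t. t \<in> I ==> dd t = f (\<kappa> t)"
   by blast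
  have k: "\<kappa> t \<in> U" "\<kappa> t \<in> fst c" "f (\<kappa> t) \<in> stereo_dom e" if "t \<in> I" for t
  proof -
   show "\<kappa> t \<in> U" using \<kappa>(2) that by blast
   then show "\<kappa> t \<in> fst c" "f (\<kappa> t) \<in> stereo_dom e" using ddW[OF that] \<kappa>(3)[OF that] hf by auto
  qed
  have I: "0 \<in> I" using r by (simp add: I_def)
  have k0: "\<kappa> 0 = p" using \<kappa>(3)[OF I] dd0 k(1)[OF I] f(1) inj by (auto simp: u_def inj_on_def)
  have k\<Omega>: "snd c (\<kappa> t) \<in> \<Omega>" if "t \<in> I" for t using k[OF that] by (auto simp: \<Omega>_def)
  have "\<Psi> (snd c (\<kappa> t)) = dd t" if "t \<in> I" for t
   using \<Psi>f[OF k\<Omega>[OF that]] k(2)[OF that] cM(1) \<kappa>(3)[OF that] by simp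
  then show ?thesis using \<kappa>(1) I k0 k\<Omega> u(3) by (intro exI[of _ I] exI[of _ \<kappa>]) (simp add: dd_def)
 qed
 show thesis
 proof (rule that[OF \<Omega>(1) x0[unfolded x0_def] _ s\<Psi> _ injD[unfolded x0_def] arc[unfolded x0_def]])
  show "\<Omega> \<subseteq> snd c ` fst c" by (auto simp: \<Omega>_def)
  show "norm (\<Psi> x) = 1" for x using stereo_inv_stereo(2)[OF e(1)] by (simp add: \<Psi>_def stereo_dom_def)
 qed
qed

text \<open>
 For the curves which a local map \<open>\<Psi>\<close> sends to great circles, \<open>\<Psi>\<close>, its first and its second
 derivative along the curve are linearly dependent.  The determinant expressing this is the cross
 product of velocity and acceleration plus a cubic form in the velocity.
\<close>

lemma flat_acceleration_cubic:
 assumes flat: "flat_path_geometry M (paths a)" and c: "chart_at M p c"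
 obtains B where "!!y z. linear (%x. B x y z)" "!!x z. linear (%y. B x y z)" "!!x y. linear (%z. B x y z)"
  "!!y. y ~= 0 ==> \<exists>\<mu>>0. \<exists>z. path_equation a c p (\<mu> *\<^sub>R y) z \<and> cross2 (\<mu> *\<^sub>R y) z = \<mu>^3 * B y y y"
proof -
 obtain \<Omega> \<Psi> where \<Psi>: "open \<Omega>" "snd c p \<in> \<Omega>" "\<Omega> \<subseteq> snd c ` fst c" "smooth_on \<Omega> \<Psi>"
  "!!x. x \<in> \<Omega> ==> norm (\<Psi> x :: real^3) = 1"
  "!!y. fderiv \<Psi> (at (snd c p)) y = 0 ==> y = 0"
  "!!w. norm w = 1 ==> \<Psi> (snd c p) \<bullet> w = 0 ==> \<exists>I \<kappa>. 0 \<in> I \<and> oriented_path M (paths a) I \<kappa> \<and> \<kappa> 0 = p \<and>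
   (\<forall>t\<in>I. snd c (\<kappa> t) \<in> \<Omega> \<and> \<Psi> (snd c (\<kappa> t)) = cos t *\<^sub>R \<Psi> (snd c p) + sin t *\<^sub>R w)"
  by (rule flat_local_map[OF flat c], rule that)
 define x0 where "x0 = snd c p"
 define L where "L = fderiv \<Psi> (at x0)"
 define u where "u = \<Psi> x0"
 have x0: "x0 \<in> \<Omega>" using \<Psi>(2) by (simp add: x0_def)
 have dL: "(\<Psi> has_derivative L) (at x0)" unfolding L_def by (rule smooth_on_has_derivative[OF \<Psi>(4) x0])
 have L: "linear L" using dL has_derivative_linear by blast
 have L0: "y = 0" if "L y = 0" for y using \<Psi>(6) that by (simp add: L_def x0_def)
 have u1: "norm u = 1" using \<Psi>(5)[OF x0] by (simp add: u_def)
 have uL: "u \<bullet> L y = 0" for y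
 proof -
  have "((%x. \<Psi> x \<bullet> \<Psi> x) has_derivative (%h. \<Psi> x0 \<bullet> L h + L h \<bullet> \<Psi> x0)) (at x0)"
   by (rule has_derivative_inner[OF dL dL])
  moreover have "((%x. \<Psi> x \<bullet> \<Psi> x) has_derivative (%h. 0)) (at x0)"
   by (rule has_derivative_transform_within_open[OF has_derivative_const[of 1] \<Psi>(1) x0]) (use \<Psi>(5) in \<open>simp add: norm_eq_1\<close>)
  ultimately have "\<Psi> x0 \<bullet> L y + L y \<bullet> \<Psi> x0 = 0" using fun_cong[OF has_derivative_unique] by blast
  then show ?thesis by (simp add: u_def inner_commute)
 qed
 define k where "k = cross3 u (L (axis 1 1)) \<bullet> L (axis 2 1)"
 have k0: "k ~= 0" unfolding k_def by (rule tangent_plane_nondegenerate[OF L L0 u1 uL])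
 have det: "cross3 u (L y) \<bullet> L z = k * cross2 y z" for y z
 proof -
  have *: "L w = w $ 1 *\<^sub>R L (axis 1 1) + w $ 2 *\<^sub>R L (axis 2 1)" for w
  proof -
   have "w = w $ 1 *\<^sub>R axis 1 1 + w $ 2 *\<^sub>R axis 2 1" by (simp add: real2_eq_iff axis_def)
   then have "L w = L (w $ 1 *\<^sub>R axis 1 1 + w $ 2 *\<^sub>R axis 2 1)" by simp
   then show ?thesis by (simp only: linear_add[OF L] linear_cmul[OF L])
  qed
  show ?thesis unfolding *[of y] *[of z] k_def
   by (simp add: inner3 cross3_simps cross2_def)
 qed
 have D2lin: "linear (D2 \<Psi> x0 y)" for y
  using smooth_on_has_derivative[OF smooth_on_frechet[OF \<Psi>(4)] x0] has_derivative_linear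
  unfolding D2_def[abs_def] by blast
 have D2sym: "D2 \<Psi> x0 y z = D2 \<Psi> x0 z y" for y z by (rule D2_symmetric[OF \<Psi>(1,4) x0])
 define B where "B x y z = - (cross3 u (L x) \<bullet> D2 \<Psi> x0 y z) / k" for x y z
 have B1: "linear (%x. B x y z)" for y z
  by (rule linearI) (simp_all add: B_def linear_add[OF L] linear_cmul[OF L] cross_add_right cross_mult_right inner_add_left add_divide_distrib diff_divide_distrib)
 have B3: "linear (%z. B x y z)" for x y
  by (rule linearI) (simp_all add: B_def linear_add[OF D2lin] linear_cmul[OF D2lin] inner_add_right add_divide_distrib diff_divide_distrib)
 have B2: "linear (%y. B x y z)" for x z
  using B3[of x z] by (simp add: B_def D2sym[of z])
 have main: "\<exists>\<mu>>0. \<exists>z. path_equation a c p (\<mu> *\<^sub>R y) z \<and> cross2 (\<mu> *\<^sub>R y) z = \<mu>^3 * B y y y" if y: "y ~= 0" for y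
 proof -
  have Ly: "L y ~= 0" using L0 y by blast
  define \<mu> where "\<mu> = 1 / norm (L y)"
  have \<mu>: "\<mu> > 0" using Ly by (simp add: \<mu>_def)
  define w where "w = L (\<mu> *\<^sub>R y)"
  have wy: "w = \<mu> *\<^sub>R L y" by (simp add: w_def linear_cmul[OF L])
  have w: "norm w = 1" "u \<bullet> w = 0" using Ly uL by (simp_all add: wy \<mu>_def)
  obtain I \<kappa> where \<kappa>: "0 \<in> I" "oriented_path M (paths a) I \<kappa>" "\<kappa> 0 = p"
   "!!t. t \<in> I ==> snd c (\<kappa> t) \<in> \<Omega> \<and> \<Psi> (snd c (\<kappa> t)) = cos t *\<^sub>R u + sin t *\<^sub>R w"
   using \<Psi>(7)[OF w(1)] w(2) unfolding u_def x0_def by blast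
  have c': "chart_at M (\<kappa> 0) c" using c \<kappa>(3) by simp
  define x where "x s = snd c (\<kappa> s)" for s
  define x' where "x' s = vector_derivative x (at s)" for s
  obtain J where J: "open J" "0 \<in> J" "J \<subseteq> I" "smooth_on J x" "path_equation a c p (x' 0) (vector_derivative x' (at 0))"
   using oriented_path_equation[OF \<kappa>(2,1) c'] \<kappa>(3) unfolding x'_def[abs_def] x_def[abs_def] by metis
  have sx': "smooth_on J x'" unfolding x'_def[abs_def] by (rule smooth_on_vector_derivative[OF J(1,4)])
  have dx: "(x has_vector_derivative x' s) (at s)" if "s \<in> J" for s
   unfolding x'_def by (rule smooth_on_has_vector_derivative[OF J(4) that])
  define x'' where "x'' = vector_derivative x' (at 0)"
  have dx': "(x' has_vector_derivative x'') (at 0)"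
   unfolding x''_def by (rule smooth_on_has_vector_derivative[OF sx' J(2)])
  have x00: "x 0 = x0" by (simp add: x_def x0_def \<kappa>(3))
  have xs: "x s \<in> \<Omega>" "\<Psi> (x s) = cos s *\<^sub>R u + sin s *\<^sub>R w" if "s \<in> J" for s
   using \<kappa>(4)[of s] J(3) that by (auto simp: x_def)
  have v1: "fderiv \<Psi> (at (x s)) (x' s) = - sin s *\<^sub>R u + cos s *\<^sub>R w" if s: "s \<in> J" for s
  proof -
   have "((%s. \<Psi> (x s)) has_vector_derivative fderiv \<Psi> (at (x s)) (x' s)) (at s)"
    by (rule has_vector_derivative_chain[OF dx[OF s] smooth_on_has_derivative[OF \<Psi>(4) xs(1)[OF s]]])
   moreover have "((%s. cos s *\<^sub>R u + sin s *\<^sub>R w) has_vector_derivative (- sin s *\<^sub>R u + cos s *\<^sub>R w)) (at s)"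
    by (auto intro!: derivative_eq_intros)
   then have "((%s. \<Psi> (x s)) has_vector_derivative (- sin s *\<^sub>R u + cos s *\<^sub>R w)) (at s)"
    by (rule has_vector_derivative_transform_open[OF _ J(1) s]) (simp add: xs)
   ultimately show ?thesis by (rule vector_derivative_unique_at)
  qed
  have "L (x' 0) = w" using v1[OF J(2)] x00 by (simp add: L_def)
  then have "L (x' 0 - \<mu> *\<^sub>R y) = 0" by (simp add: linear_diff[OF L] w_def)
  then have x'0: "x' 0 = \<mu> *\<^sub>R y" using L0 by fastforce
  have "((%s. fderiv \<Psi> (at (x s)) (x' s)) has_vector_derivative (D2 \<Psi> (x 0) (x' 0) (x' 0) + fderiv \<Psi> (at (x 0)) x'')) (at 0)"
   by (rule frechet_apply_has_vector_derivative[OF \<Psi>(1,4) xs(1)[OF J(2)] dx[OF J(2)] dx'])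
  moreover have "((%s. - sin s *\<^sub>R u + cos s *\<^sub>R w) has_vector_derivative - u) (at 0)"
   by (auto intro!: derivative_eq_intros)
  then have "((%s. fderiv \<Psi> (at (x s)) (x' s)) has_vector_derivative - u) (at 0)"
   by (rule has_vector_derivative_transform_open[OF _ J(1,2)]) (simp add: v1)
  ultimately have "D2 \<Psi> (x 0) (x' 0) (x' 0) + fderiv \<Psi> (at (x 0)) x'' = - u"
   by (rule vector_derivative_unique_at)
  then have acc: "D2 \<Psi> x0 (x' 0) (x' 0) + L x'' = - u" by (simp add: x00 L_def)
  have "cross3 u (L (x' 0)) \<bullet> (- u) = 0" by (simp add: inner3 cross3_simps)
  then have "cross3 u (L (x' 0)) \<bullet> D2 \<Psi> x0 (x' 0) (x' 0) + k * cross2 (x' 0) x'' = 0"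
   unfolding acc[symmetric] by (simp add: inner_add_right det)
  then have "cross2 (x' 0) x'' = B (x' 0) (x' 0) (x' 0)" using k0 by (simp add: B_def field_simps)
  also have "\<dots> = \<mu>^3 * B y y y"
   unfolding x'0 linear_cmul[OF B1] linear_cmul[OF B2] linear_cmul[OF B3] by (simp add: power3_eq_cube)
  finally show ?thesis using J(5) \<mu> unfolding x'0 x''_def[symmetric] by blast
 qed
 show thesis by (rule that[OF B1 B2 B3 main])
qed

text \<open>
 At a point where \<open>A\<close> does not vanish, the unit circle of the tangent plane is parametrized by
 rotating a vector; comparing the path equation with the cubic form leads to
 \<open>cubic_fourier_mode\<close>.
\<close>

lemma flat_imp_cubic_or_zero:
 assumes flat: "flat_path_geometry M (paths a)" and "m \<ge> 2" and A: "degree_differential M g m A"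
  and a: "!!q. q \<in> unit_bundle M g ==> a q = Im (A (fst q) (snd q))"
 shows "m = 3 \<or> vanishes_identically M A"
proof (rule disjCI)
 assume "\<not> vanishes_identically M A"
 then obtain p v where pv: "p \<in> points M" "v \<in> tangent_space M p" "A p v ~= 0"
  unfolding vanishes_identically_def by blast
 have hom: "A p (complex_scale M g p z v) = z ^ m * A p v" if "p \<in> points M" "v \<in> tangent_space M p" for p v z
  using A that unfolding degree_differential_def by blast
 have v0: "v ~= zero_vec"
 proof
  assume v: "v = zero_vec"
  have "complex_scale M g p 0 v = v" by (simp add: complex_scale_def lincomb_def v zero_vec_def)
  then have "A p v = 0 ^ m * A p v" using hom[OF pv(1,2), of 0] by simp
  then show False using pv(3) assms(2) by (simp add: power_0_left)
 qed
 define q where "q = (p, scale_vec (1 / sqrt (g p v v)) v)"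
 have q: "q \<in> unit_bundle M g" unfolding q_def by (rule normalize_unit[OF pv(1,2) v0])
 define Z where "Z = A p (snd q)"
 have Z: "Z ~= 0"
 proof -
  have "Z = (of_real (1 / sqrt (g p v v))) ^ m * A p v"
   using hom[OF pv(1,2), of "of_real (1 / sqrt (g p v v))"]
   unfolding complex_scale_real[OF pv(2,1)] by (simp only: Z_def q_def snd_conv)
  then show ?thesis using pv(3) metric_pos[OF pv(1,2) v0] by simp
 qed
 define c where "c = (SOME c. chart_at M p c)"
 have c: "chart_at M p c" unfolding c_def by (rule chart_at_some[OF pv(1)])
 interpret pm: plane_metric "snd c ` fst c" "Gm c" by (rule plane_metric_full[OF chart_atD(1)[OF c]])
 define x0 where "x0 = snd c p"
 have x0: "x0 \<in> snd c ` fst c" using chart_atD[OF c] by (simp add: x0_def)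
 define y w where "y = snd q c" and "w = rotation_of (Gm c x0) (snd q c)"
 obtain B where B: "!!y z. linear (%x. B x y z)" "!!x z. linear (%y. B x y z)" "!!x y. linear (%z. B x y z)"
  "!!y. y ~= 0 ==> \<exists>\<mu>>0. \<exists>z. path_equation a c p (\<mu> *\<^sub>R y) z \<and> cross2 (\<mu> *\<^sub>R y) z = \<mu>^3 * B y y y"
  by (rule flat_acceleration_cubic[OF flat c], rule that)
 define s where "s = sqrt (det (Gm c x0))"
 have s: "s > 0" using pos_def_det[OF Gm_pos_def[OF c]] by (simp add: s_def x0_def)
 define C where "C x y z = s * (B x y z + cross2 x (\<Gamma> c x0 y z))" for x y z
 have C1: "C (\<alpha> *\<^sub>R x + \<beta> *\<^sub>R x') y z = \<alpha> * C x y z + \<beta> * C x' y z" for \<alpha> \<beta> x x' y z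
  unfolding C_def linear_add[OF B(1)] linear_cmul[OF B(1)] by (simp add: cross2_add cross2_scaleR algebra_simps)
 have C2: "C x (\<alpha> *\<^sub>R y + \<beta> *\<^sub>R y') z = \<alpha> * C x y z + \<beta> * C x y' z" for \<alpha> \<beta> x y y' z
  unfolding C_def linear_add[OF B(2)] linear_cmul[OF B(2)]
  by (simp add: cross2_add cross2_scaleR pm.christoffel_of_add1[OF x0] pm.christoffel_of_scale1[OF x0] algebra_simps)
 have C3: "C x y (\<alpha> *\<^sub>R z + \<beta> *\<^sub>R z') = \<alpha> * C x y z + \<beta> * C x y z'" for \<alpha> \<beta> x y z z'
  unfolding C_def linear_add[OF B(3)] linear_cmul[OF B(3)]
  by (simp add: cross2_add cross2_scaleR pm.christoffel_of_add2[OF x0] pm.christoffel_of_scale2[OF x0] algebra_simps)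
 have unit: "Im (A p (snd q')) = C (snd q' c) (snd q' c) (snd q' c)" if q': "q' \<in> unit_bundle M g" "fst q' = p" for q'
 proof -
  let ?y = "snd q' c"
  have c': "chart_at M (fst q') c" using c q'(2) by simp
  have "?y ~= 0" using unit_bundle_chart(2)[OF q'(1) c'] .
  then obtain \<mu> z where z: "\<mu> > 0" "path_equation a c p (\<mu> *\<^sub>R ?y) z" "cross2 (\<mu> *\<^sub>R ?y) z = \<mu>^3 * B ?y ?y ?y" using B(4) by blast
  have "\<mu>^3 * B ?y ?y ?y = \<mu>^3 * (a q' / s - cross2 ?y (\<Gamma> c x0 ?y ?y))"
   using path_equation_scaled[OF q'(1) c' z(1), of a z] z(2,3) q'(2) by (simp add: s_def x0_def)
  then have "B ?y ?y ?y = a q' / s - cross2 ?y (\<Gamma> c x0 ?y ?y)" using z(1) by simp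
  then show ?thesis using a[OF q'(1)] q'(2) s by (simp add: C_def field_simps)
 qed
 have pT: "snd q \<in> tangent_space M p" using ub.rep_tangent[OF q] by (simp add: q_def)
 note J = rotate_J[OF pv(1) pT]
 have circle: "Im (Z * cis (real m * \<theta>)) = C (cos \<theta> *\<^sub>R y + sin \<theta> *\<^sub>R w) (cos \<theta> *\<^sub>R y + sin \<theta> *\<^sub>R w) (cos \<theta> *\<^sub>R y + sin \<theta> *\<^sub>R w)" for \<theta>
 proof -
  define v' where "v' = complex_scale M g p (cis \<theta>) (snd q)"
  have v': "v' = lincomb (cos \<theta>) (snd q) (sin \<theta>) (rotate_J M g p (snd q))" by (simp add: v'_def complex_scale_def)
  have vT: "v' \<in> tangent_space M p" unfolding v' by (rule lincomb_tangent[OF pT J(1)])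
  have vc: "v' c = cos \<theta> *\<^sub>R y + sin \<theta> *\<^sub>R w"
   unfolding v' lincomb_def y_def w_def x0_def rotate_J_chart[OF pT c] ..
  have "g p v' v' = 1"
  proof -
   have n: "g p (snd q) (snd q) = 1" using q by (auto simp: unit_bundle_def q_def)
   have y1: "y \<bullet> (Gm c x0 *v y) = 1" using metric_in_chart[OF c pT pT] n by (simp add: y_def x0_def)
   note pd = Gm_pos_def[OF c, folded x0_def]
   have "y \<bullet> (Gm c x0 *v w) = 0" "w \<bullet> (Gm c x0 *v w) = 1" "w \<bullet> (Gm c x0 *v y) = 0"
    using rotation_of[OF pd, of y] y1 pos_def_sym[OF pd, of w y] by (simp_all add: w_def y_def)
   then show ?thesis
    using metric_in_chart[OF c vT vT] y1
    by (simp add: vc x0_def[symmetric] matrix_vector_right_distrib matrix_vector_mult_scaleR inner_add_left inner_add_right power2_eq_square[symmetric])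
  qed
  then have "(p, v') \<in> unit_bundle M g" using pv(1) vT by (simp add: unit_bundle_def)
  from unit[OF this] have "Im (A p v') = C (v' c) (v' c) (v' c)" by simp
  moreover have "A p v' = Z * cis (real m * \<theta>)"
   unfolding v'_def Z_def using hom[OF pv(1) pT, of "cis \<theta>"] unfolding Complex.DeMoivre by (simp only: mult.commute)
  ultimately show ?thesis by (simp add: vc)
 qed
 show "m = 3"
 proof (rule cubic_fourier_mode[OF _ assms(2) Z])
  fix \<theta>
  show "Im (Z * cis (real m * \<theta>)) = C y y y * cos \<theta> ^ 3 + (C y y w + C y w y + C w y y) * (cos \<theta>)\<^sup>2 * sin \<theta>
    + (C y w w + C w y w + C w w y) * cos \<theta> * (sin \<theta>)\<^sup>2 + C w w w * sin \<theta> ^ 3"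
   unfolding circle C1 C2 C3 by (simp add: power3_eq_cube power2_eq_square algebra_simps)
 qed
qed

end

section \<open>Flat linear systems of partial differential equations\<close>

definition seg_int :: "real \<Rightarrow> (real \<Rightarrow> 'e::banach) \<Rightarrow> real \<Rightarrow> 'e" where
 "seg_int a g x = (x - a) *\<^sub>R integral {0..1} (%s. g (a + s * (x - a)))"

lemma seg_mem: "a \<in> {l..h} ==> x \<in> {l..h} ==> s \<in> {0..1} ==> a + s * (x - a) \<in> {l..h::real}"
proof -
 assume "a \<in> {l..h}" "x \<in> {l..h}" "s \<in> {0..1}"
 then have "(1 - s) *\<^sub>R a + s *\<^sub>R x \<in> {l..h}" by (intro convexD convex_real_interval) auto
 then show ?thesis by (simp add: algebra_simps)
qed

lemma seg_int_eq_diff: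
 assumes f: "!!x. x \<in> {l..h} ==> (f has_vector_derivative g x) (at x within {l..h})"
  and "a \<in> {l..h}" "x \<in> {l..h}"
 shows "seg_int a g x = f x - f a"
proof -
 have "((%s. f (a + s * (x - a))) has_vector_derivative (x - a) *\<^sub>R g (a + s * (x - a))) (at s within {0..1})"
  if s: "s \<in> {0..1}" for s
 proof -
  have 1: "((%s. a + s * (x - a)) has_vector_derivative (x - a)) (at s within {0..1})"
   by (auto intro!: derivative_eq_intros)
  have "(f has_vector_derivative g (a + s * (x - a))) (at (a + s * (x - a)) within (%s. a + s * (x - a)) ` {0..1})"
   by (rule has_vector_derivative_within_subset[OF f]) (use seg_mem[OF assms(2,3)] s in auto)
  from vector_diff_chain_within[OF 1 this] show ?thesis by (simp add: comp_def)
 qed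
 from fundamental_theorem_of_calculus[OF zero_le_one this]
 have "integral {0..1} (%s. (x - a) *\<^sub>R g (a + s * (x - a))) = f x - f a"
  by (auto dest!: integral_unique)
 then show ?thesis by (simp add: seg_int_def)
qed

lemma seg_int_has_derivative:
 assumes "continuous_on {l..h} g" "a \<in> {l..h}" "x \<in> {l..h}"
 shows "(seg_int a g has_vector_derivative g x) (at x within {l..h})"
proof -
 obtain f where f: "!!x. x \<in> {l..h} ==> (f has_vector_derivative g x) (at x within {l..h})"
  by (rule antiderivative_continuous[OF assms(1)]) blast
 have "((%x. f x - f a) has_vector_derivative g x) (at x within {l..h})"
  using f[OF assms(3)] by (auto intro!: derivative_eq_intros)
 then show ?thesis
  by (rule has_vector_derivative_transform[OF assms(3), rotated]) (rule seg_int_eq_diff[OF f assms(2)])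
qed

lemma seg_continuous:
 fixes a x l h :: real
 assumes "continuous_on {l..h} g" "a \<in> {l..h}" "x \<in> {l..h}"
 shows "continuous_on {0..1} (%s. g (a + s * (x - a)))"
 by (rule continuous_on_compose2[OF assms(1)]) (use seg_mem[OF assms(2,3)] in \<open>auto intro!: continuous_intros\<close>)

lemma seg_int_bound:
 assumes "continuous_on {l..h} g" "a \<in> {l..h}" "x \<in> {l..h}" "!!y. y \<in> {l..h} ==> norm (g y) \<le> K"
 shows "norm (seg_int a g x) \<le> \<bar>x - a\<bar> * K"
proof -
 have "norm (integral {0..1} (%s. g (a + s * (x - a)))) \<le> K * (1 - 0)"
  by (rule integral_bound[OF _ seg_continuous[OF assms(1-3)]]) (use assms(4) seg_mem[OF assms(2,3)] in auto)
 then show ?thesis by (simp add: seg_int_def mult_left_mono)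
qed

lemma seg_int_diff:
 assumes "continuous_on {l..h} g" "continuous_on {l..h} f" "a \<in> {l..h}" "x \<in> {l..h}"
 shows "seg_int a g x - seg_int a f x = seg_int a (%y. g y - f y) x"
 using integral_diff[OF integrable_continuous_interval[OF seg_continuous[OF assms(1,3,4)]] integrable_continuous_interval[OF seg_continuous[OF assms(2,3,4)]]]
 by (simp add: seg_int_def scaleR_diff_right)

lemma seg_int_continuous_param:
 assumes f: "continuous_on (U \<times> {l..h}) f" and a: "a \<in> {l..h}"
 shows "continuous_on (U \<times> {l..h}) (%z. seg_int a (%t. f (fst z, t)) (snd z))"
proof -
 have "continuous_on ((U \<times> {l..h}) \<times> cbox 0 1) (%w. f (fst (fst w), a + snd w * (snd (fst w) - a)))"
  by (rule continuous_on_compose2[OF f]) (use seg_mem[OF a] in \<open>auto intro!: continuous_intros\<close>)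
 then have "continuous_on ((U \<times> {l..h}) \<times> cbox 0 1) (%(z, s). f (fst z, a + s * (snd z - a)))"
  by (simp add: case_prod_unfold)
 from integral_continuous_on_param[OF this] show ?thesis
  unfolding seg_int_def by (auto intro!: continuous_intros)
qed

lemma seg_int_derivative_param:
 fixes p :: "real \<Rightarrow> real \<Rightarrow> 'e::banach"
 assumes der: "!!s v. s \<in> {l..h} ==> v \<in> V ==> ((%v. p s v) has_vector_derivative p' s v) (at v within V)"
  and cont: "continuous_on ({l..h} \<times> V) (%z. p' (fst z) (snd z))"
  and "a \<in> {l..h}" "x \<in> {l..h}" "v \<in> V" "convex V" and pc: "!!v. v \<in> V ==> continuous_on {l..h} (%s. p s v)"
 shows "((%v. seg_int a (%s. p s v) x) has_vector_derivative seg_int a (%s. p' s v) x) (at v within V)"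
proof -
 have m: "a + s * (x - a) \<in> {l..h}" if "s \<in> {0..1}" for s using seg_mem[OF assms(3,4) that] .
 have "((%v. integral (cbox 0 1) (%s. p (a + s * (x - a)) v)) has_vector_derivative
   integral (cbox 0 1) (%s. p' (a + s * (x - a)) v)) (at v within V)"
 proof (rule leibniz_rule_vector_derivative[OF _ _ _ assms(5,6)])
  show "((%v. p (a + s * (x - a)) v) has_vector_derivative p' (a + s * (x - a)) v) (at v within V)"
   if "v \<in> V" "s \<in> cbox 0 1" for v s using der m that by simp
  show "(%s. p (a + s * (x - a)) v) integrable_on cbox 0 1" if "v \<in> V" for v
   unfolding box_real by (rule integrable_continuous_interval[OF seg_continuous[OF pc[OF that] assms(3,4)]])
  have "continuous_on (V \<times> cbox 0 1) (%w. p' (fst (a + snd w * (x - a), fst w)) (snd (a + snd w * (x - a), fst w)))"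
   by (rule continuous_on_compose2[OF cont]) (use m in \<open>auto intro!: continuous_intros\<close>)
  then show "continuous_on (V \<times> cbox 0 1) (%(v, s). p' (a + s * (x - a)) v)" by (simp add: case_prod_unfold)
 qed
 from has_vector_derivative_scaleR[OF DERIV_const this, of "x - a"]
 show ?thesis by (simp add: seg_int_def)
qed

locale flat_square =
 fixes act :: "'a::euclidean_space \<Rightarrow> 'e::euclidean_space \<Rightarrow> 'e"
  and P Q Pv Qu :: "real \<times> real \<Rightarrow> 'a" and u0 v0 r K :: real and e0 :: 'e
 assumes act: "bounded_bilinear act" and r: "r > 0" and K: "r * (2 * K) < 1" "r * (K + r * K) < 1" "K \<ge> 0"
  and cont: "continuous_on ({u0-r..u0+r} \<times> {v0-r..v0+r}) P" "continuous_on ({u0-r..u0+r} \<times> {v0-r..v0+r}) Q"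
   "continuous_on ({u0-r..u0+r} \<times> {v0-r..v0+r}) Pv" "continuous_on ({u0-r..u0+r} \<times> {v0-r..v0+r}) Qu"
  and Pv: "!!u v. u \<in> {u0-r..u0+r} ==> v \<in> {v0-r..v0+r} ==> ((%v. P (u, v)) has_vector_derivative Pv (u, v)) (at v within {v0-r..v0+r})"
  and Qu: "!!u v. u \<in> {u0-r..u0+r} ==> v \<in> {v0-r..v0+r} ==> ((%u. Q (u, v)) has_vector_derivative Qu (u, v)) (at u within {u0-r..u0+r})"
  and bound: "!!z e. z \<in> {u0-r..u0+r} \<times> {v0-r..v0+r} ==> norm (act (P z) e) \<le> K * norm e"
   "!!z e. z \<in> {u0-r..u0+r} \<times> {v0-r..v0+r} ==> norm (act (Q z) e) \<le> K * norm e"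
   "!!z e. z \<in> {u0-r..u0+r} \<times> {v0-r..v0+r} ==> norm (act (Qu z) e) \<le> K * norm e"
  and flat: "!!z e. z \<in> {u0-r..u0+r} \<times> {v0-r..v0+r} ==>
   act (Pv z) e + act (P z) (act (Q z) e) = act (Qu z) e + act (Q z) (act (P z) e)"
begin

interpretation act: bounded_bilinear act by (rule act)

abbreviation "U \<equiv> {u0-r..u0+r}"
abbreviation "V \<equiv> {v0-r..v0+r}"

lemma centre: "u0 \<in> U" "v0 \<in> V" using r by auto

lemma act_cont: "continuous_on S A ==> continuous_on S f ==> continuous_on S (%x. act (A x) (f x))"
 by (rule act.continuous_on)

definition step :: "(real \<times> real \<Rightarrow> 'e) \<Rightarrow> real \<times> real \<Rightarrow> 'e" where
 "step f z = e0 + seg_int u0 (%s. act (P (s, v0)) (f (s, v0))) (fst z) + seg_int v0 (%t. act (Q (fst z, t)) (f (fst z, t))) (snd z)"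

lemma slice:
 "continuous_on (U \<times> V) A ==> v \<in> V ==> continuous_on U (%s. A (s, v))"
 "continuous_on (U \<times> V) A ==> u \<in> U ==> continuous_on V (%t. A (u, t))"
 by (rule continuous_on_compose2, assumption, auto intro!: continuous_intros)+

lemma actf:
 assumes "continuous_on (U \<times> V) f"
 shows "continuous_on (U \<times> V) (%z. act (P z) (f z))" "continuous_on (U \<times> V) (%z. act (Q z) (f z))" "continuous_on (U \<times> V) (%z. act (Qu z) (f z))"
  "continuous_on (U \<times> V) (%z. act (Pv z) (f z))"
 using assms cont by (auto intro!: act_cont)

lemma step_continuous:
 assumes "continuous_on (U \<times> V) f"
 shows "continuous_on (U \<times> V) (step f)"
proof -
 have 1: "continuous_on U (seg_int u0 (%s. act (P (s, v0)) (f (s, v0))))"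
  by (rule continuous_on_vector_derivative)
   (rule seg_int_has_derivative[OF slice(1)[OF actf(1)[OF assms] centre(2)] centre(1)])
 have "continuous_on (U \<times> V) (%z. seg_int u0 (%s. act (P (s, v0)) (f (s, v0))) (fst z))"
  by (rule continuous_on_compose2[OF 1]) (auto intro!: continuous_intros)
 then show ?thesis
  unfolding step_def[abs_def]
  by (intro continuous_intros seg_int_continuous_param[OF actf(2)[OF assms] centre(2)])
qed

lemma step_contraction:
 assumes f: "continuous_on (U \<times> V) f" and h: "continuous_on (U \<times> V) h" and z: "z \<in> U \<times> V"
  and d: "!!z. z \<in> U \<times> V ==> norm (f z - h z) \<le> d"
 shows "norm (step f z - step h z) \<le> r * (2 * K) * d"
proof -
 have d0: "d \<ge> 0" using d[OF z] norm_ge_zero order_trans by blast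
 have zz: "fst z \<in> U" "snd z \<in> V" using z by auto
 have fh: "continuous_on (U \<times> V) (%z. f z - h z)" using f h by (intro continuous_intros)
 have "step f z - step h z = seg_int u0 (%s. act (P (s, v0)) (f (s, v0)) - act (P (s, v0)) (h (s, v0))) (fst z)
  + seg_int v0 (%t. act (Q (fst z, t)) (f (fst z, t)) - act (Q (fst z, t)) (h (fst z, t))) (snd z)"
  unfolding step_def
   seg_int_diff[OF slice(1)[OF actf(1)[OF f] centre(2)] slice(1)[OF actf(1)[OF h] centre(2)] centre(1) zz(1), symmetric]
   seg_int_diff[OF slice(2)[OF actf(2)[OF f] zz(1)] slice(2)[OF actf(2)[OF h] zz(1)] centre(2) zz(2), symmetric]
  by simp
 also have "\<dots> = seg_int u0 (%s. act (P (s, v0)) (f (s, v0) - h (s, v0))) (fst z)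
  + seg_int v0 (%t. act (Q (fst z, t)) (f (fst z, t) - h (fst z, t))) (snd z)"
  by (simp add: act.diff_right)
 finally have eq: "step f z - step h z = \<dots>" .
 have b: "norm (act (P z) (f z - h z)) \<le> K * d" "norm (act (Q z) (f z - h z)) \<le> K * d" if "z \<in> U \<times> V" for z
  using bound(1,2)[OF that, of "f z - h z"] d[OF that] K(3) by (meson mult_left_mono order_trans)+
 have "norm (seg_int u0 (%s. act (P (s, v0)) (f (s, v0) - h (s, v0))) (fst z)) \<le> \<bar>fst z - u0\<bar> * (K * d)"
  by (rule seg_int_bound[OF slice(1)[OF actf(1)[OF fh] centre(2)] centre(1) zz(1)]) (use b centre in auto)
 moreover have "norm (seg_int v0 (%t. act (Q (fst z, t)) (f (fst z, t) - h (fst z, t))) (snd z)) \<le> \<bar>snd z - v0\<bar> * (K * d)"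
  by (rule seg_int_bound[OF slice(2)[OF actf(2)[OF fh] zz(1)] centre(2) zz(2)]) (use b zz in auto)
 moreover have "\<bar>fst z - u0\<bar> * (K * d) \<le> r * (K * d)" "\<bar>snd z - v0\<bar> * (K * d) \<le> r * (K * d)"
  using zz d0 K(3) by (auto intro!: mult_right_mono)
 ultimately have "norm (step f z - step h z) \<le> r * (K * d) + r * (K * d)"
  unfolding eq by (smt (verit) norm_triangle_ineq)
 then show ?thesis by (simp add: algebra_simps)
qed

definition clip :: "real \<times> real \<Rightarrow> real \<times> real" where
 "clip z = (max (u0 - r) (min (u0 + r) (fst z)), max (v0 - r) (min (v0 + r) (snd z)))"

lemma clip: "clip z \<in> U \<times> V" "z \<in> U \<times> V ==> clip z = z" "continuous_on S clip"
 using r by (auto simp: clip_def prod_eq_iff intro!: continuous_intros)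

lemma fixed_point: "\<exists>F. continuous_on (U \<times> V) F \<and> (\<forall>z\<in>U \<times> V. F z = step F z)"
proof -
 define T where "T F = Bcontfun (%z. step (apply_bcontfun F) (clip z))" for F :: "(real \<times> real) \<Rightarrow>\<^sub>C 'e"
 have T: "apply_bcontfun (T F) z = step (apply_bcontfun F) (clip z)" for F z
 proof -
  have c: "continuous_on (U \<times> V) (step (apply_bcontfun F))" by (rule step_continuous) simp
  have "continuous_on UNIV (%z. step (apply_bcontfun F) (clip z))"
   by (rule continuous_on_compose2[OF c clip(3)]) (use clip(1) in blast)
  moreover have "bounded (range (%z. step (apply_bcontfun F) (clip z)))"
  proof (rule bounded_subset)
   show "bounded (step (apply_bcontfun F) ` (U \<times> V))"
    by (rule compact_imp_bounded[OF compact_continuous_image[OF c]]) (intro compact_Times compact_Icc)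
   show "range (%z. step (apply_bcontfun F) (clip z)) \<subseteq> step (apply_bcontfun F) ` (U \<times> V)"
    using clip(1) by blast
  qed
  ultimately show ?thesis unfolding T_def by (subst Bcontfun_inverse) (auto simp: bcontfun_def)
 qed
 have "\<exists>!F. T F = F"
 proof (rule banach_fix_type[OF _ K(1)], use K(3) r in simp, intro allI)
  fix F G :: "(real \<times> real) \<Rightarrow>\<^sub>C 'e"
  show "dist (T F) (T G) \<le> r * (2 * K) * dist F G"
  proof (rule dist_bound)
   fix z
   show "dist (apply_bcontfun (T F) z) (apply_bcontfun (T G) z) \<le> r * (2 * K) * dist F G"
    unfolding T dist_norm
    by (rule step_contraction[OF _ _ clip(1)]) (use dist_bounded[of F _ G] in \<open>auto simp: dist_norm\<close>)
  qed
 qed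
 then obtain F where F: "T F = F" by blast
 show ?thesis
 proof (intro exI[of _ "apply_bcontfun F"] conjI ballI)
  fix z assume "z \<in> U \<times> V"
  then show "apply_bcontfun F z = step (apply_bcontfun F) z" using T[of F z] F clip(2)[of z] by simp
 qed simp
qed

text \<open>
 The fixed point satisfies the equation in the second variable by construction, the equation in
 the first one only along the central line.  Comparing it with the solution \<open>H\<close> of the equation
 in the first variable, flatness turns into a linear integral equation for the difference.
\<close>

lemma solution: "\<exists>F. continuous_on (U \<times> V) F \<and> F (u0, v0) = e0 \<and>
 (\<forall>u\<in>U. \<forall>v\<in>V. ((%u. F (u, v)) has_vector_derivative act (P (u, v)) (F (u, v))) (at u within U)) \<and>
 (\<forall>u\<in>U. \<forall>v\<in>V. ((%v. F (u, v)) has_vector_derivative act (Q (u, v)) (F (u, v))) (at v within V))"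
proof -
 obtain F where F: "continuous_on (U \<times> V) F" and fp: "!!z. z \<in> U \<times> V ==> F z = step F z" using fixed_point by blast
 have s0: "seg_int a f a = 0" for a and f :: "real \<Rightarrow> 'e" by (simp add: seg_int_def)
 have Fu: "F (u, v0) = e0 + seg_int u0 (%s. act (P (s, v0)) (F (s, v0))) u" if "u \<in> U" for u
  using fp[of "(u, v0)"] that centre by (simp add: step_def s0)
 have Fuv: "F (u, v) = F (u, v0) + seg_int v0 (%t. act (Q (u, t)) (F (u, t))) v" if "u \<in> U" "v \<in> V" for u v
  using fp[of "(u, v)"] Fu[of u] that by (simp add: step_def)
 have Q: "((%v. F (u, v)) has_vector_derivative act (Q (u, v)) (F (u, v))) (at v within V)" if "u \<in> U" "v \<in> V" for u v
 proof (rule has_vector_derivative_transform[OF that(2) Fuv[OF that(1)]])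
  show "((%v. F (u, v0) + seg_int v0 (%t. act (Q (u, t)) (F (u, t))) v) has_vector_derivative act (Q (u, v)) (F (u, v))) (at v within V)"
   using has_vector_derivative_add[OF has_vector_derivative_const seg_int_has_derivative[OF slice(2)[OF actf(2)[OF F] that(1)] centre(2) that(2)]] by simp
 qed
 define H where "H u v = F (u0, v) + seg_int u0 (%s. act (P (s, v)) (F (s, v))) u" for u v
 have Hu: "((%u. H u v) has_vector_derivative act (P (u, v)) (F (u, v))) (at u within U)" if "u \<in> U" "v \<in> V" for u v
  unfolding H_def
  using has_vector_derivative_add[OF has_vector_derivative_const seg_int_has_derivative[OF slice(1)[OF actf(1)[OF F] that(2)] centre(1) that(1)]] by simp
 define p' where "p' s v = act (Qu (s, v)) (F (s, v)) + act (Q (s, v)) (act (P (s, v)) (F (s, v)))" for s v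
 have pd: "((%v. act (P (s, v)) (F (s, v))) has_vector_derivative p' s v) (at v within V)" if "s \<in> U" "v \<in> V" for s v
 proof -
  have "((%v. act (P (s, v)) (F (s, v))) has_vector_derivative act (P (s, v)) (act (Q (s, v)) (F (s, v))) + act (Pv (s, v)) (F (s, v))) (at v within V)"
   by (rule act.has_vector_derivative[OF Pv[OF that] Q[OF that]])
  then show ?thesis using flat[of "(s, v)" "F (s, v)"] that by (simp add: p'_def add.commute)
 qed
 have cp': "continuous_on (U \<times> V) (%z. p' (fst z) (snd z))"
  unfolding p'_def using cont F by (auto intro!: continuous_intros act_cont)
 have Hc: "continuous_on (U \<times> V) (%z. H (fst z) (snd z))"
 proof -
  have sw: "continuous_on (V \<times> U) (%z. act (P (snd z, fst z)) (F (snd z, fst z)))"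
   by (rule continuous_on_compose2[OF actf(1)[OF F]]) (auto intro!: continuous_intros)
  have "continuous_on (U \<times> V) (%w. seg_int u0 (%t. act (P (t, fst (snd w, fst w))) (F (t, fst (snd w, fst w)))) (snd (snd w, fst w)))"
   by (rule continuous_on_compose2[OF seg_int_continuous_param[OF sw centre(1), unfolded fst_conv snd_conv]])
    (auto intro!: continuous_intros)
  then have "continuous_on (U \<times> V) (%w. seg_int u0 (%t. act (P (t, snd w)) (F (t, snd w))) (fst w))" by simp
  moreover have "continuous_on (U \<times> V) (%w. F (u0, snd w))"
   by (rule continuous_on_compose2[OF F]) (use centre in \<open>auto intro!: continuous_intros\<close>)
  ultimately show ?thesis unfolding H_def by (intro continuous_intros)
 qed
 have Hv: "((%v. H u v) has_vector_derivative (act (Q (u, v)) (H u v) + seg_int u0 (%s. act (Qu (s, v)) (F (s, v) - H s v)) u)) (at v within V)"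
  if uv: "u \<in> U" "v \<in> V" for u v
 proof -
  have "((%v. H u v) has_vector_derivative (act (Q (u0, v)) (F (u0, v)) + seg_int u0 (%s. p' s v) u)) (at v within V)"
   unfolding H_def
   by (intro has_vector_derivative_add Q[OF centre(1) uv(2)] seg_int_derivative_param[OF pd cp' centre(1) uv] slice(1)[OF actf(1)[OF F]]) auto
  moreover have "seg_int u0 (%s. p' s v) u = act (Q (u, v)) (H u v) - act (Q (u0, v)) (F (u0, v)) + seg_int u0 (%s. act (Qu (s, v)) (F (s, v) - H s v)) u"
  proof -
   let ?k = "%s. act (Q (s, v)) (act (P (s, v)) (F (s, v))) + act (Qu (s, v)) (H s v)"
   have "((%s. act (Q (s, v)) (H s v)) has_vector_derivative ?k s) (at s within U)" if "s \<in> U" for s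
    by (rule act.has_vector_derivative[OF Qu[OF that uv(2)] Hu[OF that uv(2)]])
   from seg_int_eq_diff[OF this centre(1) uv(1)]
   have 1: "seg_int u0 ?k u = act (Q (u, v)) (H u v) - act (Q (u0, v)) (F (u0, v))" by (simp add: H_def s0)
   have ck: "continuous_on U ?k" and cp: "continuous_on U (%s. p' s v)"
    using slice(1)[OF actf(3)[OF Hc] uv(2)] slice(1)[OF actf(2)[OF actf(1)[OF F]] uv(2)] slice(1)[OF cp' uv(2)]
    by (auto intro!: continuous_intros)
   have "seg_int u0 (%s. p' s v) u - seg_int u0 ?k u = seg_int u0 (%s. act (Qu (s, v)) (F (s, v) - H s v)) u"
    unfolding seg_int_diff[OF cp ck centre(1) uv(1)] by (simp add: p'_def act.diff_right)
   then show ?thesis using 1 by (simp add: algebra_simps)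
  qed
  ultimately show ?thesis by simp
 qed
 define D where "D z = F z - H (fst z) (snd z)" for z
 have Dc: "continuous_on (U \<times> V) D" unfolding D_def[abs_def] by (intro continuous_intros F Hc)
 have "compact (U \<times> V)" "U \<times> V ~= {}" using centre by (auto intro!: compact_Times)
 from continuous_attains_sup[OF this continuous_on_norm[OF Dc]]
 obtain zm where zm: "zm \<in> U \<times> V" "!!z. z \<in> U \<times> V ==> norm (D z) \<le> norm (D zm)" by blast
 define d where "d = norm (D zm)"
 define k where "k u v = act (Q (u, v)) (D (u, v)) - seg_int u0 (%s. act (Qu (s, v)) (D (s, v))) u" for u v
 have Dv: "((%v. D (u, v)) has_vector_derivative k u v) (at v within V)" if "u \<in> U" "v \<in> V" for u v
  unfolding D_def fst_conv snd_conv k_def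
  using has_vector_derivative_diff[OF Q[OF that] Hv[OF that]] by (simp add: act.diff_right algebra_simps)
 have kb: "norm (k u v) \<le> (K + r * K) * d" if uv: "u \<in> U" "v \<in> V" for u v
 proof -
  have b: "norm (act (Q z) (D z)) \<le> K * d" "norm (act (Qu z) (D z)) \<le> K * d" if "z \<in> U \<times> V" for z
   using bound(2,3)[OF that, of "D z"] zm(2)[OF that] K(3) unfolding d_def by (meson mult_left_mono order_trans)+
  have "norm (seg_int u0 (%s. act (Qu (s, v)) (D (s, v))) u) \<le> \<bar>u - u0\<bar> * (K * d)"
   by (rule seg_int_bound[OF slice(1)[OF actf(3)[OF Dc] uv(2)] centre(1) uv(1)]) (use b uv in auto)
  also have "\<dots> \<le> r * (K * d)" using uv K(3) by (intro mult_right_mono) (auto simp: d_def)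
  finally have 1: "norm (seg_int u0 (%s. act (Qu (s, v)) (D (s, v))) u) \<le> r * (K * d)" .
  have "norm (k u v) \<le> norm (act (Q (u, v)) (D (u, v))) + norm (seg_int u0 (%s. act (Qu (s, v)) (D (s, v))) u)"
   unfolding k_def by (rule norm_triangle_ineq4)
  then have "norm (k u v) \<le> K * d + r * (K * d)" using b(1)[OF SigmaI[OF uv]] 1 by linarith
  then show ?thesis by (simp add: algebra_simps)
 qed
 have Du0: "D (u, v0) = 0" if "u \<in> U" for u
  using Fu[OF that] Fu[OF centre(1)] by (simp add: D_def H_def s0)
 have kc: "continuous_on V (%v. k u v)" if "u \<in> U" for u
 proof -
  have sw: "continuous_on (V \<times> U) (%z. act (Qu (snd z, fst z)) (D (snd z, fst z)))"
   by (rule continuous_on_compose2[OF actf(3)[OF Dc]]) (auto intro!: continuous_intros)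
  have "continuous_on V (%v. seg_int u0 (%t. act (Qu (t, fst (v, u))) (D (t, fst (v, u)))) (snd (v, u)))"
   by (rule continuous_on_compose2[OF seg_int_continuous_param[OF sw centre(1), unfolded fst_conv snd_conv]])
    (use that in \<open>auto intro!: continuous_intros\<close>)
  then have "continuous_on V (%v. seg_int u0 (%t. act (Qu (t, v)) (D (t, v))) u)" by simp
  then show ?thesis unfolding k_def using slice(2)[OF actf(2)[OF Dc] that] by (intro continuous_intros)
 qed
 have "norm (D (u, v)) \<le> r * (K + r * K) * d" if uv: "u \<in> U" "v \<in> V" for u v
 proof -
  have "D (u, v) = seg_int v0 (k u) v"
   using seg_int_eq_diff[OF Dv[OF uv(1)] centre(2) uv(2)] Du0[OF uv(1)] by simp
  then have "norm (D (u, v)) \<le> \<bar>v - v0\<bar> * ((K + r * K) * d)"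
   using seg_int_bound[OF kc[OF uv(1)] centre(2) uv(2) kb[OF uv(1)]] by simp
  also have "\<dots> \<le> r * ((K + r * K) * d)" using uv K(3) r by (intro mult_right_mono) (auto simp: d_def)
  finally show ?thesis by (simp add: algebra_simps)
 qed
 from this[of "fst zm" "snd zm"] zm(1) have "d \<le> r * (K + r * K) * d" by (auto simp: d_def)
 then have "d \<le> 0" using K(2) by (smt (verit) mult_less_cancel_right2 mult.commute)
 then have D0: "D z = 0" if "z \<in> U \<times> V" for z using zm(2)[OF that] by (simp add: d_def)
 have FH: "F (u, v) = H u v" if "u \<in> U" "v \<in> V" for u v using D0[of "(u, v)"] that by (simp add: D_def)
 show ?thesis
 proof (intro exI[of _ F] conjI ballI)
  show "F (u0, v0) = e0" using Fu[OF centre(1)] by (simp add: s0)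
  show "((%u. F (u, v)) has_vector_derivative act (P (u, v)) (F (u, v))) (at u within U)" if "u \<in> U" "v \<in> V" for u v
   by (rule has_vector_derivative_transform[OF that(1) _ Hu[OF that]]) (rule FH, assumption, rule that(2))
 qed (use F Q in auto)
qed

end

lemma bounded_bilinear_matrix_mult: "bounded_bilinear ((**) :: real^3^3 \<Rightarrow> real^3^3 \<Rightarrow> real^3^3)"
 by (rule bilinear_conv_bounded_bilinear[THEN iffD1])
  (auto simp: bilinear_def vec_eq_iff matrix_matrix_mult_def sum.distrib sum_distrib_left algebra_simps intro!: linearI)

lemma axis_comb: "a *\<^sub>R axis 1 1 + b *\<^sub>R axis 2 1 = (vector [a, b] :: real^2)"
 by (simp add: real2_eq_iff axis_def)

lemma frechet_derivative_axis:
 fixes f :: "real^2 \<Rightarrow> 'b::real_normed_vector"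
 assumes "f differentiable (at x)"
 shows "fderiv f (at x) h = h $ 1 *\<^sub>R fderiv f (at x) (axis 1 1) + h $ 2 *\<^sub>R fderiv f (at x) (axis 2 1)"
proof -
 have l: "linear (fderiv f (at x))" using assms linear_frechet_derivative by blast
 have "h = h $ 1 *\<^sub>R axis 1 1 + h $ 2 *\<^sub>R axis 2 1" by (simp add: real2_eq_iff axis_def)
 then have "fderiv f (at x) h = fderiv f (at x) (h $ 1 *\<^sub>R axis 1 1 + h $ 2 *\<^sub>R axis 2 1)" by simp
 then show ?thesis by (simp only: linear_add[OF l] linear_cmul[OF l])
qed

lemma square_in_open:
 fixes x0 :: "real^2"
 assumes "open \<Omega>" "x0 \<in> \<Omega>"
 obtains R where "R > 0" "!!u v. u \<in> {x0$1-R..x0$1+R} ==> v \<in> {x0$2-R..x0$2+R} ==> vector [u, v] \<in> \<Omega>"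
proof -
 obtain e where e: "e > 0" "ball x0 e \<subseteq> \<Omega>" using assms open_contains_ball by blast
 show thesis
 proof (rule that[of "e / 3"])
  show "e / 3 > 0" using e by simp
  fix u v assume a: "u \<in> {x0$1-e/3..x0$1+e/3}" "v \<in> {x0$2-e/3..x0$2+e/3}"
  have "norm (vector [u, v] - x0) \<le> \<bar>(vector [u, v] - x0) $ 1\<bar> + \<bar>(vector [u, v] - x0) $ 2\<bar>"
   using norm_le_l1_cart[of "vector [u, v] - x0"] by (simp add: sum_2)
  also have "\<dots> < e" using a e by auto
  finally show "vector [u, v] \<in> \<Omega>" using e(2) by (auto simp: dist_norm norm_minus_commute)
 qed
qed

text \<open>The Frobenius theorem for a flat connection on a trivial bundle over a plane domain.\<close>

theorem flat_system_solution:
 fixes P Q :: "real^2 \<Rightarrow> real^3^3"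
 assumes \<Omega>: "open \<Omega>" "x0 \<in> \<Omega>" and P: "smooth_on \<Omega> P" and Q: "smooth_on \<Omega> Q"
  and flat: "!!x. x \<in> \<Omega> ==> fderiv P (at x) (axis 2 1) + P x ** Q x = fderiv Q (at x) (axis 1 1) + Q x ** P x"
 obtains S \<Phi> where "open S" "x0 \<in> S" "S \<subseteq> \<Omega>" "smooth_on S \<Phi>" "\<Phi> x0 = mat 1"
  "!!x. x \<in> S ==> (\<Phi> has_derivative (%h. h $ 1 *\<^sub>R (P x ** \<Phi> x) + h $ 2 *\<^sub>R (Q x ** \<Phi> x))) (at x)"
proof -
 define V2 where "V2 z = (vector [fst z, snd z] :: real^2)" for z :: "real \<times> real"
 obtain R where R: "R > 0" "!!u v. u \<in> {x0$1-R..x0$1+R} ==> v \<in> {x0$2-R..x0$2+R} ==> vector [u, v] \<in> \<Omega>"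
  by (rule square_in_open[OF \<Omega>]) blast
 let ?B = "{x0$1-R..x0$1+R} \<times> {x0$2-R..x0$2+R}"
 define Pv where "Pv z = fderiv P (at (V2 z)) (axis 2 1)" for z
 define Qu where "Qu z = fderiv Q (at (V2 z)) (axis 1 1)" for z
 have V2c: "continuous_on S V2" for S
 proof -
  have "V2 = (%z. fst z *\<^sub>R axis 1 1 + snd z *\<^sub>R axis 2 1)" by (rule ext) (simp add: V2_def real2_eq_iff axis_def)
  then show ?thesis by (simp only:) (intro continuous_intros)
 qed
 have V2m: "V2 ` ?B \<subseteq> \<Omega>" using R(2) by (auto simp: V2_def)
 have comp: "continuous_on ?B (%z. f (V2 z))" if "continuous_on \<Omega> f" for f :: "real^2 \<Rightarrow> real^3^3"
  by (rule continuous_on_compose2[OF that V2c V2m])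
 have cont: "continuous_on ?B (%z. P (V2 z))" "continuous_on ?B (%z. Q (V2 z))" "continuous_on ?B Pv" "continuous_on ?B Qu"
  unfolding Pv_def[abs_def] Qu_def[abs_def] by (intro comp smooth_on_continuous_on P Q smooth_on_frechet)+
 obtain k where k': "k > 0 \<and> (\<forall>(A :: real^3^3) (e :: real^3^3). norm (A ** e) \<le> norm A * norm e * k)"
  using bounded_bilinear.pos_bounded[OF bounded_bilinear_matrix_mult] ..
 note k = conjunct1[OF k'] conjunct2[OF k', rule_format]
 have cB: "compact ?B" by (intro compact_Times compact_Icc)
 have bd: "\<exists>b. \<forall>z\<in>?B. norm (f z) \<le> b" if "continuous_on ?B f" for f :: "real \<times> real \<Rightarrow> real^3^3"
  using compact_imp_bounded[OF compact_continuous_image[OF that cB]] by (auto simp: bounded_iff)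
 obtain b1 where b1: "\<forall>z\<in>?B. norm (P (V2 z)) \<le> b1" using bd[OF cont(1)] ..
 obtain b2 where b2: "\<forall>z\<in>?B. norm (Q (V2 z)) \<le> b2" using bd[OF cont(2)] ..
 obtain b3 where b3: "\<forall>z\<in>?B. norm (Qu z) \<le> b3" using bd[OF cont(4)] ..
 note b = b1[rule_format] b2[rule_format] b3[rule_format]
 define K where "K = (\<bar>b1\<bar> + \<bar>b2\<bar> + \<bar>b3\<bar>) * k"
 have K0: "K \<ge> 0" using k by (simp add: K_def)
 have Kb: "norm (A ** e) \<le> K * norm e" if "norm A \<le> b1 \<or> norm A \<le> b2 \<or> norm A \<le> b3" for A e :: "real^3^3"
 proof -
  have "norm A \<le> \<bar>b1\<bar> + \<bar>b2\<bar> + \<bar>b3\<bar>" using that by auto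
  then have "norm A * (norm e * k) \<le> (\<bar>b1\<bar> + \<bar>b2\<bar> + \<bar>b3\<bar>) * (norm e * k)"
   using k(1) by (intro mult_right_mono) auto
  then show ?thesis using k(2)[of A e] by (simp add: K_def mult_ac)
 qed
 define r where "r = min (min R 1) (1 / (4 * (K + 1)))"
 have r: "r > 0" "r \<le> R" "r \<le> 1" "r * (4 * (K + 1)) \<le> 1"
 proof -
  show "r > 0" "r \<le> R" "r \<le> 1" using R(1) K0 by (auto simp: r_def)
  have "r \<le> 1 / (4 * (K + 1))" by (simp add: r_def)
  then show "r * (4 * (K + 1)) \<le> 1" using K0 by (simp add: pos_le_divide_eq)
 qed
 have rK: "r * (2 * K) < 1" "r * (K + r * K) < 1"
 proof -
  have "r * K \<ge> 0" using r K0 by simp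
  then show 1: "r * (2 * K) < 1" using r(1,4) by (simp add: algebra_simps)
  have "r * (r * K) \<le> 1 * (r * K)" by (rule mult_right_mono[OF r(3) \<open>r * K \<ge> 0\<close>])
  then show "r * (K + r * K) < 1" using 1 by (simp add: algebra_simps)
 qed
 let ?U = "{x0$1-r..x0$1+r}" and ?V = "{x0$2-r..x0$2+r}"
 have sub: "?U \<times> ?V \<subseteq> ?B" using r by auto
 have mem: "V2 z \<in> \<Omega>" if "z \<in> ?U \<times> ?V" for z using that sub V2m by auto
 interpret fs: flat_square "(**)" "%z. P (V2 z)" "%z. Q (V2 z)" Pv Qu "x0$1" "x0$2" r K "mat 1 :: real^3^3"
 proof (rule flat_square.intro)
  show "bounded_bilinear ((**) :: real^3^3 \<Rightarrow> real^3^3 \<Rightarrow> real^3^3)" by (rule bounded_bilinear_matrix_mult)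
  show "continuous_on (?U \<times> ?V) (%z. P (V2 z))" "continuous_on (?U \<times> ?V) (%z. Q (V2 z))"
   "continuous_on (?U \<times> ?V) Pv" "continuous_on (?U \<times> ?V) Qu"
   using cont sub continuous_on_subset by blast+
  fix u v assume uv: "u \<in> ?U" "v \<in> ?V"
  have m: "V2 (u, v) \<in> \<Omega>" using mem uv by auto
  have "((%v. V2 (u, v)) has_vector_derivative axis 2 1) (at v within ?V)"
   "((%u. V2 (u, v)) has_vector_derivative axis 1 1) (at u within ?U)"
  proof -
   have 1: "V2 (u, v) = u *\<^sub>R axis 1 1 + v *\<^sub>R axis 2 1" for u v by (simp add: V2_def real2_eq_iff axis_def)
   show "((%v. V2 (u, v)) has_vector_derivative axis 2 1) (at v within ?V)"
    "((%u. V2 (u, v)) has_vector_derivative axis 1 1) (at u within ?U)"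
    unfolding 1 by (auto intro!: derivative_eq_intros)
  qed
  note d = this
  have ch: "((%s. f (x s)) has_vector_derivative fderiv f (at (x s)) x') (at s within T)"
   if "smooth_on \<Omega> f" "x s \<in> \<Omega>" "(x has_vector_derivative x') (at s within T)" for f :: "real^2 \<Rightarrow> real^3^3" and x x' s T
  proof -
   have "((%s. f (x s)) has_derivative (%h. fderiv f (at (x s)) (h *\<^sub>R x'))) (at s within T)"
    using has_derivative_compose[OF that(3)[unfolded has_vector_derivative_def] smooth_on_has_derivative[OF that(1,2)]] .
   then show ?thesis
    unfolding has_vector_derivative_def using has_derivative_linear[OF smooth_on_has_derivative[OF that(1,2)]] by (simp add: linear_cmul)
  qed
  show "((%v. P (V2 (u, v))) has_vector_derivative Pv (u, v)) (at v within ?V)"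
   unfolding Pv_def by (rule ch[OF P m d(1)])
  show "((%u. Q (V2 (u, v))) has_vector_derivative Qu (u, v)) (at u within ?U)"
   unfolding Qu_def by (rule ch[OF Q m d(2)])
 next
  fix z and e :: "real^3^3" assume z: "z \<in> ?U \<times> ?V"
  show "norm (P (V2 z) ** e) \<le> K * norm e" "norm (Q (V2 z) ** e) \<le> K * norm e" "norm (Qu z ** e) \<le> K * norm e"
   using Kb[of "P (V2 z)" e] Kb[of "Q (V2 z)" e] Kb[of "Qu z" e] b[OF subsetD[OF sub z]] by auto
  have "Pv z + P (V2 z) ** Q (V2 z) = Qu z + Q (V2 z) ** P (V2 z)" unfolding Pv_def Qu_def by (rule flat[OF mem[OF z]])
  then have "(Pv z + P (V2 z) ** Q (V2 z)) ** e = (Qu z + Q (V2 z) ** P (V2 z)) ** e" by simp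
  then show "Pv z ** e + P (V2 z) ** (Q (V2 z) ** e) = Qu z ** e + Q (V2 z) ** (P (V2 z) ** e)"
   by (simp only: bounded_bilinear.add_left[OF bounded_bilinear_matrix_mult] matrix_mul_assoc)
 qed (use r rK K0 in auto)
 obtain F where F: "continuous_on (?U \<times> ?V) F" "F (x0$1, x0$2) = mat 1"
  "!!u v. u \<in> ?U ==> v \<in> ?V ==> ((%u. F (u, v)) has_vector_derivative P (V2 (u, v)) ** F (u, v)) (at u within ?U)"
  "!!u v. u \<in> ?U ==> v \<in> ?V ==> ((%v. F (u, v)) has_vector_derivative Q (V2 (u, v)) ** F (u, v)) (at v within ?V)"
  using fs.solution by blast
 define \<Phi> where "\<Phi> x = F (x $ 1, x $ 2)" for x :: "real^2"
 let ?X = "{x0$1-r<..<x0$1+r}" and ?Y = "{x0$2-r<..<x0$2+r}"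
 define S where "S = {x :: real^2. x $ 1 \<in> ?X \<and> x $ 2 \<in> ?Y}"
 have oS: "open S" unfolding S_def greaterThanLessThan_iff by (intro open_Collect_conj open_Collect_less continuous_intros)
 have V2S: "V2 (x $ 1, x $ 2) = x" for x by (simp add: V2_def real2_eq_iff)
 have dF: "(\<Phi> has_derivative (%h. h $ 1 *\<^sub>R (P x ** \<Phi> x) + h $ 2 *\<^sub>R (Q x ** \<Phi> x))) (at x)" if x: "x \<in> S" for x
 proof -
  have xm: "x $ 1 \<in> ?X" "x $ 2 \<in> ?Y" using x by (auto simp: S_def)
  have Fx: "((%u. F (u, v)) has_vector_derivative P (V2 (u, v)) ** F (u, v)) (at u within ?X)"
   "((%v. F (u, v)) has_vector_derivative Q (V2 (u, v)) ** F (u, v)) (at v within ?Y)" if "u \<in> ?X" "v \<in> ?Y" for u v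
   by (rule has_vector_derivative_within_subset[OF F(3)], use that in auto)
    (rule has_vector_derivative_within_subset[OF F(4)], use that in auto)
  have "((%(u, v). F (u, v)) has_derivative (%(tu, tv). tu *\<^sub>R (P (V2 (x $ 1, x $ 2)) ** F (x $ 1, x $ 2)) +
   blinfun_scaleR_left (Q (V2 (x $ 1, x $ 2)) ** F (x $ 1, x $ 2)) tv)) (at (x $ 1, x $ 2) within ?X \<times> ?Y)"
  proof (rule has_derivative_partialsI[where fy = "%u v. blinfun_scaleR_left (Q (V2 (u, v)) ** F (u, v))"])
   show "((%u. F (u, x $ 2)) has_derivative (%tu. tu *\<^sub>R (P (V2 (x $ 1, x $ 2)) ** F (x $ 1, x $ 2)))) (at (x $ 1) within ?X)"
    using Fx(1)[OF xm] by (simp add: has_vector_derivative_def)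
   show "((%v. F (u, v)) has_derivative blinfun_apply (blinfun_scaleR_left (Q (V2 (u, v)) ** F (u, v)))) (at v within ?Y)"
    if "u \<in> ?X" "v \<in> ?Y" for u v
    using Fx(2)[OF that] by (simp add: has_vector_derivative_def)
   have "continuous_on (?X \<times> ?Y) (%z. Q (V2 z) ** F z)"
    by (intro bounded_bilinear.continuous_on[OF bounded_bilinear_matrix_mult])
     (rule continuous_on_subset[OF cont(2)], use r in force, rule continuous_on_subset[OF F(1)], auto)
   then have "continuous_on (?X \<times> ?Y) (%(u, v). blinfun_scaleR_left (Q (V2 (u, v)) ** F (u, v)))"
    using bounded_linear.continuous_on[OF bounded_linear_blinfun_scaleR_left] by (simp add: case_prod_unfold)
   then show "continuous (at (x $ 1, x $ 2) within ?X \<times> ?Y) (%(u, v). blinfun_scaleR_left (Q (V2 (u, v)) ** F (u, v)))"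
    using xm by (simp add: continuous_on_eq_continuous_within case_prod_unfold)
  qed (use xm in auto)
  moreover have "at (x $ 1, x $ 2) within ?X \<times> ?Y = at (x $ 1, x $ 2)"
   using xm by (intro at_within_open open_Times) auto
  ultimately have 1: "(F has_derivative (%(tu, tv). tu *\<^sub>R (P x ** F (x $ 1, x $ 2)) + tv *\<^sub>R (Q x ** F (x $ 1, x $ 2)))) (at (x $ 1, x $ 2))"
   by (simp add: V2S)
  have 2: "((%x :: real^2. (x $ 1, x $ 2)) has_derivative (%h. (h $ 1, h $ 2))) (at x)"
   by (intro has_derivative_Pair bounded_linear_imp_has_derivative bounded_linear_vec_nth)
  show ?thesis using has_derivative_compose[OF 2 1] unfolding \<Phi>_def by simp
 qed
 have S\<Omega>: "S \<subseteq> \<Omega>"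
 proof
  fix x assume "x \<in> S"
  then have "(x $ 1, x $ 2) \<in> ?U \<times> ?V" by (auto simp: S_def)
  from mem[OF this] show "x \<in> \<Omega>" by (simp add: V2S)
 qed
 have "Ck_on k S \<Phi>" for k
 proof (induction k)
  case 0
  have "continuous_on S \<Phi>" by (rule has_derivative_continuous_on) (rule has_derivative_at_withinI, rule dF)
  then show ?case by simp
 next
  case (Suc k)
  show ?case
  proof (rule Ck_on_SucI[OF oS dF])
   fix h :: "real^2"
   have "Ck_on k S P" "Ck_on k S Q"
    using smooth_on_subset[OF P S\<Omega>] smooth_on_subset[OF Q S\<Omega>] by (simp_all add: smooth_on_def)
   then show "Ck_on k S (%x. h $ 1 *\<^sub>R (P x ** \<Phi> x) + h $ 2 *\<^sub>R (Q x ** \<Phi> x))"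
    using Suc by (intro Ck_on_add[OF oS] Ck_on_linear[OF bounded_linear_scaleR_right oS] Ck_on_bilinear[OF bounded_bilinear_matrix_mult oS])
  qed
 qed
 then have "smooth_on S \<Phi>" by (simp add: smooth_on_def)
 moreover have "x0 \<in> S" using r(1) by (simp add: S_def)
 moreover have "\<Phi> x0 = mat 1" using F(2) by (simp add: \<Phi>_def)
 ultimately show thesis using that[OF oS _ S\<Omega>] dF by blast
qed

section \<open>Conformal metrics in the plane\<close>

text \<open>
 The metric \<open>\<rho> (dx\<^sup>2 + dy\<^sup>2)\<close>; \<open>logd\<close> are the partial derivatives of \<open>(log \<rho>) / 2\<close>.
\<close>

locale conformal_metric =
 fixes \<Omega> :: "(real^2) set" and \<rho> :: "real^2 \<Rightarrow> real"
 assumes dom: "open \<Omega>" and rho_smooth: "smooth_on \<Omega> \<rho>" and rho_pos: "x \<in> \<Omega> ==> \<rho> x > 0"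
begin

definition conf :: "real^2 \<Rightarrow> real^2^2" where "conf x = \<rho> x *\<^sub>R mat 1"

definition logd :: "2 \<Rightarrow> real^2 \<Rightarrow> real" where
 "logd i x = fderiv \<rho> (at x) (axis i 1) / (2 * \<rho> x)"

abbreviation (input) "D f i x \<equiv> fderiv f (at x) (axis i (1::real))"

lemma conf_mult: "conf x *v y = \<rho> x *\<^sub>R y"
 by (simp add: conf_def scaleR_matrix_vector_assoc[symmetric])

lemma conf_det: "det (conf x) = (\<rho> x)\<^sup>2"
 by (simp add: conf_def det_2 mat_def power2_eq_square)

sublocale plane_metric \<Omega> conf
proof
 have "bounded_linear (%t. t *\<^sub>R (mat 1 :: real^2^2))" by (rule bounded_linear_scaleR_left)
 from smooth_on_linear[OF this dom rho_smooth] show "smooth_on \<Omega> conf" by (simp add: conf_def[abs_def])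
 show "pos_def (conf x)" if "x \<in> \<Omega>" for x
  unfolding pos_def_def conf_mult using rho_pos[OF that] by (simp add: conf_def mat_def)
qed (rule dom)

lemma rho_derivative:
 assumes "x \<in> \<Omega>"
 shows "fderiv \<rho> (at x) h = 2 * \<rho> x * (logd 1 x * h $ 1 + logd 2 x * h $ 2)"
 unfolding frechet_derivative_axis[OF smooth_on_differentiable[OF rho_smooth assms], of h]
 using rho_pos[OF assms] by (simp add: logd_def field_simps)

lemma logd_smooth: "smooth_on \<Omega> (logd i)"
 unfolding logd_def[abs_def]
 by (intro smooth_intros dom smooth_on_frechet rho_smooth) (use rho_pos in force)

lemma logd_sym:
 assumes x: "x \<in> \<Omega>"
 shows "D (logd 1) 2 x = D (logd 2) 1 x"
proof -
 have 1: "D (logd i) j x = D2 \<rho> x (axis i 1) (axis j 1) / (2 * \<rho> x) - 2 * (logd i x * logd j x)" for i j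
 proof -
  have d1: "((%x. fderiv \<rho> (at x) (axis i 1)) has_derivative D2 \<rho> x (axis i 1)) (at x)"
   unfolding D2_def by (rule smooth_on_has_derivative[OF smooth_on_frechet[OF rho_smooth] x])
  have d2: "((%x. 2 * \<rho> x) has_derivative (%h. 2 * fderiv \<rho> (at x) h)) (at x)"
   by (rule has_derivative_mult_right[OF smooth_on_has_derivative[OF rho_smooth x]])
  have nz: "2 * \<rho> x ~= 0" using rho_pos[OF x] by simp
  have "(logd i has_derivative (%h. - fderiv \<rho> (at x) (axis i 1) * (inverse (2 * \<rho> x) * (2 * fderiv \<rho> (at x) h) * inverse (2 * \<rho> x))
    + D2 \<rho> x (axis i 1) h / (2 * \<rho> x))) (at x)"
   unfolding logd_def[abs_def] by (rule has_derivative_divide[OF d1 d2 nz])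
  from fun_cong[OF frechet_derivative_at[OF this], of "axis j 1"]
  show ?thesis using rho_pos[OF x] by (simp add: logd_def field_simps)
 qed
 show ?thesis unfolding 1 using D2_symmetric[OF dom rho_smooth x, of "axis 1 1" "axis 2 1"] by simp
qed

definition logv :: "real^2 \<Rightarrow> real^2" where "logv x = vector [logd 1 x, logd 2 x]"

lemma christoffel_conf:
 assumes "x \<in> \<Omega>"
 shows "christoffel_of conf x y z = (logv x \<bullet> y) *\<^sub>R z + (logv x \<bullet> z) *\<^sub>R y - (y \<bullet> z) *\<^sub>R logv x"
proof (rule pos_def_eqI[OF metric_pos_def[OF assms]])
 fix w
 have "(conf has_derivative (%h. fderiv \<rho> (at x) h *\<^sub>R mat 1)) (at x)"
  unfolding conf_def[abs_def] by (rule has_derivative_scaleR_left[OF smooth_on_has_derivative[OF rho_smooth assms]])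
 from frechet_derivative_at[OF this]
 have "fderiv conf (at x) h = (2 * \<rho> x * (logv x \<bullet> h)) *\<^sub>R mat 1" for h
  by (metis rho_derivative[OF assms] inner2 logv_def vector_2)
 then have "2 * (w \<bullet> (conf x *v christoffel_of conf x y z)) =
  2 * (\<rho> x * ((logv x \<bullet> y) * (w \<bullet> z) + (logv x \<bullet> z) * (w \<bullet> y) - (logv x \<bullet> w) * (y \<bullet> z)))"
  unfolding christoffel_of_char[OF assms] by (simp add: scaleR_matrix_vector_assoc[symmetric] algebra_simps)
 then show "w \<bullet> (conf x *v christoffel_of conf x y z) = w \<bullet> (conf x *v ((logv x \<bullet> y) *\<^sub>R z + (logv x \<bullet> z) *\<^sub>R y - (y \<bullet> z) *\<^sub>R logv x))"
  by (simp add: conf_mult inner_diff_right inner_add_right inner_commute algebra_simps)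
qed

lemma curvature_conf:
 assumes x: "x \<in> \<Omega>"
 shows "curvature_of (christoffel_of conf) x y w z =
  - (D (logd 1) 1 x + D (logd 2) 2 x) *\<^sub>R ((w \<bullet> z) *\<^sub>R y - (y \<bullet> z) *\<^sub>R w)"
proof -
 define L where "L h = (vector [D (logd 1) 1 x * h $ 1 + D (logd 1) 2 x * h $ 2, D (logd 1) 2 x * h $ 1 + D (logd 2) 2 x * h $ 2] :: real^2)" for h :: "real^2"
 have dl: "(logv has_derivative L) (at x)"
 proof -
  have 1: "(logd i has_derivative (%h. D (logd i) 1 x * h $ 1 + D (logd i) 2 x * h $ 2)) (at x)" for i
  proof (rule has_derivative_eq_rhs[OF smooth_on_has_derivative[OF logd_smooth x]], rule ext)
   show "fderiv (logd i) (at x) h = D (logd i) 1 x * h $ 1 + D (logd i) 2 x * h $ 2" for h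
    by (subst frechet_derivative_axis[OF smooth_on_differentiable[OF logd_smooth x]]) (simp add: mult.commute)
  qed
  have e: "logv = (%x. logd 1 x *\<^sub>R axis 1 1 + logd 2 x *\<^sub>R axis 2 1)" by (rule ext) (simp add: logv_def real2_eq_iff axis_def)
  have "(logv has_derivative (%h. (D (logd 1) 1 x * h $ 1 + D (logd 1) 2 x * h $ 2) *\<^sub>R axis 1 1 + (D (logd 2) 1 x * h $ 1 + D (logd 2) 2 x * h $ 2) *\<^sub>R axis 2 1)) (at x)"
   unfolding e by (intro has_derivative_add has_derivative_scaleR_left 1)
  moreover have "(D (logd 1) 1 x * h $ 1 + D (logd 1) 2 x * h $ 2) *\<^sub>R axis 1 1 + (D (logd 2) 1 x * h $ 1 + D (logd 2) 2 x * h $ 2) *\<^sub>R axis 2 1 = L h" for h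
   unfolding L_def logd_sym[OF x] by (rule axis_comb)
  ultimately show ?thesis by (simp only:)
 qed
 have dG: "fderiv (%x. christoffel_of conf x w z) (at x) y = (L y \<bullet> w) *\<^sub>R z + (L y \<bullet> z) *\<^sub>R w - (w \<bullet> z) *\<^sub>R L y" for w z y
 proof -
  have "((%x. (logv x \<bullet> w) *\<^sub>R z + (logv x \<bullet> z) *\<^sub>R w - (w \<bullet> z) *\<^sub>R logv x) has_derivative
   (%y. (L y \<bullet> w) *\<^sub>R z + (L y \<bullet> z) *\<^sub>R w - (w \<bullet> z) *\<^sub>R L y)) (at x)"
   by (intro has_derivative_diff has_derivative_add has_derivative_scaleR_left has_derivative_scaleR_right has_derivative_inner_left dl)
  then have "((%x. christoffel_of conf x w z) has_derivative
   (%y. (L y \<bullet> w) *\<^sub>R z + (L y \<bullet> z) *\<^sub>R w - (w \<bullet> z) *\<^sub>R L y)) (at x)"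
   by (rule has_derivative_transform_within_open[OF _ dom x]) (simp add: christoffel_conf)
  from fun_cong[OF frechet_derivative_at[OF this], of y] show ?thesis by (rule sym)
 qed
 show ?thesis
  unfolding curvature_of_def dG christoffel_conf[OF x] L_def
  by (simp add: real2_eq_iff inner2 logv_def) (simp add: algebra_simps)
qed

end

section \<open>Straightening coordinates\<close>

lemma vector3_axis: "(vector [f, g, h] :: 'b::euclidean_space^3) = axis 1 f + axis 2 g + axis 3 h"
 by (simp add: vec_eq_iff forall_3 axis_def)

lemma smooth_on_rows3:
 fixes f g h :: "_ \<Rightarrow> 'b::euclidean_space"
 assumes "open S" "smooth_on S f" "smooth_on S g" "smooth_on S h"
 shows "smooth_on S (%x. vector [f x, g x, h x] :: 'b^3)"
 unfolding vector3_axis by (intro smooth_on_add smooth_on_linear[OF bounded_linear_axis] assms)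

lemma has_derivative_rows3:
 fixes f g h :: "_ \<Rightarrow> 'b::euclidean_space"
 assumes "(f has_derivative f') F" "(g has_derivative g') F" "(h has_derivative h') F"
 shows "((%x. vector [f x, g x, h x] :: 'b^3) has_derivative (%t. vector [f' t, g' t, h' t])) F"
 unfolding vector3_axis by (intro has_derivative_add bounded_linear.has_derivative[OF bounded_linear_axis] assms)

text \<open>
 For a curve in space given in homogeneous coordinates, the acceleration of its projection to the
 plane \<open>f1 = 1\<close> is measured by the determinant of the curve and its first two derivatives.
\<close>

lemma projective_cross:
 fixes f1 f2 f3 :: "real \<Rightarrow> real"
 assumes J: "open J" "t \<in> J" and nz: "!!s. s \<in> J ==> f1 s ~= 0"
  and d: "!!s. s \<in> J ==> (f1 has_real_derivative g1 s) (at s)" "!!s. s \<in> J ==> (f2 has_real_derivative g2 s) (at s)"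
   "!!s. s \<in> J ==> (f3 has_real_derivative g3 s) (at s)"
  and dd: "(g1 has_real_derivative k1) (at t)" "(g2 has_real_derivative k2) (at t)" "(g3 has_real_derivative k3) (at t)"
  and y: "!!s. s \<in> J ==> \<eta> s = (vector [f2 s / f1 s, f3 s / f1 s] :: real^2)"
  and \<eta>': "!!s. s \<in> J ==> (\<eta> has_vector_derivative \<eta>' s) (at s)" and \<eta>'': "(\<eta>' has_vector_derivative \<eta>'') (at t)"
 shows "cross2 (\<eta>' t) \<eta>'' * (f1 t)^3 =
  f1 t * (g2 t * k3 - g3 t * k2) - f2 t * (g1 t * k3 - g3 t * k1) + f3 t * (g1 t * k2 - g2 t * k1)"
proof -
 have comp: "((%s. \<eta> s $ i) has_real_derivative \<eta>' s $ i) (at s)" if "s \<in> J" for s i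
  using bounded_linear.has_vector_derivative[OF bounded_linear_vec_nth \<eta>'[OF that]]
  by (simp add: has_real_derivative_iff_has_vector_derivative)
 have comp': "((%s. \<eta>' s $ i) has_real_derivative \<eta>'' $ i) (at t)" for i
  using bounded_linear.has_vector_derivative[OF bounded_linear_vec_nth \<eta>'']
  by (simp add: has_real_derivative_iff_has_vector_derivative)
 have q: "\<eta>' s $ i * f1 s = g s - \<eta> s $ i * g1 s"
  if s: "s \<in> J" and e: "!!s. s \<in> J ==> f s = \<eta> s $ i * f1 s" and df: "(f has_real_derivative g s) (at s)" for s i f g
 proof -
  have "((%s. \<eta> s $ i * f1 s) has_real_derivative (\<eta>' s $ i * f1 s + g1 s * \<eta> s $ i)) (at s)"
   by (rule DERIV_mult[OF comp[OF s] d(1)[OF s]])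
  moreover have "((%s. \<eta> s $ i * f1 s) has_real_derivative g s) (at s)"
   using has_field_derivative_transform_within_open[OF df J(1) s e] .
  ultimately have "\<eta>' s $ i * f1 s + g1 s * \<eta> s $ i = g s" by (rule DERIV_unique)
  then show ?thesis by (simp add: algebra_simps)
 qed
 have r: "\<eta>'' $ i * f1 t + \<eta>' t $ i * g1 t = k - (\<eta>' t $ i * g1 t + \<eta> t $ i * k1)"
  if e: "!!s. s \<in> J ==> \<eta>' s $ i * f1 s = g s - \<eta> s $ i * g1 s" and dg: "(g has_real_derivative k) (at t)" for i g k
 proof -
  have 1: "((%s. \<eta>' s $ i * f1 s) has_real_derivative (\<eta>'' $ i * f1 t + g1 t * \<eta>' t $ i)) (at t)"
   by (rule DERIV_mult[OF comp' d(1)[OF J(2)]])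
  have "((%s. g s - \<eta> s $ i * g1 s) has_real_derivative (k - (\<eta>' t $ i * g1 t + k1 * \<eta> t $ i))) (at t)"
   by (rule DERIV_diff[OF dg DERIV_mult[OF comp[OF J(2)] dd(1)]])
  then have "((%s. \<eta>' s $ i * f1 s) has_real_derivative (k - (\<eta>' t $ i * g1 t + k1 * \<eta> t $ i))) (at t)"
   by (rule has_field_derivative_transform_within_open[OF _ J]) (simp add: e)
  from DERIV_unique[OF 1 this] show ?thesis by (simp add: mult.commute)
 qed
 have e1: "f2 s = \<eta> s $ 1 * f1 s" and e2: "f3 s = \<eta> s $ 2 * f1 s" if "s \<in> J" for s
  using y[OF that] nz[OF that] by simp_all
 have q1: "\<eta>' s $ 1 * f1 s = g2 s - \<eta> s $ 1 * g1 s" if "s \<in> J" for s by (rule q[of s f2 1 g2, OF that e1 d(2)[OF that]])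
 have q2: "\<eta>' s $ 2 * f1 s = g3 s - \<eta> s $ 2 * g1 s" if "s \<in> J" for s by (rule q[of s f3 2 g3, OF that e2 d(3)[OF that]])
 have r1: "\<eta>'' $ 1 * f1 t + \<eta>' t $ 1 * g1 t = k2 - (\<eta>' t $ 1 * g1 t + \<eta> t $ 1 * k1)" by (rule r[of 1 g2, OF q1 dd(2)])
 have r2: "\<eta>'' $ 2 * f1 t + \<eta>' t $ 2 * g1 t = k3 - (\<eta>' t $ 2 * g1 t + \<eta> t $ 2 * k1)" by (rule r[of 2 g3, OF q2 dd(3)])
 have s: "g2 t = \<eta>' t $ 1 * f1 t + \<eta> t $ 1 * g1 t" "g3 t = \<eta>' t $ 2 * f1 t + \<eta> t $ 2 * g1 t"
  "k2 = \<eta>'' $ 1 * f1 t + 2 * (\<eta>' t $ 1 * g1 t) + \<eta> t $ 1 * k1" "k3 = \<eta>'' $ 2 * f1 t + 2 * (\<eta>' t $ 2 * g1 t) + \<eta> t $ 2 * k1"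
  using q1[OF J(2)] q2[OF J(2)] r1 r2 by linarith+
 show ?thesis unfolding s e1[OF J(2)] e2[OF J(2)] cross2_def power3_eq_cube by (simp add: algebra_simps)
qed

text \<open>
 The structure equations of a convex projective structure in a conformal coordinate: \<open>\<rho>\<close> is the
 density of the metric and \<open>b1 + \<i> b2\<close> the coefficient of the cubic differential divided by \<open>\<rho>\<close>.
\<close>

locale wang_system = conformal_metric +
 fixes b1 b2 :: "real^2 \<Rightarrow> real"
 assumes b_smooth: "smooth_on \<Omega> b1" "smooth_on \<Omega> b2"
  and gauss: "x \<in> \<Omega> ==> D (logd 1) 1 x + D (logd 2) 2 x = \<rho> x - 2 * ((b1 x)\<^sup>2 + (b2 x)\<^sup>2)"
  and codazzi1: "x \<in> \<Omega> ==> D b1 2 x + D b2 1 x = - 2 * (logd 2 x * b1 x) - 2 * (logd 1 x * b2 x)"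
  and codazzi2: "x \<in> \<Omega> ==> D b1 1 x - D b2 2 x = 2 * (logd 2 x * b2 x) - 2 * (logd 1 x * b1 x)"
begin

definition Pm :: "real^2 \<Rightarrow> real^3^3" where
 "Pm x = vector [vector [0, 1, 0], vector [\<rho> x, logd 1 x + b1 x, - (logd 2 x + b2 x)], vector [0, logd 2 x - b2 x, logd 1 x - b1 x]]"

definition Qm :: "real^2 \<Rightarrow> real^3^3" where
 "Qm x = vector [vector [0, 0, 1], vector [0, logd 2 x - b2 x, logd 1 x - b1 x], vector [\<rho> x, - (logd 1 x + b1 x), logd 2 x + b2 x]]"

lemma PQ_smooth: "smooth_on \<Omega> Pm" "smooth_on \<Omega> Qm"
 unfolding Pm_def[abs_def] Qm_def[abs_def]
 by (intro smooth_on_rows3 smooth_on_vector3 smooth_intros dom logd_smooth b_smooth rho_smooth)+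

text \<open>
 The curvature of the connection with the matrices \<open>Pm\<close> and \<open>Qm\<close> vanishes by the assumptions of
 Gauss and Codazzi type.
\<close>

lemma PQ_flat:
 assumes x: "x \<in> \<Omega>"
 shows "fderiv Pm (at x) (axis 2 1) + Pm x ** Qm x = fderiv Qm (at x) (axis 1 1) + Qm x ** Pm x"
proof -
 note hd = smooth_on_has_derivative[OF _ x]
 note d = hd[OF rho_smooth] hd[OF logd_smooth[of 1]] hd[OF logd_smooth[of 2]] hd[OF b_smooth(1)] hd[OF b_smooth(2)]
 have "(Pm has_derivative (%t. vector [vector [0, 0, 0],
   vector [fderiv \<rho> (at x) t, fderiv (logd 1) (at x) t + fderiv b1 (at x) t,
    - (fderiv (logd 2) (at x) t + fderiv b2 (at x) t)],
   vector [0, fderiv (logd 2) (at x) t - fderiv b2 (at x) t,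
    fderiv (logd 1) (at x) t - fderiv b1 (at x) t]])) (at x)"
  unfolding Pm_def[abs_def]
  by (intro has_derivative_rows3 has_derivative_add has_derivative_diff has_derivative_minus has_derivative_const d)
 from fun_cong[OF frechet_derivative_at[OF this], of "axis 2 1"]
 have P: "fderiv Pm (at x) (axis 2 1) = vector [vector [0, 0, 0],
   vector [D \<rho> 2 x, D (logd 1) 2 x + D b1 2 x, - (D (logd 2) 2 x + D b2 2 x)],
   vector [0, D (logd 2) 2 x - D b2 2 x, D (logd 1) 2 x - D b1 2 x]]" by (rule sym)
 have "(Qm has_derivative (%t. vector [vector [0, 0, 0],
   vector [0, fderiv (logd 2) (at x) t - fderiv b2 (at x) t,
    fderiv (logd 1) (at x) t - fderiv b1 (at x) t],
   vector [fderiv \<rho> (at x) t, - (fderiv (logd 1) (at x) t + fderiv b1 (at x) t),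
    fderiv (logd 2) (at x) t + fderiv b2 (at x) t]])) (at x)"
  unfolding Qm_def[abs_def]
  by (intro has_derivative_rows3 has_derivative_add has_derivative_diff has_derivative_minus has_derivative_const d)
 from fun_cong[OF frechet_derivative_at[OF this], of "axis 1 1"]
 have Q: "fderiv Qm (at x) (axis 1 1) = vector [vector [0, 0, 0],
   vector [0, D (logd 2) 1 x - D b2 1 x, D (logd 1) 1 x - D b1 1 x],
   vector [D \<rho> 1 x, - (D (logd 1) 1 x + D b1 1 x), D (logd 2) 1 x + D b2 1 x]]" by (rule sym)
 have \<rho>: "D \<rho> 1 x = 2 * \<rho> x * logd 1 x" "D \<rho> 2 x = 2 * \<rho> x * logd 2 x"
  using rho_pos[OF x] by (simp_all add: logd_def)
 define p q \<beta>1 \<beta>2 r where "p = logd 1 x" and "q = logd 2 x" and "\<beta>1 = b1 x" and "\<beta>2 = b2 x" and "r = \<rho> x"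
 define p1 p2 q2 c11 c12 c21 c22 where "p1 = D (logd 1) 1 x" and "p2 = D (logd 1) 2 x" and "q2 = D (logd 2) 2 x"
  and "c11 = D b1 1 x" and "c12 = D b1 2 x" and "c21 = D b2 1 x" and "c22 = D b2 2 x"
 note defs = p_def[symmetric] q_def[symmetric] \<beta>1_def[symmetric] \<beta>2_def[symmetric] r_def[symmetric]
  p1_def[symmetric] p2_def[symmetric] q2_def[symmetric] c11_def[symmetric] c12_def[symmetric] c21_def[symmetric] c22_def[symmetric]
 have q1: "D (logd 2) 1 x = p2" using logd_sym[OF x] by (simp add: p2_def)
 have g: "p1 = r - 2 * (\<beta>1 * \<beta>1 + \<beta>2 * \<beta>2) - q2" using gauss[OF x] unfolding defs power2_eq_square by simp
 have k1: "c12 = - 2 * (q * \<beta>1) - 2 * (p * \<beta>2) - c21" using codazzi1[OF x] unfolding defs by simp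
 have k2: "c11 = 2 * (q * \<beta>2) - 2 * (p * \<beta>1) + c22" using codazzi2[OF x] unfolding defs by simp
 show ?thesis
  unfolding P Q q1 \<rho> Pm_def Qm_def defs g k1 k2
  by (simp add: vec_eq_iff forall_3 matrix_matrix_mult_def sum_3 algebra_simps)
qed

text \<open>
 The ratios of three independent solutions of the linear system are coordinates in which the path
 equation becomes the equation of straight lines (\<open>projective_cross\<close>).
\<close>

lemma straightening:
 assumes x0: "x0 \<in> \<Omega>"
 obtains S h \<kappa> where "open S" "x0 \<in> S" "S \<subseteq> \<Omega>" "smooth_on S (h :: real^2 \<Rightarrow> real^2)" "!!x. x \<in> S ==> \<kappa> x > (0::real)"
  "!!x y z. x \<in> S ==> \<exists>k>0. cross2 (fderiv h (at x) y) (fderiv h (at x) z) = k * cross2 y z"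
  "!!J t w w' w''. open J ==> t \<in> J ==> w ` J \<subseteq> S ==> (!!s. s \<in> J ==> (w has_vector_derivative w' s) (at s)) ==>
   (w' has_vector_derivative w'') (at t) ==>
   \<exists>\<eta>''. ((%s. fderiv h (at (w s)) (w' s)) has_vector_derivative \<eta>'') (at t) \<and>
   cross2 (fderiv h (at (w t)) (w' t)) \<eta>'' = \<kappa> (w t) *
    (cross2 (w' t) (w'' + christoffel_of conf (w t) (w' t) (w' t))
    - (b1 (w t) * (3 * (w' t $ 1)\<^sup>2 * w' t $ 2 - w' t $ 2 ^ 3) + b2 (w t) * (w' t $ 1 ^ 3 - 3 * w' t $ 1 * (w' t $ 2)\<^sup>2)))"
proof -
 obtain S \<Phi> where S: "open S" "x0 \<in> S" "S \<subseteq> \<Omega>" "smooth_on S \<Phi>" "\<Phi> x0 = mat 1"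
  "!!x. x \<in> S ==> (\<Phi> has_derivative (%h. h $ 1 *\<^sub>R (Pm x ** \<Phi> x) + h $ 2 *\<^sub>R (Qm x ** \<Phi> x))) (at x)"
  by (rule flat_system_solution[OF dom x0 PQ_smooth PQ_flat], assumption, rule that)
 define T where "T = {x \<in> S. \<Phi> x $ 1 $ 1 > 0 \<and> det (\<Phi> x) > 0}"
 have cT: "continuous_on S (%x. \<Phi> x $ i $ j)" for i j
  by (rule smooth_on_continuous_on[OF smooth_on_nth[OF S(1) smooth_on_nth[OF S(1,4)]]])
 have cdet: "continuous_on S (%x. det (\<Phi> x))" unfolding det_3 by (intro continuous_on_add continuous_on_diff continuous_on_mult cT)
 have oT: "open T"
 proof -
  have "T = (S \<inter> (%x. \<Phi> x $ 1 $ 1) -` {0<..}) \<inter> (S \<inter> (%x. det (\<Phi> x)) -` {0<..})" by (auto simp: T_def)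
  then show ?thesis using continuous_open_preimage[OF cT S(1) open_greaterThan] continuous_open_preimage[OF cdet S(1) open_greaterThan]
   by (simp add: open_Int)
 qed
 have xT: "x0 \<in> T" using S(2,5) by (simp add: T_def mat_def det_3)
 have TS: "T \<subseteq> S" by (auto simp: T_def)
 define h where "h x = (vector [\<Phi> x $ 1 $ 2 / \<Phi> x $ 1 $ 1, \<Phi> x $ 1 $ 3 / \<Phi> x $ 1 $ 1] :: real^2)" for x
 have sh: "smooth_on T h" unfolding h_def[abs_def]
  by (intro smooth_intros oT smooth_on_subset[OF S(4) TS]) (auto simp: T_def)
 have dh: "(h has_derivative fderiv h (at x)) (at x)" if "x \<in> T" for x
  by (rule smooth_on_has_derivative[OF sh that])
 have ent: "((%x. \<Phi> x $ i $ j) has_derivative (%h. h $ 1 * (Pm x ** \<Phi> x) $ i $ j + h $ 2 * (Qm x ** \<Phi> x) $ i $ j)) (at x)"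
  if "x \<in> S" for x i j
  using bounded_linear.has_derivative[OF bounded_linear_vec_nth bounded_linear.has_derivative[OF bounded_linear_vec_nth S(6)[OF that]], of i j] by simp
 have entc: "((%s. \<Phi> (w s) $ i $ j) has_real_derivative (w' $ 1 * (Pm (w s) ** \<Phi> (w s)) $ i $ j + w' $ 2 * (Qm (w s) ** \<Phi> (w s)) $ i $ j)) (at s)"
  if "w s \<in> S" "(w has_vector_derivative w') (at s)" for w w' s i j
  using has_vector_derivative_chain[OF that(2) ent[OF that(1)]] by (simp add: has_real_derivative_iff_has_vector_derivative)
 have rows: "(Pm x ** \<Phi> x) $ 1 $ j = \<Phi> x $ 2 $ j" "(Qm x ** \<Phi> x) $ 1 $ j = \<Phi> x $ 3 $ j"
  "(Pm x ** \<Phi> x) $ 2 $ j = \<rho> x * \<Phi> x $ 1 $ j + (logd 1 x + b1 x) * \<Phi> x $ 2 $ j - (logd 2 x + b2 x) * \<Phi> x $ 3 $ j"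
  "(Qm x ** \<Phi> x) $ 2 $ j = (logd 2 x - b2 x) * \<Phi> x $ 2 $ j + (logd 1 x - b1 x) * \<Phi> x $ 3 $ j"
  "(Pm x ** \<Phi> x) $ 3 $ j = (logd 2 x - b2 x) * \<Phi> x $ 2 $ j + (logd 1 x - b1 x) * \<Phi> x $ 3 $ j"
  "(Qm x ** \<Phi> x) $ 3 $ j = \<rho> x * \<Phi> x $ 1 $ j - (logd 1 x + b1 x) * \<Phi> x $ 2 $ j + (logd 2 x + b2 x) * \<Phi> x $ 3 $ j" for x j
  by (simp_all add: matrix_matrix_mult_def sum_3 Pm_def Qm_def algebra_simps)
 define \<kappa> where "\<kappa> x = det (\<Phi> x) / (\<Phi> x $ 1 $ 1)^3" for x
 have \<kappa>: "\<kappa> x > 0" if "x \<in> T" for x using that by (simp add: \<kappa>_def T_def)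
 have jac: "\<exists>k>0. cross2 (fderiv h (at x) y) (fderiv h (at x) z) = k * cross2 y z" if x: "x \<in> T" for x y z
 proof -
  have f1: "\<Phi> x $ 1 $ 1 ~= 0" using x by (auto simp: T_def)
  have comp: "fderiv h (at x) v $ i * (\<Phi> x $ 1 $ 1)\<^sup>2 =
    (v $ 1 * \<Phi> x $ 2 $ j + v $ 2 * \<Phi> x $ 3 $ j) * \<Phi> x $ 1 $ 1 - \<Phi> x $ 1 $ j * (v $ 1 * \<Phi> x $ 2 $ 1 + v $ 2 * \<Phi> x $ 3 $ 1)"
   if "!!x. h x $ i = \<Phi> x $ 1 $ j / \<Phi> x $ 1 $ 1" for v i j
  proof -
   have "((%x. h x $ i) has_derivative (%v. fderiv h (at x) v $ i)) (at x)"
    by (rule bounded_linear.has_derivative[OF bounded_linear_vec_nth dh[OF x]])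
   moreover have "((%x. h x $ i) has_derivative (%v. ((v $ 1 * \<Phi> x $ 2 $ j + v $ 2 * \<Phi> x $ 3 $ j) * \<Phi> x $ 1 $ 1 - \<Phi> x $ 1 $ j * (v $ 1 * \<Phi> x $ 2 $ 1 + v $ 2 * \<Phi> x $ 3 $ 1)) / (\<Phi> x $ 1 $ 1 * \<Phi> x $ 1 $ 1))) (at x)"
    unfolding that using has_derivative_divide'[OF ent[of x 1 j] ent[of x 1 1] f1] x TS by (auto simp: rows)
   ultimately have "fderiv h (at x) v $ i = ((v $ 1 * \<Phi> x $ 2 $ j + v $ 2 * \<Phi> x $ 3 $ j) * \<Phi> x $ 1 $ 1 - \<Phi> x $ 1 $ j * (v $ 1 * \<Phi> x $ 2 $ 1 + v $ 2 * \<Phi> x $ 3 $ 1)) / (\<Phi> x $ 1 $ 1 * \<Phi> x $ 1 $ 1)"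
    by (rule fun_cong[where x=v, OF has_derivative_unique])
   then show ?thesis using f1 by (simp add: power2_eq_square)
  qed
  have c1: "fderiv h (at x) v $ 1 * (\<Phi> x $ 1 $ 1)\<^sup>2 = (v $ 1 * \<Phi> x $ 2 $ 2 + v $ 2 * \<Phi> x $ 3 $ 2) * \<Phi> x $ 1 $ 1 - \<Phi> x $ 1 $ 2 * (v $ 1 * \<Phi> x $ 2 $ 1 + v $ 2 * \<Phi> x $ 3 $ 1)"
   and c2: "fderiv h (at x) v $ 2 * (\<Phi> x $ 1 $ 1)\<^sup>2 = (v $ 1 * \<Phi> x $ 2 $ 3 + v $ 2 * \<Phi> x $ 3 $ 3) * \<Phi> x $ 1 $ 1 - \<Phi> x $ 1 $ 3 * (v $ 1 * \<Phi> x $ 2 $ 1 + v $ 2 * \<Phi> x $ 3 $ 1)" for v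
   by (rule comp, simp add: h_def)+
  have "cross2 (fderiv h (at x) y) (fderiv h (at x) z) * ((\<Phi> x $ 1 $ 1)\<^sup>2 * (\<Phi> x $ 1 $ 1)\<^sup>2) =
   (fderiv h (at x) y $ 1 * (\<Phi> x $ 1 $ 1)\<^sup>2) * (fderiv h (at x) z $ 2 * (\<Phi> x $ 1 $ 1)\<^sup>2)
   - (fderiv h (at x) y $ 2 * (\<Phi> x $ 1 $ 1)\<^sup>2) * (fderiv h (at x) z $ 1 * (\<Phi> x $ 1 $ 1)\<^sup>2)"
   by (simp add: cross2_def algebra_simps)
  also have "\<dots> = \<Phi> x $ 1 $ 1 * det (\<Phi> x) * cross2 y z"
   unfolding c1 c2 by (simp add: cross2_def det_3 algebra_simps)
  finally have "cross2 (fderiv h (at x) y) (fderiv h (at x) z) =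
   (\<Phi> x $ 1 $ 1 * det (\<Phi> x) / ((\<Phi> x $ 1 $ 1)\<^sup>2 * (\<Phi> x $ 1 $ 1)\<^sup>2)) * cross2 y z" using f1 by (simp add: field_simps)
  moreover have "\<Phi> x $ 1 $ 1 * det (\<Phi> x) / ((\<Phi> x $ 1 $ 1)\<^sup>2 * (\<Phi> x $ 1 $ 1)\<^sup>2) > 0" using x by (simp add: T_def)
  ultimately show ?thesis by blast
 qed
 have main: "\<exists>\<eta>''. ((%s. fderiv h (at (w s)) (w' s)) has_vector_derivative \<eta>'') (at t) \<and>
   cross2 (fderiv h (at (w t)) (w' t)) \<eta>'' = \<kappa> (w t) *
    (cross2 (w' t) (w'' + christoffel_of conf (w t) (w' t) (w' t))
    - (b1 (w t) * (3 * (w' t $ 1)\<^sup>2 * w' t $ 2 - w' t $ 2 ^ 3) + b2 (w t) * (w' t $ 1 ^ 3 - 3 * w' t $ 1 * (w' t $ 2)\<^sup>2)))"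
  if J: "open J" "t \<in> J" "w ` J \<subseteq> T" and w': "!!s. s \<in> J ==> (w has_vector_derivative w' s) (at s)"
   and w'': "(w' has_vector_derivative w'') (at t)" for J t w w' w''
 proof -
  have wT: "w s \<in> T" if "s \<in> J" for s using J(3) that by auto
  let ?\<eta> = "%s. h (w s)"
  let ?\<eta>' = "%s. fderiv h (at (w s)) (w' s)"
  have d1: "(?\<eta> has_vector_derivative ?\<eta>' s) (at s)" if "s \<in> J" for s
   by (rule has_vector_derivative_chain[OF w'[OF that] dh[OF wT[OF that]]])
  define \<eta>'' where "\<eta>'' = D2 h (w t) (w' t) (w' t) + fderiv h (at (w t)) w''"
  have d2: "(?\<eta>' has_vector_derivative \<eta>'') (at t)"
   unfolding \<eta>''_def by (rule frechet_apply_has_vector_derivative[OF oT sh wT[OF J(2)] w'[OF J(2)] w''])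
  define f where "f i j s = \<Phi> (w s) $ i $ j" for i j s
  define \<eta> where "\<eta> s = h (w s)" for s
  define g where "g j s = w' s $ 1 * f 2 j s + w' s $ 2 * f 3 j s" for j s
  have fd: "(f 1 j has_real_derivative g j s) (at s)" if "s \<in> J" for j s
   using entc[OF subsetD[OF TS wT[OF that]] w'[OF that], of 1 j] unfolding f_def g_def rows .
  have wc: "((%s. w' s $ i) has_real_derivative w'' $ i) (at t)" for i
   using bounded_linear.has_vector_derivative[OF bounded_linear_vec_nth w'']
   by (simp add: has_real_derivative_iff_has_vector_derivative)
  define k where "k j = (w'' $ 1 * f 2 j t + (w' t $ 1 * (Pm (w t) ** \<Phi> (w t)) $ 2 $ j + w' t $ 2 * (Qm (w t) ** \<Phi> (w t)) $ 2 $ j) * w' t $ 1)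
   + (w'' $ 2 * f 3 j t + (w' t $ 1 * (Pm (w t) ** \<Phi> (w t)) $ 3 $ j + w' t $ 2 * (Qm (w t) ** \<Phi> (w t)) $ 3 $ j) * w' t $ 2)" for j
  have gd: "(g j has_real_derivative k j) (at t)" for j
   unfolding g_def k_def f_def
   by (intro DERIV_add DERIV_mult wc entc[OF subsetD[OF TS wT[OF J(2)]] w'[OF J(2)]])
  have f1: "f 1 1 s ~= 0" if "s \<in> J" for s using wT[OF that] by (auto simp: f_def T_def)
  have hy: "h (w s) = vector [f 1 2 s / f 1 1 s, f 1 3 s / f 1 1 s]" for s by (simp add: h_def f_def)
  have id: "cross2 (?\<eta>' t) \<eta>'' * (f 1 1 t)^3 = f 1 1 t * (g 2 t * k 3 - g 3 t * k 2) - f 1 2 t * (g 1 t * k 3 - g 3 t * k 1) + f 1 3 t * (g 1 t * k 2 - g 2 t * k 1)"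
   by (rule projective_cross[OF J(1,2) f1 fd fd fd gd gd gd hy d1 d2])
  let ?E = "cross2 (w' t) (w'' + christoffel_of conf (w t) (w' t) (w' t))
    - (b1 (w t) * (3 * (w' t $ 1)\<^sup>2 * w' t $ 2 - w' t $ 2 ^ 3) + b2 (w t) * (w' t $ 1 ^ 3 - 3 * w' t $ 1 * (w' t $ 2)\<^sup>2))"
  have w\<Omega>: "w t \<in> \<Omega>" using wT[OF J(2)] TS S(3) by auto
  define y1 y2 z1 z2 where "y1 = w' t $ 1" and "y2 = w' t $ 2" and "z1 = w'' $ 1" and "z2 = w'' $ 2"
  define p q \<beta>1 \<beta>2 r where "p = logd 1 (w t)" and "q = logd 2 (w t)" and "\<beta>1 = b1 (w t)" and "\<beta>2 = b2 (w t)" and "r = \<rho> (w t)"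
  define m2 m3 where "m2 = z1 + (p + \<beta>1) * (y1 * y1 - y2 * y2) + 2 * (q - \<beta>2) * (y1 * y2)"
   and "m3 = z2 - (q + \<beta>2) * (y1 * y1 - y2 * y2) + 2 * (p - \<beta>1) * (y1 * y2)"
  have kj: "k j = r * (y1 * y1 + y2 * y2) * f 1 j t + m2 * f 2 j t + m3 * f 3 j t" for j
   unfolding k_def rows f_def[symmetric] m2_def m3_def y1_def y2_def z1_def z2_def p_def q_def \<beta>1_def \<beta>2_def r_def
   by (simp add: algebra_simps)
  have gj: "g j t = y1 * f 2 j t + y2 * f 3 j t" for j by (simp add: g_def y1_def y2_def)
  have det: "det (\<Phi> (w t)) = f 1 1 t * (f 2 2 t * f 3 3 t - f 2 3 t * f 3 2 t) - f 1 2 t * (f 2 1 t * f 3 3 t - f 2 3 t * f 3 1 t) + f 1 3 t * (f 2 1 t * f 3 2 t - f 2 2 t * f 3 1 t)"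
   by (simp add: det_3 f_def algebra_simps)
  have "f 1 1 t * (g 2 t * k 3 - g 3 t * k 2) - f 1 2 t * (g 1 t * k 3 - g 3 t * k 1) + f 1 3 t * (g 1 t * k 2 - g 2 t * k 1)
   = det (\<Phi> (w t)) * (y1 * m3 - y2 * m2)"
   unfolding kj gj det by (simp add: algebra_simps)
  moreover have "y1 * m3 - y2 * m2 = ?E"
   unfolding christoffel_conf[OF w\<Omega>] m2_def m3_def
   by (simp add: cross2_def inner2 logv_def y1_def[symmetric] y2_def[symmetric] z1_def[symmetric] z2_def[symmetric]
     p_def[symmetric] q_def[symmetric] \<beta>1_def[symmetric] \<beta>2_def[symmetric] power2_eq_square power3_eq_cube algebra_simps)
  ultimately have "cross2 (?\<eta>' t) \<eta>'' * (f 1 1 t)^3 = det (\<Phi> (w t)) * ?E" using id by simp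
  then have "cross2 (?\<eta>' t) \<eta>'' = \<kappa> (w t) * ?E" using f1[OF J(2)] by (simp add: \<kappa>_def f_def field_simps)
  with d2 show ?thesis by blast
 qed
 show thesis by (rule that[OF oT xT subset_trans[OF TS S(3)] sh \<kappa> jac main])
qed

end

section \<open>Straight lines and great circles\<close>

lemma Ck_on_local:
 assumes "!!x. x \<in> S ==> \<exists>J. open J \<and> x \<in> J \<and> Ck_on k J f"
 shows "Ck_on k S f"
 using assms
proof (induction k arbitrary: f)
 case 0
 have "isCont f x" if "x \<in> S" for x
  using 0[OF that] continuous_on_eq_continuous_at by auto
 then show ?case by (simp add: continuous_at_imp_continuous_on)
next
 case (Suc k)
 have "f differentiable (at x)" if "x \<in> S" for x using Suc.prems[OF that] by auto
 moreover have "Ck_on k S (%x. fderiv f (at x) h)" for h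
 proof (rule Suc.IH)
  fix x assume "x \<in> S"
  from Suc.prems[OF this] obtain J where "open J" "x \<in> J" "Ck_on (Suc k) J f" by blast
  then show "\<exists>J. open J \<and> x \<in> J \<and> Ck_on k J (%x. fderiv f (at x) h)" by (intro exI[of _ J]) simp
 qed
 ultimately show ?case by simp
qed

lemma smooth_on_local:
 assumes "!!x. x \<in> S ==> \<exists>J. open J \<and> x \<in> J \<and> smooth_on J f"
 shows "smooth_on S f"
 unfolding smooth_on_def
proof
 fix k show "Ck_on k S f" by (rule Ck_on_local) (use assms in \<open>auto simp: smooth_on_def\<close>)
qed

lemma bounded_bilinear_cross2: "bounded_bilinear cross2"
 by (rule bilinear_conv_bounded_bilinear[THEN iffD1])
  (auto simp: bilinear_def cross2_add cross2_scaleR intro!: linearI)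

text \<open>
 The inverse function theorem gives a differentiable inverse.  By Cramer's rule its derivative is
 a rational expression in the derivative of \<open>H\<close> at the inverse, so smoothness of the inverse follows by
 induction on the order of differentiability.
\<close>

lemma local_inverse:
 fixes H :: "real^2 \<Rightarrow> real^2"
 assumes O: "open S" "x0 \<in> S" and H: "smooth_on S H"
  and jac: "!!x y z. x \<in> S ==> \<exists>k>0. cross2 (fderiv H (at x) y) (fderiv H (at x) z) = k * cross2 y z"
 obtains S' V g where "open S'" "x0 \<in> S'" "S' \<subseteq> S" "open V" "H ` S' = V" "!!x. x \<in> S' ==> g (H x) = x"
  "!!y. y \<in> V ==> g y \<in> S' \<and> H (g y) = y" "smooth_on V g"
proof -
 let ?L = "%x. fderiv H (at x)"
 have dH: "(H has_derivative ?L x) (at x)" if "x \<in> S" for x by (rule smooth_on_has_derivative[OF H that])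
 have lin: "linear (?L x)" if "x \<in> S" for x using dH[OF that] has_derivative_linear by blast
 have inj: "y = 0" if "x \<in> S" "?L x y = 0" for x y
 proof -
  have "cross2 y z = 0" for z
   using jac[OF that(1), of y z] that(2) by (auto simp: cross2_def)
  from this[of "axis 1 1"] this[of "axis 2 1"] show ?thesis by (simp add: cross2_def axis_def real2_eq_iff)
 qed
 define f' where "f' x = Blinfun (?L x)" for x
 have f': "blinfun_apply (f' x) = ?L x" if "x \<in> S" for x
  unfolding f'_def by (rule bounded_linear_Blinfun_apply) (use lin[OF that] linear_conv_bounded_linear in blast)
 have cf': "continuous_on S f'"
 proof (rule continuous_on_blinfun_componentwise)
  fix i :: "real^2"
  have "continuous_on S (%x. ?L x i)" by (rule smooth_on_continuous_on[OF smooth_on_frechet[OF H]])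
  then show "continuous_on S (%x. blinfun_apply (f' x) i)" using f' by (simp cong: continuous_on_cong)
 qed
 obtain G where G: "linear G" "G \<circ> ?L x0 = id"
  using linear_injective_left_inverse[OF lin[OF O(2)]] linear_injective_0[OF lin[OF O(2)]] inj[OF O(2)] by blast
 have Gi: "Blinfun G o\<^sub>L f' x0 = id_blinfun"
 proof (rule blinfun_eqI)
  fix i
  have "blinfun_apply (Blinfun G) = G" by (rule bounded_linear_Blinfun_apply) (use G(1) linear_conv_bounded_linear in blast)
  then show "blinfun_apply (Blinfun G o\<^sub>L f' x0) i = blinfun_apply id_blinfun i" using fun_cong[OF G(2), of i] f'[OF O(2)] by simp
 qed
 obtain S' V g g' where inv: "open S'" "S' \<subseteq> S" "x0 \<in> S'" "open V" "H x0 \<in> V" "homeomorphism S' V H g"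
  "!!y. y \<in> V ==> (g has_derivative (g' y)) (at y)" "!!y. y \<in> V ==> g' y = inv_into UNIV (blinfun_apply (f' (g y)))"
 proof (rule inverse_function_theorem[OF O(1) _ cf' O(2) Gi])
  show "(H has_derivative blinfun_apply (f' x)) (at x)" if "x \<in> S" for x using dH[OF that] f'[OF that] by simp
 qed (rule that)
 have gS: "g y \<in> S'" "H (g y) = y" if "y \<in> V" for y using inv(6) that by (auto simp: homeomorphism_def)
 have g'eq: "g' y h = (cross2 h (?L (g y) (axis 2 1)) * inverse (cross2 (?L (g y) (axis 1 1)) (?L (g y) (axis 2 1)))) *\<^sub>R axis 1 1
   + (cross2 (?L (g y) (axis 1 1)) h * inverse (cross2 (?L (g y) (axis 1 1)) (?L (g y) (axis 2 1)))) *\<^sub>R axis 2 1" (is "_ = ?R")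
  and nz: "cross2 (?L (g y) (axis 1 1)) (?L (g y) (axis 2 1)) ~= 0" if y: "y \<in> V" for y h
 proof -
  have gy: "g y \<in> S" using gS(1)[OF y] inv(2) by auto
  let ?a = "?L (g y) (axis 1 1)" and ?b = "?L (g y) (axis 2 1)"
  show n: "cross2 ?a ?b ~= 0" using jac[OF gy, of "axis 1 1" "axis 2 1"] by (auto simp: cross2_def axis_def)
  have "(cross2 h ?b) *\<^sub>R ?a + (cross2 ?a h) *\<^sub>R ?b = (cross2 ?a ?b) *\<^sub>R h"
   by (simp add: real2_eq_iff cross2_def algebra_simps)
  then have "inverse (cross2 ?a ?b) *\<^sub>R ((cross2 h ?b) *\<^sub>R ?a + (cross2 ?a h) *\<^sub>R ?b) = h" using n by simp
  moreover have "?L (g y) ?R = inverse (cross2 ?a ?b) *\<^sub>R ((cross2 h ?b) *\<^sub>R ?a + (cross2 ?a h) *\<^sub>R ?b)"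
   unfolding linear_add[OF lin[OF gy]] linear_cmul[OF lin[OF gy]] by (simp add: scaleR_add_right mult.commute)
  ultimately have "?L (g y) ?R = h" by simp
  moreover have "inj (?L (g y))" using linear_injective_0[OF lin[OF gy]] inj[OF gy] by blast
  ultimately show "g' y h = ?R" unfolding inv(8)[OF y] f'[OF gy] by (intro inv_f_eq)
 qed
 have "Ck_on k V g" for k
 proof (induction k)
  case 0
  then show ?case using inv(6) by (simp add: homeomorphism_def)
 next
  case (Suc k)
  have L: "Ck_on k V (%y. ?L (g y) b)" for b
   by (rule Ck_on_compose[OF inv(4) O(1) _ Suc]) (use smooth_on_frechet[OF H, of b] gS inv(2) in \<open>auto simp: smooth_on_def\<close>)
  show ?case
  proof (rule Ck_on_SucI[OF inv(4,7)])
   fix h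
   have "Ck_on k V (%y. (cross2 h (?L (g y) (axis 2 1)) * inverse (cross2 (?L (g y) (axis 1 1)) (?L (g y) (axis 2 1)))) *\<^sub>R axis 1 1
    + (cross2 (?L (g y) (axis 1 1)) h * inverse (cross2 (?L (g y) (axis 1 1)) (?L (g y) (axis 2 1)))) *\<^sub>R (axis 2 1 :: real^2))"
    by (intro Ck_on_add[OF inv(4)] Ck_on_bilinear[OF bounded_bilinear_scaleR inv(4)] Ck_on_bilinear[OF bounded_bilinear_mult inv(4)]
      Ck_on_bilinear[OF bounded_bilinear_cross2 inv(4)] Ck_on_inverse[OF inv(4)] Ck_on_const[OF inv(4)] L nz)
   then show "Ck_on k V (%y. g' y h)" using Ck_on_cong[OF inv(4), of "%y. g' y h"] g'eq by simp
  qed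
 qed
 then have "smooth_on V g" by (simp add: smooth_on_def)
 then show thesis
  using that[OF inv(1,3,2,4), of g] inv(6) gS by (auto simp: homeomorphism_def)
qed

text \<open>
 The inverse of the central projection of the upper hemisphere to the plane touching it at the
 north pole.
\<close>

definition hemi :: "real^2 \<Rightarrow> real^3" where
 "hemi y = (1 / sqrt (1 + y \<bullet> y)) *\<^sub>R vector [y $ 1, y $ 2, 1]"

definition gnomonic :: "real^3 \<Rightarrow> real^2" where
 "gnomonic d = vector [d $ 1 / d $ 3, d $ 2 / d $ 3]"

lemma one_plus_inner_pos: "1 + y \<bullet> y > 0" for y :: "real^2"
 by (simp add: add_pos_nonneg)

lemma hemi_norm: "norm (hemi y) = 1"
proof -
 have "hemi y \<bullet> hemi y = (1 / sqrt (1 + y \<bullet> y)) * ((1 / sqrt (1 + y \<bullet> y)) * (1 + y \<bullet> y))"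
  unfolding hemi_def inner_scaleR_left inner_scaleR_right by (simp only: inner3 inner2 vector_3) simp
 also have "\<dots> = 1" using one_plus_inner_pos[of y] by (simp add: divide_simps)
 finally show ?thesis by (simp add: norm_eq_1)
qed

lemma hemi_3: "hemi y $ 3 > 0" using one_plus_inner_pos[of y] by (simp add: hemi_def)

lemma gnomonic_hemi: "gnomonic (hemi y) = y"
 using one_plus_inner_pos[of y] by (simp add: gnomonic_def hemi_def real2_eq_iff)

lemma hemi_gnomonic:
 assumes "norm d = 1" "d $ 3 > 0"
 shows "hemi (gnomonic d) = d"
proof -
 have "d $ 1 * d $ 1 + d $ 2 * d $ 2 + d $ 3 * d $ 3 = 1" using assms(1) by (simp add: norm3_eq_1)
 then have "1 + gnomonic d \<bullet> gnomonic d = (1 / d $ 3)\<^sup>2"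
  using assms(2) by (simp add: gnomonic_def inner2 power2_eq_square field_simps)
 then have "sqrt (1 + gnomonic d \<bullet> gnomonic d) = 1 / d $ 3" using assms(2) by (simp add: real_sqrt_divide)
 then show ?thesis using assms(2) by (simp add: hemi_def vec3_eq_iff gnomonic_def)
qed

lemma smooth_on_hemi [smooth_intros]: "open S ==> smooth_on S f ==> smooth_on S (%x. hemi (f x))"
 unfolding hemi_def by (intro smooth_intros) (auto simp: one_plus_inner_pos less_imp_neq[symmetric, OF one_plus_inner_pos])

lemma smooth_on_gnomonic [smooth_intros]:
 "open S ==> smooth_on S f ==> (!!x. x \<in> S ==> f x $ 3 ~= 0) ==> smooth_on S (%x. gnomonic (f x))"
 unfolding gnomonic_def by (intro smooth_intros) auto

text \<open>
 A curve whose acceleration is parallel to its velocity has a constant direction \<open>e\<close> and hence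
 lies on a line at a distance \<open>\<bar>c\<bar>\<close> from the origin.  Its position along the line divided by
 \<open>sqrt (1 + c\<^sup>2)\<close> is the tangent of the angle of the corresponding point on the great circle.
\<close>

lemma straight_imp_great_circle:
 fixes \<eta> :: "real \<Rightarrow> real^2"
 assumes I: "open_interval I" and \<eta>: "smooth_on I \<eta>"
  and d: "!!t. t \<in> I ==> (\<eta> has_vector_derivative \<eta>' t) (at t)" and nz: "!!t. t \<in> I ==> \<eta>' t ~= 0"
  and dd: "!!t. t \<in> I ==> \<exists>\<eta>''. (\<eta>' has_vector_derivative \<eta>'') (at t) \<and> cross2 (\<eta>' t) \<eta>'' = 0"
 shows "great_circle_arc I (%t. hemi (\<eta> t))"
proof -
 have oI: "open I" and cI: "convex I" and neI: "I ~= {}" using I by (auto simp: open_interval_def is_interval_convex)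
 define n where "n t = (1 / sqrt (\<eta>' t \<bullet> \<eta>' t)) *\<^sub>R \<eta>' t" for t
 have nd: "(n has_vector_derivative 0) (at t)" if t: "t \<in> I" for t
 proof -
  obtain \<eta>'' where e: "(\<eta>' has_vector_derivative \<eta>'') (at t)" "cross2 (\<eta>' t) \<eta>'' = 0" using dd[OF t] by blast
  define s where "s = \<eta>' t \<bullet> \<eta>' t"
  have s: "s > 0" using nz[OF t] by (simp add: s_def)
  have par: "s *\<^sub>R \<eta>'' = (\<eta>' t \<bullet> \<eta>'') *\<^sub>R \<eta>' t"
  proof -
   have "s *\<^sub>R \<eta>'' - (\<eta>' t \<bullet> \<eta>'') *\<^sub>R \<eta>' t = cross2 (\<eta>' t) \<eta>'' *\<^sub>R vector [- \<eta>' t $ 2, \<eta>' t $ 1]"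
    by (simp add: s_def real2_eq_iff inner2 cross2_def algebra_simps)
   then show ?thesis using e(2) by simp
  qed
  have "((%t. \<eta>' t \<bullet> \<eta>' t) has_vector_derivative (\<eta>' t \<bullet> \<eta>'' + \<eta>'' \<bullet> \<eta>' t)) (at t)"
   by (rule bounded_bilinear.has_vector_derivative[OF bounded_bilinear_inner e(1) e(1)])
  then have ds: "((%t. \<eta>' t \<bullet> \<eta>' t) has_real_derivative 2 * (\<eta>' t \<bullet> \<eta>'')) (at t)"
   by (simp add: has_real_derivative_iff_has_vector_derivative inner_commute)
  have "((%t. sqrt (\<eta>' t \<bullet> \<eta>' t)) has_real_derivative (inverse (sqrt s) / 2) * (2 * (\<eta>' t \<bullet> \<eta>''))) (at t)"
   by (rule DERIV_chain2[OF _ ds]) (use DERIV_real_sqrt[OF s] in \<open>simp add: s_def\<close>)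
  from DERIV_inverse'[OF this] s
  have "((%t. 1 / sqrt (\<eta>' t \<bullet> \<eta>' t)) has_real_derivative - (inverse (sqrt s) * ((inverse (sqrt s) / 2) * (2 * (\<eta>' t \<bullet> \<eta>''))) * inverse (sqrt s))) (at t)"
   by (simp add: s_def inverse_eq_divide)
  from has_vector_derivative_scaleR[OF this e(1)]
  have "(n has_vector_derivative ((1 / sqrt s) *\<^sub>R \<eta>'' + (- (inverse (sqrt s) * ((inverse (sqrt s) / 2) * (2 * (\<eta>' t \<bullet> \<eta>''))) * inverse (sqrt s))) *\<^sub>R \<eta>' t)) (at t)"
   unfolding n_def[abs_def] s_def .
  moreover have "(1 / sqrt s) *\<^sub>R \<eta>'' + (- (inverse (sqrt s) * ((inverse (sqrt s) / 2) * (2 * (\<eta>' t \<bullet> \<eta>''))) * inverse (sqrt s))) *\<^sub>R \<eta>' t = 0"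
  proof -
   have ss: "inverse (sqrt s) * inverse (sqrt s) = 1 / s" using s by (simp add: inverse_eq_divide)
   have "\<eta>'' = (1 / s) *\<^sub>R (s *\<^sub>R \<eta>'')" using s by simp
   then have e2: "\<eta>'' = ((\<eta>' t \<bullet> \<eta>'') / s) *\<^sub>R \<eta>' t" unfolding par by simp
   have "inverse (sqrt s) * ((inverse (sqrt s) / 2) * (2 * (\<eta>' t \<bullet> \<eta>''))) * inverse (sqrt s) = (inverse (sqrt s) * inverse (sqrt s)) * (inverse (sqrt s) * (\<eta>' t \<bullet> \<eta>''))" by simp
   also have "\<dots> = (1 / sqrt s) * ((\<eta>' t \<bullet> \<eta>'') / s)" unfolding ss by (simp add: inverse_eq_divide)
   finally have c: "inverse (sqrt s) * ((inverse (sqrt s) / 2) * (2 * (\<eta>' t \<bullet> \<eta>''))) * inverse (sqrt s) = (1 / sqrt s) * ((\<eta>' t \<bullet> \<eta>'') / s)" .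
   have "(1 / sqrt s) *\<^sub>R \<eta>'' = ((1 / sqrt s) * ((\<eta>' t \<bullet> \<eta>'') / s)) *\<^sub>R \<eta>' t"
    using e2 by (metis scaleR_scaleR)
   then show ?thesis unfolding c by simp
  qed
  ultimately show ?thesis by simp
 qed
 have nw: "(n has_vector_derivative 0) (at t within I)" if "t \<in> I" for t
  using nd[OF that] has_vector_derivative_at_within by blast
 obtain e where e: "!!t. t \<in> I ==> n t = e"
  by (rule has_vector_derivative_zero_constant[OF cI], erule nw, blast intro: that)
 obtain t0 where t0: "t0 \<in> I" using neI by blast
 have ee: "e \<bullet> e = 1"
 proof -
  have "n t0 \<bullet> n t0 = 1" using nz[OF t0] by (simp add: n_def)
  then show ?thesis using e[OF t0] by simp
 qed
 have \<eta>'e: "\<eta>' t = norm (\<eta>' t) *\<^sub>R e" if "t \<in> I" for t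
  using e[OF that] nz[OF that] by (simp add: n_def norm_eq_sqrt_inner[symmetric]) (metis norm_eq_zero right_inverse scaleR_one scaleR_scaleR inverse_eq_divide)
 define \<mu> where "\<mu> t = e \<bullet> \<eta> t" for t
 have \<mu>d: "(\<mu> has_real_derivative norm (\<eta>' t)) (at t)" if "t \<in> I" for t
 proof -
  have "(\<mu> has_vector_derivative e \<bullet> \<eta>' t) (at t)" unfolding \<mu>_def by (rule bounded_linear.has_vector_derivative[OF bounded_linear_inner_right d[OF that]])
  moreover have "e \<bullet> \<eta>' t = norm (\<eta>' t)" by (subst \<eta>'e[OF that]) (simp add: ee)
  ultimately show ?thesis by (simp add: has_real_derivative_iff_has_vector_derivative)
 qed
 have cw: "((%t. cross2 e (\<eta> t)) has_vector_derivative 0) (at t within I)" if t: "t \<in> I" for t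
 proof -
  have "((%t. cross2 e (\<eta> t)) has_vector_derivative (cross2 e (\<eta>' t) + cross2 0 (\<eta> t))) (at t)"
   by (rule bounded_bilinear.has_vector_derivative[OF bounded_bilinear_cross2 has_vector_derivative_const d[OF t]])
  moreover have "cross2 e (\<eta>' t) + cross2 0 (\<eta> t) = 0" by (subst \<eta>'e[OF t]) (simp add: cross2_scaleR, simp add: cross2_def)
  ultimately show ?thesis using has_vector_derivative_at_within by simp
 qed
 obtain c where c: "!!t. t \<in> I ==> cross2 e (\<eta> t) = c"
  by (rule has_vector_derivative_zero_constant[OF cI], erule cw, blast intro: that)
 have e2: "e $ 1 * e $ 1 + e $ 2 * e $ 2 = 1" using ee by (simp add: inner2)
 have line: "\<eta> t = \<mu> t *\<^sub>R e + c *\<^sub>R vector [- e $ 2, e $ 1]" if t: "t \<in> I" for t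
 proof -
  have "\<mu> t *\<^sub>R e + cross2 e (\<eta> t) *\<^sub>R vector [- e $ 2, e $ 1] = (e $ 1 * e $ 1 + e $ 2 * e $ 2) *\<^sub>R \<eta> t"
   by (simp add: \<mu>_def real2_eq_iff inner2 cross2_def algebra_simps)
  then show ?thesis using c[OF t] e2 by simp
 qed
 define k where "k = sqrt (1 + c\<^sup>2)"
 have k: "k > 0" "k\<^sup>2 = 1 + c\<^sup>2" using add_pos_nonneg[of 1 "c\<^sup>2"] by (simp_all add: k_def)
 define u where "u = (1 / k) *\<^sub>R (vector [- (c * e $ 2), c * e $ 1, 1] :: real^3)"
 define w where "w = (vector [e $ 1, e $ 2, 0] :: real^3)"
 define \<theta> where "\<theta> t = arctan (\<mu> t / k)" for t
 have uu: "norm u = 1"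
 proof -
  have "u \<bullet> u = (1 / k) * ((1 / k) * (c\<^sup>2 * (e $ 1 * e $ 1 + e $ 2 * e $ 2) + 1))"
   by (simp add: u_def inner3 power2_eq_square algebra_simps)
  also have "\<dots> = (1 / k) * ((1 / k) * k\<^sup>2)" using k(2) e2 by (simp add: add.commute)
  also have "\<dots> = 1" using k(1) by (simp add: power2_eq_square)
  finally show ?thesis by (simp add: norm_eq_1)
 qed
 have ww: "norm w = 1" using e2 by (simp add: norm3_eq_1 w_def)
 have uw: "u \<bullet> w = 0" by (simp add: u_def w_def inner3)
 have "smooth_on I \<mu>" unfolding \<mu>_def[abs_def] by (intro smooth_intros oI \<eta>)
 then have s\<theta>: "smooth_on I \<theta>" unfolding \<theta>_def[abs_def] using k by (intro smooth_intros oI) auto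
 have d\<theta>: "deriv \<theta> t > 0" if t: "t \<in> I" for t
 proof -
  have "(\<theta> has_real_derivative inverse (1 + (\<mu> t / k)\<^sup>2) * (norm (\<eta>' t) / k)) (at t)"
   unfolding \<theta>_def[abs_def] by (rule DERIV_chain2[OF DERIV_arctan DERIV_cdivide[OF \<mu>d[OF t]]])
  moreover have "inverse (1 + (\<mu> t / k)\<^sup>2) * (norm (\<eta>' t) / k) > 0"
   using k nz[OF t] by (intro mult_pos_pos) (auto simp: add_pos_nonneg)
  ultimately show ?thesis using DERIV_imp_deriv by metis
 qed
 have arc: "hemi (\<eta> t) = cos (\<theta> t) *\<^sub>R u + sin (\<theta> t) *\<^sub>R w" if t: "t \<in> I" for t
 proof -
  have "\<eta> t \<bullet> \<eta> t = (\<mu> t)\<^sup>2 * (e $ 1 * e $ 1 + e $ 2 * e $ 2) + c\<^sup>2 * (e $ 1 * e $ 1 + e $ 2 * e $ 2)"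
   by (simp add: line[OF t] inner2 power2_eq_square algebra_simps)
  moreover have "k\<^sup>2 * (1 + (\<mu> t / k)\<^sup>2) = k\<^sup>2 + (\<mu> t)\<^sup>2" using k(1) by (simp add: power_divide field_simps)
  ultimately have "1 + \<eta> t \<bullet> \<eta> t = k\<^sup>2 * (1 + (\<mu> t / k)\<^sup>2)" using k(2) e2 by simp
  then have r: "sqrt (1 + \<eta> t \<bullet> \<eta> t) = k * sqrt (1 + (\<mu> t / k)\<^sup>2)" using k(1) by (simp add: real_sqrt_mult)
  have q: "sqrt (1 + (\<mu> t / k)\<^sup>2) > 0" by (simp add: add_pos_nonneg)
  define Q where "Q = sqrt (1 + (\<mu> t / k)\<^sup>2)"
  have c': "cos (\<theta> t) = 1 / Q" "sin (\<theta> t) = (\<mu> t / k) / Q" by (simp_all add: \<theta>_def Q_def cos_arctan sin_arctan)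
  have h: "hemi (\<eta> t) = (1 / (k * Q)) *\<^sub>R vector [\<eta> t $ 1, \<eta> t $ 2, 1]" by (simp add: hemi_def r Q_def)
  have Q: "Q > 0" using q by (simp add: Q_def)
  show ?thesis
   unfolding h c' using Q k(1) by (simp add: u_def w_def vec3_eq_iff line[OF t] field_simps)
 qed
 show ?thesis unfolding great_circle_arc_def using I uu ww uw s\<theta> d\<theta> arc by blast
qed

text \<open>
 The derivative of a quotient of two components of a great circle is a positive function times
 the constant vector \<open>K\<close> formed by minors of \<open>u\<close> and \<open>w\<close>.
\<close>

lemma great_circle_imp_straight:
 assumes arc: "great_circle_arc I d" and pos: "!!t. t \<in> I ==> d t $ 3 > 0"
 obtains \<eta>' where "open_interval I" "smooth_on I (%t. gnomonic (d t))"
  "!!t. t \<in> I ==> ((%t. gnomonic (d t)) has_vector_derivative \<eta>' t) (at t)" "!!t. t \<in> I ==> \<eta>' t ~= 0"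
  "!!t. t \<in> I ==> \<exists>\<eta>''. (\<eta>' has_vector_derivative \<eta>'') (at t) \<and> cross2 (\<eta>' t) \<eta>'' = 0" "!!t. t \<in> I ==> norm (d t) = 1"
proof -
 obtain u w \<theta> where a: "open_interval I" "norm u = 1" "norm w = 1" "u \<bullet> w = 0" "smooth_on I \<theta>"
  "!!t. t \<in> I ==> deriv \<theta> t > 0" "!!t. t \<in> I ==> d t = cos (\<theta> t) *\<^sub>R u + sin (\<theta> t) *\<^sub>R w"
  using arc unfolding great_circle_arc_def by blast
 have oI: "open I" and neI: "I ~= {}" using a(1) by (auto simp: open_interval_def)
 define \<theta>' where "\<theta>' t = vector_derivative \<theta> (at t)" for t
 have d\<theta>: "(\<theta> has_real_derivative \<theta>' t) (at t)" if "t \<in> I" for t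
  using smooth_on_has_vector_derivative[OF a(5) that] by (simp add: \<theta>'_def has_real_derivative_iff_has_vector_derivative)
 have \<theta>'p: "\<theta>' t > 0" if "t \<in> I" for t using a(6)[OF that] DERIV_imp_deriv[OF d\<theta>[OF that]] by simp
 have s\<theta>': "smooth_on I \<theta>'" unfolding \<theta>'_def[abs_def] by (rule smooth_on_vector_derivative[OF oI a(5)])
 define D where "D i t = cos (\<theta> t) * u $ i + sin (\<theta> t) * w $ i" for i :: 3 and t
 have dD: "d t $ i = D i t" if "t \<in> I" for t i using a(7)[OF that] by (simp add: D_def)
 have Dd: "(D i has_real_derivative \<theta>' t * (cos (\<theta> t) * w $ i - sin (\<theta> t) * u $ i)) (at t)" if "t \<in> I" for i t
  unfolding D_def[abs_def] by (rule derivative_eq_intros d\<theta>[OF that] refl)+ (simp add: algebra_simps)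
 have D3: "D 3 t > 0" if "t \<in> I" for t using pos[OF that] dD[OF that] by simp
 define K where "K = (vector [w $ 1 * u $ 3 - u $ 1 * w $ 3, w $ 2 * u $ 3 - u $ 2 * w $ 3] :: real^2)"
 have q: "((%t. D i t / D 3 t) has_real_derivative (\<theta>' t / (D 3 t)\<^sup>2) * (w $ i * u $ 3 - u $ i * w $ 3)) (at t)" if t: "t \<in> I" for i t
 proof -
  let ?c = "cos (\<theta> t)" and ?s = "sin (\<theta> t)"
  have "((%t. D i t / D 3 t) has_real_derivative ((\<theta>' t * (?c * w $ i - ?s * u $ i)) * D 3 t - D i t * (\<theta>' t * (?c * w $ 3 - ?s * u $ 3))) / (D 3 t * D 3 t)) (at t)"
   by (rule DERIV_divide[OF Dd[OF t] Dd[OF t]]) (use D3[OF t] in simp)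
  moreover have "(\<theta>' t * (?c * w $ i - ?s * u $ i)) * D 3 t - D i t * (\<theta>' t * (?c * w $ 3 - ?s * u $ 3)) = \<theta>' t * (w $ i * u $ 3 - u $ i * w $ 3)"
  proof -
   have "(q * (c * wi - s * ui)) * (c * u3 + s * w3) - (c * ui + s * wi) * (q * (c * w3 - s * u3)) = (s\<^sup>2 + c\<^sup>2) * (q * (wi * u3 - ui * w3))" for q c s wi ui w3 u3 :: real
    by (simp add: power2_eq_square algebra_simps)
   then show ?thesis unfolding D_def sin_cos_squared_add by simp
  qed
  ultimately show ?thesis by (simp add: power2_eq_square[of "D 3 t"])
 qed
 define \<eta>' where "\<eta>' t = (\<theta>' t / (D 3 t)\<^sup>2) *\<^sub>R K" for t
 have gn: "gnomonic (d t) = (D 1 t / D 3 t) *\<^sub>R axis 1 1 + (D 2 t / D 3 t) *\<^sub>R axis 2 1" if "t \<in> I" for t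
  using dD[OF that] by (simp add: gnomonic_def axis_comb)
 have 1: "((%t. gnomonic (d t)) has_vector_derivative \<eta>' t) (at t)" if t: "t \<in> I" for t
 proof -
  have "((%t. (D 1 t / D 3 t) *\<^sub>R (axis 1 1 :: real^2) + (D 2 t / D 3 t) *\<^sub>R (axis 2 1 :: real^2)) has_vector_derivative
   (((D 1 t / D 3 t) *\<^sub>R 0 + ((\<theta>' t / (D 3 t)\<^sup>2) * (w $ 1 * u $ 3 - u $ 1 * w $ 3)) *\<^sub>R (axis 1 1 :: real^2))
   + ((D 2 t / D 3 t) *\<^sub>R 0 + ((\<theta>' t / (D 3 t)\<^sup>2) * (w $ 2 * u $ 3 - u $ 2 * w $ 3)) *\<^sub>R (axis 2 1 :: real^2)))) (at t)"
   by (intro has_vector_derivative_add has_vector_derivative_scaleR q[OF t] has_vector_derivative_const)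
  moreover have "((D 1 t / D 3 t) *\<^sub>R 0 + ((\<theta>' t / (D 3 t)\<^sup>2) * (w $ 1 * u $ 3 - u $ 1 * w $ 3)) *\<^sub>R (axis 1 1 :: real^2))
   + ((D 2 t / D 3 t) *\<^sub>R 0 + ((\<theta>' t / (D 3 t)\<^sup>2) * (w $ 2 * u $ 3 - u $ 2 * w $ 3)) *\<^sub>R (axis 2 1 :: real^2)) = \<eta>' t"
   by (simp add: \<eta>'_def K_def real2_eq_iff axis_def)
  ultimately have "((%t. (D 1 t / D 3 t) *\<^sub>R (axis 1 1 :: real^2) + (D 2 t / D 3 t) *\<^sub>R (axis 2 1 :: real^2)) has_vector_derivative \<eta>' t) (at t)" by simp
  then show ?thesis by (rule has_vector_derivative_transform_open[OF _ oI t]) (rule gn[symmetric])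
 qed
 have K0: "K ~= 0"
 proof
  assume "K = 0"
  then have z: "w $ 1 * u $ 3 = u $ 1 * w $ 3" "w $ 2 * u $ 3 = u $ 2 * w $ 3" by (simp_all add: K_def real2_eq_iff)
  have "w $ 3 *\<^sub>R u = u $ 3 *\<^sub>R w" using z by (simp add: vec3_eq_iff mult.commute)
  then have "w $ 3 * (u \<bullet> u) = u $ 3 * (w \<bullet> u)" "w $ 3 * (u \<bullet> w) = u $ 3 * (w \<bullet> w)" unfolding inner_scaleR_left[symmetric] by simp_all
  moreover have "w \<bullet> u = 0" "u \<bullet> u = 1" "w \<bullet> w = 1" using a(2-4) by (simp_all add: norm_eq_1 inner_commute)
  ultimately have "w $ 3 = 0" "u $ 3 = 0" using a(4) by simp_all
  then show False using D3 neI by (auto simp: D_def)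
 qed
 have 2: "\<eta>' t ~= 0" if "t \<in> I" for t using K0 \<theta>'p[OF that] D3[OF that] by (simp add: \<eta>'_def)
 have sD: "smooth_on I (D i)" for i unfolding D_def[abs_def] by (intro smooth_intros oI a(5))
 have sm: "smooth_on I (%t. \<theta>' t / (D 3 t)\<^sup>2)"
  by (intro smooth_intros oI s\<theta>' sD) (use D3 in force)
 have 3: "\<exists>\<eta>''. (\<eta>' has_vector_derivative \<eta>'') (at t) \<and> cross2 (\<eta>' t) \<eta>'' = 0" if t: "t \<in> I" for t
 proof -
  let ?m = "vector_derivative (%t. \<theta>' t / (D 3 t)\<^sup>2) (at t)"
  have "((%t. \<theta>' t / (D 3 t)\<^sup>2) has_real_derivative ?m) (at t)"
   using smooth_on_has_vector_derivative[OF sm t] by (simp add: has_real_derivative_iff_has_vector_derivative)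
  from has_vector_derivative_scaleR[OF this has_vector_derivative_const[of K]]
  have "(\<eta>' has_vector_derivative ?m *\<^sub>R K) (at t)" unfolding \<eta>'_def[abs_def] by simp
  then show ?thesis by (auto simp: \<eta>'_def cross2_scaleR)
 qed
 have "smooth_on I (%t. (D 1 t / D 3 t) *\<^sub>R axis 1 1 + (D 2 t / D 3 t) *\<^sub>R (axis 2 1 :: real^2))"
  by (intro smooth_intros oI sD) (use D3 in force)+
 then have 4: "smooth_on I (%t. gnomonic (d t))"
  using smooth_on_cong[OF oI, of "%t. gnomonic (d t)"] gn by simp
 have 5: "norm (d t) = 1" if "t \<in> I" for t
 proof -
  have "d t \<bullet> d t = (cos (\<theta> t))\<^sup>2 * (u \<bullet> u) + 2 * (cos (\<theta> t) * sin (\<theta> t)) * (u \<bullet> w) + (sin (\<theta> t))\<^sup>2 * (w \<bullet> w)"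
   by (simp add: a(7)[OF that] inner_add_left inner_add_right inner_commute power2_eq_square algebra_simps)
  then show ?thesis using a(2-4) by (simp add: norm_eq_1)
 qed
 show thesis by (rule that[OF a(1) 4 1 2 3 5])
qed

text \<open>
 The composition is a radial map of the plane, followed for \<open>e = -1\<close> by the reflection of the second
 coordinate; in that case the radial factor is decreasing, so both reverse the orientation.
\<close>

lemma stereo_hemi_orientation:
 assumes e: "e = 1 \<or> e = -1" and nz: "1 + e * hemi y $ 3 ~= 0"
 shows "\<exists>k>0. \<forall>h k'. cross2 (fderiv (%y. stereo e (hemi y)) (at y) h) (fderiv (%y. stereo e (hemi y)) (at y) k') = k * cross2 h k'"
proof -
 define r where "r y = sqrt (1 + y \<bullet> y)" for y :: "real^2"
 have r0: "r y > 0" "r y * r y = 1 + y \<bullet> y" for y using one_plus_inner_pos[of y] by (simp_all add: r_def)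
 have re: "r y + e ~= 0"
 proof
  assume "r y + e = 0"
  then have "1 + e * (1 / r y) = 1 - 1" using r0[of y] e by (auto simp: divide_simps)
  then show False using nz by (simp add: hemi_def r_def)
 qed
 have ee: "e * e = 1" using e by auto
 have s: "stereo e (hemi y) = (1 / (r y + e)) *\<^sub>R vector [y $ 1, e * y $ 2]" for y
 proof -
  have "1 + e * hemi y $ 3 = (r y + e) / r y" using r0[of y] by (simp add: hemi_def r_def field_simps)
  moreover have "hemi y $ 1 = y $ 1 / r y" "hemi y $ 2 = y $ 2 / r y" by (simp_all add: hemi_def r_def)
  ultimately show ?thesis using r0(1)[of y] by (simp add: stereo_def real2_eq_iff)
 qed
 have "((%y. y \<bullet> y) has_derivative (%h. y \<bullet> h + h \<bullet> y)) (at y)"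
  by (rule has_derivative_inner[OF has_derivative_ident has_derivative_ident])
 then have "((%y. 1 + y \<bullet> y) has_derivative (%h. 2 * (y \<bullet> h))) (at y)"
  by (auto intro!: derivative_eq_intros simp: inner_commute)
 from has_derivative_compose[OF this has_field_derivative_imp_has_derivative[OF DERIV_real_sqrt[OF one_plus_inner_pos]]]
 have dr: "(r has_derivative (%h. (y \<bullet> h) / r y)) (at y)"
  unfolding r_def[abs_def] by (simp add: inverse_eq_divide)
 define Dl where "Dl h = (1 / (r y + e)) *\<^sub>R (vector [h $ 1, e * h $ 2] :: real^2) - ((y \<bullet> h) / r y / (r y + e)\<^sup>2) *\<^sub>R vector [y $ 1, e * y $ 2]" for h
 have lin: "bounded_linear (%h. vector [h $ 1, e * h $ 2] :: real^2)"
  by (intro linear_conv_bounded_linear[THEN iffD1] linearI) (simp_all add: real2_eq_iff algebra_simps)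
 have "((%y. 1 / (r y + e)) has_derivative (%h. - ((y \<bullet> h) / r y / (r y + e)\<^sup>2))) (at y)"
 proof -
  have "((%y. r y + e) has_derivative (%h. (y \<bullet> h) / r y)) (at y)" using has_derivative_add_const[OF dr] .
  from Deriv.has_derivative_inverse[OF re this] show ?thesis using re by (simp add: inverse_eq_divide power2_eq_square mult_ac)
 qed
 from has_derivative_scaleR[OF this bounded_linear_imp_has_derivative[OF lin]]
 have "((%y. stereo e (hemi y)) has_derivative Dl) (at y)"
  unfolding s Dl_def[abs_def] by simp
 from frechet_derivative_at[OF this] have F: "fderiv (%y. stereo e (hemi y)) (at y) = Dl" by simp
 have "cross2 (Dl h) (Dl k') = 1 / (r y * (r y + e)\<^sup>2) * cross2 h k'" for h k'
 proof -
  let ?q = "r y + e" and ?v = "%h. vector [h $ 1, e * h $ 2] :: real^2"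
  have "cross2 (Dl h) (Dl k') * (r y * ?q ^ 3) = e * (r y * ?q - (y \<bullet> y)) * cross2 h k'"
  proof -
   have Dq: "Dl h = (1 / (r y * ?q\<^sup>2)) *\<^sub>R ((r y * ?q) *\<^sub>R ?v h - (y \<bullet> h) *\<^sub>R ?v y)" for h
    using re r0(1)[of y] by (simp add: Dl_def scaleR_diff_right power2_eq_square)
   have "cross2 ((r y * ?q) *\<^sub>R ?v h - (y \<bullet> h) *\<^sub>R ?v y) ((r y * ?q) *\<^sub>R ?v k' - (y \<bullet> k') *\<^sub>R ?v y) =
    (r y * ?q) * (e * (r y * ?q - (y \<bullet> y)) * cross2 h k')"
    by (simp add: cross2_def inner2 algebra_simps)
   then have "cross2 (Dl h) (Dl k') = (1 / (r y * ?q\<^sup>2)) * ((1 / (r y * ?q\<^sup>2)) * ((r y * ?q) * (e * (r y * ?q - (y \<bullet> y)) * cross2 h k')))"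
    unfolding Dq cross2_scaleR by simp
   then show ?thesis using re r0(1)[of y] by (simp add: power2_eq_square power3_eq_cube)
  qed
  also have "e * (r y * ?q - (y \<bullet> y)) = ?q"
  proof -
   have "r y * ?q - (y \<bullet> y) = 1 + e * r y" using r0(2)[of y] by (simp add: algebra_simps)
   then have "e * (r y * ?q - (y \<bullet> y)) = e + (e * e) * r y" by (simp only:) (simp add: algebra_simps)
   then show ?thesis using ee by simp
  qed
  finally have fin: "cross2 (Dl h) (Dl k') * (r y * ?q ^ 3) = ?q * cross2 h k'" .
  have "X = 1 / (b * q\<^sup>2) * C" if "X * (b * q ^ 3) = q * C" "q ~= 0" "b > 0" for X b q C :: real
   using that by (simp add: power2_eq_square power3_eq_cube field_simps)
  from this[OF fin re r0(1)] show ?thesis .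
 qed
 moreover have "1 / (r y * (r y + e)\<^sup>2) > 0" using re r0(1)[of y] by simp
 ultimately show ?thesis unfolding F by blast
qed

context riemannian_surface
begin

text \<open>
 A local diffeomorphism \<open>H\<close> from chart coordinates to the plane which preserves the orientation and
 straightens the paths gives, after central projection to the sphere, the diffeomorphism required by
 flatness.  The orientation of the paths is preserved since velocities are mapped by the
 derivative.
\<close>

lemma flat_chart:
 assumes c: "chart_at M p c" and \<Omega>: "open \<Omega>" "snd c p \<in> \<Omega>" "\<Omega> \<subseteq> snd c ` fst c" and H: "smooth_on \<Omega> H"
  and jac: "!!x y z. x \<in> \<Omega> ==> \<exists>k>0. cross2 (fderiv H (at x) y) (fderiv H (at x) z) = k * cross2 y z"
  and str: "!!J x x' x'' t. open J ==> t \<in> J ==> x ` J \<subseteq> \<Omega> ==> (!!s. s \<in> J ==> (x has_vector_derivative x' s) (at s)) ==>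
   (x' has_vector_derivative x'') (at t) ==>
   \<exists>\<eta>''. ((%s. fderiv H (at (x s)) (x' s)) has_vector_derivative \<eta>'') (at t) \<and>
    (path_equation a c (param c (x t)) (x' t) x'' \<longleftrightarrow> x' t ~= 0 \<and> cross2 (fderiv H (at (x t)) (x' t)) \<eta>'' = 0)"
 shows "\<exists>U W f. p \<in> U \<and> diffeomorphism M U sphere_atlas W f \<and> orientation_preserving M U sphere_atlas f \<and>
  (\<forall>I \<kappa>. oriented_path M (paths a) I \<kappa> \<and> \<kappa> ` I \<subseteq> U --> great_circle_arc I (f \<circ> \<kappa>)) \<and>
  (\<forall>I d. great_circle_arc I d \<and> d ` I \<subseteq> W -->
   (\<exists>\<kappa>. oriented_path M (paths a) I \<kappa> \<and> \<kappa> ` I \<subseteq> U \<and> (\<forall>t\<in>I. d t = f (\<kappa> t))))"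
proof -
 obtain S' V h where S: "open S'" "snd c p \<in> S'" "S' \<subseteq> \<Omega>" "open V" "H ` S' = V" "!!x. x \<in> S' ==> h (H x) = x"
  "!!y. y \<in> V ==> h y \<in> S' \<and> H (h y) = y" "smooth_on V h"
  by (rule local_inverse[OF \<Omega>(1,2) H], erule jac) (rule that)
 note cM = chart_atD[OF c]
 have HS: "smooth_on S' H" by (rule smooth_on_subset[OF H S(3)])
 have HV: "H x \<in> V" if "x \<in> S'" for x using S(5) that by blast
 have dH: "(H has_derivative fderiv H (at x)) (at x)" if "x \<in> \<Omega>" for x by (rule smooth_on_has_derivative[OF H that])
 have linH: "linear (fderiv H (at x))" if "x \<in> \<Omega>" for x using dH[OF that] has_derivative_linear by blast
 have injH: "y = 0" if "x \<in> \<Omega>" "fderiv H (at x) y = 0" for x y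
 proof -
  have "cross2 y z = 0" for z using jac[OF that(1), of y z] that(2) by (auto simp: cross2_def)
  from this[of "axis 1 1"] this[of "axis 2 1"] show ?thesis by (simp add: cross2_def axis_def real2_eq_iff)
 qed
 define U where "U = fst c \<inter> snd c -` S'"
 define f where "f q = hemi (H (snd c q))" for q
 define W where "W = hemi ` V"
 define fi where "fi d = param c (h (gnomonic d))" for d
 have pc: "snd c (param c x) = x" "param c x \<in> fst c" "param c x \<in> U" if "x \<in> S'" for x
 proof -
  have "x \<in> snd c ` fst c" using that S(3) \<Omega>(3) by blast
  then show 1: "snd c (param c x) = x" "param c x \<in> fst c" using snd_param[of x c "fst c"] by blast+
  then show "param c x \<in> U" using that by (simp add: U_def)
 qed
 have WI: "d \<in> W \<longleftrightarrow> norm d = 1 \<and> d $ 3 > 0 \<and> gnomonic d \<in> V" for d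
 proof
  assume "d \<in> W"
  then obtain v where "v \<in> V" "d = hemi v" unfolding W_def by blast
  then show "norm d = 1 \<and> d $ 3 > 0 \<and> gnomonic d \<in> V" using hemi_norm[of v] hemi_3[of v] gnomonic_hemi[of v] by simp
 next
  assume d: "norm d = 1 \<and> d $ 3 > 0 \<and> gnomonic d \<in> V"
  then have "d = hemi (gnomonic d)" using hemi_gnomonic[of d] by simp
  then show "d \<in> W" unfolding W_def using d by blast
 qed
 have fU: "f q \<in> W" "fi (f q) = q" if "q \<in> U" for q
 proof -
  have q: "snd c q \<in> S'" "q \<in> fst c" using that by (simp_all add: U_def)
  show "f q \<in> W" unfolding f_def W_def using HV[OF q(1)] by blast
  show "fi (f q) = q" by (simp add: f_def fi_def gnomonic_hemi S(6)[OF q(1)] param_snd[OF cM(1) q(2)])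
 qed
 have fiW: "fi d \<in> U" "f (fi d) = d" "snd c (fi d) = h (gnomonic d)" if "d \<in> W" for d
 proof -
  have d: "norm d = 1" "d $ 3 > 0" "gnomonic d \<in> V" using that WI by blast+
  have hS: "h (gnomonic d) \<in> S'" "H (h (gnomonic d)) = gnomonic d" using S(7)[OF d(3)] by blast+
  show "fi d \<in> U" unfolding fi_def by (rule pc(3)[OF hS(1)])
  show "snd c (fi d) = h (gnomonic d)" unfolding fi_def by (rule pc(1)[OF hS(1)])
  then show "f (fi d) = d" by (simp add: f_def hS(2) hemi_gnomonic[OF d(1,2)])
 qed
 have bij: "bij_betw f U W" by (rule bij_betw_byWitness[where f' = fi]) (use fU fiW in blast)+
 have inv: "inv_into U f d = fi d" if "d \<in> W" for d
  by (rule inv_into_f_eq) (use bij fiW[OF that] in \<open>auto simp: bij_betw_def\<close>)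
 have fcont: "continuous_on S' (%y. hemi (H y) $ 3)"
  by (rule smooth_on_continuous_on) (intro smooth_intros S(1) HS)
 define P where "P e = {\<xi>. inv_stereo e \<xi> $ 3 > 0 \<and> gnomonic (inv_stereo e \<xi>) \<in> V}" for e
 have E: "open {\<xi>. inv_stereo e \<xi> $ 3 > 0}" for e
 proof -
  have "continuous_on UNIV (%\<xi>. inv_stereo e \<xi> $ 3)"
   by (rule smooth_on_continuous_on) (intro smooth_intros open_UNIV)
  from continuous_open_preimage[OF this open_UNIV open_greaterThan[of 0]] show ?thesis by (simp add: vimage_def)
 qed
 have sg: "smooth_on {\<xi>. inv_stereo e \<xi> $ 3 > 0} (%\<xi>. gnomonic (inv_stereo e \<xi>))" for e
  by (intro smooth_intros E) auto
 have oP: "open (P e)" for e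
 proof -
  have "P e = {\<xi>. inv_stereo e \<xi> $ 3 > 0} \<inter> (%\<xi>. gnomonic (inv_stereo e \<xi>)) -` V" by (auto simp: P_def)
  then show ?thesis using continuous_open_preimage[OF smooth_on_continuous_on[OF sg] E S(4)] by simp
 qed
 have sh: "smooth_on (P e) (%\<xi>. h (gnomonic (inv_stereo e \<xi>)))" for e
  by (rule smooth_on_compose[OF oP S(4,8)], rule smooth_on_subset[OF sg]) (auto simp: P_def)
 have sd: "d \<in> stereo_dom e \<longleftrightarrow> norm d = 1 \<and> 1 + e * d $ 3 ~= 0" if "e = 1 \<or> e = -1" for d e
  using that by (auto simp: stereo_dom_def)
 have PW: "inv_stereo e \<xi> \<in> W" if "e = 1 \<or> e = -1" "\<xi> \<in> P e" for e \<xi>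
  using stereo_inv_stereo(2)[OF that(1), of \<xi>] that(2) by (simp add: WI P_def sd[OF that(1)])
 have WP: "stereo e d \<in> P e" if "e = 1 \<or> e = -1" "d \<in> W" "d \<in> stereo_dom e" for e d
  using that(2) by (simp add: WI P_def inv_stereo_stereo[OF that(1,3)])
 have oU: "openin (manifold_topology M) U" unfolding U_def by (rule openin_chart_preimage[OF cM(1) S(1)])
 have oW: "openin (manifold_topology sphere_atlas) W"
 proof -
  have "W = stereo_dom 1 \<inter> stereo 1 -` P 1"
  proof (rule Set.set_eqI, rule iffI)
   fix d assume "d \<in> W"
   moreover have "d \<in> stereo_dom 1" using \<open>d \<in> W\<close> by (simp add: WI sd)
   ultimately show "d \<in> stereo_dom 1 \<inter> stereo 1 -` P 1" using WP[of 1 d] by simp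
  next
   fix d assume d: "d \<in> stereo_dom 1 \<inter> stereo 1 -` P 1"
   then have "inv_stereo 1 (stereo 1 d) \<in> W" using PW[of 1] by simp
   then show "d \<in> W" using inv_stereo_stereo[of 1 d] d by simp
  qed
  moreover have "openin (manifold_topology sphere_atlas) (fst (stereo_dom 1, stereo 1) \<inter> snd (stereo_dom 1, stereo 1) -` P 1)"
   unfolding manifold_topology_def
   by (rule topology_generated_by_Basis) (use oP[of 1] in \<open>unfold sphere_atlas_eq, blast\<close>)
  ultimately show ?thesis by simp
 qed
 define SE where "SE e = {y. 1 + e * hemi y $ 3 ~= 0}" for e
 have oSE: "open (SE e)" for e
 proof -
  have "continuous_on UNIV (%y. 1 + e * hemi y $ 3)" by (rule smooth_on_continuous_on) (intro smooth_intros open_UNIV)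
  moreover have "open (- {0::real})" by (simp add: open_Compl)
  ultimately have "open (UNIV \<inter> (%y. 1 + e * hemi y $ 3) -` (- {0}))" by (rule continuous_open_preimage[OF _ open_UNIV])
  then show ?thesis by (simp add: SE_def vimage_def Compl_eq)
 qed
 have sSE: "smooth_on (SE e) (%y. stereo e (hemi y))" for e by (intro smooth_intros oSE) (simp add: SE_def)
 have smf: "smooth_map M U sphere_atlas f"
  unfolding smooth_map_def Let_def
 proof (intro conjI ballI)
  show "f ` U \<subseteq> points sphere_atlas"
  proof
   fix d assume "d \<in> f ` U"
   then have "d \<in> W" using fU(1) by blast
   then have "d \<in> stereo_dom 1" by (simp add: WI sd)
   then show "d \<in> points sphere_atlas" by (simp add: points_def sphere_atlas_eq)
  qed
  fix c' d assume c': "c' \<in> M" and d: "d \<in> sphere_atlas"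
  obtain e where e: "e = 1 \<or> e = -1" "d = (stereo_dom e, stereo e)" by (rule sphere_atlasE[OF d])
  define S2 where "S2 = S' \<inter> H -` SE e"
  have oS2: "open S2" unfolding S2_def by (rule continuous_open_preimage[OF smooth_on_continuous_on[OF HS] S(1) oSE])
  have set: "U \<inter> fst c' \<inter> f -` fst d = fst c' \<inter> fst c \<inter> snd c -` S2"
   by (auto simp: U_def S2_def SE_def f_def e(2) sd[OF e(1)] hemi_norm simp del: split_paired_All)
  have oT: "open (snd c' ` (U \<inter> fst c' \<inter> f -` fst d))"
   unfolding set by (rule preimage_transition_open[OF cM(1) c' oS2])
  then show "open (snd c' ` (U \<inter> fst c' \<inter> f -` fst d))" .
  have s2: "smooth_on S2 (%y. stereo e (hemi (H y)))"
   by (rule smooth_on_compose[OF oS2 oSE sSE], rule smooth_on_subset[OF HS]) (auto simp: S2_def)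
  have "smooth_on (snd c' ` (U \<inter> fst c' \<inter> f -` fst d)) (%x. stereo e (hemi (H (transition c' c x))))"
  proof (rule smooth_on_compose[OF oT oS2 s2])
   show "smooth_on (snd c' ` (U \<inter> fst c' \<inter> f -` fst d)) (transition c' c)"
    by (rule smooth_on_subset[OF transition_smooth[OF c' cM(1)]]) (use set in blast)
   show "transition c' c ` (snd c' ` (U \<inter> fst c' \<inter> f -` fst d)) \<subseteq> S2"
   proof
    fix y assume "y \<in> transition c' c ` (snd c' ` (U \<inter> fst c' \<inter> f -` fst d))"
    then obtain q where q: "q \<in> fst c' \<inter> fst c \<inter> snd c -` S2" "y = transition c' c (snd c' q)" unfolding set by blast
    have "transition c' c (snd c' q) = snd c q" by (rule transition_snd[OF c']) (use q(1) in blast)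
    then show "y \<in> S2" using q by simp
   qed
  qed
  then show "smooth_on (snd c' ` (U \<inter> fst c' \<inter> f -` fst d)) (snd d \<circ> f \<circ> param c')"
   by (simp add: o_def f_def e(2) transition_def)
 qed
 have smi: "smooth_map sphere_atlas W M (inv_into U f)"
  unfolding smooth_map_def Let_def
 proof (intro conjI ballI)
  show "inv_into U f ` W \<subseteq> points M"
  proof
   fix q assume "q \<in> inv_into U f ` W"
   then obtain d where d: "d \<in> W" "q = inv_into U f d" by blast
   then have "q \<in> fst c" using fiW(1)[OF d(1)] inv[OF d(1)] by (simp add: U_def)
   then show "q \<in> points M" using cM(1) unfolding points_def by blast
  qed
  fix d c' assume d: "d \<in> sphere_atlas" and c': "c' \<in> M"
  obtain e where e: "e = 1 \<or> e = -1" "d = (stereo_dom e, stereo e)" by (rule sphere_atlasE[OF d])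
  define T where "T = P e \<inter> (%\<xi>. h (gnomonic (inv_stereo e \<xi>))) -` (snd c ` (fst c \<inter> fst c'))"
  have oT: "open T" unfolding T_def by (rule continuous_open_preimage[OF smooth_on_continuous_on[OF sh] oP overlap_open[OF cM(1) c']])
  have mem: "fi d' \<in> fst c' \<longleftrightarrow> h (gnomonic d') \<in> snd c ` (fst c \<inter> fst c')" if "d' \<in> W" for d'
  proof -
   have u: "fi d' \<in> fst c" using fiW(1)[OF that] by (simp add: U_def)
   have "fi d' \<in> fst c \<inter> fst c' \<longleftrightarrow> snd c (fi d') \<in> snd c ` (fst c \<inter> fst c')"
    by (rule inj_on_image_mem_iff[OF chart_inj[OF cM(1)] u, symmetric]) blast
   then show ?thesis using u fiW(3)[OF that] by simp
  qed
  have set: "snd d ` (W \<inter> fst d \<inter> inv_into U f -` fst c') = T"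
  proof (rule Set.set_eqI, rule iffI)
   fix \<xi> assume "\<xi> \<in> snd d ` (W \<inter> fst d \<inter> inv_into U f -` fst c')"
   then obtain d' where d': "d' \<in> W" "d' \<in> stereo_dom e" "inv_into U f d' \<in> fst c'" "\<xi> = stereo e d'" unfolding e(2) by auto
   then have "fi d' \<in> fst c'" using inv by simp
   then show "\<xi> \<in> T" unfolding T_def using mem[OF d'(1)] WP[OF e(1) d'(1,2)] by (simp add: d'(4) inv_stereo_stereo[OF e(1) d'(2)])
  next
   fix \<xi> assume \<xi>: "\<xi> \<in> T"
   then have w: "inv_stereo e \<xi> \<in> W" using PW[OF e(1)] by (simp add: T_def)
   have "inv_into U f (inv_stereo e \<xi>) \<in> fst c'" using mem[OF w] \<xi> inv[OF w] by (simp add: T_def)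
   moreover have "\<xi> = stereo e (inv_stereo e \<xi>)" using stereo_inv_stereo(1)[OF e(1)] by simp
   ultimately show "\<xi> \<in> snd d ` (W \<inter> fst d \<inter> inv_into U f -` fst c')"
    using w stereo_inv_stereo(2)[OF e(1), of \<xi>] unfolding e(2) fst_conv snd_conv by blast
  qed
  show "open (snd d ` (W \<inter> fst d \<inter> inv_into U f -` fst c'))" unfolding set by (rule oT)
  have "smooth_on T (%\<xi>. transition c c' (h (gnomonic (inv_stereo e \<xi>))))"
   by (rule smooth_on_compose[OF oT overlap_open[OF cM(1) c'] transition_smooth[OF cM(1) c']], rule smooth_on_subset[OF sh])
    (auto simp: T_def simp del: split_paired_All)
  moreover have "(snd d \<circ> id) = snd d" by simp
  moreover have "(snd c' \<circ> inv_into U f \<circ> param d) \<xi> = transition c c' (h (gnomonic (inv_stereo e \<xi>)))" if "\<xi> \<in> T" for \<xi>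
  proof -
   have w: "inv_stereo e \<xi> \<in> W" using PW[OF e(1)] that by (simp add: T_def)
   show ?thesis by (simp add: e(2) param_stereo[OF e(1)] inv[OF w] fi_def transition_def)
  qed
  ultimately show "smooth_on (snd d ` (W \<inter> fst d \<inter> inv_into U f -` fst c')) (snd c' \<circ> inv_into U f \<circ> param d)"
   unfolding set by (subst smooth_on_cong[OF oT]) auto
 qed
 have orient: "orientation_preserving M U sphere_atlas f"
  unfolding orientation_preserving_def
 proof (intro ballI allI impI)
  fix q c' d assume q: "q \<in> U" and c': "chart_at M q c'" and d: "chart_at sphere_atlas (f q) d"
  have "d \<in> sphere_atlas" using d by (simp add: chart_at_def)
  then obtain e where e: "e = 1 \<or> e = -1" "d = (stereo_dom e, stereo e)" by (rule sphere_atlasE)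
  have qS: "snd c q \<in> S'" "q \<in> fst c" using q by (simp_all add: U_def)
  have qc: "chart_at M q c" using qS cM(1) by (simp add: chart_at_def)
  have q\<Omega>: "snd c q \<in> \<Omega>" using qS S(3) by blast
  have tq: "transition c' c (snd c' q) = snd c q" by (rule transition_snd[OF chart_atD[OF c']])
  have "f q \<in> stereo_dom e" using d by (simp add: chart_at_def e(2))
  then have nz: "1 + e * hemi (H (snd c q)) $ 3 ~= 0" by (simp add: sd[OF e(1)] f_def)
  let ?T = "fderiv (transition c' c) (at (snd c' q))" and ?L = "fderiv H (at (snd c q))"
   and ?R = "fderiv (%y. stereo e (hemi y)) (at (H (snd c q)))"
  have "((%y. stereo e (hemi y)) has_derivative ?R) (at (H (snd c q)))"
   by (rule smooth_on_has_derivative[OF sSE]) (use nz in \<open>simp add: SE_def\<close>)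
  then have 1: "((%x. stereo e (hemi (H x))) has_derivative (%y. ?R (?L y))) (at (snd c q))"
   using has_derivative_compose[OF dH[OF q\<Omega>]] by blast
  then have "((%x. stereo e (hemi (H x))) has_derivative (%y. ?R (?L y))) (at (transition c' c (snd c' q)))"
   using tq by simp
  from has_derivative_compose[OF transition_has_derivative[OF c' qc] this]
  have D: "((%x. stereo e (hemi (H (transition c' c x)))) has_derivative (%y. ?R (?L (?T y)))) (at (snd c' q))" .
  have eq: "snd d \<circ> f \<circ> param c' = (%x. stereo e (hemi (H (transition c' c x))))"
   by (simp add: o_def f_def e(2) transition_def)
  have F: "fderiv (snd d \<circ> f \<circ> param c') (at (snd c' q)) = (%y. ?R (?L (?T y)))"
   unfolding eq using frechet_derivative_at[OF D] by simp
  have lin: "linear (%y. ?R (?L (?T y)))" using D has_derivative_linear by blast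
  obtain k1 where k1: "k1 > 0" "!!y z. cross2 (?R y) (?R z) = k1 * cross2 y z"
   using stereo_hemi_orientation[OF e(1) nz] by blast
  obtain k2 where k2: "k2 > 0" "cross2 (?L (?T (axis 1 1))) (?L (?T (axis 2 1))) = k2 * cross2 (?T (axis 1 1)) (?T (axis 2 1))"
   using jac[OF q\<Omega>] by blast
  have a12: "cross2 (axis 1 1) (axis 2 1) = 1" by (simp add: cross2_def axis_def)
  have "det (matrix (%y. ?R (?L (?T y)))) = k1 * (k2 * det (matrix ?T))"
   using cross2_linear[OF lin, of "axis 1 1" "axis 2 1"] cross2_linear[OF transition_linear[OF c' qc], of "axis 1 1" "axis 2 1"]
   unfolding k1(2) k2(2) a12 by simp
  then show "det (matrix (fderiv (snd d \<circ> f \<circ> param c') (at (snd c' q)))) > 0"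
   unfolding F using k1(1) k2(1) transition_det_pos[OF c' qc] by simp
 qed
 have to_circle: "great_circle_arc I (f \<circ> \<kappa>)" if path: "oriented_path M (paths a) I \<kappa>" and sub: "\<kappa> ` I \<subseteq> U" for I \<kappa>
 proof -
  have I: "open_interval I" using path by (auto simp: oriented_path_def smooth_curve_def)
  have oI: "open I" using I by (simp add: open_interval_def)
  define x where "x s = snd c (\<kappa> s)" for s
  define x' where "x' s = vector_derivative x (at s)" for s
  define \<eta>' where "\<eta>' s = fderiv H (at (x s)) (x' s)" for s
  have \<kappa>: "\<kappa> t \<in> fst c" "x t \<in> S'" "chart_at M (\<kappa> t) c" "x t \<in> \<Omega>" if "t \<in> I" for t
   using sub that cM(1) S(3) by (auto simp: U_def x_def chart_at_def simp del: split_paired_All)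
  have loc: "\<exists>J. open J \<and> t \<in> J \<and> J \<subseteq> I \<and> smooth_on J x \<and> path_equation a c (\<kappa> t) (x' t) (vector_derivative x' (at t))" if "t \<in> I" for t
   by (rule oriented_path_equation[OF path that \<kappa>(3)[OF that]]) (unfold x_def[symmetric] x'_def[symmetric], blast)
  have sx: "smooth_on I x" by (rule smooth_on_local) (use loc in blast)
  have xd: "(x has_vector_derivative x' s) (at s)" if "s \<in> I" for s
   unfolding x'_def by (rule smooth_on_has_vector_derivative[OF sx that])
  have xdd: "(x' has_vector_derivative vector_derivative x' (at s)) (at s)" if "s \<in> I" for s
   unfolding x'_def[abs_def] by (rule smooth_on_has_vector_derivative[OF smooth_on_vector_derivative[OF oI sx] that])
  have im: "x ` I \<subseteq> \<Omega>" using \<kappa>(4) by blast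
  have pe: "path_equation a c (param c (x t)) (x' t) (vector_derivative x' (at t))" if "t \<in> I" for t
  proof -
   have "param c (x t) = \<kappa> t" unfolding x_def by (rule param_snd[OF cM(1) \<kappa>(1)[OF that]])
   moreover have "path_equation a c (\<kappa> t) (x' t) (vector_derivative x' (at t))"
    using loc[OF that] by (elim exE conjE)
   ultimately show ?thesis by simp
  qed
  have "great_circle_arc I (%t. hemi (H (x t)))"
  proof (rule straight_imp_great_circle[OF I, where \<eta>' = \<eta>'])
   show "smooth_on I (%t. H (x t))" by (rule smooth_on_compose[OF oI \<Omega>(1) H sx im])
   show "((%t. H (x t)) has_vector_derivative \<eta>' t) (at t)" if "t \<in> I" for t
    unfolding \<eta>'_def by (rule has_vector_derivative_chain[OF xd[OF that] dH[OF \<kappa>(4)[OF that]]])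
   show "\<eta>' t ~= 0" if "t \<in> I" for t
    using injH[OF \<kappa>(4)[OF that], of "x' t"] pe[OF that] by (auto simp: \<eta>'_def path_equation_def)
   show "\<exists>\<eta>''. (\<eta>' has_vector_derivative \<eta>'') (at t) \<and> cross2 (\<eta>' t) \<eta>'' = 0" if "t \<in> I" for t
    using str[OF oI that im xd xdd[OF that]] pe[OF that] unfolding \<eta>'_def[abs_def] by blast
  qed
  then show ?thesis by (simp add: o_def f_def x_def)
 qed
 have from_circle: "\<exists>\<kappa>. oriented_path M (paths a) I \<kappa> \<and> \<kappa> ` I \<subseteq> U \<and> (\<forall>t\<in>I. d t = f (\<kappa> t))"
  if arc: "great_circle_arc I d" and sub: "d ` I \<subseteq> W" for I d
 proof -
  have dW: "d t \<in> W" if "t \<in> I" for t using sub that by blast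
  obtain \<eta>' where I: "open_interval I" and \<eta>: "smooth_on I (%t. gnomonic (d t))"
   "!!t. t \<in> I ==> ((%t. gnomonic (d t)) has_vector_derivative \<eta>' t) (at t)" "!!t. t \<in> I ==> \<eta>' t ~= 0"
   "!!t. t \<in> I ==> \<exists>\<eta>''. (\<eta>' has_vector_derivative \<eta>'') (at t) \<and> cross2 (\<eta>' t) \<eta>'' = 0"
   by (rule great_circle_imp_straight[OF arc]) (use dW WI in blast)+
  have oI: "open I" using I by (simp add: open_interval_def)
  define x where "x s = h (gnomonic (d s))" for s
  define x' where "x' s = vector_derivative x (at s)" for s
  define \<kappa> where "\<kappa> s = fi (d s)" for s
  have gV: "gnomonic (d t) \<in> V" if "t \<in> I" for t using dW[OF that] WI by blast
  have xS: "x t \<in> S'" "H (x t) = gnomonic (d t)" "x t \<in> \<Omega>" if "t \<in> I" for t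
   using S(7)[OF gV[OF that]] S(3) by (auto simp: x_def)
  have \<kappa>: "\<kappa> t \<in> U" "f (\<kappa> t) = d t" "snd c (\<kappa> t) = x t" "\<kappa> t = param c (x t)" "\<kappa> t \<in> fst c" if "t \<in> I" for t
   using fiW[OF dW[OF that]] by (simp_all add: \<kappa>_def x_def fi_def U_def)
  have sx: "smooth_on I x" unfolding x_def[abs_def]
   by (rule smooth_on_compose[OF oI S(4,8) \<eta>(1)]) (use gV in blast)
  have xd: "(x has_vector_derivative x' s) (at s)" if "s \<in> I" for s
   unfolding x'_def by (rule smooth_on_has_vector_derivative[OF sx that])
  have xdd: "(x' has_vector_derivative vector_derivative x' (at s)) (at s)" if "s \<in> I" for s
   unfolding x'_def[abs_def] by (rule smooth_on_has_vector_derivative[OF smooth_on_vector_derivative[OF oI sx] that])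
  have im: "x ` I \<subseteq> \<Omega>" using xS(3) by blast
  have \<eta>'eq: "fderiv H (at (x t)) (x' t) = \<eta>' t" if t: "t \<in> I" for t
  proof -
   have "((%t. H (x t)) has_vector_derivative fderiv H (at (x t)) (x' t)) (at t)"
    by (rule has_vector_derivative_chain[OF xd[OF t] dH[OF xS(3)[OF t]]])
   then have "((%t. gnomonic (d t)) has_vector_derivative fderiv H (at (x t)) (x' t)) (at t)"
    by (rule has_vector_derivative_transform_open[OF _ oI t]) (rule xS(2))
   then show ?thesis using \<eta>(2)[OF t] vector_derivative_unique_at by blast
  qed
  have pe: "path_equation a c (\<kappa> t) (x' t) (vector_derivative x' (at t))" if t: "t \<in> I" for t
  proof -
   obtain \<eta>'' where e: "((%s. fderiv H (at (x s)) (x' s)) has_vector_derivative \<eta>'') (at t)"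
    "path_equation a c (param c (x t)) (x' t) (vector_derivative x' (at t)) \<longleftrightarrow> x' t ~= 0 \<and> cross2 (fderiv H (at (x t)) (x' t)) \<eta>'' = 0"
    using str[OF oI t im xd xdd[OF t]] by blast
   obtain \<zeta> where z: "(\<eta>' has_vector_derivative \<zeta>) (at t)" "cross2 (\<eta>' t) \<zeta> = 0" using \<eta>(4)[OF t] by blast
   have "(\<eta>' has_vector_derivative \<eta>'') (at t)"
    by (rule has_vector_derivative_transform_open[OF e(1) oI t]) (rule \<eta>'eq)
   then have "\<eta>'' = \<zeta>" using z(1) vector_derivative_unique_at by blast
   moreover have "x' t ~= 0" using \<eta>(3)[OF t] \<eta>'eq[OF t] linear_0[OF linH[OF xS(3)[OF t]]] by auto
   ultimately show ?thesis using e(2) z(2) \<eta>'eq[OF t] \<kappa>(4)[OF t] by simp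
  qed
  have "oriented_path M (paths a) I \<kappa>"
  proof (rule oriented_pathI)
   show "smooth_curve M I \<kappa>"
    unfolding smooth_curve_def
   proof (intro conjI ballI I)
    show "\<kappa> ` I \<subseteq> points M" using \<kappa>(5) cM(1) unfolding points_def by blast
    fix c' assume c': "c' \<in> M"
    have mem: "\<kappa> t \<in> fst c' \<longleftrightarrow> x t \<in> snd c ` (fst c \<inter> fst c')" if "t \<in> I" for t
    proof -
     have "\<kappa> t \<in> fst c \<inter> fst c' \<longleftrightarrow> snd c (\<kappa> t) \<in> snd c ` (fst c \<inter> fst c')"
      by (rule inj_on_image_mem_iff[OF chart_inj[OF cM(1)] \<kappa>(5)[OF that], symmetric]) blast
     then show ?thesis using \<kappa>(3,5)[OF that] by simp
    qed
    have set: "I \<inter> \<kappa> -` fst c' = I \<inter> x -` (snd c ` (fst c \<inter> fst c'))" using mem by blast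
    show oJ: "open (I \<inter> \<kappa> -` fst c')" unfolding set
     by (rule continuous_open_preimage[OF smooth_on_continuous_on[OF sx] oI overlap_open[OF cM(1) c']])
    have "smooth_on (I \<inter> \<kappa> -` fst c') (%t. transition c c' (x t))"
     by (rule smooth_on_compose[OF oJ overlap_open[OF cM(1) c'] transition_smooth[OF cM(1) c']], rule smooth_on_subset[OF sx]) (use set in blast)+
    moreover have "(snd c' \<circ> \<kappa>) t = transition c c' (x t)" if "t \<in> I \<inter> \<kappa> -` fst c'" for t
     using \<kappa>(4)[of t] that by (simp add: transition_def)
    ultimately show "smooth_on (I \<inter> \<kappa> -` fst c') (snd c' \<circ> \<kappa>)"
     using smooth_on_cong[OF oJ, of "snd c' \<circ> \<kappa>" "%t. transition c c' (x t)"] by blast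
   qed
   fix t assume t: "t \<in> I"
   have v1: "vector_derivative (%s. snd c (\<kappa> s)) (at s) = x' s" if "s \<in> I" for s
    by (rule vector_derivative_at, rule has_vector_derivative_transform_open[OF xd[OF that] oI that]) (rule \<kappa>(3)[symmetric])
   have v2: "vector_derivative (%s. vector_derivative (%s. snd c (\<kappa> s)) (at s)) (at t) = vector_derivative x' (at t)"
    by (rule vector_derivative_at, rule has_vector_derivative_transform_open[OF xdd[OF t] oI t]) (rule v1[symmetric])
   show "\<exists>c. chart_at M (\<kappa> t) c \<and> path_equation a c (\<kappa> t) (vector_derivative (%s. snd c (\<kappa> s)) (at t))
    (vector_derivative (%s. vector_derivative (%s. snd c (\<kappa> s)) (at s)) (at t))"
    by (rule exI[of _ c]) (use pe[OF t] v1[OF t] v2 \<kappa>(5)[OF t] cM(1) in \<open>simp add: chart_at_def\<close>)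
  qed
  then show ?thesis using \<kappa>(1,2) by (intro exI[of _ \<kappa>]) auto
 qed
 have "p \<in> U" using cM(2) S(2) by (simp add: U_def)
 moreover have "diffeomorphism M U sphere_atlas W f"
  unfolding diffeomorphism_def using oU oW bij smf smi by blast
 ultimately show ?thesis using orient to_circle from_circle by blast
qed

end

section \<open>Isothermal coordinates\<close>

lemma smooth_mapD:
 assumes "smooth_map M U N f" "c \<in> M" "d \<in> N"
 shows "open (snd c ` (U \<inter> fst c \<inter> f -` fst d)) \<and> smooth_on (snd c ` (U \<inter> fst c \<inter> f -` fst d)) (snd d \<circ> f \<circ> param c)"
 using bspec[OF bspec[OF conjunct2[OF assms(1)[unfolded smooth_map_def Let_def]] assms(2)] assms(3)] .

text \<open>
 A holomorphic coordinate is used as a map \<open>\<phi>\<close> to the real plane, with inverse \<open>\<psi>\<close> on its image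
 \<open>\<Omega>\<close>.
\<close>

locale isothermal_coordinate = riemannian_surface M g
 for M :: "('p, real^2) atlas" and g +
 fixes U :: "'p set" and z :: "'p \<Rightarrow> complex"
 assumes coordinate: "holomorphic_coordinate M g U z"
begin

definition \<phi> :: "'p \<Rightarrow> real^2" where "\<phi> q = vector [Re (z q), Im (z q)]"
definition \<psi> :: "real^2 \<Rightarrow> 'p" where "\<psi> x = inv_into U z (Complex (x $ 1) (x $ 2))"
definition \<Omega> :: "(real^2) set" where "\<Omega> = \<phi> ` U"

text \<open>The coordinate change from a chart and its inverse.\<close>

definition \<tau> :: "('p, real^2) chart \<Rightarrow> real^2 \<Rightarrow> real^2" where "\<tau> c x = \<phi> (param c x)"
definition \<sigma> :: "('p, real^2) chart \<Rightarrow> real^2 \<Rightarrow> real^2" where "\<sigma> c x = snd c (\<psi> x)"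

definition \<Sigma> :: "('p, real^2) chart \<Rightarrow> (real^2) set" where "\<Sigma> c = {x \<in> \<Omega>. \<psi> x \<in> fst c}"

lemma z_diff: "diffeomorphism M U complex_plane (z ` U) z"
 using coordinate unfolding holomorphic_coordinate_def by blast

lemma z_inj: "inj_on z U"
 using z_diff unfolding diffeomorphism_def bij_betw_def by blast

lemma U_points: "U \<subseteq> points M"
 using z_diff unfolding diffeomorphism_def openin_manifold_topology_iff by blast

lemma z_\<phi>: "z q = Complex (\<phi> q $ 1) (\<phi> q $ 2)"
 by (simp add: \<phi>_def)

lemma \<psi>_\<phi>: "q \<in> U ==> \<psi> (\<phi> q) = q"
 using inv_into_f_f[OF z_inj] by (simp add: \<psi>_def \<phi>_def)

lemma \<Omega>D:
 assumes "x \<in> \<Omega>"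
 shows "\<psi> x \<in> U" "\<phi> (\<psi> x) = x"
proof -
 obtain q where "q \<in> U" "x = \<phi> q" using assms unfolding \<Omega>_def by blast
 then show "\<psi> x \<in> U" "\<phi> (\<psi> x) = x" using \<psi>_\<phi> by simp_all
qed

lemma \<phi>_in: "q \<in> U ==> \<phi> q \<in> \<Omega>" by (simp add: \<Omega>_def)

lemma param_complex_plane: "param (UNIV, %w :: complex. w) = (%w. w)"
proof
 fix w :: complex show "param (UNIV, %w. w) w = w"
  unfolding param_def fst_conv snd_conv by (rule inv_into_f_eq) auto
qed

lemma source_open: "c \<in> M ==> open (snd c ` (U \<inter> fst c))"
 and \<tau>_smooth: "c \<in> M ==> smooth_on (snd c ` (U \<inter> fst c)) (\<tau> c)"
proof -
 assume c: "c \<in> M"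
 have sm: "smooth_map M U complex_plane z" using z_diff unfolding diffeomorphism_def by blast
 let ?I = "(UNIV, %w. w) :: complex set \<times> (complex \<Rightarrow> complex)"
 have mem: "?I \<in> complex_plane" by (simp add: complex_plane_def)
 have 1: "open (snd c ` (U \<inter> fst c \<inter> z -` fst ?I))
   \<and> smooth_on (snd c ` (U \<inter> fst c \<inter> z -` fst ?I)) (snd ?I \<circ> z \<circ> param c)"
  by (rule smooth_mapD[OF sm c mem])
 then have o: "open (snd c ` (U \<inter> fst c))" and s: "smooth_on (snd c ` (U \<inter> fst c)) (%x. z (param c x))"
  by (simp_all add: o_def)
 show "open (snd c ` (U \<inter> fst c))" by (rule o)
 have "smooth_on (snd c ` (U \<inter> fst c)) (%x. Re (z (param c x)) *\<^sub>R (axis 1 1 :: real^2) + Im (z (param c x)) *\<^sub>R axis 2 1)"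
  by (intro smooth_intros o smooth_on_linear[OF bounded_linear_Re o s] smooth_on_linear[OF bounded_linear_Im o s])
 moreover have "\<tau> c = (%x. Re (z (param c x)) *\<^sub>R (axis 1 1 :: real^2) + Im (z (param c x)) *\<^sub>R axis 2 1)"
  by (rule ext) (simp add: \<tau>_def \<phi>_def axis_comb)
 ultimately show "smooth_on (snd c ` (U \<inter> fst c)) (\<tau> c)" by simp
qed

lemma \<Sigma>_open: "c \<in> M ==> open (\<Sigma> c)"
 and \<sigma>_smooth: "c \<in> M ==> smooth_on (\<Sigma> c) (\<sigma> c)"
proof -
 assume c: "c \<in> M"
 have sm: "smooth_map complex_plane (z ` U) M (inv_into U z)" using z_diff unfolding diffeomorphism_def by blast
 let ?I = "(UNIV, %w. w) :: complex set \<times> (complex \<Rightarrow> complex)"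
 have mem: "?I \<in> complex_plane" by (simp add: complex_plane_def)
 let ?W = "z ` U \<inter> inv_into U z -` fst c"
 have "open (snd ?I ` (z ` U \<inter> fst ?I \<inter> inv_into U z -` fst c))
   \<and> smooth_on (snd ?I ` (z ` U \<inter> fst ?I \<inter> inv_into U z -` fst c)) (snd c \<circ> inv_into U z \<circ> param ?I)"
  by (rule smooth_mapD[OF sm mem c])
 then have o: "open ?W" and s: "smooth_on ?W (%w. snd c (inv_into U z w))"
  by (simp_all add: o_def param_complex_plane)
 let ?C = "%x :: real^2. Complex (x $ 1) (x $ 2)"
 have lin: "bounded_linear ?C"
  by (intro linear_conv_bounded_linear[THEN iffD1] linearI) (simp_all add: complex_eq_iff)
 have eq: "\<Sigma> c = ?C -` ?W"
 proof (rule Set.set_eqI, rule iffI)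
  fix x assume x: "x \<in> \<Sigma> c"
  then have "x \<in> \<Omega>" by (simp add: \<Sigma>_def)
  then have "?C x = z (\<psi> x)" "\<psi> x \<in> U" using \<Omega>D[of x] z_\<phi>[of "\<psi> x"] by simp_all
  then show "x \<in> ?C -` ?W" using x by (auto simp: \<Sigma>_def \<psi>_def)
 next
  fix x assume x: "x \<in> ?C -` ?W"
  then obtain q where q: "q \<in> U" "?C x = z q" by blast
  then have "x = \<phi> q" by (simp add: \<phi>_def real2_eq_iff complex_eq_iff)
  then show "x \<in> \<Sigma> c" using x q by (simp add: \<Sigma>_def \<Omega>_def \<psi>_def)
 qed
 have "open (UNIV \<inter> ?C -` ?W)"
  by (rule continuous_open_preimage[OF _ open_UNIV o]) (rule linear_continuous_on[OF lin])
 then show oS: "open (\<Sigma> c)" by (simp add: eq)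
 have "smooth_on (\<Sigma> c) (%x. snd c (inv_into U z (?C x)))"
  by (rule smooth_on_compose[OF oS o s smooth_on_linear[OF lin oS smooth_on_id[OF oS]]]) (use eq in blast)
 then show "smooth_on (\<Sigma> c) (\<sigma> c)" by (simp add: \<sigma>_def[abs_def] \<psi>_def)
qed

lemma \<Omega>_open: "open \<Omega>"
proof -
 have "\<Omega> = (\<Union>c\<in>M. \<Sigma> c)"
  using \<Omega>D(1) U_points by (fastforce simp: \<Sigma>_def points_def simp del: split_paired_All split_paired_Ex)
 then show ?thesis using \<Sigma>_open by auto
qed

lemma chart_point:
 assumes "q \<in> U" "chart_at M q c"
 shows "snd c q \<in> snd c ` (U \<inter> fst c)" "\<phi> q \<in> \<Sigma> c" "\<tau> c (snd c q) = \<phi> q" "\<sigma> c (\<phi> q) = snd c q"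
 using assms chart_atD[OF assms(2)] \<phi>_in[OF assms(1)] by (auto simp: \<Sigma>_def \<psi>_\<phi> \<tau>_def \<sigma>_def simp del: split_paired_All)

abbreviation (input) "T c x \<equiv> fderiv (\<tau> c) (at x)"

lemma T_has_derivative:
 assumes "q \<in> U" "chart_at M q c"
 shows "(\<tau> c has_derivative T c (snd c q)) (at (snd c q))"
 by (rule smooth_on_has_derivative[OF \<tau>_smooth[OF chart_atD(1)[OF assms(2)]] chart_point(1)[OF assms]])

lemma T_linear: "q \<in> U ==> chart_at M q c ==> linear (T c (snd c q))"
 using T_has_derivative has_derivative_linear by blast

lemma T_inverse:
 assumes q: "q \<in> U" and c: "chart_at M q c"
 shows "T c (snd c q) (fderiv (\<sigma> c) (at (\<phi> q)) y) = y"
  and "fderiv (\<sigma> c) (at (\<phi> q)) (T c (snd c q) y) = y"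
proof -
 note cM = chart_atD(1)[OF c] and cp = chart_point[OF q c]
 let ?S = "fderiv (\<sigma> c) (at (\<phi> q))"
 have ds: "(\<sigma> c has_derivative ?S) (at (\<phi> q))" by (rule smooth_on_has_derivative[OF \<sigma>_smooth[OF cM] cp(2)])
 have "((%x. \<tau> c (\<sigma> c x)) has_derivative (%y. T c (snd c q) (?S y))) (at (\<phi> q))"
  by (rule has_derivative_compose[OF ds]) (use T_has_derivative[OF q c] cp(4) in simp)
 then have "((%x. x) has_derivative (%y. T c (snd c q) (?S y))) (at (\<phi> q))"
  by (rule has_derivative_transform_within_open[OF _ \<Sigma>_open[OF cM] cp(2)])
   (use \<Omega>D cM in \<open>auto simp: \<Sigma>_def \<tau>_def \<sigma>_def simp del: split_paired_All\<close>)
 from fun_cong[OF has_derivative_unique[OF this has_derivative_ident], of y] show "T c (snd c q) (?S y) = y" .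
 have "((%x. \<sigma> c (\<tau> c x)) has_derivative (%y. ?S (T c (snd c q) y))) (at (snd c q))"
  by (rule has_derivative_compose[OF T_has_derivative[OF q c]]) (use ds cp(3) in simp)
 then have "((%x. x) has_derivative (%y. ?S (T c (snd c q) y))) (at (snd c q))"
  by (rule has_derivative_transform_within_open[OF _ source_open[OF cM] cp(1)])
   (use \<psi>_\<phi> cM in \<open>auto simp: \<tau>_def \<sigma>_def simp del: split_paired_All\<close>)
 from fun_cong[OF has_derivative_unique[OF this has_derivative_ident], of y] show "?S (T c (snd c q) y) = y" .
qed

lemma deriv_along_z:
 assumes "q \<in> U" "chart_at M q c" "v \<in> tangent_space M q"
 shows "deriv_along M z q v = Complex (T c (snd c q) (v c) $ 1) (T c (snd c q) (v c) $ 2)"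
proof -
 let ?C = "%x :: real^2. Complex (x $ 1) (x $ 2)"
 have lin: "bounded_linear ?C"
  by (intro linear_conv_bounded_linear[THEN iffD1] linearI) (simp_all add: complex_eq_iff)
 have "((%x. ?C (\<tau> c x)) has_derivative (%y. ?C (T c (snd c q) y))) (at (snd c q))"
  by (rule bounded_linear.has_derivative[OF lin T_has_derivative[OF assms(1,2)]])
 moreover have "z \<circ> param c = (%x. ?C (\<tau> c x))" by (simp add: o_def \<tau>_def z_\<phi>[symmetric])
 ultimately have "(z \<circ> param c has_derivative (%y. ?C (T c (snd c q) y))) (at (snd c q))" by simp
 from deriv_along_eq[OF assms(3,2) this] show ?thesis .
qed

text \<open>
 The derivative of a holomorphic coordinate intertwines the rotation of the metric with the
 standard rotation of the plane.
\<close>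

lemma T_rotation:
 assumes q: "q \<in> U" and c: "chart_at M q c"
 shows "T c (snd c q) (rotation_of (Gm c (snd c q)) y) = vector [- T c (snd c q) y $ 2, T c (snd c q) y $ 1]"
proof -
 let ?v = "vec_at M c q y"
 have v: "?v \<in> tangent_space M q" by (rule vec_at_tangent[OF c])
 have qp: "q \<in> points M" using U_points q by blast
 have "deriv_along M z q (rotate_J M g q ?v) = \<i> * deriv_along M z q ?v"
  using coordinate q v unfolding holomorphic_coordinate_def by blast
 then show ?thesis
  unfolding deriv_along_z[OF q c v] deriv_along_z[OF q c rotate_J(1)[OF qp v]] rotate_J_chart[OF v c] vec_at_self[OF c]
  by (simp add: complex_eq_iff real2_eq_iff)
qed

text \<open>The ratio of the metric and the pulled back flat metric, read off on any nonzero vector.\<close>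

definition \<rho> :: "real^2 \<Rightarrow> real" where
 "\<rho> x = (let q = \<psi> x; v = (SOME v. v \<in> tangent_space M q \<and> v ~= zero_vec) in g q v v / (cmod (deriv_along M z q v))\<^sup>2)"

text \<open>
 A vector and its rotation form a basis which is orthogonal with vectors of equal length both for
 the metric and, by \<open>T_rotation\<close>, for the flat metric of the coordinate.  Therefore the two metrics are
 proportional.
\<close>

lemma conformal:
 assumes q: "q \<in> U" and c: "chart_at M q c"
 shows "\<rho> (\<phi> q) > 0" "y \<bullet> (Gm c (snd c q) *v w) = \<rho> (\<phi> q) * (T c (snd c q) y \<bullet> T c (snd c q) w)"
proof -
 let ?L = "T c (snd c q)" and ?G = "Gm c (snd c q)" and ?R = "rotation_of (Gm c (snd c q))"
 note lin = T_linear[OF q c] and pd = Gm_pos_def[OF c]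
 define v where "v = (SOME v. v \<in> tangent_space M q \<and> v ~= zero_vec)"
 have "vec_at M c q (axis 1 1) \<in> tangent_space M q \<and> vec_at M c q (axis 1 1) ~= zero_vec"
  using vec_at_tangent[OF c, of "axis 1 1"] tangent_zero_iff[OF vec_at_tangent[OF c, of "axis 1 1"] c] c
  by (simp add: real2_eq_iff axis_def)
 then have "v \<in> tangent_space M q \<and> v ~= zero_vec" unfolding v_def by (rule someI[of "%v. v \<in> tangent_space M q \<and> v ~= zero_vec"])
 then have v: "v \<in> tangent_space M q" "v ~= zero_vec" by simp_all
 have cm: "(cmod (Complex k l))\<^sup>2 = k * k + l * l" for k l
  unfolding complex_norm by (subst real_sqrt_pow2) (simp_all add: power2_eq_square)
 define y0 where "y0 = v c"
 have y0: "y0 ~= 0" using v tangent_zero_iff[OF v(1) c] by (simp add: y0_def)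
 have Ly0: "?L y0 ~= 0"
 proof
  assume "?L y0 = 0"
  then have "fderiv (\<sigma> c) (at (\<phi> q)) (?L y0) = fderiv (\<sigma> c) (at (\<phi> q)) (?L 0)" using linear_0[OF lin] by simp
  then show False using T_inverse(2)[OF q c] y0 by simp
 qed
 have \<rho>: "\<rho> (\<phi> q) = (y0 \<bullet> (?G *v y0)) / (?L y0 \<bullet> ?L y0)"
  unfolding \<rho>_def Let_def \<psi>_\<phi>[OF q] v_def[symmetric] deriv_along_z[OF q c v(1)] metric_in_chart[OF c v(1) v(1)] y0_def cm
  by (simp add: inner2)
 have pos: "y0 \<bullet> (?G *v y0) > 0" using pd y0 by (simp add: pos_def_def)
 show "\<rho> (\<phi> q) > 0" unfolding \<rho> using pos Ly0 by simp
 note rot = rotation_of[OF pd, of y0]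
 have cr: "cross2 y0 (?R y0) > 0" unfolding rot(3) using pos pos_def_det[OF pd] by simp
 have dec: "\<exists>a b. y = a *\<^sub>R y0 + b *\<^sub>R ?R y0" for y
 proof (intro exI)
  have "cross2 y0 (?R y0) *\<^sub>R y = cross2 y (?R y0) *\<^sub>R y0 + cross2 y0 y *\<^sub>R ?R y0"
   by (simp add: real2_eq_iff cross2_def algebra_simps)
  then have "(1 / cross2 y0 (?R y0)) *\<^sub>R (cross2 y0 (?R y0) *\<^sub>R y) = (1 / cross2 y0 (?R y0)) *\<^sub>R (cross2 y (?R y0) *\<^sub>R y0 + cross2 y0 y *\<^sub>R ?R y0)" by simp
  then show "y = (cross2 y (?R y0) / cross2 y0 (?R y0)) *\<^sub>R y0 + (cross2 y0 y / cross2 y0 (?R y0)) *\<^sub>R ?R y0"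
   using cr by (simp add: scaleR_add_right)
 qed
 obtain a b where y: "y = a *\<^sub>R y0 + b *\<^sub>R ?R y0" using dec by blast
 obtain a' b' where w: "w = a' *\<^sub>R y0 + b' *\<^sub>R ?R y0" using dec by blast
 have 1: "y \<bullet> (?G *v w) = (a * a' + b * b') * (y0 \<bullet> (?G *v y0))"
  using rot(1,2) pos_def_sym[OF pd, of "?R y0" y0]
  by (simp add: y w matrix_vector_right_distrib matrix_vector_mult_scaleR inner_add_left inner_add_right algebra_simps)
 have 2: "?L y \<bullet> ?L w = (a * a' + b * b') * (?L y0 \<bullet> ?L y0)"
  unfolding y w linear_add[OF lin] linear_cmul[OF lin] T_rotation[OF q c] by (simp add: inner2 algebra_simps)
 show "y \<bullet> (?G *v w) = \<rho> (\<phi> q) * (?L y \<bullet> ?L w)"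
  unfolding 1 2 \<rho> using Ly0 by simp
qed

lemma \<rho>_smooth: "smooth_on \<Omega> \<rho>"
proof (rule smooth_on_local)
 fix x assume x: "x \<in> \<Omega>"
 define c where "c = (SOME c. chart_at M (\<psi> x) c)"
 have c: "chart_at M (\<psi> x) c" unfolding c_def by (rule chart_at_some) (use \<Omega>D(1)[OF x] U_points in blast)
 note cM = chart_atD(1)[OF c]
 have xc: "x \<in> \<Sigma> c" using x chart_atD(2)[OF c] by (simp add: \<Sigma>_def)
 let ?Y = "%x. fderiv (\<sigma> c) (at x) (axis 1 1)"
 have im: "\<sigma> c ` \<Sigma> c \<subseteq> snd c ` fst c" by (auto simp: \<Sigma>_def \<sigma>_def simp del: split_paired_All)
 have sG: "smooth_on (\<Sigma> c) (%x. Gm c (\<sigma> c x))"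
  by (rule smooth_on_compose[OF \<Sigma>_open[OF cM] chart_open[OF cM] plane_metric.metric_smooth[OF plane_metric_full[OF cM]] \<sigma>_smooth[OF cM] im])
 have "smooth_on (\<Sigma> c) (%x. ?Y x \<bullet> (Gm c (\<sigma> c x) *v ?Y x))"
  by (intro smooth_intros \<Sigma>_open[OF cM] sG smooth_on_frechet[OF \<sigma>_smooth[OF cM]])
 moreover have "\<rho> x' = ?Y x' \<bullet> (Gm c (\<sigma> c x') *v ?Y x')" if "x' \<in> \<Sigma> c" for x'
 proof -
  have x': "x' \<in> \<Omega>" "\<psi> x' \<in> fst c" using that by (simp_all add: \<Sigma>_def)
  have cc: "chart_at M (\<psi> x') c" using x'(2) cM by (simp add: chart_at_def)
  show ?thesis using conformal(2)[OF \<Omega>D(1)[OF x'(1)] cc, of "?Y x'" "?Y x'"]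
    T_inverse(1)[OF \<Omega>D(1)[OF x'(1)] cc] by (simp add: \<Omega>D(2)[OF x'(1)] \<sigma>_def)
 qed
 ultimately have "smooth_on (\<Sigma> c) \<rho>" using smooth_on_cong[OF \<Sigma>_open[OF cM], of \<rho>] by simp
 then show "\<exists>J. open J \<and> x \<in> J \<and> smooth_on J \<rho>" using \<Sigma>_open[OF cM] xc by blast
qed

sublocale cf: conformal_metric \<Omega> \<rho>
proof
 show "\<rho> x > 0" if "x \<in> \<Omega>" for x
 proof -
  have "\<psi> x \<in> points M" using \<Omega>D(1)[OF that] U_points by blast
  from conformal(1)[OF \<Omega>D(1)[OF that] chart_at_some[OF this]] show ?thesis by (simp add: \<Omega>D(2)[OF that])
 qed
qed (rule \<Omega>_open \<rho>_smooth)+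

lemma \<tau>_isometry:
 assumes c: "c \<in> M"
 shows "plane_isometry (snd c ` (U \<inter> fst c)) (Gm c) \<Omega> cf.conf (\<tau> c)"
proof -
 interpret src: plane_metric "snd c ` (U \<inter> fst c)" "Gm c"
  by (rule plane_metric_chart[OF c source_open[OF c]]) blast
 show ?thesis
 proof
  show "smooth_on (snd c ` (U \<inter> fst c)) (\<tau> c)" by (rule \<tau>_smooth[OF c])
  show "\<tau> c ` snd c ` (U \<inter> fst c) \<subseteq> \<Omega>" using c \<phi>_in by (auto simp: \<tau>_def simp del: split_paired_All)
  fix x y w assume "x \<in> snd c ` (U \<inter> fst c)"
  then obtain q where q: "q \<in> U" "q \<in> fst c" "x = snd c q" by blast
  then have cc: "chart_at M q c" using c by (simp add: chart_at_def)
  show "y \<bullet> (Gm c x *v w) = T c x y \<bullet> (cf.conf (\<tau> c x) *v T c x w)"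
   unfolding q(3) chart_point(3)[OF q(1) cc] cf.conf_mult using conformal(2)[OF q(1) cc, of y w] by simp
 qed
qed

lemma T_det_pos:
 assumes q: "q \<in> U" and c: "chart_at M q c"
 shows "det (matrix (T c (snd c q))) > 0" "sqrt (det (Gm c (snd c q))) = \<rho> (\<phi> q) * det (matrix (T c (snd c q)))"
proof -
 let ?L = "T c (snd c q)" and ?G = "Gm c (snd c q)"
 note lin = T_linear[OF q c] and pd = Gm_pos_def[OF c]
 let ?r = "rotation_of ?G (axis 1 1)"
 have p: "axis 1 1 \<bullet> (?G *v axis 1 1) > 0" using pd by (simp add: pos_def_def axis_def real2_eq_iff)
 have "cross2 (axis 1 1) ?r > 0" unfolding rotation_of(3)[OF pd] using p pos_def_det[OF pd] by simp
 moreover have "cross2 (?L (axis 1 1)) (?L ?r) = ?L (axis 1 1) \<bullet> ?L (axis 1 1)"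
  unfolding T_rotation[OF q c] by (simp add: cross2_def inner2)
 moreover have "?L (axis 1 1) \<bullet> ?L (axis 1 1) > 0"
  using conformal(1)[OF q c] conformal(2)[OF q c, of "axis 1 1" "axis 1 1"] p by (simp add: zero_less_mult_iff)
 ultimately have "0 < det (matrix ?L) * cross2 (axis 1 1) ?r" "cross2 (axis 1 1) ?r > 0"
  unfolding cross2_linear[OF lin] by simp_all
 then show pos: "det (matrix ?L) > 0" by (rule zero_less_mult_pos2)
 have "det ?G = (\<rho> (\<phi> q))\<^sup>2 * (det (matrix ?L))\<^sup>2"
 proof -
  have "det ?G * (cross2 (axis 1 1) (axis 2 1))\<^sup>2 = det (cf.conf (\<tau> c (snd c q))) * (cross2 (?L (axis 1 1)) (?L (axis 2 1)))\<^sup>2"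
   by (rule plane_isometry.T_det[OF \<tau>_isometry[OF chart_atD(1)[OF c]] chart_point(1)[OF q c]])
  then show ?thesis
  unfolding cross2_linear[OF lin] chart_point(3)[OF q c] cf.conf_det by (simp add: cross2_def axis_def)
 qed
 then have "det ?G = (\<rho> (\<phi> q) * det (matrix ?L))\<^sup>2" by (simp add: power_mult_distrib)
 then show "sqrt (det ?G) = \<rho> (\<phi> q) * det (matrix ?L)" using pos conformal(1)[OF q c] by simp
qed

text \<open>
 Curvature is invariant under isometries, and the curvature of \<open>\<rho> \<bar>dz\<bar>\<^sup>2\<close> is \<open>-\<Delta> log \<rho> / (2 \<rho>)\<close>.
\<close>

lemma gauss_curvature:
 assumes q: "q \<in> U"
 shows "fderiv (cf.logd 1) (at (\<phi> q)) (axis 1 1) + fderiv (cf.logd 2) (at (\<phi> q)) (axis 2 1)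
  = - (\<rho> (\<phi> q) * gauss_curvature M g q)"
proof -
 define c where "c = (SOME c. chart_at M q c)"
 have c: "chart_at M q c" unfolding c_def by (rule chart_at_some) (use q U_points in blast)
 interpret iso: plane_isometry "snd c ` (U \<inter> fst c)" "Gm c" \<Omega> cf.conf "\<tau> c" by (rule \<tau>_isometry[OF chart_atD(1)[OF c]])
 let ?L = "T c (snd c q)" and ?G = "Gm c (snd c q)" and ?r = "\<rho> (\<phi> q)"
 define s where "s = fderiv (cf.logd 1) (at (\<phi> q)) (axis 1 1) + fderiv (cf.logd 2) (at (\<phi> q)) (axis 2 1)"
 define e f where "e = ?L (axis 1 1)" and "f = ?L (axis 2 1)"
 have K: "gauss_curvature M g q = (riemann_curvature M g c (snd c q) (axis 1 1) (axis 2 1) (axis 2 1) \<bullet> (?G *v axis 1 1)) / det ?G"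
  by (simp add: gauss_curvature_def Let_def c_def)
 have "?L (riemann_curvature M g c (snd c q) (axis 1 1) (axis 2 1) (axis 2 1)) = - s *\<^sub>R ((f \<bullet> f) *\<^sub>R e - (e \<bullet> f) *\<^sub>R f)"
  unfolding riemann_curvature_eq using iso.curvature_isometry[OF chart_point(1)[OF q c], of "axis 1 1" "axis 2 1" "axis 2 1"]
  unfolding chart_point(3)[OF q c] cf.curvature_conf[OF \<phi>_in[OF q]] s_def e_def f_def by simp
 then have "riemann_curvature M g c (snd c q) (axis 1 1) (axis 2 1) (axis 2 1) \<bullet> (?G *v axis 1 1) = ?r * (- s * ((f \<bullet> f) * (e \<bullet> e) - (e \<bullet> f)\<^sup>2))"
  unfolding conformal(2)[OF q c] by (simp add: e_def[symmetric] inner_diff_left inner_diff_right inner_commute power2_eq_square)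
 also have "(f \<bullet> f) * (e \<bullet> e) - (e \<bullet> f)\<^sup>2 = (cross2 e f)\<^sup>2" by (simp add: inner2 cross2_def power2_eq_square algebra_simps)
 finally have n: "riemann_curvature M g c (snd c q) (axis 1 1) (axis 2 1) (axis 2 1) \<bullet> (?G *v axis 1 1) = ?r * (- s * (cross2 e f)\<^sup>2)" .
 have cr: "cross2 e f = det (matrix ?L)"
  unfolding e_def f_def cross2_linear[OF T_linear[OF q c]] by (simp add: cross2_def axis_def)
 have "det ?G = (sqrt (det ?G))\<^sup>2" using pos_def_det[OF Gm_pos_def[OF c]] by simp
 then have dG: "det ?G = (?r * det (matrix ?L))\<^sup>2" unfolding T_det_pos(2)[OF q c] .
 show ?thesis unfolding K n cr dG s_def[symmetric] using T_det_pos(1)[OF q c] conformal(1)[OF q c]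
  by (simp add: power2_eq_square field_simps)
qed

end

context isothermal_coordinate
begin

subsection \<open>Flatness near a point\<close>

lemma quotient_derivative:
 assumes b: "smooth_on \<Omega> b" and x: "x \<in> \<Omega>"
 shows "fderiv (%x. b x / \<rho> x) (at x) (axis j 1) = fderiv b (at x) (axis j 1) / \<rho> x - 2 * (cf.logd j x * (b x / \<rho> x))"
proof -
 have r: "\<rho> x > 0" by (rule cf.rho_pos[OF x])
 have nz: "\<rho> x ~= 0" using r by simp
 have "((%x. b x / \<rho> x) has_derivative (%h. - b x * (inverse (\<rho> x) * fderiv \<rho> (at x) h * inverse (\<rho> x)) + fderiv b (at x) h / \<rho> x)) (at x)"
  by (rule has_derivative_divide[OF smooth_on_has_derivative[OF b x] smooth_on_has_derivative[OF \<rho>_smooth x] nz])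
 from fun_cong[OF frechet_derivative_at[OF this], of "axis j 1", symmetric]
 show ?thesis using r by (simp add: cf.logd_def field_simps)
qed

text \<open>
 Here \<open>\<beta>r + \<i> \<beta>i\<close> is the coefficient of a holomorphic cubic differential.  Dividing it by
 \<open>\<rho>\<close> turns the Cauchy-Riemann equations and the curvature equation into the assumptions of
 \<open>wang_system\<close>; the straightening map is then pulled back to a chart, where the Christoffel symbols
 transform with the second derivative of the coordinate change.
\<close>

lemma flat_at:
 assumes p: "p \<in> U" and \<beta>: "smooth_on \<Omega> \<beta>r" "smooth_on \<Omega> \<beta>i"
  and cr: "!!x. x \<in> \<Omega> ==> fderiv \<beta>r (at x) (axis 1 1) = fderiv \<beta>i (at x) (axis 2 1)"
   "!!x. x \<in> \<Omega> ==> fderiv \<beta>r (at x) (axis 2 1) = - fderiv \<beta>i (at x) (axis 1 1)"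
  and K: "!!q. q \<in> U ==> gauss_curvature M g q = -1 + 2 * (((\<beta>r (\<phi> q))\<^sup>2 + (\<beta>i (\<phi> q))\<^sup>2) / \<rho> (\<phi> q) ^ 3)"
  and a: "!!q v c y. q \<in> U ==> (q, v) \<in> unit_bundle M g ==> chart_at M q c ==> y = fderiv (\<tau> c) (at (snd c q)) (v c) ==>
   a (q, v) = \<beta>r (\<phi> q) * (3 * (y $ 1)\<^sup>2 * y $ 2 - y $ 2 ^ 3) + \<beta>i (\<phi> q) * (y $ 1 ^ 3 - 3 * y $ 1 * (y $ 2)\<^sup>2)"
 shows "\<exists>U W f. p \<in> U \<and> diffeomorphism M U sphere_atlas W f \<and> orientation_preserving M U sphere_atlas f \<and>
  (\<forall>I \<kappa>. oriented_path M (paths a) I \<kappa> \<and> \<kappa> ` I \<subseteq> U --> great_circle_arc I (f \<circ> \<kappa>)) \<and>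
  (\<forall>I d. great_circle_arc I d \<and> d ` I \<subseteq> W -->
   (\<exists>\<kappa>. oriented_path M (paths a) I \<kappa> \<and> \<kappa> ` I \<subseteq> U \<and> (\<forall>t\<in>I. d t = f (\<kappa> t))))"
proof -
 define b1 where "b1 x = \<beta>r x / \<rho> x" for x
 define b2 where "b2 x = \<beta>i x / \<rho> x" for x
 note q1 = quotient_derivative[OF \<beta>(1), folded b1_def[abs_def] b1_def]
 note q2 = quotient_derivative[OF \<beta>(2), folded b2_def[abs_def] b2_def]
 have W: "wang_system \<Omega> \<rho> b1 b2"
 proof (rule wang_system.intro, rule cf.conformal_metric_axioms, rule wang_system_axioms.intro)
  show "smooth_on \<Omega> b1" unfolding b1_def[abs_def] by (intro smooth_intros \<Omega>_open \<beta> \<rho>_smooth) (use cf.rho_pos in force)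
  show "smooth_on \<Omega> b2" unfolding b2_def[abs_def] by (intro smooth_intros \<Omega>_open \<beta> \<rho>_smooth) (use cf.rho_pos in force)
  fix x assume x: "x \<in> \<Omega>"
  have r: "\<rho> x > 0" by (rule cf.rho_pos[OF x])
  have "gauss_curvature M g (\<psi> x) = -1 + 2 * (((\<beta>r x)\<^sup>2 + (\<beta>i x)\<^sup>2) / \<rho> x ^ 3)" using K[OF \<Omega>D(1)[OF x]] by (simp only: \<Omega>D(2)[OF x])
  then have "- (\<rho> x * gauss_curvature M g (\<psi> x)) = \<rho> x - 2 * ((b1 x)\<^sup>2 + (b2 x)\<^sup>2)"
   using r by (simp add: b1_def b2_def field_simps power2_eq_square power3_eq_cube)
  then show "fderiv (cf.logd 1) (at x) (axis 1 1) + fderiv (cf.logd 2) (at x) (axis 2 1) = \<rho> x - 2 * ((b1 x)\<^sup>2 + (b2 x)\<^sup>2)"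
   using gauss_curvature[OF \<Omega>D(1)[OF x]] by (simp only: \<Omega>D(2)[OF x])
  show "fderiv b1 (at x) (axis 2 1) + fderiv b2 (at x) (axis 1 1) = - 2 * (cf.logd 2 x * b1 x) - 2 * (cf.logd 1 x * b2 x)"
   unfolding q1[OF x] q2[OF x] cr(2)[OF x] by simp
  show "fderiv b1 (at x) (axis 1 1) - fderiv b2 (at x) (axis 2 1) = 2 * (cf.logd 2 x * b2 x) - 2 * (cf.logd 1 x * b1 x)"
   unfolding q1[OF x] q2[OF x] cr(1)[OF x] by simp
 qed
 obtain S h \<kappa> where S: "open S" "\<phi> p \<in> S" "S \<subseteq> \<Omega>" "smooth_on S (h :: real^2 \<Rightarrow> real^2)" "!!x. x \<in> S ==> \<kappa> x > (0::real)"
  and jac: "!!x y z. x \<in> S ==> \<exists>k>0. cross2 (fderiv h (at x) y) (fderiv h (at x) z) = k * cross2 y z"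
  and str: "!!J t w w' w''. open J ==> t \<in> J ==> w ` J \<subseteq> S ==> (!!s. s \<in> J ==> (w has_vector_derivative w' s) (at s)) ==>
   (w' has_vector_derivative w'') (at t) ==>
   \<exists>\<eta>''. ((%s. fderiv h (at (w s)) (w' s)) has_vector_derivative \<eta>'') (at t) \<and>
   cross2 (fderiv h (at (w t)) (w' t)) \<eta>'' = \<kappa> (w t) *
    (cross2 (w' t) (w'' + christoffel_of cf.conf (w t) (w' t) (w' t))
    - (b1 (w t) * (3 * (w' t $ 1)\<^sup>2 * w' t $ 2 - w' t $ 2 ^ 3) + b2 (w t) * (w' t $ 1 ^ 3 - 3 * w' t $ 1 * (w' t $ 2)\<^sup>2)))"
  apply (rule wang_system.straightening[OF W \<phi>_in[OF p]])
  subgoal premises prems for S h \<kappa>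
   by (rule prems(1)) (fact prems)+
  done
 define c where "c = (SOME c. chart_at M p c)"
 have c: "chart_at M p c" unfolding c_def by (rule chart_at_some) (use p U_points in blast)
 note cM = chart_atD(1)[OF c]
 let ?D = "snd c ` (U \<inter> fst c)"
 interpret iso: plane_isometry ?D "Gm c" \<Omega> cf.conf "\<tau> c" by (rule \<tau>_isometry[OF cM])
 define X where "X = ?D \<inter> \<tau> c -` S"
 have oX: "open X" unfolding X_def
  by (rule continuous_open_preimage[OF smooth_on_continuous_on[OF \<tau>_smooth[OF cM]] source_open[OF cM] S(1)])
 have pX: "snd c p \<in> X" using chart_point(1,3)[OF p c] S(2) by (simp add: X_def)
 have XD: "X \<subseteq> snd c ` fst c" "X \<subseteq> ?D" "\<tau> c ` X \<subseteq> S" by (auto simp: X_def)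
 have s\<tau>: "smooth_on X (\<tau> c)" by (rule smooth_on_subset[OF \<tau>_smooth[OF cM] XD(2)])
 define H where "H x = h (\<tau> c x)" for x
 have sH: "smooth_on X H" unfolding H_def[abs_def] by (rule smooth_on_compose[OF oX S(1,4) s\<tau> XD(3)])
 have DH: "fderiv H (at x) = (%y. fderiv h (at (\<tau> c x)) (fderiv (\<tau> c) (at x) y))" if "x \<in> X" for x
 proof -
  have "\<tau> c x \<in> S" using XD(3) that by blast
  from has_derivative_compose[OF smooth_on_has_derivative[OF s\<tau> that] smooth_on_has_derivative[OF S(4) this]]
  have "(H has_derivative (%y. fderiv h (at (\<tau> c x)) (fderiv (\<tau> c) (at x) y))) (at x)" unfolding H_def[abs_def] .
  from frechet_derivative_at[OF this] show ?thesis by simp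
 qed
 have pt: "\<exists>q. q \<in> U \<and> chart_at M q c \<and> x = snd c q \<and> param c x = q" if "x \<in> X" for x
 proof -
  have "x \<in> ?D" using XD(2) that by blast
  then obtain q where "q \<in> U" "q \<in> fst c" "x = snd c q" by blast
  then show ?thesis using cM param_snd[OF cM, of q] by (intro exI[of _ q]) (simp add: chart_at_def)
 qed
 have lin: "cross2 (fderiv (\<tau> c) (at x) y) (fderiv (\<tau> c) (at x) y') = det (matrix (fderiv (\<tau> c) (at x))) * cross2 y y'"
  and detp: "det (matrix (fderiv (\<tau> c) (at x))) > 0" if x: "x \<in> X" for x y y'
  using pt[OF x] T_linear T_det_pos(1) cross2_linear by blast+
 show ?thesis
 proof (rule flat_chart[OF c oX pX XD(1) sH])
  fix x y y' assume x: "x \<in> X"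
  have "\<tau> c x \<in> S" using XD(3) x by blast
  from jac[OF this, of "fderiv (\<tau> c) (at x) y" "fderiv (\<tau> c) (at x) y'"]
  obtain k where k: "k > 0" "cross2 (fderiv H (at x) y) (fderiv H (at x) y') = k * (det (matrix (fderiv (\<tau> c) (at x))) * cross2 y y')"
   unfolding DH[OF x] lin[OF x] by blast
  then show "\<exists>k>0. cross2 (fderiv H (at x) y) (fderiv H (at x) y') = k * cross2 y y'"
   using detp[OF x] by (intro exI[of _ "k * det (matrix (fderiv (\<tau> c) (at x)))"]) simp
 next
  fix J :: "real set" and x x' :: "real \<Rightarrow> real^2" and x'' t
  assume J: "open J" "t \<in> J" "x ` J \<subseteq> X" and xd: "!!s. s \<in> J ==> (x has_vector_derivative x' s) (at s)"
   and xdd: "(x' has_vector_derivative x'') (at t)"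
  define w where "w s = \<tau> c (x s)" for s
  define w' where "w' s = fderiv (\<tau> c) (at (x s)) (x' s)" for s
  define w'' where "w'' = D2 (\<tau> c) (x t) (x' t) (x' t) + fderiv (\<tau> c) (at (x t)) x''"
  have xX: "x s \<in> X" if "s \<in> J" for s using J(3) that by blast
  have wS: "w ` J \<subseteq> S" using xX XD(3) by (auto simp: w_def)
  have wd: "(w has_vector_derivative w' s) (at s)" if "s \<in> J" for s
   unfolding w_def[abs_def] w'_def
   by (rule has_vector_derivative_chain[OF xd[OF that] smooth_on_has_derivative[OF s\<tau> xX[OF that]]])
  have wdd: "(w' has_vector_derivative w'') (at t)"
   unfolding w'_def[abs_def] w''_def
   by (rule frechet_apply_has_vector_derivative[OF oX s\<tau> xX[OF J(2)] xd[OF J(2)] xdd])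
  obtain \<eta>'' where e: "((%s. fderiv h (at (w s)) (w' s)) has_vector_derivative \<eta>'') (at t)"
   "cross2 (fderiv h (at (w t)) (w' t)) \<eta>'' = \<kappa> (w t) *
    (cross2 (w' t) (w'' + christoffel_of cf.conf (w t) (w' t) (w' t))
    - (b1 (w t) * (3 * (w' t $ 1)\<^sup>2 * w' t $ 2 - w' t $ 2 ^ 3) + b2 (w t) * (w' t $ 1 ^ 3 - 3 * w' t $ 1 * (w' t $ 2)\<^sup>2)))"
   using str[OF J(1,2) wS wd wdd] by blast
  have e1: "((%s. fderiv H (at (x s)) (x' s)) has_vector_derivative \<eta>'') (at t)"
   by (rule has_vector_derivative_transform_open[OF e(1) J(1,2)]) (simp add: DH[OF xX] w_def w'_def)
  note xt = xX[OF J(2)]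
  obtain q where q: "q \<in> U" "chart_at M q c" "x t = snd c q" "param c (x t) = q" using pt[OF xt] by blast
  define L where "L = fderiv (\<tau> c) (at (x t))"
  have linL: "linear L" unfolding L_def q(3) by (rule T_linear[OF q(1,2)])
  define \<delta> where "\<delta> = det (matrix L)"
  have \<delta>: "\<delta> > 0" unfolding \<delta>_def L_def by (rule detp[OF xt])
  define r where "r = \<rho> (\<phi> q)"
  have r: "r > 0" unfolding r_def by (rule conformal(1)[OF q(1,2)])
  have wt: "w t = \<phi> q" unfolding w_def q(3) by (rule chart_point(3)[OF q(1,2)])
  have w't: "w' t = L (x' t)" by (simp add: w'_def L_def)
  have acc: "cross2 (w' t) (w'' + christoffel_of cf.conf (w t) (w' t) (w' t)) = \<delta> * cross2 (x' t) (x'' + \<Gamma> c (x t) (x' t) (x' t))"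
  proof -
   have "x t \<in> ?D" using xt XD(2) by blast
   from iso.christoffel_isometry[OF this, of "x' t" "x' t"]
   have "w'' + christoffel_of cf.conf (w t) (w' t) (w' t) = L x'' + L (\<Gamma> c (x t) (x' t) (x' t))"
    by (simp add: w_def w'_def w''_def L_def)
   also have "\<dots> = L (x'' + \<Gamma> c (x t) (x' t) (x' t))" by (simp add: linear_add[OF linL])
   finally show ?thesis by (simp only: w't cross2_linear[OF linL] \<delta>_def)
  qed
  have "path_equation a c q (x' t) x'' \<longleftrightarrow> x' t ~= 0 \<and> cross2 (fderiv h (at (w t)) (w' t)) \<eta>'' = 0"
  proof (cases "x' t = 0")
   case True
   then show ?thesis by (simp add: path_equation_def)
  next
   case False
   define N where "N = speed c (snd c q) (x' t)"
   have NN: "x' t \<bullet> (Gm c (snd c q) *v x' t) > 0" using Gm_pos_def[OF q(2)] False by (simp add: pos_def_def)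
   have N: "N > 0" "N * N = x' t \<bullet> (Gm c (snd c q) *v x' t)" using NN by (simp_all add: N_def speed_def)
   define v where "v = vec_at M c q ((1 / N) *\<^sub>R x' t)"
   have vT: "v \<in> tangent_space M q" unfolding v_def by (rule vec_at_tangent[OF q(2)])
   have vc: "v c = (1 / N) *\<^sub>R x' t" unfolding v_def by (rule vec_at_self[OF q(2)])
   have "g q v v = (1 / N) * ((1 / N) * (N * N))"
    unfolding metric_in_chart[OF q(2) vT vT] vc matrix_vector_mult_scaleR inner_scaleR_left inner_scaleR_right N(2) ..
   then have "g q v v = 1" using N(1) by simp
   then have u: "(q, v) \<in> unit_bundle M g" using vT chart_at_points[OF q(2)] by (simp add: unit_bundle_def)
   define y where "y = fderiv (\<tau> c) (at (snd c q)) (v c)"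
   have y: "w' t = N *\<^sub>R y" unfolding y_def vc q(3)[symmetric] L_def[symmetric] linear_cmul[OF linL] w't using N(1) by simp
   have cub: "b1 (w t) * (3 * (w' t $ 1)\<^sup>2 * w' t $ 2 - w' t $ 2 ^ 3) + b2 (w t) * (w' t $ 1 ^ 3 - 3 * w' t $ 1 * (w' t $ 2)\<^sup>2) = N ^ 3 * a (q, v) / r"
    unfolding a[OF q(1) u q(2) y_def] y wt b1_def b2_def r_def
    by (simp add: power2_eq_square power3_eq_cube add_divide_distrib diff_divide_distrib algebra_simps)
   have sq: "sqrt (det (Gm c (snd c q))) = r * \<delta>" unfolding T_det_pos(2)[OF q(1,2)] r_def \<delta>_def L_def q(3) ..
   have "path_equation a c q (x' t) x'' \<longleftrightarrow> cross2 (x' t) (x'' + \<Gamma> c (x t) (x' t) (x' t)) = N ^ 3 * a (q, v) / (r * \<delta>)"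
    using False by (simp add: path_equation_def sq q(3) N_def[symmetric] v_def)
   also have "\<dots> \<longleftrightarrow> \<delta> * cross2 (x' t) (x'' + \<Gamma> c (x t) (x' t) (x' t)) - N ^ 3 * a (q, v) / r = 0"
    using r \<delta> by (simp add: field_simps)
   also have "\<dots> \<longleftrightarrow> cross2 (fderiv h (at (w t)) (w' t)) \<eta>'' = 0"
    unfolding e(2) acc cub using S(5)[of "w t"] wS J(2) by fastforce
   finally show ?thesis using False by simp
  qed
  then show "\<exists>\<eta>''. ((%s. fderiv H (at (x s)) (x' s)) has_vector_derivative \<eta>'') (at t) \<and>
    (path_equation a c (param c (x t)) (x' t) x'' \<longleftrightarrow> x' t ~= 0 \<and> cross2 (fderiv H (at (x t)) (x' t)) \<eta>'' = 0)"
   using e1 unfolding q(4) DH[OF xt] w_def w'_def by blast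
 qed
qed

end

context isothermal_coordinate
begin

lemma norm_sqI:
 assumes q: "q \<in> U" and eq: "!!v. (q, v) \<in> unit_bundle M g ==> (cmod (A q v))\<^sup>2 = R"
 shows "norm_sq M g A q = R"
 unfolding norm_sq_def
proof (rule the_equality)
 show "\<forall>v. (q, v) \<in> unit_bundle M g --> R = (cmod (A q v))\<^sup>2" using eq by simp
next
 fix r assume r: "\<forall>v. (q, v) \<in> unit_bundle M g --> r = (cmod (A q v))\<^sup>2"
 define c where "c = (SOME c. chart_at M q c)"
 have qp: "q \<in> points M" using q U_points by blast
 have c: "chart_at M q c" unfolding c_def by (rule chart_at_some[OF qp])
 have "vec_at M c q (axis 1 1) ~= zero_vec"
  using tangent_zero_iff[OF vec_at_tangent[OF c, of "axis 1 1"] c] c by (simp add: real2_eq_iff axis_def)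
 from normalize_unit[OF qp vec_at_tangent[OF c] this] show "r = R" using r eq by fastforce
qed

lemma flat_zero:
 assumes p: "p \<in> U" and zero: "!!q v. (q, v) \<in> unit_bundle M g ==> A q v = 0"
  and K: "!!q. q \<in> U ==> gauss_curvature M g q = -1 + k * norm_sq M g A q"
  and a: "!!q v. (q, v) \<in> unit_bundle M g ==> a (q, v) = Im (A q v)"
 shows "\<exists>U W f. p \<in> U \<and> diffeomorphism M U sphere_atlas W f \<and> orientation_preserving M U sphere_atlas f \<and>
  (\<forall>I \<kappa>. oriented_path M (paths a) I \<kappa> \<and> \<kappa> ` I \<subseteq> U --> great_circle_arc I (f \<circ> \<kappa>)) \<and>
  (\<forall>I d. great_circle_arc I d \<and> d ` I \<subseteq> W -->
   (\<exists>\<kappa>. oriented_path M (paths a) I \<kappa> \<and> \<kappa> ` I \<subseteq> U \<and> (\<forall>t\<in>I. d t = f (\<kappa> t))))"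
proof (rule flat_at[OF p, where \<beta>r = "%x. 0" and \<beta>i = "%x. 0"])
 show "gauss_curvature M g q = -1 + 2 * (((0::real)\<^sup>2 + 0\<^sup>2) / \<rho> (\<phi> q) ^ 3)" if "q \<in> U" for q
  using K[OF that] norm_sqI[OF that, of A 0] zero by simp
qed (use zero a in \<open>simp_all add: smooth_on_const[OF \<Omega>_open]\<close>)

lemma complex_cube: "Complex x y ^ 3 = Complex (x ^ 3 - 3 * x * y\<^sup>2) (3 * x\<^sup>2 * y - y ^ 3)"
 by (simp add: complex_eq_iff power3_eq_cube power2_eq_square algebra_simps)

text \<open>
 The coefficient \<open>\<alpha>\<close> is smooth because it is the value of \<open>A\<close> on a coordinate vector of a chart
 divided by the cube of the derivative of \<open>z\<close> along this vector.
\<close>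

lemma flat_cubic:
 assumes p: "p \<in> U" and A: "degree_differential M g 3 A"
  and \<alpha>: "!!q v. q \<in> U ==> v \<in> tangent_space M q ==> A q v = \<alpha> (z q) * deriv_along M z q v ^ 3"
  and hol: "!!w. w \<in> z ` U ==> wirtinger_bar \<alpha> w = 0"
  and K: "!!q. q \<in> U ==> gauss_curvature M g q = -1 + 2 * norm_sq M g A q"
  and a: "!!q v. (q, v) \<in> unit_bundle M g ==> a (q, v) = Im (A q v)"
 shows "\<exists>U W f. p \<in> U \<and> diffeomorphism M U sphere_atlas W f \<and> orientation_preserving M U sphere_atlas f \<and>
  (\<forall>I \<kappa>. oriented_path M (paths a) I \<kappa> \<and> \<kappa> ` I \<subseteq> U --> great_circle_arc I (f \<circ> \<kappa>)) \<and>
  (\<forall>I d. great_circle_arc I d \<and> d ` I \<subseteq> W -->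
   (\<exists>\<kappa>. oriented_path M (paths a) I \<kappa> \<and> \<kappa> ` I \<subseteq> U \<and> (\<forall>t\<in>I. d t = f (\<kappa> t))))"
proof -
 let ?C = "%x :: real^2. Complex (x $ 1) (x $ 2)"
 define \<gamma> where "\<gamma> x = \<alpha> (?C x)" for x
 have z\<phi>: "\<alpha> (z q) = \<gamma> (\<phi> q)" for q unfolding \<gamma>_def by (simp add: z_\<phi>)
 have Aq: "A q v = \<gamma> (\<phi> q) * ?C (fderiv (\<tau> c) (at (snd c q)) (v c)) ^ 3"
  if "q \<in> U" "chart_at M q c" "v \<in> tangent_space M q" for q c v
  using \<alpha>[OF that(1,3)] deriv_along_z[OF that] z\<phi> by simp
 have lin: "bounded_linear ?C"
  by (intro linear_conv_bounded_linear[THEN iffD1] linearI) (simp_all add: complex_eq_iff)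
 have s\<gamma>: "smooth_on \<Omega> \<gamma>"
 proof (rule smooth_on_local)
  fix x assume x: "x \<in> \<Omega>"
  define c where "c = (SOME c. chart_at M (\<psi> x) c)"
  have c: "chart_at M (\<psi> x) c" unfolding c_def by (rule chart_at_some) (use \<Omega>D(1)[OF x] U_points in blast)
  note cM = chart_atD(1)[OF c]
  have xc: "x \<in> \<Sigma> c" using x chart_atD(2)[OF c] by (simp add: \<Sigma>_def)
  note oS = \<Sigma>_open[OF cM] and s\<sigma> = \<sigma>_smooth[OF cM]
  define Y where "Y x = fderiv (\<tau> c) (at (\<sigma> c x)) (axis 1 1)" for x
  define B where "B x = A (param c (\<sigma> c x)) (vec_at M c (param c (\<sigma> c x)) (axis 1 1))" for x
  have pt: "\<psi> x' \<in> U" "chart_at M (\<psi> x') c" "\<phi> (\<psi> x') = x'" "\<sigma> c x' = snd c (\<psi> x')" "param c (\<sigma> c x') = \<psi> x'" if "x' \<in> \<Sigma> c" for x'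
   using that \<Omega>D cM by (simp_all add: \<Sigma>_def chart_at_def \<sigma>_def)
  have im1: "\<sigma> c ` \<Sigma> c \<subseteq> snd c ` (U \<inter> fst c)"
  proof
   fix w assume "w \<in> \<sigma> c ` \<Sigma> c"
   then obtain x' where "x' \<in> \<Sigma> c" "w = \<sigma> c x'" by blast
   then show "w \<in> snd c ` (U \<inter> fst c)" using chart_point(1)[OF pt(1,2)] pt(4) by simp
  qed
  then have im2: "\<sigma> c ` \<Sigma> c \<subseteq> snd c ` fst c" by blast
  have sY: "smooth_on (\<Sigma> c) Y" unfolding Y_def[abs_def]
   by (rule smooth_on_compose[OF oS source_open[OF cM] smooth_on_frechet[OF \<tau>_smooth[OF cM]] s\<sigma> im1])
  have "smooth_on (snd c ` fst c) (%x. A (param c x) (vec_at M c (param c x) (axis 1 1)))"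
   using A cM unfolding degree_differential_def by blast
  then have sB: "smooth_on (\<Sigma> c) B" unfolding B_def[abs_def]
   by (rule smooth_on_compose[OF oS chart_open[OF cM] _ s\<sigma> im2])
  have Bx: "B x' = \<gamma> x' * ?C (Y x') ^ 3" if "x' \<in> \<Sigma> c" for x'
   unfolding B_def Y_def pt(5)[OF that] using Aq[OF pt(1,2)[OF that] vec_at_tangent[OF pt(2)[OF that], of "axis 1 1"]] pt[OF that]
   by simp
  have Y0: "Y x' ~= 0" if "x' \<in> \<Sigma> c" for x'
  proof
   assume 0: "Y x' = 0"
   have "axis 1 1 \<bullet> (Gm c (snd c (\<psi> x')) *v axis 1 1) = 0"
    unfolding conformal(2)[OF pt(1,2)[OF that]] using 0 by (simp add: Y_def pt(4)[OF that])
   then show False using Gm_pos_def[OF pt(2)[OF that]] unfolding pos_def_def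
    by (metis axis_eq_0_iff less_irrefl zero_neq_one)
  qed
  have "smooth_on (\<Sigma> c) (%x. inverse (Y x \<bullet> Y x) ^ 3 *\<^sub>R (B x * ?C (vector [Y x $ 1, - Y x $ 2]) ^ 3))"
   by (intro smooth_intros oS sY sB smooth_on_linear[OF lin]) (use Y0 in auto)
  moreover have "\<gamma> x' = inverse (Y x' \<bullet> Y x') ^ 3 *\<^sub>R (B x' * ?C (vector [Y x' $ 1, - Y x' $ 2]) ^ 3)" if "x' \<in> \<Sigma> c" for x'
  proof -
   have "?C (Y x') * ?C (vector [Y x' $ 1, - Y x' $ 2]) = of_real (Y x' \<bullet> Y x')"
    by (simp add: complex_eq_iff inner2)
   then have "?C (Y x') ^ 3 * ?C (vector [Y x' $ 1, - Y x' $ 2]) ^ 3 = of_real ((Y x' \<bullet> Y x') ^ 3)"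
    by (metis power_mult_distrib of_real_power)
   then have "B x' * ?C (vector [Y x' $ 1, - Y x' $ 2]) ^ 3 = \<gamma> x' * of_real ((Y x' \<bullet> Y x') ^ 3)"
    unfolding Bx[OF that] by (simp only: mult.assoc)
   then show ?thesis using Y0[OF that] by (simp add: scaleR_conv_of_real power_inverse)
  qed
  ultimately have "smooth_on (\<Sigma> c) \<gamma>" using smooth_on_cong[OF oS, of \<gamma>] by simp
  then show "\<exists>J. open J \<and> x \<in> J \<and> smooth_on J \<gamma>" using oS xc by blast
 qed
 let ?\<beta>r = "%x. Re (\<gamma> x)" and ?\<beta>i = "%x. Im (\<gamma> x)"
 have dRe: "fderiv ?\<beta>r (at x) h = Re (fderiv \<gamma> (at x) h)"
  and dIm: "fderiv ?\<beta>i (at x) h = Im (fderiv \<gamma> (at x) h)" if "x \<in> \<Omega>" for x h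
 proof -
  have d: "(\<gamma> has_derivative fderiv \<gamma> (at x)) (at x)" by (rule smooth_on_has_derivative[OF s\<gamma> that])
  show "fderiv ?\<beta>r (at x) h = Re (fderiv \<gamma> (at x) h)"
   using frechet_derivative_at[OF bounded_linear.has_derivative[OF bounded_linear_Re d]] by metis
  show "fderiv ?\<beta>i (at x) h = Im (fderiv \<gamma> (at x) h)"
   using frechet_derivative_at[OF bounded_linear.has_derivative[OF bounded_linear_Im d]] by metis
 qed
 have CR: "fderiv \<gamma> (at x) (axis 1 1) + \<i> * fderiv \<gamma> (at x) (axis 2 1) = 0" if x: "x \<in> \<Omega>" for x
 proof -
  let ?R = "%w. vector [Re w, Im w] :: real^2"
  have linR: "bounded_linear ?R"
   by (intro linear_conv_bounded_linear[THEN iffD1] linearI) (simp_all add: real2_eq_iff)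
  have w: "?C x = z (\<psi> x)" using \<Omega>D[OF x] z_\<phi>[of "\<psi> x"] by simp
  have wU: "?C x \<in> z ` U" unfolding w using \<Omega>D(1)[OF x] by (rule imageI)
  have Rx: "?R (?C x) = x" by (simp add: real2_eq_iff)
  have "(\<gamma> has_derivative fderiv \<gamma> (at x)) (at (?R (?C x)))"
   unfolding Rx by (rule smooth_on_has_derivative[OF s\<gamma> x])
  from has_derivative_compose[OF bounded_linear_imp_has_derivative[OF linR] this]
  have "(\<alpha> has_derivative (%h. fderiv \<gamma> (at x) (?R h))) (at (?C x))"
   by (simp add: \<gamma>_def)
  from frechet_derivative_at[OF this]
  have "fderiv \<alpha> (at (?C x)) = (%h. fderiv \<gamma> (at x) (?R h))" by simp
  moreover have "?R 1 = axis 1 1" "?R \<i> = axis 2 1" by (simp_all add: real2_eq_iff axis_def)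
  ultimately show ?thesis using hol[OF wU] by (simp add: wirtinger_bar_def)
 qed
 have AU: "A q v = \<gamma> (\<phi> q) * ?C y ^ 3" "y \<bullet> y = 1 / \<rho> (\<phi> q)"
  if "q \<in> U" "(q, v) \<in> unit_bundle M g" "chart_at M q c" "y = fderiv (\<tau> c) (at (snd c q)) (v c)" for q v c y
 proof -
  have v: "v \<in> tangent_space M q" using that(2) by (simp add: unit_bundle_def)
  show "A q v = \<gamma> (\<phi> q) * ?C y ^ 3" unfolding that(4) by (rule Aq[OF that(1,3) v])
  have "\<rho> (\<phi> q) * (y \<bullet> y) = 1"
   unfolding that(4) conformal(2)[OF that(1,3), symmetric] using unit_bundle_chart(1)[OF that(2)] that(3) by simp
  then show "y \<bullet> y = 1 / \<rho> (\<phi> q)" using conformal(1)[OF that(1,3)] by (simp add: field_simps)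
 qed
 show ?thesis
 proof (rule flat_at[OF p, where \<beta>r = ?\<beta>r and \<beta>i = ?\<beta>i])
  show "smooth_on \<Omega> ?\<beta>r" by (rule smooth_on_linear[OF bounded_linear_Re \<Omega>_open s\<gamma>])
  show "smooth_on \<Omega> ?\<beta>i" by (rule smooth_on_linear[OF bounded_linear_Im \<Omega>_open s\<gamma>])
  show "fderiv ?\<beta>r (at x) (axis 1 1) = fderiv ?\<beta>i (at x) (axis 2 1)" if "x \<in> \<Omega>" for x
   unfolding dRe[OF that] dIm[OF that] using arg_cong[OF CR[OF that], of Re] by simp
  show "fderiv ?\<beta>r (at x) (axis 2 1) = - fderiv ?\<beta>i (at x) (axis 1 1)" if "x \<in> \<Omega>" for x
   unfolding dRe[OF that] dIm[OF that] using arg_cong[OF CR[OF that], of Im] by simp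
  show "gauss_curvature M g q = -1 + 2 * (((?\<beta>r (\<phi> q))\<^sup>2 + (?\<beta>i (\<phi> q))\<^sup>2) / \<rho> (\<phi> q) ^ 3)" if q: "q \<in> U" for q
  proof -
   have "(cmod (A q v))\<^sup>2 = ((?\<beta>r (\<phi> q))\<^sup>2 + (?\<beta>i (\<phi> q))\<^sup>2) / \<rho> (\<phi> q) ^ 3" if v: "(q, v) \<in> unit_bundle M g" for v
   proof -
    define c where "c = (SOME c. chart_at M q c)"
    have c: "chart_at M q c" unfolding c_def by (rule chart_at_some) (use q U_points in blast)
    define y where "y = fderiv (\<tau> c) (at (snd c q)) (v c)"
    note Ay = AU[OF q v c y_def]
    have "(cmod (?C y))\<^sup>2 = y \<bullet> y"
     unfolding complex_norm by (subst real_sqrt_pow2) (simp_all add: inner2 power2_eq_square)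
    then have "(cmod (?C y) ^ 3)\<^sup>2 = (1 / \<rho> (\<phi> q)) ^ 3"
     unfolding Ay(2)[symmetric] by (metis power_mult mult.commute)
    then have "(cmod (A q v))\<^sup>2 = (cmod (\<gamma> (\<phi> q)))\<^sup>2 * (1 / \<rho> (\<phi> q)) ^ 3"
     unfolding Ay(1) norm_mult norm_power power_mult_distrib by simp
    then show ?thesis by (simp add: cmod_power2 power_one_over)
   qed
   from norm_sqI[of q A, OF q this] show ?thesis using K[OF q] by simp
  qed
  show "a (q, v) = ?\<beta>r (\<phi> q) * (3 * (y $ 1)\<^sup>2 * y $ 2 - y $ 2 ^ 3) + ?\<beta>i (\<phi> q) * (y $ 1 ^ 3 - 3 * y $ 1 * (y $ 2)\<^sup>2)"
   if "q \<in> U" "(q, v) \<in> unit_bundle M g" "chart_at M q c" "y = fderiv (\<tau> c) (at (snd c q)) (v c)" for q v c y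
   unfolding a[OF that(2)] AU(1)[OF that] complex_cube by simp
 qed
qed

end

theorem theorem8p3:
  fixes M :: "('p, real^2) atlas"
    and g :: "'p metric"
    and m :: nat
    and A :: "'p kdiff"
    and a :: "'p tpoint \<Rightarrow> real"
  assumes "closed_connected_oriented_surface M"
    and "surface_euler_characteristic M < 0"
    and "m \<ge> 2"
    and "riemannian_metric M g"
    and "degree_differential M g m A"
    and "coupled_vortex_equations M g m A"
    and "corresponding_function M g m A a"
  shows "flat_path_geometry M (thermostat_path_geometry M g (thermostat M g a)) \<longleftrightarrow>
           m = 3 \<or> vanishes_identically M A"
proof -
  interpret riemannian_surface M g
  proof (rule riemannian_surface.intro, rule smooth_manifold.intro, rule_tac [2] riemannian_surface_axioms.intro)
    show "smooth_atlas M" "oriented_atlas M" using assms(1) by (simp_all add: closed_connected_oriented_surface_def)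
    show "riemannian_metric M g" by (rule assms(4))
  qed
  have a: "a q = Im (A (fst q) (snd q))" if "q \<in> unit_bundle M g" for q
    by (rule corresponding_function_eq[OF assms(7) that])
  have dbar: "dbar_vanishes M g m A" and K: "\<And>p. p \<in> points M \<Longrightarrow> gauss_curvature M g p = -1 + (real m - 1) * norm_sq M g A p"
    using assms(6) by (simp_all add: coupled_vortex_equations_def)
  show ?thesis
  proof
    assume "flat_path_geometry M (paths a)"
    then show "m = 3 \<or> vanishes_identically M A" by (rule flat_imp_cubic_or_zero[OF _ assms(3,5) a])
  next
    assume cases: "m = 3 \<or> vanishes_identically M A"
    have "smooth_function ub.batlas a" using assms(7) by (simp add: corresponding_function_def ub_atlas)
    then have pg: "path_geometry M (paths a)" by (rule path_geometry_thermostat)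
    have "\<exists>U W f. p \<in> U \<and> diffeomorphism M U sphere_atlas W f \<and> orientation_preserving M U sphere_atlas f \<and>
      (\<forall>I \<kappa>. oriented_path M (paths a) I \<kappa> \<and> \<kappa> ` I \<subseteq> U \<longrightarrow> great_circle_arc I (f \<circ> \<kappa>)) \<and>
      (\<forall>I d. great_circle_arc I d \<and> d ` I \<subseteq> W \<longrightarrow>
        (\<exists>\<kappa>. oriented_path M (paths a) I \<kappa> \<and> \<kappa> ` I \<subseteq> U \<and> (\<forall>t\<in>I. d t = f (\<kappa> t))))" if p: "p \<in> points M" for p
    proof -
      obtain U z \<alpha> where z: "p \<in> U" "holomorphic_coordinate M g U z"
        "\<forall>q\<in>U. \<forall>v\<in>tangent_space M q. A q v = \<alpha> (z q) * deriv_along M z q v ^ m"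
        "\<forall>w\<in>z ` U. wirtinger_bar \<alpha> w = 0"
        using bspec[OF dbar[unfolded dbar_vanishes_def] p] by (elim exE conjE)
      interpret isothermal_coordinate M g U z
        by (rule isothermal_coordinate.intro, rule riemannian_surface_axioms, rule isothermal_coordinate_axioms.intro, rule z(2))
      have KU: "gauss_curvature M g q = -1 + (real m - 1) * norm_sq M g A q" if "q \<in> U" for q
        using K U_points that by blast
      have aU: "a (q, v) = Im (A q v)" if "(q, v) \<in> unit_bundle M g" for q v using a[OF that] by simp
      show ?thesis
      proof (cases "m = 3")
        case True
        show ?thesis
        proof (rule flat_cubic[OF z(1), of A \<alpha>])
          show "degree_differential M g 3 A" using assms(5) True by simp
          show "A q v = \<alpha> (z q) * deriv_along M z q v ^ 3" if "q \<in> U" "v \<in> tangent_space M q" for q v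
            using z(3) that True by simp
          show "wirtinger_bar \<alpha> w = 0" if "w \<in> z ` U" for w using z(4) that by blast
          show "gauss_curvature M g q = -1 + 2 * norm_sq M g A q" if "q \<in> U" for q using KU[OF that] True by simp
          show "a (q, v) = Im (A q v)" if "(q, v) \<in> unit_bundle M g" for q v by (rule aU[OF that])
        qed
      next
        case False
        then have "A q v = 0" if "(q, v) \<in> unit_bundle M g" for q v
          using cases that by (simp add: vanishes_identically_def unit_bundle_def)
        then show ?thesis by (rule flat_zero[OF z(1) _ KU aU])
      qed
    qed
    then show "flat_path_geometry M (paths a)"
      unfolding flat_path_geometry_def using pg by blast
  qed
qed

end
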